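(* Let $z\in Z_2$, $w=\Phi_\lambda(z)\in Z_{r+1}$, and let $X,Y,\omega,\tilde\omega$ and $\pi:X^r\to Y$, $\pi_i:X^r\to X$ be as defined in the context, where the parameter $\alpha\in\mathbb{C}^N$ satisfies $\sum_{k}\alpha_0^{(k)}=0$, and, for $1\le k\le\ell$, $\alpha_{n_k-1}^{(k)}\notin\mathbb{Z}$ if $n_k=1$ and $\alpha_{n_k-1}^{(k)}\ne0$ if $n_k>1$. Suppose that $1$-forms $\varphi_1,\dots,\varphi_{N-2}\in\Omega^1(X)$ give a basis of $H^1(\Omega^\bullet(X),\nabla_\omega)$, and let $\psi_1,\dots,\psi_{N-2}\in\Omega^1(Y)$ be such that $$\pi^*\psi_j=\sum_{1\le i\le r}\pi_i^*\varphi_j\qquad(1\le j\le N-2).$$ Then $$H^r(\Omega^\bullet(Y),\nabla_{\tilde\omega})=\bigoplus_{1\le j_1<\cdots<j_r\le N-2}\mathbb{C}\,\psi_{j_1}\wedge\cdots\wedge\psi_{j_r},$$ i.e. the classes of the $r$-forms $\psi_{j_1}\wedge\cdots\wedge\psi_{j_r}$ form a basis of $H^r(\Omega^\bullet(Y),\nabla_{\tilde\omega})$.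
   Context: Let $r,N$ be positive integers with $r+1<N$ and let $\lambda=(n_1,\dots,n_\ell)$ be a partition of $N$ (all $n_k\ge1$). Functions $\theta_m$: for $x=(x_0,x_1,x_2,\dots)$, define $\theta_m(x)$ ($m\ge0$) by $\sum_{m\ge0}\theta_m(x)T^m=\log(x_0+x_1T+x_2T^2+\cdots)$, so $\theta_0(x)=\log x_0$ and, for $m\ge1$, $\theta_m(x)$ is a polynomial in $x_1/x_0,\dots,x_m/x_0$. Since $\theta_m$ involves only $x_0,\dots,x_m$, $\theta_m(x)$ makes sense for $x\in\mathbb{C}^n$ with $m<n$. Generic stratum: a matrix $z\in\mathrm{Mat}_{m,N}(\mathbb{C})$ is written in blocks $z=(z^{(1)},\dots,z^{(\ell)})$, $z^{(k)}=(z^{(k)}_0,\dots,z^{(k)}_{n_k-1})\in\mathrm{Mat}_{m,n_k}(\mathbb{C})$, with columns $z^{(k)}_j$; rows are indexed from $0$. For $\mu=(m_1,\dots,m_\ell)\in\mathbb{Z}_{\ge0}^\ell$ with $0\le m_k\le n_k$ and $\sum_k m_k=m$, put $z_\mu=(z^{(1)}_0,\dots,z^{(1)}_{m_1-1},\dots,z^{(\ell)}_0,\dots,z^{(\ell)}_{m_\ell-1})\in\mathrm{Mat}_m(\mathbb{C})$. Then $Z_m\subset\mathrm{Mat}_{m,N}(\mathbb{C})$ is the set of $z$ with $\det z_\mu\ne0$ for all such $\mu$. Veronese map: $\Phi_n:\mathrm{Mat}_{2,n}(\mathbb{C})\to\mathrm{Mat}_{r+1,n}(\mathbb{C})$ sends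 $(w_{ij})_{i=0,1;\,0\le j<n}$ to $(\varphi_{ij}(w))_{0\le i\le r;\,0\le j<n}$, where $\varphi_{ij}(w)=\sum w_{0j_1}\cdots w_{0j_{r-i}}w_{1j_{r-i+1}}\cdots w_{1j_r}$, summed over all $(j_1,\dots,j_r)$ with $0\le j_p<n$, $j_1+\cdots+j_r=j$. The map $\Phi_\lambda:\mathrm{Mat}_{2,N}(\mathbb{C})\to\mathrm{Mat}_{r+1,N}(\mathbb{C})$ is $(z^{(1)},\dots,z^{(\ell)})\mapsto(\Phi_{n_1}(z^{(1)}),\dots,\Phi_{n_\ell}(z^{(\ell)}))$. It is known that $\Phi_\lambda(Z_2)\subset Z_{r+1}$. Spaces and forms: for $z\in Z_2$, $w=\Phi_\lambda(z)$, with row vectors $\mathbf{x}$, $\mathbf{y}$ of homogeneous coordinates of $\mathbb{P}^1$, $\mathbb{P}^r$ respectively, put $X=\mathbb{P}^1\setminus\bigcup_{k=1}^\ell\{[\mathbf{x}]\mid\mathbf{x}z_0^{(k)}=0\}$, $Y=\mathbb{P}^r\setminus\bigcup_{k=1}^\ell\{[\mathbf{y}]\mid\mathbf{y}w_0^{(k)}=0\}$. For $\alpha=(\alpha^{(1)},\dots,\alpha^{(\ell)})\in\mathbb{C}^N$, $\alpha^{(k)}=(\alpha^{(k)}_0,\dots,\alpha^{(k)}_{n_k-1})$, put $\omega=\sum_{k=1}^\ell\sum_{0\le i<n_k}\alpha_i^{(k)}d\theta_i(\mathbf{x}z^{(k)})$ and $\tilde\omega=\sum_{k=1}^\ell\sum_{0\le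 i<n_k}\alpha_i^{(k)}d\theta_i(\mathbf{y}w^{(k)})$; because $\sum_k\alpha_0^{(k)}=0$ these are well-defined rational $1$-forms on $\mathbb{P}^1$, $\mathbb{P}^r$, regular on $X$, $Y$. De Rham cohomology: $\Omega^p(X)$ (resp. $\Omega^p(Y)$) is the set of rational $p$-forms on $\mathbb{P}^1$ (resp. $\mathbb{P}^r$) with poles at most on the complement of $X$ (resp. $Y$), $\nabla_\omega=d+\omega\wedge$, $\nabla_{\tilde\omega}=d+\tilde\omega\wedge$, and $H^p(\Omega^\bullet(\cdot),\nabla)$ is the $p$-th cohomology of the resulting complex. It is known that $\dim_{\mathbb{C}}H^1(\Omega^\bullet(X),\nabla_\omega)=N-2$. Maps: $\pi_i:X^r\to X$ is the $i$-th projection. The map $\pi:X^r\to Y$ sends $([s^1],\dots,[s^r])$, $s^i=(s^i_0,s^i_1)$, to $[t_0:\cdots:t_r]$ with $t_k=\sum_{j_1+\cdots+j_r=k,\ j_p\in\{0,1\}}s^1_{j_1}\cdots s^r_{j_r}$ (in affine coordinates $x_i=s^i_1/s^i_0$, $y_k=t_k/t_0$, $y_k$ is the $k$-th elementary symmetric function of $x_1,\dots,x_r$); it identifies $Y$ with the symmetric product $S^rX=\mathfrak{S}_r\backslash X^r$. *)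

theory Defs
  imports
    "HOL-Analysis.Complex_Transcendental"
    "HOL-Computational_Algebra.Formal_Power_Series"
    "Jordan_Normal_Form.Determinant"
begin

unbundle no vec_syntax

section \<open>The functions theta and their differentials\<close>

text \<open>
  Coefficient of \<open>T^m\<close> in \<open>log (x0 + x1 T + x2 T^2 + ...)\<close>, expanded as
  \<open>log x0 + log (1 + (x1/x0) T + (x2/x0) T^2 + ...)\<close>; note that \<^term>\<open>fps_ln (1::complex)\<close> is
  the power series of \<open>log (1 + T)\<close>.
\<close>
definition theta :: "nat \<Rightarrow> (nat \<Rightarrow> complex) \<Rightarrow> complex" where
  "theta m x = fps_nth
     (fps_const (Ln (x 0)) + fps_compose (fps_ln 1) (Abs_fps (\<lambda>j. if j = 0 then 0 else x j / x 0))) m"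

text \<open>
  The differential of \<open>theta m\<close> at \<open>x\<close> applied to the tangent vector \<open>v\<close>.  For \<open>m = 0\<close> it is
  \<open>d log x0 = dx0 / x0\<close>, whichever branch of the logarithm is taken; this case is spelled out
  because the principal branch \<^const>\<open>Ln\<close> is not differentiable on its cut.
\<close>
definition dtheta :: "nat \<Rightarrow> (nat \<Rightarrow> complex) \<Rightarrow> (nat \<Rightarrow> complex) \<Rightarrow> complex" where
  "dtheta m x v =
     (if m = 0 then v 0 / x 0 else deriv (\<lambda>t. theta m (\<lambda>j. x j + t * v j)) 0)"

section \<open>Block decomposition, generic stratum and Veronese map\<close>

text \<open>
  The partition is a list \<open>lam = [n_1, ..., n_l]\<close>.  Blocks are indexed from 0, so block \<open>k\<close> here is
  the block with superscript \<open>k + 1\<close> in the mathematical notation.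
\<close>
definition block :: "nat list \<Rightarrow> complex mat \<Rightarrow> nat \<Rightarrow> complex mat" where
  "block lam z k = mat (dim_row z) (lam ! k) (\<lambda>(i, j). z $$ (i, sum_list (take k lam) + j))"

definition vblock :: "nat list \<Rightarrow> complex vec \<Rightarrow> nat \<Rightarrow> complex vec" where
  "vblock lam a k = vec (lam ! k) (\<lambda>j. a $ (sum_list (take k lam) + j))"

definition sub_mu :: "nat list \<Rightarrow> complex mat \<Rightarrow> nat list \<Rightarrow> complex mat" where
  "sub_mu lam z mu = mat_of_cols (dim_row z)
     (concat (map (\<lambda>k. map (\<lambda>j. col (block lam z k) j) [0..<mu ! k]) [0..<length lam]))"

definition generic_stratum :: "nat list \<Rightarrow> nat \<Rightarrow> complex mat set" where
  "generic_stratum lam m = {z \<in> carrier_mat m (sum_list lam).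
     \<forall>mu. length mu = length lam \<and> (\<forall>k<length lam. mu ! k \<le> lam ! k) \<and> sum_list mu = m
       \<longrightarrow> Determinant.det (sub_mu lam z mu) \<noteq> 0}"

definition veronese_block :: "nat \<Rightarrow> complex mat \<Rightarrow> complex mat" where
  "veronese_block r w = mat (r + 1) (dim_col w) (\<lambda>(i, j).
     \<Sum>js \<in> {js. length js = r \<and> set js \<subseteq> {0..<dim_col w} \<and> sum_list js = j}.
       \<Prod>p<r. w $$ (if p < r - i then 0 else 1, js ! p))"

definition veronese :: "nat list \<Rightarrow> nat \<Rightarrow> complex mat \<Rightarrow> complex mat" where
  "veronese lam r z = mat_of_cols (r + 1)
     (concat (map (\<lambda>k. cols (veronese_block r (block lam z k))) [0..<length lam]))"

section \<open>Rational differential forms on complements of hyperplanes\<close>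

text \<open>
  Everything is expressed in homogeneous coordinates.  The open set
  \<open>Y = {[y] | y w_0^(k) \<noteq> 0 for all k}\<close> of the projective space with homogeneous coordinates
  \<open>y \<in> C^n\<close> is represented by the cone over it, a subset of \<open>C^n\<close>.
\<close>
definition arr_cone :: "nat list \<Rightarrow> complex mat \<Rightarrow> complex vec set" where
  "arr_cone lam w = {y \<in> carrier_vec (dim_row w).
     \<forall>k<length lam. scalar_prod y (col (block lam w k) 0) \<noteq> 0}"

inductive_set polyfun :: "nat \<Rightarrow> (complex vec \<Rightarrow> complex) set" for n :: nat where
  const: "(\<lambda>y. c) \<in> polyfun n"
| coord: "i < n \<Longrightarrow> (\<lambda>y. y $ i) \<in> polyfun n"
| add: "f \<in> polyfun n \<Longrightarrow> g \<in> polyfun n \<Longrightarrow> (\<lambda>y. f y + g y) \<in> polyfun n"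
| mult: "f \<in> polyfun n \<Longrightarrow> g \<in> polyfun n \<Longrightarrow> (\<lambda>y. f y * g y) \<in> polyfun n"

text \<open>Rational functions whose poles lie outside \<open>U\<close>.\<close>
definition regular_on :: "nat \<Rightarrow> complex vec set \<Rightarrow> (complex vec \<Rightarrow> complex) \<Rightarrow> bool" where
  "regular_on n U f \<longleftrightarrow>
     (\<exists>P\<in>polyfun n. \<exists>Q\<in>polyfun n. \<forall>y\<in>U. Q y \<noteq> 0 \<and> f y = P y / Q y)"

text \<open>
  A \<open>p\<close>-form assigns a number to a point \<open>y\<close> and a list of \<open>p\<close> tangent vectors.
  So that equality of forms is equality of functions, forms are extended by 0 to all other arguments.
\<close>
type_synonym dform = "complex vec \<Rightarrow> complex vec list \<Rightarrow> complex"

definition form_on :: "nat \<Rightarrow> complex vec set \<Rightarrow> nat \<Rightarrow> dform \<Rightarrow> dform" where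
  "form_on n U p F = (\<lambda>y vs.
     if y \<in> U \<and> length vs = p \<and> set vs \<subseteq> carrier_vec n then F y vs else 0)"

text \<open>
  The space of rational \<open>p\<close>-forms on projective \<open>(n - 1)\<close>-space without poles in the open set over
  which \<open>U\<close> is the cone, each form being identified with its pullback to \<open>U\<close>.  The pullbacks are the
  regular \<open>p\<close>-forms on \<open>U\<close> that are invariant under scaling and vanish as soon as one of
  the tangent vectors is radial, i.e. that descend to the tangent spaces \<open>C^n / C y\<close> of
  projective space.
\<close>
definition Omega :: "nat \<Rightarrow> complex vec set \<Rightarrow> nat \<Rightarrow> dform set" where
  "Omega n U p = {\<eta>. form_on n U p \<eta> = \<eta> \<and>
     (\<forall>vs. length vs = p \<and> set vs \<subseteq> carrier_vec n \<longrightarrow> regular_on n U (\<lambda>y. \<eta> y vs)) \<and>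
     (\<forall>y\<in>U. \<forall>vs. length vs = p \<and> set vs \<subseteq> carrier_vec n \<longrightarrow>
        (\<forall>i<p. \<forall>u\<in>carrier_vec n. \<forall>v\<in>carrier_vec n. \<forall>a b.
           \<eta> y (vs[i := a \<cdot>\<^sub>v u + b \<cdot>\<^sub>v v]) = a * \<eta> y (vs[i := u]) + b * \<eta> y (vs[i := v])) \<and>
        (\<not> distinct vs \<longrightarrow> \<eta> y vs = 0) \<and>
        (\<forall>c. c \<noteq> 0 \<longrightarrow> \<eta> (c \<cdot>\<^sub>v y) (map (\<lambda>v. c \<cdot>\<^sub>v v) vs) = \<eta> y vs) \<and>
        (y \<in> set vs \<longrightarrow> \<eta> y vs = 0))}"

definition omit :: "nat \<Rightarrow> 'a list \<Rightarrow> 'a list" where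
  "omit i vs = take i vs @ drop (Suc i) vs"

text \<open>
  Exterior derivative, evaluated on constant vector fields:
  \<open>(d\<eta>)(v_0, ..., v_p) = \<Sum>_i (-1)^i D_{v_i} \<eta>(v_0, ..., v_{i-1}, v_{i+1}, ..., v_p)\<close>.
\<close>
definition ext_d :: "nat \<Rightarrow> complex vec set \<Rightarrow> dform \<Rightarrow> dform" where
  "ext_d n U \<eta> = (\<lambda>y vs.
     if y \<in> U \<and> set vs \<subseteq> carrier_vec n
     then \<Sum>i<length vs. (-1) ^ i * deriv (\<lambda>t. \<eta> (y + t \<cdot>\<^sub>v (vs ! i)) (omit i vs)) 0
     else 0)"

text \<open>Exterior product of a 1-form (left factor) with an arbitrary form.\<close>
definition wedge1 :: "dform \<Rightarrow> dform \<Rightarrow> dform" where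
  "wedge1 \<omega> \<eta> = (\<lambda>y vs. \<Sum>i<length vs. (-1) ^ i * \<omega> y [vs ! i] * \<eta> y (omit i vs))"

text \<open>The product \<open>\<psi>_1 \<and> (\<psi>_2 \<and> ( ... \<and> 1))\<close> of a list of 1-forms.\<close>
definition wedge_list :: "nat \<Rightarrow> complex vec set \<Rightarrow> dform list \<Rightarrow> dform" where
  "wedge_list n U \<psi>s = foldr wedge1 \<psi>s (form_on n U 0 (\<lambda>y vs. 1))"

section \<open>Twisted de Rham cohomology\<close>

definition nabla :: "nat \<Rightarrow> complex vec set \<Rightarrow> dform \<Rightarrow> dform \<Rightarrow> dform" where
  "nabla n U \<omega> \<eta> = (\<lambda>y vs. ext_d n U \<eta> y vs + wedge1 \<omega> \<eta> y vs)"

definition cocycles :: "nat \<Rightarrow> complex vec set \<Rightarrow> dform \<Rightarrow> nat \<Rightarrow> dform set" where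
  "cocycles n U \<omega> p = {\<eta> \<in> Omega n U p. nabla n U \<omega> \<eta> = (\<lambda>y vs. 0)}"

definition coboundaries :: "nat \<Rightarrow> complex vec set \<Rightarrow> dform \<Rightarrow> nat \<Rightarrow> dform set" where
  "coboundaries n U \<omega> p =
     (if p = 0 then {\<lambda>y vs. 0} else nabla n U \<omega> ` Omega n U (p - 1))"

definition coh_class :: "nat \<Rightarrow> complex vec set \<Rightarrow> dform \<Rightarrow> nat \<Rightarrow> dform \<Rightarrow> dform set" where
  "coh_class n U \<omega> p \<eta> = {(\<lambda>y vs. \<eta> y vs + \<beta> y vs) | \<beta>. \<beta> \<in> coboundaries n U \<omega> p}"

definition cohomology :: "nat \<Rightarrow> complex vec set \<Rightarrow> dform \<Rightarrow> nat \<Rightarrow> dform set set" where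
  "cohomology n U \<omega> p = coh_class n U \<omega> p ` cocycles n U \<omega> p"

text \<open>
  The classes of the finite family \<open>f\<close>, indexed by \<open>J\<close>, form a basis of the quotient space: every
  class is a linear combination of the classes of the \<open>f j\<close> with unique coefficients.
\<close>
definition cohomology_basis ::
  "nat \<Rightarrow> complex vec set \<Rightarrow> dform \<Rightarrow> nat \<Rightarrow> 'j set \<Rightarrow> ('j \<Rightarrow> dform) \<Rightarrow> bool" where
  "cohomology_basis n U \<omega> p J f \<longleftrightarrow>
     finite J \<and> f ` J \<subseteq> cocycles n U \<omega> p \<and>
     (\<forall>h\<in>cohomology n U \<omega> p. \<exists>!c. c \<in> J \<rightarrow>\<^sub>E (UNIV :: complex set) \<and>
        h = coh_class n U \<omega> p (\<lambda>y vs. \<Sum>j\<in>J. c j * f j y vs))"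

section \<open>The forms omega and the symmetric product map\<close>

text \<open>
  \<open>\<Sum>_k \<Sum>_i \<alpha>_i^(k) d theta_i (y w^(k))\<close>; the row vector \<open>y w^(k)\<close> is written
  \<^term>\<open>transpose_mat (block lam w k) *\<^sub>v y\<close>.  It depends linearly on \<open>y\<close>, so the tangent vector \<open>v\<close>
  is mapped to \<open>v w^(k)\<close>.
\<close>
definition omega :: "nat list \<Rightarrow> complex vec \<Rightarrow> complex mat \<Rightarrow> dform" where
  "omega lam \<alpha> w = form_on (dim_row w) (arr_cone lam w) 1 (\<lambda>y vs.
     \<Sum>k<length lam. \<Sum>i<lam ! k. vblock lam \<alpha> k $ i *
       dtheta i (\<lambda>j. (transpose_mat (block lam w k) *\<^sub>v y) $ j)
                (\<lambda>j. (transpose_mat (block lam w k) *\<^sub>v (vs ! 0)) $ j))"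

text \<open>The map \<open>\<pi>\<close> from \<open>X^r\<close> to \<open>Y\<close> in homogeneous coordinates.\<close>
definition sym_map :: "nat \<Rightarrow> complex vec list \<Rightarrow> complex vec" where
  "sym_map r ss = vec (r + 1) (\<lambda>k.
     \<Sum>js \<in> {js. length js = r \<and> set js \<subseteq> {0, 1} \<and> sum_list js = k}. \<Prod>p<r. (ss ! p) $ (js ! p))"

text \<open>
  Pullbacks of 1-forms along \<open>\<pi>\<close> and along the \<open>i\<close>-th projection (\<open>i\<close> counted from 0), evaluated at
  \<open>ss = (s^1, ..., s^r)\<close> and the tangent vector \<open>us = (u^1, ..., u^r)\<close>.  These are forms on
  the product of \<open>r\<close> copies of the cone over \<open>X\<close>; since that product projects onto \<open>X^r\<close> by a submersion,
  forms on \<open>X^r\<close> agree iff they agree there.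
\<close>
definition sym_pullback :: "nat \<Rightarrow> dform \<Rightarrow> complex vec list \<Rightarrow> complex vec list \<Rightarrow> complex" where
  "sym_pullback r \<psi> ss us = \<psi> (sym_map r ss)
     [vec (r + 1) (\<lambda>k. deriv (\<lambda>t. sym_map r (map2 (\<lambda>s u. s + t \<cdot>\<^sub>v u) ss us) $ k) 0)]"

definition proj_pullback :: "nat \<Rightarrow> dform \<Rightarrow> complex vec list \<Rightarrow> complex vec list \<Rightarrow> complex" where
  "proj_pullback i \<phi> ss us = \<phi> (ss ! i) [us ! i]"

end

theory Submission
  imports Defs "HOL-Computational_Algebra.Fundamental_Theorem_Algebra"
begin

text \<open>
  In an affine coordinate \<open>t\<close> that puts one puncture at infinity, \<open>X\<close> is the complex line minus a finite set,
  functions and 1-forms on \<open>X\<close> are elements \<open>f\<close> of the ring \<open>A\<close> of rational functions regular there, and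
  \<open>H^1\<close> is the quotient of \<open>A\<close> by the image of \<open>\<nabla> g = g' + w g\<close>.  An \<open>r\<close>-form on \<open>Y\<close>
  pulls back to an antisymmetric function \<open>F (t_1, ..., t_r)\<close> that determines it, because by the
  fundamental theorem of algebra every point of \<open>Y\<close> comes from \<open>X^r\<close>.  Every \<open>f\<close> in \<open>A\<close> is the trace of
  a 1-form on \<open>Y\<close> (partial fractions; the traces are coefficients of logarithmic derivatives), and the wedge
  product of \<open>r\<close> such forms pulls back to \<open>det (f_i (t_j))\<close>.

  Since \<open>F\<close> is rational of bounded degree in each variable, Lagrange interpolation followed by
  antisymmetrization writes it as a combination of such determinants.  A determinant with a row \<open>\<nabla> g\<close> is a
  coboundary, so all rows may be taken from the given basis of \<open>H^1\<close>: the classes span.  For independence, the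
  coefficient functionals of that basis, applied in the \<open>r\<close> variables, annihilate coboundaries and
  are dual to the determinants.
\<close>

section \<open>Alternating multilinear functions of lists of vectors\<close>

text \<open>In substance, \<open>H^r\<close> of the symmetric product is the \<open>r\<close>-th
  exterior power of \<open>H^1\<close>; this would follow from the Kuenneth formula and invariants
  of the symmetric group. Neither is invoked. Descent from \<open>X^r\<close> is avoided because
  only determinants of one-variable functions have to come from \<open>Y\<close>, and for these the
  forms on \<open>Y\<close> are written down. Kuenneth is replaced by finite sums: once degrees in
  each variable are bounded uniformly in the others, a coefficient functional of \<open>H^1\<close>
  is a weighted sum of values at finitely many nodes and can be applied in one variable while the
  others stay fixed. Two obstacles shape the details. The tangent vectors to the coordinates
  \<open>t q\<close> become dependent where coordinates coincide, so there a form on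
  \<open>Y\<close> is recovered only as a limit. They also move with \<open>t\<close>, so pulling
  back the differential produces second derivatives, which cancel by symmetry. The forms \<omega> on
  \<open>X\<close> and on \<open>Y\<close> are compared by one trace formula that does not involve
  \<open>r\<close>, and the hypothesis on \<open>H^1\<close> is translated by the same machinery
  with \<open>r = 1\<close>.\<close>

definition alternating :: "nat \<Rightarrow> nat \<Rightarrow> (complex vec list \<Rightarrow> complex) \<Rightarrow> bool" where
  "alternating n p f \<longleftrightarrow> (\<forall>vs. length vs = p \<and> set vs \<subseteq> carrier_vec n \<longrightarrow>
     (\<forall>i<p. \<forall>u\<in>carrier_vec n. \<forall>v\<in>carrier_vec n. \<forall>a b.
        f (vs[i := a \<cdot>\<^sub>v u + b \<cdot>\<^sub>v v]) = a * f (vs[i := u]) + b * f (vs[i := v])) \<and>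
     (\<not> distinct vs \<longrightarrow> f vs = 0))"

lemma set_list_update_carrier:
  "set vs \<subseteq> carrier_vec n \<Longrightarrow> u \<in> carrier_vec n \<Longrightarrow> set (vs[i := u]) \<subseteq> carrier_vec n"
  by (meson insert_subset set_update_subset_insert subset_trans)

lemma alternating_lin:
  assumes "alternating n p f" "length vs = p" "set vs \<subseteq> carrier_vec n" "i < p"
    "u \<in> carrier_vec n" "v \<in> carrier_vec n"
  shows "f (vs[i := a \<cdot>\<^sub>v u + b \<cdot>\<^sub>v v]) = a * f (vs[i := u]) + b * f (vs[i := v])"
  using assms unfolding alternating_def by blast

lemma alternating_add:
  assumes "alternating n p f" "length vs = p" "set vs \<subseteq> carrier_vec n" "i < p"
    "u \<in> carrier_vec n" "v \<in> carrier_vec n"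
  shows "f (vs[i := u + v]) = f (vs[i := u]) + f (vs[i := v])"
  using alternating_lin[OF assms, of 1 1] by simp

lemma alternating_smult:
  assumes "alternating n p f" "length vs = p" "set vs \<subseteq> carrier_vec n" "i < p"
    "u \<in> carrier_vec n"
  shows "f (vs[i := a \<cdot>\<^sub>v u]) = a * f (vs[i := u])"
proof -
  have "a \<cdot>\<^sub>v u + 0 \<cdot>\<^sub>v u = a \<cdot>\<^sub>v u" using assms(5) by auto
  then show ?thesis using alternating_lin[OF assms assms(5), of a 0] by simp
qed

lemma alternating_add_smult:
  assumes "alternating n p f" "length vs = p" "set vs \<subseteq> carrier_vec n" "i < p"
    "u \<in> carrier_vec n" "v \<in> carrier_vec n"
  shows "f (vs[i := u + b \<cdot>\<^sub>v v]) = f (vs[i := u]) + b * f (vs[i := v])"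
  using alternating_lin[OF assms, of 1 b] by simp

lemma alternating_repeat:
  assumes "alternating n p f" "length vs = p" "set vs \<subseteq> carrier_vec n" "\<not> distinct vs"
  shows "f vs = 0"
  using assms unfolding alternating_def by blast

text \<open>Polarization: with \<open>u + v\<close> in both slots the value is zero, and after
  expansion only the two mixed terms are left.\<close>

lemma alternating_swap:
  assumes alt: "alternating n p f" and vs: "length vs = p" "set vs \<subseteq> carrier_vec n"
    and ij: "i < p" "j < p" "i \<noteq> j"
  shows "f (vs[i := vs ! j, j := vs ! i]) = - f vs"
proof -
  define u where "u = vs ! i"
  define v where "v = vs ! j"
  have uv: "u \<in> carrier_vec n" "v \<in> carrier_vec n"
    using vs ij by (auto simp: u_def v_def)
  have c: "set (vs[i := a, j := b]) \<subseteq> carrier_vec n" "set (vs[i := a]) \<subseteq> carrier_vec n"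
    if "a \<in> carrier_vec n" "b \<in> carrier_vec n" for a b
    using vs that by (simp_all add: set_list_update_carrier)
  have rep: "f (vs[i := a, j := a]) = 0" if "a \<in> carrier_vec n" for a
  proof -
    have "vs[i := a, j := a] ! i = vs[i := a, j := a] ! j" using ij vs by simp
    then have "\<not> distinct (vs[i := a, j := a])"
      using ij vs by (metis length_list_update nth_eq_iff_index_eq)
    then show ?thesis using alternating_repeat[OF alt] c[OF that that] vs by simp
  qed
  have s: "f (vs[i := a, j := u + v]) = f (vs[i := a, j := u]) + f (vs[i := a, j := v])"
    if "a \<in> carrier_vec n" for a
    using alternating_add[OF alt, of "vs[i := a]" j u v] c[OF that that] vs ij uv by simp
  have t: "f (vs[i := u + v, j := a]) = f (vs[i := u, j := a]) + f (vs[i := v, j := a])"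
    if "a \<in> carrier_vec n" for a
    using alternating_add[OF alt, of "vs[j := a]" i u v] set_list_update_carrier[OF vs(2) that]
      vs ij uv by (simp add: list_update_swap)
  have "0 = f (vs[i := u + v, j := u + v])" using rep[of "u + v"] uv by simp
  also have "\<dots> = f (vs[i := u, j := v]) + f (vs[i := v, j := u])"
    using s[of "u + v"] t[OF uv(1)] t[OF uv(2)] rep[OF uv(1)] rep[OF uv(2)] uv by simp
  also have "vs[i := u, j := v] = vs" using ij by (simp add: u_def v_def)
  finally show ?thesis by (simp add: u_def v_def eq_neg_iff_add_eq_0 add.commute)
qed

lemma alternating_permute:
  assumes alt: "alternating n p f" and vs: "length vs = p" "set vs \<subseteq> carrier_vec n"
    and \<pi>: "\<pi> permutes {0..<p}"
  shows "f (map (\<lambda>i. vs ! \<pi> i) [0..<p]) = of_int (sign \<pi>) * f vs"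
  using finite_atLeastLessThan \<pi>
proof (induction rule: permutes_rev_induct)
  case id
  have "map (\<lambda>i. vs ! id i) [0..<p] = vs" using vs map_nth[of vs] by simp
  then show ?case by simp
next
  case (swap a b \<pi>)
  let ?us = "map (\<lambda>i. vs ! \<pi> i) [0..<p]"
  have us: "length ?us = p" "set ?us \<subseteq> carrier_vec n"
    using vs permutes_in_image[OF swap(4)] by auto
  have "map (\<lambda>i. vs ! (\<pi> \<circ> Transposition.transpose a b) i) [0..<p] = ?us[a := ?us ! b, b := ?us ! a]"
    using swap(1-3) by (intro nth_equalityI) (auto simp: nth_list_update Transposition.transpose_def)
  also have "f \<dots> = - f ?us"
    using alternating_swap[OF alt us] swap(1-3) by auto
  also have "\<dots> = of_int (sign (\<pi> \<circ> Transposition.transpose a b)) * f vs"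
  proof -
    have "permutation \<pi>" using swap(4) permutation_permutes by blast
    then have "sign (\<pi> \<circ> Transposition.transpose a b) = - sign \<pi>"
      using swap(3) by (simp add: sign_compose permutation_swap_id sign_swap_id)
    then show ?thesis using swap(5) by simp
  qed
  finally show ?case .
qed

lemma length_omit: "i < length vs \<Longrightarrow> length (omit i vs) = length vs - 1"
  by (auto simp: omit_def)

lemma set_omit: "set (omit i vs) \<subseteq> set vs"
  by (auto simp: omit_def dest: in_set_takeD in_set_dropD)

lemma nth_omit: "i < length vs \<Longrightarrow> k < length vs - 1 \<Longrightarrow>
    omit i vs ! k = vs ! (if k < i then k else Suc k)"
  by (auto simp: omit_def nth_append min_def)

lemma map_omit: "map f (omit i vs) = omit i (map f vs)"
  by (simp add: omit_def take_map drop_map)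

lemma omit_update_same: "i < length vs \<Longrightarrow> omit i (vs[i := x]) = omit i vs"
  by (auto simp: omit_def)

lemma omit_update: "i < length vs \<Longrightarrow> j < length vs \<Longrightarrow> i \<noteq> j \<Longrightarrow>
    omit i (vs[j := x]) = (omit i vs)[(if j < i then j else j - 1) := x]"
  by (rule nth_equalityI) (auto simp: length_omit nth_omit nth_list_update)

lemma in_set_omit: "i < length vs \<Longrightarrow> k < length vs \<Longrightarrow> k \<noteq> i \<Longrightarrow> vs ! k \<in> set (omit i vs)"
  by (subst in_set_conv_nth, rule exI[of _ "if k < i then k else k - 1"])
     (auto simp: length_omit nth_omit)

text \<open>Moving the vector \<open>h\<close> past the entries between positions \<open>i\<close> and \<open>j\<close>.\<close>
lemma alternating_omit_slot_less:
  assumes alt: "alternating n p f"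
  shows "length vs = Suc p \<Longrightarrow> set vs \<subseteq> carrier_vec n \<Longrightarrow> h \<in> carrier_vec n \<Longrightarrow>
    i + Suc d < Suc p \<Longrightarrow>
    (-1) ^ i * f (omit i (vs[i + Suc d := h])) = - ((-1) ^ (i + Suc d) * f (omit (i + Suc d) (vs[i := h])))"
proof (induction d arbitrary: vs)
  case 0
  have "omit i (vs[Suc i := h]) = omit (Suc i) (vs[i := h])"
    using 0 by (intro nth_equalityI) (auto simp: length_omit nth_omit nth_list_update)
  then show ?case by simp
next
  case (Suc d)
  let ?j = "i + Suc d"
  let ?v = "vs ! ?j"
  let ?vs = "vs[Suc ?j := ?v]"
  have v: "?v \<in> carrier_vec n" using Suc.prems by auto
  have vs': "length ?vs = Suc p" "set ?vs \<subseteq> carrier_vec n"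
    using Suc.prems v by (simp_all add: set_list_update_carrier)
  let ?us = "omit i (vs[Suc ?j := h])"
  have us: "length ?us = p" "set ?us \<subseteq> carrier_vec n"
    using Suc.prems set_omit[of i "vs[Suc ?j := h]"] set_list_update_carrier[of vs n h "Suc ?j"]
    by (auto simp: length_omit)
  have "omit i (?vs[?j := h]) = ?us[i + d := ?us ! (i + Suc d), i + Suc d := ?us ! (i + d)]"
    using Suc.prems by (intro nth_equalityI) (auto simp: length_omit nth_omit nth_list_update)
  then have 1: "f (omit i (?vs[?j := h])) = - f ?us"
    using alternating_swap[OF alt us, of "i + d" "i + Suc d"] Suc.prems by simp
  have 2: "omit ?j (?vs[i := h]) = omit (Suc ?j) (vs[i := h])"
    using Suc.prems by (intro nth_equalityI) (auto simp: length_omit nth_omit nth_list_update)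
  have "(-1) ^ i * f (omit i (?vs[?j := h])) = - ((-1) ^ ?j * f (omit ?j (?vs[i := h])))"
    using Suc.IH[OF vs' Suc.prems(3)] Suc.prems(4) by simp
  then show ?case using 1 2 by simp (metis minus_minus)
qed

lemma alternating_omit_slot:
  assumes alt: "alternating n p f" and "length vs = Suc p" "set vs \<subseteq> carrier_vec n"
    "h \<in> carrier_vec n" "i < Suc p" "j < Suc p" "i \<noteq> j"
  shows "(-1) ^ i * f (omit i (vs[j := h])) = - ((-1) ^ j * f (omit j (vs[i := h])))"
proof (cases "i < j")
  case True
  then obtain d where "j = i + Suc d" by (metis less_natE add_Suc_right)
  then show ?thesis using alternating_omit_slot_less[OF assms(1-4), of i d] assms by simp
next
  case False
  then obtain d where "i = j + Suc d" using assms(7) by (metis less_natE add_Suc_right nat_neq_iff)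
  then show ?thesis using alternating_omit_slot_less[OF assms(1-4), of j d] assms by simp
qed

text \<open>The span is generated by two-term combinations, so that vanishing of a multilinear
  function spreads from \<open>S\<close> to the span by rule induction.\<close>

inductive_set vspan :: "complex vec set \<Rightarrow> complex vec set" for S where
  base: "s \<in> S \<Longrightarrow> s \<in> vspan S"
| comb: "u \<in> vspan S \<Longrightarrow> v \<in> vspan S \<Longrightarrow> a \<cdot>\<^sub>v u + b \<cdot>\<^sub>v v \<in> vspan S"

lemma vspan_carrier:
  assumes "S \<subseteq> carrier_vec n" "x \<in> vspan S"
  shows "x \<in> carrier_vec n"
  using assms(2) by (induction rule: vspan.induct) (use assms(1) in auto)

text \<open>The list is split into a part in the span and a part in \<open>S\<close>; the induction
  moves the last vector of the first part into the second, where rule induction on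
  \<open>vspan\<close> reduces it to a generator.\<close>

lemma alternating_zero_vspan:
  assumes alt: "alternating n p f" and S: "S \<subseteq> carrier_vec n"
    and zero: "\<And>vs. length vs = p \<Longrightarrow> set vs \<subseteq> S \<Longrightarrow> f vs = 0"
  shows "length (xs @ ys) = p \<Longrightarrow> set xs \<subseteq> vspan S \<Longrightarrow> set ys \<subseteq> S \<Longrightarrow> f (xs @ ys) = 0"
proof (induction xs arbitrary: ys rule: rev_induct)
  case Nil
  then show ?case using zero by simp
next
  case (snoc x xs)
  have "x \<in> vspan S" using snoc.prems by simp
  then have "f (xs @ x # ys) = 0"
  proof (induction rule: vspan.induct)
    case (base s)
    then show ?case using snoc.IH[of "s # ys"] snoc.prems by simp
  next
    case (comb u v a b)
    have c: "u \<in> carrier_vec n" "v \<in> carrier_vec n" using comb vspan_carrier[OF S] by auto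
    have l: "length (xs @ u # ys) = p" "set (xs @ u # ys) \<subseteq> carrier_vec n" "length xs < p"
      using snoc.prems c S vspan_carrier[OF S] by auto
    have "(xs @ u # ys)[length xs := y] = xs @ y # ys" for y by simp
    then show ?case using alternating_lin[OF alt l c, of a b] comb.IH by simp
  qed
  then show ?case by simp
qed

section \<open>Regular functions and forms on open cones\<close>

lemma polyfun_sum: "(\<And>i. i \<in> I \<Longrightarrow> f i \<in> polyfun n) \<Longrightarrow> (\<lambda>y. \<Sum>i\<in>I. f i y) \<in> polyfun n"
  by (induction I rule: infinite_finite_induct) (auto intro: polyfun.intros)

text \<open>A gradient with polynomial entries yields two facts at once: directional derivatives are
  linear in the direction, and they depend on the point in a regular way.\<close>

lemma polyfun_gradient:
  assumes "f \<in> polyfun n"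
  shows "\<exists>G. (\<forall>i. G i \<in> polyfun n) \<and> (\<forall>y\<in>carrier_vec n. \<forall>v\<in>carrier_vec n.
    ((\<lambda>t. f (y + t \<cdot>\<^sub>v v)) has_field_derivative (\<Sum>i<n. G i y * v $ i)) (at 0))"
  using assms
proof induction
  case (const c)
  show ?case by (rule exI[of _ "\<lambda>i y. 0"]) (auto intro: polyfun.intros)
next
  case (coord i)
  have "((\<lambda>t. (y + t \<cdot>\<^sub>v v) $ i) has_field_derivative (\<Sum>k<n. (if k = i then 1 else 0) * v $ k)) (at 0)"
    if "y \<in> carrier_vec n" "v \<in> carrier_vec n" for y v :: "complex vec"
  proof -
    have "(\<Sum>k<n. (if k = i then 1 else 0) * v $ k) = v $ i"
      using coord by (simp add: sum.delta if_distrib[of "\<lambda>x. x * _"] cong: if_cong)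
    moreover have "((\<lambda>t. y $ i + t * v $ i) has_field_derivative v $ i) (at 0)"
      by (auto intro!: derivative_eq_intros)
    ultimately show ?thesis using that coord by simp
  qed
  then show ?case
    by (intro exI[of _ "\<lambda>k y. if k = i then 1 else 0"]) (auto intro: polyfun.intros)
next
  case (add f g)
  then obtain F G where F: "\<forall>i. F i \<in> polyfun n" "\<forall>y\<in>carrier_vec n. \<forall>v\<in>carrier_vec n.
    ((\<lambda>t. f (y + t \<cdot>\<^sub>v v)) has_field_derivative (\<Sum>i<n. F i y * v $ i)) (at 0)"
    and G: "\<forall>i. G i \<in> polyfun n" "\<forall>y\<in>carrier_vec n. \<forall>v\<in>carrier_vec n.
    ((\<lambda>t. g (y + t \<cdot>\<^sub>v v)) has_field_derivative (\<Sum>i<n. G i y * v $ i)) (at 0)" by blast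
  show ?case
  proof (intro exI[of _ "\<lambda>i y. F i y + G i y"] conjI allI ballI)
    show "(\<lambda>y. F i y + G i y) \<in> polyfun n" for i using F G by (intro polyfun.add) auto
    show "((\<lambda>t. f (y + t \<cdot>\<^sub>v v) + g (y + t \<cdot>\<^sub>v v)) has_field_derivative
      (\<Sum>i<n. (F i y + G i y) * v $ i)) (at 0)" if "y \<in> carrier_vec n" "v \<in> carrier_vec n" for y v
      using DERIV_add[OF F(2)[rule_format, OF that] G(2)[rule_format, OF that]]
      by (simp add: sum.distrib distrib_right)
  qed
next
  case (mult f g)
  then obtain F G where F: "\<forall>i. F i \<in> polyfun n" "\<forall>y\<in>carrier_vec n. \<forall>v\<in>carrier_vec n.
    ((\<lambda>t. f (y + t \<cdot>\<^sub>v v)) has_field_derivative (\<Sum>i<n. F i y * v $ i)) (at 0)"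
    and G: "\<forall>i. G i \<in> polyfun n" "\<forall>y\<in>carrier_vec n. \<forall>v\<in>carrier_vec n.
    ((\<lambda>t. g (y + t \<cdot>\<^sub>v v)) has_field_derivative (\<Sum>i<n. G i y * v $ i)) (at 0)" by blast
  show ?case
  proof (intro exI[of _ "\<lambda>i y. F i y * g y + G i y * f y"] conjI allI ballI)
    show "(\<lambda>y. F i y * g y + G i y * f y) \<in> polyfun n" for i
      using F G mult by (intro polyfun.add polyfun.mult) auto
    show "((\<lambda>t. f (y + t \<cdot>\<^sub>v v) * g (y + t \<cdot>\<^sub>v v)) has_field_derivative
      (\<Sum>i<n. (F i y * g y + G i y * f y) * v $ i)) (at 0)"
      if "y \<in> carrier_vec n" "v \<in> carrier_vec n" for y v
    proof -
      have "y + 0 \<cdot>\<^sub>v v = y" using that by auto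
      then show ?thesis
        using DERIV_mult[OF F(2)[rule_format, OF that] G(2)[rule_format, OF that]]
        by (simp add: sum.distrib sum_distrib_left algebra_simps)
    qed
  qed
qed

lemma regular_const: "regular_on n U (\<lambda>y. c)"
  unfolding regular_on_def
  by (rule bexI[of _ "\<lambda>y. c"], rule bexI[of _ "\<lambda>y. 1"]) (auto intro: polyfun.const)

lemma regular_polyfun: "f \<in> polyfun n \<Longrightarrow> regular_on n U f"
  unfolding regular_on_def
  by (rule bexI[of _ f], rule bexI[of _ "\<lambda>y. 1"]) (auto intro: polyfun.const)

lemma regular_cong: "regular_on n U f \<Longrightarrow> (\<And>y. y \<in> U \<Longrightarrow> f y = g y) \<Longrightarrow> regular_on n U g"
  unfolding regular_on_def by metis

lemma regular_add:
  assumes "regular_on n U f" "regular_on n U g"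
  shows "regular_on n U (\<lambda>y. f y + g y)"
proof -
  obtain P Q where 1: "P \<in> polyfun n" "Q \<in> polyfun n" "\<forall>y\<in>U. Q y \<noteq> 0 \<and> f y = P y / Q y"
    using assms(1) unfolding regular_on_def by blast
  obtain R S where 2: "R \<in> polyfun n" "S \<in> polyfun n" "\<forall>y\<in>U. S y \<noteq> 0 \<and> g y = R y / S y"
    using assms(2) unfolding regular_on_def by blast
  show ?thesis unfolding regular_on_def
    using 1 2 by (intro bexI[of _ "\<lambda>y. P y * S y + R y * Q y"] bexI[of _ "\<lambda>y. Q y * S y"])
      (auto simp: field_simps intro!: polyfun.add polyfun.mult)
qed

lemma regular_mult:
  assumes "regular_on n U f" "regular_on n U g"
  shows "regular_on n U (\<lambda>y. f y * g y)"
proof -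
  obtain P Q where 1: "P \<in> polyfun n" "Q \<in> polyfun n" "\<forall>y\<in>U. Q y \<noteq> 0 \<and> f y = P y / Q y"
    using assms(1) unfolding regular_on_def by blast
  obtain R S where 2: "R \<in> polyfun n" "S \<in> polyfun n" "\<forall>y\<in>U. S y \<noteq> 0 \<and> g y = R y / S y"
    using assms(2) unfolding regular_on_def by blast
  show ?thesis unfolding regular_on_def
    using 1 2 by (intro bexI[of _ "\<lambda>y. P y * R y"] bexI[of _ "\<lambda>y. Q y * S y"])
      (auto simp: field_simps intro!: polyfun.add polyfun.mult)
qed

lemma regular_inverse:
  assumes "regular_on n U f" "\<And>y. y \<in> U \<Longrightarrow> f y \<noteq> 0"
  shows "regular_on n U (\<lambda>y. inverse (f y))"
proof -
  obtain P Q where 1: "P \<in> polyfun n" "Q \<in> polyfun n" "\<forall>y\<in>U. Q y \<noteq> 0 \<and> f y = P y / Q y"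
    using assms(1) unfolding regular_on_def by blast
  show ?thesis unfolding regular_on_def
    using 1 assms(2) by (intro bexI[of _ Q] bexI[of _ P]) auto
qed

lemma regular_sum: "(\<And>i. i \<in> I \<Longrightarrow> regular_on n U (f i)) \<Longrightarrow> regular_on n U (\<lambda>y. \<Sum>i\<in>I. f i y)"
  by (induction I rule: infinite_finite_induct) (auto intro: regular_const regular_add)

lemma regular_cmult: "regular_on n U f \<Longrightarrow> regular_on n U (\<lambda>y. c * f y)"
  by (intro regular_mult regular_const)

text \<open>Openness is demanded along complex lines only. This is all that directional derivatives
  see, and no topology on vectors enters.\<close>

definition open_cone :: "nat \<Rightarrow> complex vec set \<Rightarrow> bool" where
  "open_cone n U \<longleftrightarrow> U \<subseteq> carrier_vec n \<and>
     (\<forall>y\<in>U. \<forall>v\<in>carrier_vec n. \<forall>\<^sub>F t in nhds 0. y + t \<cdot>\<^sub>v v \<in> U) \<and>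
     (\<forall>y\<in>U. \<forall>c. c \<noteq> 0 \<longrightarrow> c \<cdot>\<^sub>v y \<in> U)"

lemma open_cone_carrier: "open_cone n U \<Longrightarrow> y \<in> U \<Longrightarrow> y \<in> carrier_vec n"
  by (auto simp: open_cone_def)

lemma open_cone_line: "open_cone n U \<Longrightarrow> y \<in> U \<Longrightarrow> v \<in> carrier_vec n \<Longrightarrow>
    \<forall>\<^sub>F t in nhds 0. y + t \<cdot>\<^sub>v v \<in> U"
  by (auto simp: open_cone_def)

lemma open_cone_smult: "open_cone n U \<Longrightarrow> y \<in> U \<Longrightarrow> c \<noteq> 0 \<Longrightarrow> c \<cdot>\<^sub>v y \<in> U"
  by (auto simp: open_cone_def)

lemma regular_gradient:
  assumes U: "open_cone n U" and "regular_on n U f"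
  shows "\<exists>G. (\<forall>i. regular_on n U (G i)) \<and> (\<forall>y\<in>U. \<forall>v\<in>carrier_vec n.
    ((\<lambda>t. f (y + t \<cdot>\<^sub>v v)) has_field_derivative (\<Sum>i<n. G i y * v $ i)) (at 0))"
proof -
  obtain P Q where PQ: "P \<in> polyfun n" "Q \<in> polyfun n" "\<forall>y\<in>U. Q y \<noteq> 0 \<and> f y = P y / Q y"
    using assms unfolding regular_on_def by blast
  obtain F where F: "\<forall>i. F i \<in> polyfun n" "\<forall>y\<in>carrier_vec n. \<forall>v\<in>carrier_vec n.
    ((\<lambda>t. P (y + t \<cdot>\<^sub>v v)) has_field_derivative (\<Sum>i<n. F i y * v $ i)) (at 0)"
    using polyfun_gradient[OF PQ(1)] by blast
  obtain G where G: "\<forall>i. G i \<in> polyfun n" "\<forall>y\<in>carrier_vec n. \<forall>v\<in>carrier_vec n.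
    ((\<lambda>t. Q (y + t \<cdot>\<^sub>v v)) has_field_derivative (\<Sum>i<n. G i y * v $ i)) (at 0)"
    using polyfun_gradient[OF PQ(2)] by blast
  let ?H = "\<lambda>i y. (F i y * Q y + (-1) * P y * G i y) * inverse (Q y) * inverse (Q y)"
  show ?thesis
  proof (intro exI[of _ ?H] conjI allI ballI)
    show "regular_on n U (?H i)" for i
      using PQ F G by (intro regular_mult regular_add regular_const regular_inverse)
        (auto intro: regular_polyfun)
    fix y v :: "complex vec" assume y: "y \<in> U" and v: "v \<in> carrier_vec n"
    have yc: "y \<in> carrier_vec n" using U y by (rule open_cone_carrier)
    have y0: "y + 0 \<cdot>\<^sub>v v = y" using yc v by auto
    have Q0: "Q y \<noteq> 0" using PQ y by auto
    have "((\<lambda>t. P (y + t \<cdot>\<^sub>v v) / Q (y + t \<cdot>\<^sub>v v)) has_field_derivative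
      ((\<Sum>i<n. F i y * v $ i) * Q y - P y * (\<Sum>i<n. G i y * v $ i)) / (Q y * Q y)) (at 0)"
      using DERIV_divide[OF F(2)[rule_format, OF yc v] G(2)[rule_format, OF yc v]] Q0 y0 by simp
    also have "((\<Sum>i<n. F i y * v $ i) * Q y - P y * (\<Sum>i<n. G i y * v $ i)) / (Q y * Q y) =
      (\<Sum>i<n. ?H i y * v $ i)"
      unfolding sum_distrib_left sum_distrib_right sum_subtractf[symmetric] sum_divide_distrib
      using Q0 by (intro sum.cong) (auto simp: field_simps)
    finally have "((\<lambda>t. P (y + t \<cdot>\<^sub>v v) / Q (y + t \<cdot>\<^sub>v v)) has_field_derivative
      (\<Sum>i<n. ?H i y * v $ i)) (at 0)" .
    \<comment> \<open>\<open>f\<close> agrees with \<open>P / Q\<close> on \<open>U\<close> only;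
      openness of \<open>U\<close> along the line carries the derivative over.\<close>
    moreover have "\<forall>\<^sub>F t in nhds 0. P (y + t \<cdot>\<^sub>v v) / Q (y + t \<cdot>\<^sub>v v) = f (y + t \<cdot>\<^sub>v v)"
      using open_cone_line[OF U y v] by eventually_elim (use PQ in auto)
    ultimately show "((\<lambda>t. f (y + t \<cdot>\<^sub>v v)) has_field_derivative (\<Sum>i<n. ?H i y * v $ i)) (at 0)"
      by (subst (asm) DERIV_cong_ev[OF refl _ refl]) 
  qed
qed

lemma Omega_form:
  assumes "\<eta> \<in> Omega n U p" "\<not> (y \<in> U \<and> length vs = p \<and> set vs \<subseteq> carrier_vec n)"
  shows "\<eta> y vs = 0"
proof -
  have "form_on n U p \<eta> = \<eta>" using assms(1) by (simp add: Omega_def)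
  then have "\<eta> y vs = form_on n U p \<eta> y vs" by simp
  then show ?thesis using assms(2) unfolding form_on_def by (simp only: if_False)
qed

lemma Omega_regular: "\<eta> \<in> Omega n U p \<Longrightarrow> length vs = p \<Longrightarrow> set vs \<subseteq> carrier_vec n \<Longrightarrow>
    regular_on n U (\<lambda>y. \<eta> y vs)"
  unfolding Omega_def by blast

lemma Omega_alternating: "\<eta> \<in> Omega n U p \<Longrightarrow> y \<in> U \<Longrightarrow> alternating n p (\<eta> y)"
  unfolding Omega_def alternating_def by blast

lemma Omega_scale: "\<eta> \<in> Omega n U p \<Longrightarrow> y \<in> U \<Longrightarrow> length vs = p \<Longrightarrow> set vs \<subseteq> carrier_vec n \<Longrightarrow>
    c \<noteq> 0 \<Longrightarrow> \<eta> (c \<cdot>\<^sub>v y) (map (\<lambda>v. c \<cdot>\<^sub>v v) vs) = \<eta> y vs"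
  unfolding Omega_def by blast

lemma Omega_radial: "\<eta> \<in> Omega n U p \<Longrightarrow> y \<in> U \<Longrightarrow> length vs = p \<Longrightarrow> set vs \<subseteq> carrier_vec n \<Longrightarrow>
    y \<in> set vs \<Longrightarrow> \<eta> y vs = 0"
  unfolding Omega_def by blast

lemma OmegaI:
  assumes "\<And>y vs. \<not> (y \<in> U \<and> length vs = p \<and> set vs \<subseteq> carrier_vec n) \<Longrightarrow> \<eta> y vs = 0"
    and "\<And>vs. length vs = p \<Longrightarrow> set vs \<subseteq> carrier_vec n \<Longrightarrow> regular_on n U (\<lambda>y. \<eta> y vs)"
    and "\<And>y. y \<in> U \<Longrightarrow> alternating n p (\<eta> y)"
    and "\<And>y vs c. y \<in> U \<Longrightarrow> length vs = p \<Longrightarrow> set vs \<subseteq> carrier_vec n \<Longrightarrow> c \<noteq> 0 \<Longrightarrow>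
      \<eta> (c \<cdot>\<^sub>v y) (map (\<lambda>v. c \<cdot>\<^sub>v v) vs) = \<eta> y vs"
    and "\<And>y vs. y \<in> U \<Longrightarrow> length vs = p \<Longrightarrow> set vs \<subseteq> carrier_vec n \<Longrightarrow> y \<in> set vs \<Longrightarrow> \<eta> y vs = 0"
  shows "\<eta> \<in> Omega n U p"
proof -
  have "form_on n U p \<eta> = \<eta>"
    unfolding form_on_def
  proof (intro ext)
    fix y vs
    show "(if y \<in> U \<and> length vs = p \<and> set vs \<subseteq> carrier_vec n then \<eta> y vs else 0) = \<eta> y vs"
      using assms(1)[of y vs] by (cases "y \<in> U \<and> length vs = p \<and> set vs \<subseteq> carrier_vec n") auto
  qed
  moreover note assms(2-)[unfolded alternating_def]
  ultimately show ?thesis unfolding Omega_def mem_Collect_eq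
    by (intro conjI allI impI ballI) blast+
qed

lemma Omega_lincomb:
  assumes "\<eta> \<in> Omega n U p" "\<theta> \<in> Omega n U p"
  shows "(\<lambda>y vs. a * \<eta> y vs + b * \<theta> y vs) \<in> Omega n U p"
proof (rule OmegaI)
  show "alternating n p (\<lambda>vs. a * \<eta> y vs + b * \<theta> y vs)" if "y \<in> U" for y
    using Omega_alternating[OF assms(1) that] Omega_alternating[OF assms(2) that]
    unfolding alternating_def by (simp add: algebra_simps)
next
  show "regular_on n U (\<lambda>y. a * \<eta> y vs + b * \<theta> y vs)"
    if "length vs = p" "set vs \<subseteq> carrier_vec n" for vs
    using that assms by (intro regular_add regular_cmult Omega_regular)
next
  fix y :: "complex vec" and vs :: "complex vec list" assume "\<not> (y \<in> U \<and> length vs = p \<and> set vs \<subseteq> carrier_vec n)"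
  from Omega_form[OF assms(1) this] Omega_form[OF assms(2) this]
  show "a * \<eta> y vs + b * \<theta> y vs = 0" by simp
next
  fix y :: "complex vec" and vs :: "complex vec list" and c assume *: "y \<in> U" "length vs = p" "set vs \<subseteq> carrier_vec n" "(c :: complex) \<noteq> 0"
  show "a * \<eta> (c \<cdot>\<^sub>v y) (map (\<lambda>v. c \<cdot>\<^sub>v v) vs) + b * \<theta> (c \<cdot>\<^sub>v y) (map (\<lambda>v. c \<cdot>\<^sub>v v) vs) =
      a * \<eta> y vs + b * \<theta> y vs"
    using Omega_scale[OF assms(1) *] Omega_scale[OF assms(2) *] by simp
next
  fix y :: "complex vec" and vs :: "complex vec list" assume *: "y \<in> U" "length vs = p" "set vs \<subseteq> carrier_vec n" "y \<in> set vs"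
  show "a * \<eta> y vs + b * \<theta> y vs = 0"
    using Omega_radial[OF assms(1) *] Omega_radial[OF assms(2) *] by simp
qed

lemma Omega_zero: "(\<lambda>y vs. 0) \<in> Omega n U p"
  by (rule OmegaI) (auto simp: alternating_def regular_const)

lemma Omega_sum:
  assumes "\<And>j. j \<in> J \<Longrightarrow> f j \<in> Omega n U p"
  shows "(\<lambda>y vs. \<Sum>j\<in>J. c j * f j y vs) \<in> Omega n U p"
  using assms
proof (induction J rule: infinite_finite_induct)
  case (insert x F)
  then show ?case using Omega_lincomb[of "f x" n U p "\<lambda>y vs. \<Sum>j\<in>F. c j * f j y vs" "c x" 1] by simp
qed (simp_all add: Omega_zero)

lemma alternating_cong:
  assumes f: "alternating n p f"
    and eq: "\<And>vs. length vs = p \<Longrightarrow> set vs \<subseteq> carrier_vec n \<Longrightarrow> f vs = g vs"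
  shows "alternating n p g"
  unfolding alternating_def
proof (intro allI impI conjI ballI)
  fix vs :: "complex vec list" and i and u v :: "complex vec" and a b
  assume vs: "length vs = p \<and> set vs \<subseteq> carrier_vec n" and i: "i < p"
    and uv: "u \<in> carrier_vec n" "v \<in> carrier_vec n"
  have "g (vs[i := w]) = f (vs[i := w])" if "w \<in> carrier_vec n" for w
    using eq[of "vs[i := w]"] vs set_list_update_carrier[OF _ that, of vs] by simp
  then show "g (vs[i := a \<cdot>\<^sub>v u + b \<cdot>\<^sub>v v]) = a * g (vs[i := u]) + b * g (vs[i := v])"
    using alternating_lin[OF f, of vs i u v a b] vs i uv by simp
next
  fix vs :: "complex vec list"
  assume "length vs = p \<and> set vs \<subseteq> carrier_vec n" "\<not> distinct vs"
  then show "g vs = 0" using eq[of vs] alternating_repeat[OF f, of vs] by simp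
qed

lemma not_distinct_omit:
  assumes i: "i < length vs" and k: "k < length vs" "k \<noteq> i" and l: "l < length vs" "l \<noteq> i"
    and kl: "k \<noteq> l" "vs ! k = vs ! l"
  shows "\<not> distinct (omit i vs)"
proof -
  define pos where "pos m = (if m < i then m else m - 1)" for m
  have pos: "omit i vs ! pos m = vs ! m" "pos m < length (omit i vs)"
    if "m < length vs" "m \<noteq> i" for m
    using i that by (cases "m < i"; simp add: nth_omit length_omit pos_def; linarith)+
  have "pos k \<noteq> pos l"
    using k(2) l(2) kl(1) unfolding pos_def by (simp split: if_split) linarith
  then show ?thesis using pos[OF k] pos[OF l] kl(2) nth_eq_iff_index_eq by metis
qed

text \<open>Common shape of \<open>nabla\<close> and \<open>wedge1\<close>. A given slot is either
  the vector taken out, where \<open>lin\<close> applies, or belongs to the rest, where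
  \<open>alt\<close> applies. If vectors \<open>k\<close> and \<open>l\<close> coincide, every term
  that omits neither contains a repetition, and the two remaining terms cancel because moving a
  vector from one position to the other costs exactly the sign between them.\<close>

lemma alternating_antisymmetrize:
  assumes alt: "\<And>u. u \<in> carrier_vec n \<Longrightarrow> alternating n p (N u)"
    and lin: "\<And>u v ws a b. u \<in> carrier_vec n \<Longrightarrow> v \<in> carrier_vec n \<Longrightarrow> length ws = p \<Longrightarrow>
      set ws \<subseteq> carrier_vec n \<Longrightarrow> N (a \<cdot>\<^sub>v u + b \<cdot>\<^sub>v v) ws = a * N u ws + b * N v ws"
  shows "alternating n (Suc p) (\<lambda>vs. \<Sum>i<length vs. (-1) ^ i * N (vs ! i) (omit i vs))"
  unfolding alternating_def
proof (intro allI impI conjI ballI)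
  fix vs :: "complex vec list" and k and u v :: "complex vec" and a b
  assume vs: "length vs = Suc p \<and> set vs \<subseteq> carrier_vec n" and k: "k < Suc p"
    and u: "u \<in> carrier_vec n" and v: "v \<in> carrier_vec n"
  let ?T = "\<lambda>w i. (-1) ^ i * N (vs[k := w] ! i) (omit i (vs[k := w]))"
  have "?T (a \<cdot>\<^sub>v u + b \<cdot>\<^sub>v v) i = a * ?T u i + b * ?T v i" if i: "i < Suc p" for i
  proof (cases "i = k")
    case True
    have "set (omit k vs) \<subseteq> carrier_vec n" using vs set_omit[of k vs] by auto
    then have "N (a \<cdot>\<^sub>v u + b \<cdot>\<^sub>v v) (omit k vs) = a * N u (omit k vs) + b * N v (omit k vs)"
      using vs k by (intro lin[OF u v]) (simp_all add: length_omit)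
    then show ?thesis using True vs k by (simp add: omit_update_same distrib_left mult.left_commute)
  next
    case False
    have c: "vs ! i \<in> carrier_vec n" "set (omit i vs) \<subseteq> carrier_vec n" "length (omit i vs) = p"
      using vs set_omit[of i vs] i by (auto simp: length_omit)
    have l: "(if k < i then k else k - 1) < p" using False i k by auto
    have "omit i (vs[k := w]) = (omit i vs)[(if k < i then k else k - 1) := w]" for w
      using False vs i k by (intro omit_update) auto
    then show ?thesis
      using False alternating_lin[OF alt[OF c(1)] c(3,2) l u v, of a b]
      by (simp only: nth_list_update_neq) (simp add: distrib_left mult.left_commute split del: if_split)
  qed
  then show "(\<Sum>i<length (vs[k := a \<cdot>\<^sub>v u + b \<cdot>\<^sub>v v]). ?T (a \<cdot>\<^sub>v u + b \<cdot>\<^sub>v v) i) =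
      a * (\<Sum>i<length (vs[k := u]). ?T u i) + b * (\<Sum>i<length (vs[k := v]). ?T v i)"
    using vs by (simp add: sum.distrib sum_distrib_left del: sum.lessThan_Suc)
next
  fix vs :: "complex vec list"
  assume vs: "length vs = Suc p \<and> set vs \<subseteq> carrier_vec n" and nd: "\<not> distinct vs"
  then obtain k l where kl: "k < Suc p" "l < Suc p" "k \<noteq> l" "vs ! k = vs ! l"
    by (auto simp: distinct_conv_nth)
  let ?T = "\<lambda>i. (-1) ^ i * N (vs ! i) (omit i vs)"
  have c: "vs ! i \<in> carrier_vec n" "set (omit i vs) \<subseteq> carrier_vec n" if "i < Suc p" for i
    using vs set_omit[of i vs] that by auto
  have other: "?T i = 0" if i: "i \<in> {..<Suc p} - {k, l}" for i
  proof -
    have "\<not> distinct (omit i vs)"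
      using i kl vs by (intro not_distinct_omit[of i vs k l]) auto
    then show ?thesis using alternating_repeat[OF alt[OF c(1)], of i "omit i vs"] c vs i
      by (simp add: length_omit)
  qed
  have "(\<Sum>i<length vs. ?T i) = (\<Sum>i\<in>{k, l}. ?T i)"
    using vs kl other by (intro sum.mono_neutral_right) auto
  also have "\<dots> = ?T k + ?T l" using kl by simp
  also have "\<dots> = 0"
  proof -
    have "vs[l := vs ! k] = vs" "vs[k := vs ! k] = vs" using kl(4) by (metis list_update_id)+
    then show ?thesis
      using alternating_omit_slot[OF alt[OF c(1)[OF kl(1)]], of vs "vs ! k" k l] vs kl c(1)[OF kl(1)]
      by simp
  qed
  finally show "(\<Sum>i<length vs. ?T i) = 0" .
qed

section \<open>The twisted differential as an antisymmetrized covariant derivative\<close>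

definition cov :: "dform \<Rightarrow> dform \<Rightarrow> complex vec \<Rightarrow> complex vec \<Rightarrow> complex vec list \<Rightarrow> complex" where
  "cov \<omega> \<eta> y u ws = deriv (\<lambda>t. \<eta> (y + t \<cdot>\<^sub>v u) ws) 0 + \<omega> y [u] * \<eta> y ws"

lemma nabla_eq:
  assumes "y \<in> U" "set vs \<subseteq> carrier_vec n"
  shows "nabla n U \<omega> \<eta> y vs = (\<Sum>i<length vs. (-1) ^ i * cov \<omega> \<eta> y (vs ! i) (omit i vs))"
proof -
  have "ext_d n U \<eta> y vs =
      (\<Sum>i<length vs. (-1) ^ i * deriv (\<lambda>t. \<eta> (y + t \<cdot>\<^sub>v (vs ! i)) (omit i vs)) 0)"
    unfolding ext_d_def using assms by (simp only: simp_thms if_True)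
  then show ?thesis
    unfolding nabla_def wedge1_def cov_def distrib_left sum.distrib mult.assoc by (simp only:)
qed

lemma Omega_field_derivative:
  assumes "open_cone n U" "\<eta> \<in> Omega n U p" "y \<in> U" "u \<in> carrier_vec n"
  shows "((\<lambda>t. \<eta> (y + t \<cdot>\<^sub>v u) ws) has_field_derivative deriv (\<lambda>t. \<eta> (y + t \<cdot>\<^sub>v u) ws) 0) (at 0)"
proof (cases "length ws = p \<and> set ws \<subseteq> carrier_vec n")
  case True
  then obtain G where "\<forall>y\<in>U. \<forall>v\<in>carrier_vec n.
    ((\<lambda>t. \<eta> (y + t \<cdot>\<^sub>v v) ws) has_field_derivative (\<Sum>i<n. G i y * v $ i)) (at 0)"
    using regular_gradient[OF assms(1) Omega_regular[OF assms(2)]] by blast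
  then have d: "((\<lambda>t. \<eta> (y + t \<cdot>\<^sub>v u) ws) has_field_derivative (\<Sum>i<n. G i y * u $ i)) (at 0)"
    using assms(3,4) by blast
  from d DERIV_imp_deriv[OF d] show ?thesis by simp
next
  case False
  then have "\<eta> (y + t \<cdot>\<^sub>v u) ws = 0" for t by (intro Omega_form[OF assms(2)]) blast
  then show ?thesis by simp
qed

lemma wedge1_outside:
  assumes \<omega>: "\<omega> \<in> Omega n U 1" and \<eta>: "\<eta> \<in> Omega n U p"
    and bad: "\<not> (y \<in> U \<and> length vs = Suc p \<and> set vs \<subseteq> carrier_vec n)"
  shows "wedge1 \<omega> \<eta> y vs = 0"
proof -
  have "\<omega> y [vs ! i] * \<eta> y (omit i vs) = 0" if i: "i < length vs" for i
  proof (cases "y \<in> U \<and> length vs = Suc p")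
    case True
    then obtain k where k: "k < length vs" "vs ! k \<notin> carrier_vec n"
      using bad by (metis in_set_conv_nth subsetI)
    show ?thesis
    proof (cases "k = i")
      case True then show ?thesis using k Omega_form[OF \<omega>, of y "[vs ! i]"] by simp
    next
      case False
      then have "\<not> set (omit i vs) \<subseteq> carrier_vec n" using k in_set_omit[OF i k(1)] by auto
      then show ?thesis using Omega_form[OF \<eta>] by simp
    qed
  next
    case False
    then have "y \<notin> U \<or> length (omit i vs) \<noteq> p" using i by (auto simp: length_omit)
    then show ?thesis using Omega_form[OF \<eta>] by auto
  qed
  then show ?thesis by (auto simp: wedge1_def mult.assoc intro!: sum.neutral)
qed

context
  fixes n :: nat and U :: "complex vec set" and \<omega> :: dform
  assumes U: "open_cone n U" and \<omega>: "\<omega> \<in> Omega n U 1"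
begin

lemma Omega1_lin:
  assumes "y \<in> U" "u \<in> carrier_vec n" "v \<in> carrier_vec n"
  shows "\<omega> y [a \<cdot>\<^sub>v u + b \<cdot>\<^sub>v v] = a * \<omega> y [u] + b * \<omega> y [v]"
proof -
  have "\<omega> y ([u][0 := a \<cdot>\<^sub>v u + b \<cdot>\<^sub>v v]) = a * \<omega> y ([u][0 := u]) + b * \<omega> y ([u][0 := v])"
    by (rule alternating_lin[OF Omega_alternating[OF \<omega> assms(1)]]) (use assms in auto)
  then show ?thesis by simp
qed

lemma cov_lin:
  assumes \<eta>: "\<eta> \<in> Omega n U p" and y: "y \<in> U" and u: "u \<in> carrier_vec n" and v: "v \<in> carrier_vec n"
    and ws: "length ws = p" "set ws \<subseteq> carrier_vec n"
  shows "cov \<omega> \<eta> y (a \<cdot>\<^sub>v u + b \<cdot>\<^sub>v v) ws = a * cov \<omega> \<eta> y u ws + b * cov \<omega> \<eta> y v ws"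
proof -
  obtain G where G: "\<forall>y\<in>U. \<forall>v\<in>carrier_vec n.
    ((\<lambda>t. \<eta> (y + t \<cdot>\<^sub>v v) ws) has_field_derivative (\<Sum>i<n. G i y * v $ i)) (at 0)"
    using regular_gradient[OF U Omega_regular[OF \<eta> ws]] by blast
  have "deriv (\<lambda>t. \<eta> (y + t \<cdot>\<^sub>v x) ws) 0 = (\<Sum>i<n. G i y * x $ i)" if "x \<in> carrier_vec n" for x
    using G y that by (blast intro: DERIV_imp_deriv)
  then have "deriv (\<lambda>t. \<eta> (y + t \<cdot>\<^sub>v (a \<cdot>\<^sub>v u + b \<cdot>\<^sub>v v)) ws) 0 =
      a * deriv (\<lambda>t. \<eta> (y + t \<cdot>\<^sub>v u) ws) 0 + b * deriv (\<lambda>t. \<eta> (y + t \<cdot>\<^sub>v v) ws) 0"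
    using u v by (simp add: sum_distrib_left sum.distrib[symmetric] algebra_simps)
  then show ?thesis using Omega1_lin[OF y u v, of a b] by (simp add: cov_def algebra_simps)
qed

text \<open>The identities that make \<open>\<eta>\<close> alternating hold at all points of the
  line near \<open>y\<close>, so they can be differentiated.\<close>

lemma alternating_cov:
  assumes \<eta>: "\<eta> \<in> Omega n U p" and y: "y \<in> U" and u: "u \<in> carrier_vec n"
  shows "alternating n p (cov \<omega> \<eta> y u)"
proof -
  have ev: "\<forall>\<^sub>F t in nhds 0. alternating n p (\<eta> (y + t \<cdot>\<^sub>v u))"
    using open_cone_line[OF U y u] by eventually_elim (use Omega_alternating[OF \<eta>] in auto)
  note D = Omega_field_derivative[OF U \<eta> y u]
  show ?thesis unfolding alternating_def
  proof (intro allI impI conjI ballI)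
    fix vs :: "complex vec list" and i and v w :: "complex vec" and a b
    assume vs: "length vs = p \<and> set vs \<subseteq> carrier_vec n" and i: "i < p"
      and v: "v \<in> carrier_vec n" and w: "w \<in> carrier_vec n"
    have "((\<lambda>t. a * \<eta> (y + t \<cdot>\<^sub>v u) (vs[i := v]) + b * \<eta> (y + t \<cdot>\<^sub>v u) (vs[i := w]))
      has_field_derivative a * deriv (\<lambda>t. \<eta> (y + t \<cdot>\<^sub>v u) (vs[i := v])) 0 +
        b * deriv (\<lambda>t. \<eta> (y + t \<cdot>\<^sub>v u) (vs[i := w])) 0) (at 0)"
      by (intro DERIV_add DERIV_cmult D)
    moreover have "\<forall>\<^sub>F t in nhds 0. a * \<eta> (y + t \<cdot>\<^sub>v u) (vs[i := v]) + b * \<eta> (y + t \<cdot>\<^sub>v u) (vs[i := w]) =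
        \<eta> (y + t \<cdot>\<^sub>v u) (vs[i := a \<cdot>\<^sub>v v + b \<cdot>\<^sub>v w])"
      using ev by eventually_elim (use alternating_lin vs i v w in auto)
    ultimately have "deriv (\<lambda>t. \<eta> (y + t \<cdot>\<^sub>v u) (vs[i := a \<cdot>\<^sub>v v + b \<cdot>\<^sub>v w])) 0 =
        a * deriv (\<lambda>t. \<eta> (y + t \<cdot>\<^sub>v u) (vs[i := v])) 0 + b * deriv (\<lambda>t. \<eta> (y + t \<cdot>\<^sub>v u) (vs[i := w])) 0"
      by (intro trans[OF deriv_cong_ev[OF _ refl] DERIV_imp_deriv]) (simp_all add: eq_commute)
    then show "cov \<omega> \<eta> y u (vs[i := a \<cdot>\<^sub>v v + b \<cdot>\<^sub>v w]) =
        a * cov \<omega> \<eta> y u (vs[i := v]) + b * cov \<omega> \<eta> y u (vs[i := w])"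
      using alternating_lin[OF Omega_alternating[OF \<eta> y], of vs i v w a b] vs i v w
      by (simp add: cov_def algebra_simps)
  next
    fix vs :: "complex vec list"
    assume vs: "length vs = p \<and> set vs \<subseteq> carrier_vec n" and nd: "\<not> distinct vs"
    have "\<forall>\<^sub>F t in nhds 0. \<eta> (y + t \<cdot>\<^sub>v u) vs = 0"
      using ev by eventually_elim (use alternating_repeat vs nd in blast)
    then have "deriv (\<lambda>t. \<eta> (y + t \<cdot>\<^sub>v u) vs) 0 = deriv (\<lambda>t. 0) 0"
      by (intro deriv_cong_ev) auto
    then show "cov \<omega> \<eta> y u vs = 0"
      using alternating_repeat[OF Omega_alternating[OF \<eta> y]] vs nd by (simp add: cov_def)
  qed
qed

text \<open>At the moving point \<open>y + t u\<close> the form kills the radial vector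
  \<open>y + t u\<close>. With the fixed vector \<open>y\<close> in the slot it therefore equals
  \<open>- t\<close> times its value with \<open>u\<close>, and the derivative of this at
  \<open>t = 0\<close> is the claim.\<close>

lemma cov_radial_slot:
  assumes \<eta>: "\<eta> \<in> Omega n U p" and y: "y \<in> U" and u: "u \<in> carrier_vec n"
    and ws: "length ws = p" "set ws \<subseteq> carrier_vec n" and k: "k < p"
  shows "cov \<omega> \<eta> y u (ws[k := y]) = - \<eta> y (ws[k := u])"
proof -
  note yc = open_cone_carrier[OF U y]
  have mem: "x \<in> set (ws[k := x])" for x using k ws by (simp add: set_update_memI)
  have "\<forall>\<^sub>F t in nhds 0. \<eta> (y + t \<cdot>\<^sub>v u) (ws[k := y]) = - t * \<eta> (y + t \<cdot>\<^sub>v u) (ws[k := u])"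
    using open_cone_line[OF U y u]
  proof eventually_elim
    case (elim t)
    note a = Omega_alternating[OF \<eta> elim]
    have c: "y + t \<cdot>\<^sub>v u \<in> carrier_vec n" using yc u by simp
    have "\<eta> (y + t \<cdot>\<^sub>v u) (ws[k := y + t \<cdot>\<^sub>v u]) = 0"
      using Omega_radial[OF \<eta> elim] ws set_list_update_carrier[OF ws(2) c] mem by simp
    then show ?case using alternating_add_smult[OF a ws k yc u, of t] by (simp add: eq_neg_iff_add_eq_0)
  qed
  moreover have "((\<lambda>t. - t * \<eta> (y + t \<cdot>\<^sub>v u) (ws[k := u])) has_field_derivative
      - \<eta> y (ws[k := u])) (at 0)"
  proof -
    have "y + 0 \<cdot>\<^sub>v u = y" using yc u by auto
    then show ?thesis
      using DERIV_mult[OF DERIV_minus[OF DERIV_ident] Omega_field_derivative[OF U \<eta> y u, of "ws[k := u]"]]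
      by simp
  qed
  ultimately have "deriv (\<lambda>t. \<eta> (y + t \<cdot>\<^sub>v u) (ws[k := y])) 0 = - \<eta> y (ws[k := u])"
    by (rule trans[OF deriv_cong_ev[OF _ refl] DERIV_imp_deriv])
  moreover have "\<eta> y (ws[k := y]) = 0"
    using Omega_radial[OF \<eta> y] ws set_list_update_carrier[OF ws(2) yc] mem by simp
  ultimately show ?thesis by (simp add: cov_def)
qed

text \<open>Euler's identity for the homogeneity of a form under scaling.\<close>
lemma cov_radial:
  assumes \<eta>: "\<eta> \<in> Omega n U p" and y: "y \<in> U" and ws: "length ws = p" "set ws \<subseteq> carrier_vec n"
  shows "cov \<omega> \<eta> y y ws = - of_nat p * \<eta> y ws"
proof -
  note yc = open_cone_carrier[OF U y]
  have scale: "\<eta> z (map (\<lambda>v. c \<cdot>\<^sub>v v) ws) = c ^ p * \<eta> z ws" if z: "z \<in> U" for z c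
  proof -
    have "\<eta> z (map (\<lambda>v. c \<cdot>\<^sub>v v) (take k ws) @ drop k ws) = c ^ k * \<eta> z ws" if "k \<le> p" for k
      using that
    proof (induction k)
      case (Suc k)
      let ?us = "map (\<lambda>v. c \<cdot>\<^sub>v v) (take k ws) @ drop k ws"
      have us: "length ?us = p" "set ?us \<subseteq> carrier_vec n"
        using Suc.prems ws by (auto dest!: in_set_takeD in_set_dropD)
      have e: "?us[k := ws ! k] = ?us" "?us[k := c \<cdot>\<^sub>v ws ! k] =
          map (\<lambda>v. c \<cdot>\<^sub>v v) (take (Suc k) ws) @ drop (Suc k) ws"
        using Suc.prems ws
        by (auto intro!: nth_equalityI simp: nth_append nth_list_update less_Suc_eq)
      have "ws ! k \<in> carrier_vec n" using Suc.prems ws by auto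
      then show ?case
        using alternating_smult[OF Omega_alternating[OF \<eta> z] us, of k "ws ! k" c] e Suc by simp
    qed simp
    from this[of p] show ?thesis using ws by simp
  qed
  have "((\<lambda>t::complex. 1 + t) \<longlongrightarrow> 1) (nhds 0)"
    by (auto intro!: tendsto_eq_intros filterlim_ident)
  then have "\<forall>\<^sub>F t in nhds 0. (1 + t :: complex) \<noteq> 0"
    by (rule tendsto_imp_eventually_ne) simp
  \<comment> \<open>Scaling point and vectors together changes nothing, and scaling the
    \<open>p\<close> vectors alone gives the factor \<open>c ^ p\<close>; hence the form is
    homogeneous of degree \<open>- p\<close> in the point.\<close>
  then have "\<forall>\<^sub>F t in nhds 0. \<eta> (y + t \<cdot>\<^sub>v y) ws = inverse ((1 + t) ^ p) * \<eta> y ws"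
  proof eventually_elim
    case (elim t)
    have e: "y + t \<cdot>\<^sub>v y = (1 + t) \<cdot>\<^sub>v y" by (auto simp: algebra_simps)
    have "y + t \<cdot>\<^sub>v y \<in> U" unfolding e using open_cone_smult[OF U y elim] .
    then show ?case
      using scale[of "y + t \<cdot>\<^sub>v y" "1 + t"] Omega_scale[OF \<eta> y ws elim] elim
      unfolding e by (simp add: field_simps)
  qed
  moreover have "((\<lambda>t. inverse ((1 + t) ^ p) * \<eta> y ws) has_field_derivative - of_nat p * \<eta> y ws) (at 0)"
    by (auto intro!: derivative_eq_intros)
  ultimately have "deriv (\<lambda>t. \<eta> (y + t \<cdot>\<^sub>v y) ws) 0 = - of_nat p * \<eta> y ws"
    by (rule trans[OF deriv_cong_ev[OF _ refl] DERIV_imp_deriv])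
  moreover have "\<omega> y [y] = 0" using Omega_radial[OF \<omega> y, of "[y]"] yc by simp
  ultimately show ?thesis by (simp add: cov_def)
qed

text \<open>Let \<open>y\<close> be in slot \<open>i\<close>. Each of the \<open>p\<close> terms
  that take out another vector equals \<open>(-1) ^ i\<close> times the form on the vectors other
  than \<open>y\<close>, by \<open>cov_radial_slot\<close>; the term that takes out \<open>y\<close>
  itself gives \<open>- p\<close> times this, by Euler's identity.\<close>

lemma nabla_radial:
  assumes \<eta>: "\<eta> \<in> Omega n U p" and y: "y \<in> U"
    and vs: "length vs = Suc p" "set vs \<subseteq> carrier_vec n" "y \<in> set vs"
  shows "nabla n U \<omega> \<eta> y vs = 0"
proof -
  obtain i where i: "i < Suc p" "vs ! i = y" using vs by (metis in_set_conv_nth)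
  have c: "vs ! k \<in> carrier_vec n" "length (omit k vs) = p" "set (omit k vs) \<subseteq> carrier_vec n"
    if "k < Suc p" for k
    using vs that set_omit[of k vs] by (auto simp: length_omit)
  have "(-1) ^ k * cov \<omega> \<eta> y (vs ! k) (omit k vs) = (-1) ^ i * \<eta> y (omit i vs)"
    if k: "k < Suc p" "k \<noteq> i" for k
  proof -
    define j where "j = (if i < k then i else i - 1)"
    have j: "j < p" using k i by (auto simp: j_def)
    have slot: "(omit k vs)[j := x] = omit k (vs[i := x])" for x
      using k i vs by (simp add: omit_update j_def)
    have "(omit k vs)[j := y] = omit k vs"
      using slot[of y] i by (metis list_update_id)
    then have "cov \<omega> \<eta> y (vs ! k) (omit k vs) = - \<eta> y (omit k (vs[i := vs ! k]))"
      using cov_radial_slot[OF \<eta> y c(1)[OF k(1)] c(2,3)[OF k(1)] j] slot by simp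
    then show ?thesis
      using alternating_omit_slot[OF Omega_alternating[OF \<eta> y] vs(1,2) c(1)[OF k(1)] k(1) i(1) k(2)]
      by simp
  qed
  then have "nabla n U \<omega> \<eta> y vs = (\<Sum>k<Suc p. if k = i then (-1) ^ i * cov \<omega> \<eta> y y (omit i vs)
      else (-1) ^ i * \<eta> y (omit i vs))"
    unfolding nabla_eq[OF y vs(2)] using vs i by (intro sum.cong) auto
  also have "\<dots> = (-1) ^ i * cov \<omega> \<eta> y y (omit i vs) + of_nat p * ((-1) ^ i * \<eta> y (omit i vs))"
    using i by (subst sum.remove[of _ i]) (auto simp del: sum.lessThan_Suc)
  also have "\<dots> = 0" using cov_radial[OF \<eta> y c(2,3)[OF i(1)]] by simp
  finally show ?thesis .
qed

lemma nabla_Omega: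
  assumes \<eta>: "\<eta> \<in> Omega n U p"
  shows "nabla n U \<omega> \<eta> \<in> Omega n U (Suc p)"
proof (rule OmegaI)
  fix y :: "complex vec" and vs :: "complex vec list" assume bad: "\<not> (y \<in> U \<and> length vs = Suc p \<and> set vs \<subseteq> carrier_vec n)"
  have "ext_d n U \<eta> y vs = 0"
  proof (cases "y \<in> U \<and> set vs \<subseteq> carrier_vec n")
    case True
    then have "length (omit i vs) \<noteq> p" if "i < length vs" for i
      using bad that by (simp add: length_omit)
    then have "\<eta> z (omit i vs) = 0" if "i < length vs" for z i
      using that Omega_form[OF \<eta>] by blast
    then show ?thesis by (simp add: ext_d_def)
  qed (auto simp: ext_d_def)
  then show "nabla n U \<omega> \<eta> y vs = 0"
    using wedge1_outside[OF \<omega> \<eta> bad] by (simp add: nabla_def)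
next
  fix vs :: "complex vec list" assume vs: "length vs = Suc p" "set vs \<subseteq> carrier_vec n"
  have "regular_on n U (\<lambda>y. cov \<omega> \<eta> y (vs ! i) (omit i vs))" if i: "i < Suc p" for i
  proof -
    have c: "vs ! i \<in> carrier_vec n" "length (omit i vs) = p" "set (omit i vs) \<subseteq> carrier_vec n"
      using vs i set_omit[of i vs] by (auto simp: length_omit)
    obtain G where G: "\<forall>i. regular_on n U (G i)" "\<forall>y\<in>U. \<forall>v\<in>carrier_vec n.
      ((\<lambda>t. \<eta> (y + t \<cdot>\<^sub>v v) (omit i vs)) has_field_derivative (\<Sum>i<n. G i y * v $ i)) (at 0)"
      using regular_gradient[OF U Omega_regular[OF \<eta> c(2,3)]] by blast
    have "regular_on n U (\<lambda>y. (\<Sum>k<n. G k y * vs ! i $ k) + \<omega> y [vs ! i] * \<eta> y (omit i vs))"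
      using G c Omega_regular[OF \<omega>, of "[vs ! i]"] Omega_regular[OF \<eta> c(2,3)]
      by (intro regular_add regular_sum regular_mult regular_const) auto
    then show ?thesis
    proof (rule regular_cong)
      fix y assume "y \<in> U"
      then have "deriv (\<lambda>t. \<eta> (y + t \<cdot>\<^sub>v vs ! i) (omit i vs)) 0 = (\<Sum>k<n. G k y * vs ! i $ k)"
        using G(2) c(1) by (intro DERIV_imp_deriv) blast
      then show "(\<Sum>k<n. G k y * vs ! i $ k) + \<omega> y [vs ! i] * \<eta> y (omit i vs) =
          cov \<omega> \<eta> y (vs ! i) (omit i vs)"
        by (simp add: cov_def)
    qed
  qed
  then have "regular_on n U (\<lambda>y. \<Sum>i<Suc p. (-1) ^ i * cov \<omega> \<eta> y (vs ! i) (omit i vs))"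
    by (intro regular_sum regular_cmult) auto
  then show "regular_on n U (\<lambda>y. nabla n U \<omega> \<eta> y vs)"
    by (rule regular_cong) (use vs in \<open>simp add: nabla_eq\<close>)
next
  fix y assume y: "y \<in> U"
  have "alternating n (Suc p) (\<lambda>vs. \<Sum>i<length vs. (-1) ^ i * cov \<omega> \<eta> y (vs ! i) (omit i vs))"
    using alternating_cov[OF \<eta> y] cov_lin[OF \<eta> y] by (rule alternating_antisymmetrize)
  then show "alternating n (Suc p) (nabla n U \<omega> \<eta> y)"
    by (rule alternating_cong) (simp add: nabla_eq[OF y])
next
  fix y :: "complex vec" and vs :: "complex vec list" and c assume y: "y \<in> U" and vs: "length vs = Suc p" "set vs \<subseteq> carrier_vec n" and "(c :: complex) \<noteq> 0"
  have "cov \<omega> \<eta> (c \<cdot>\<^sub>v y) (c \<cdot>\<^sub>v u) (map (\<lambda>v. c \<cdot>\<^sub>v v) ws) = cov \<omega> \<eta> y u ws"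
    if u: "u \<in> carrier_vec n" and ws: "length ws = p" "set ws \<subseteq> carrier_vec n" for u ws
  proof -
    have "\<forall>\<^sub>F t in nhds 0. \<eta> (c \<cdot>\<^sub>v y + t \<cdot>\<^sub>v (c \<cdot>\<^sub>v u)) (map (\<lambda>v. c \<cdot>\<^sub>v v) ws) = \<eta> (y + t \<cdot>\<^sub>v u) ws"
      using open_cone_line[OF U y u]
    proof eventually_elim
      case (elim t)
      have "c \<cdot>\<^sub>v y + t \<cdot>\<^sub>v (c \<cdot>\<^sub>v u) = c \<cdot>\<^sub>v (y + t \<cdot>\<^sub>v u)"
        using open_cone_carrier[OF U y] u by (auto simp: algebra_simps)
      then show ?case using Omega_scale[OF \<eta> elim ws] \<open>c \<noteq> 0\<close> by simp
    qed
    then have "deriv (\<lambda>t. \<eta> (c \<cdot>\<^sub>v y + t \<cdot>\<^sub>v (c \<cdot>\<^sub>v u)) (map (\<lambda>v. c \<cdot>\<^sub>v v) ws)) 0 =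
        deriv (\<lambda>t. \<eta> (y + t \<cdot>\<^sub>v u) ws) 0"
      by (rule deriv_cong_ev) (rule refl)
    then show ?thesis
      using Omega_scale[OF \<eta> y ws \<open>c \<noteq> 0\<close>] Omega_scale[OF \<omega> y, of "[u]" c] u \<open>c \<noteq> 0\<close>
      unfolding cov_def by simp
  qed
  then have cov: "cov \<omega> \<eta> (c \<cdot>\<^sub>v y) (map (\<lambda>v. c \<cdot>\<^sub>v v) vs ! i) (omit i (map (\<lambda>v. c \<cdot>\<^sub>v v) vs)) =
      cov \<omega> \<eta> y (vs ! i) (omit i vs)" if "i < length vs" for i
    using vs that set_omit[of i vs] unfolding map_omit[symmetric] nth_map[OF that]
    by (metis length_omit diff_Suc_1 nth_mem subset_iff)
  have "c \<cdot>\<^sub>v y \<in> U" using open_cone_smult[OF U y \<open>c \<noteq> 0\<close>] .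
  moreover have "set (map (\<lambda>v. c \<cdot>\<^sub>v v) vs) \<subseteq> carrier_vec n" using vs by auto
  ultimately show "nabla n U \<omega> \<eta> (c \<cdot>\<^sub>v y) (map (\<lambda>v. c \<cdot>\<^sub>v v) vs) = nabla n U \<omega> \<eta> y vs"
    unfolding nabla_eq[OF y vs(2)]
    by (subst nabla_eq) (assumption+, intro sum.cong, simp_all only: length_map cov lessThan_iff)
next
  fix y :: "complex vec" and vs :: "complex vec list"
  assume "y \<in> U" "length vs = Suc p" "set vs \<subseteq> carrier_vec n" "y \<in> set vs"
  then show "nabla n U \<omega> \<eta> y vs = 0" by (rule nabla_radial[OF \<eta>])
qed

lemma nabla_lincomb:
  assumes "\<eta> \<in> Omega n U p" "\<theta> \<in> Omega n U p"
  shows "nabla n U \<omega> (\<lambda>y vs. a * \<eta> y vs + b * \<theta> y vs) =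
    (\<lambda>y vs. a * nabla n U \<omega> \<eta> y vs + b * nabla n U \<omega> \<theta> y vs)" (is "?L = ?R")
proof (intro ext)
  fix y vs
  show "?L y vs = ?R y vs"
  proof (cases "y \<in> U \<and> set vs \<subseteq> carrier_vec n")
    case True
    have "cov \<omega> (\<lambda>y vs. a * \<eta> y vs + b * \<theta> y vs) y (vs ! i) ws =
        a * cov \<omega> \<eta> y (vs ! i) ws + b * cov \<omega> \<theta> y (vs ! i) ws" if "i < length vs" for i ws
    proof -
      have "vs ! i \<in> carrier_vec n" using True that by auto
      then have "deriv (\<lambda>t. a * \<eta> (y + t \<cdot>\<^sub>v (vs ! i)) ws + b * \<theta> (y + t \<cdot>\<^sub>v (vs ! i)) ws) 0 =
        a * deriv (\<lambda>t. \<eta> (y + t \<cdot>\<^sub>v (vs ! i)) ws) 0 + b * deriv (\<lambda>t. \<theta> (y + t \<cdot>\<^sub>v (vs ! i)) ws) 0"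
        using True by (intro DERIV_imp_deriv DERIV_add DERIV_cmult 
          Omega_field_derivative[OF U assms(1)] Omega_field_derivative[OF U assms(2)]) auto
      then show ?thesis by (simp add: cov_def algebra_simps)
    qed
    then show ?thesis using True
      by (simp add: nabla_eq sum_distrib_left sum.distrib[symmetric] algebra_simps)
  next
    case False
    note z = Omega_form[OF nabla_Omega, of _ p y vs]
    show ?thesis using z[OF assms(1)] z[OF assms(2)] z[OF Omega_lincomb[OF assms, of a b]] False by auto
  qed
qed

end

section \<open>Cohomology in the top degree\<close>

lemma ex1_unique: "\<exists>!x. P x \<Longrightarrow> P a \<Longrightarrow> P b \<Longrightarrow> a = b"
  by blast

context
  fixes n :: nat and U :: "complex vec set" and \<omega> :: dform
  assumes U: "open_cone n U" and \<omega>: "\<omega> \<in> Omega n U 1"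
begin

lemma coboundaries_iff:
  "b \<in> coboundaries n U \<omega> (Suc p) \<longleftrightarrow> (\<exists>\<beta>\<in>Omega n U p. b = nabla n U \<omega> \<beta>)"
  unfolding coboundaries_def by (simp add: image_iff)

lemma coboundaries_lincomb:
  assumes "b \<in> coboundaries n U \<omega> (Suc p)" "b' \<in> coboundaries n U \<omega> (Suc p)"
  shows "(\<lambda>y vs. x * b y vs + x' * b' y vs) \<in> coboundaries n U \<omega> (Suc p)"
proof -
  obtain \<beta> where \<beta>: "\<beta> \<in> Omega n U p" "b = nabla n U \<omega> \<beta>"
    using assms(1) unfolding coboundaries_iff by blast
  obtain \<beta>' where \<beta>': "\<beta>' \<in> Omega n U p" "b' = nabla n U \<omega> \<beta>'"
    using assms(2) unfolding coboundaries_iff by blast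
  show ?thesis
    unfolding coboundaries_iff \<beta>(2) \<beta>'(2) nabla_lincomb[OF U \<omega> \<beta>(1) \<beta>'(1), symmetric]
    by (rule bexI[OF refl Omega_lincomb[OF \<beta>(1) \<beta>'(1)]])
qed

lemma coboundaries_zero: "(\<lambda>y vs. 0) \<in> coboundaries n U \<omega> (Suc p)"
proof -
  have "nabla n U \<omega> (\<lambda>y vs. 0) \<in> coboundaries n U \<omega> (Suc p)"
    unfolding coboundaries_iff by (rule bexI[OF refl Omega_zero])
  then show ?thesis using coboundaries_lincomb[of _ p _ 0 0] by simp
qed

lemma coh_class_eq_iff:
  "coh_class n U \<omega> (Suc p) \<eta> = coh_class n U \<omega> (Suc p) \<theta> \<longleftrightarrow>
    (\<lambda>y vs. \<eta> y vs - \<theta> y vs) \<in> coboundaries n U \<omega> (Suc p)"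
proof
  assume eq: "coh_class n U \<omega> (Suc p) \<eta> = coh_class n U \<omega> (Suc p) \<theta>"
  have "\<eta> \<in> coh_class n U \<omega> (Suc p) \<eta>"
    unfolding coh_class_def using coboundaries_zero by force
  then obtain b where "b \<in> coboundaries n U \<omega> (Suc p)" "\<eta> = (\<lambda>y vs. \<theta> y vs + b y vs)"
    unfolding eq by (auto simp: coh_class_def)
  then show "(\<lambda>y vs. \<eta> y vs - \<theta> y vs) \<in> coboundaries n U \<omega> (Suc p)" by simp
next
  have sub: "coh_class n U \<omega> (Suc p) \<eta> \<subseteq> coh_class n U \<omega> (Suc p) \<theta>"
    if d: "(\<lambda>y vs. \<eta> y vs - \<theta> y vs) \<in> coboundaries n U \<omega> (Suc p)" for \<eta> \<theta>
  proof
    fix h assume "h \<in> coh_class n U \<omega> (Suc p) \<eta>"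
    then obtain b where b: "b \<in> coboundaries n U \<omega> (Suc p)" "h = (\<lambda>y vs. \<eta> y vs + b y vs)"
      by (auto simp: coh_class_def)
    have "(\<lambda>y vs. (\<eta> y vs - \<theta> y vs) + b y vs) \<in> coboundaries n U \<omega> (Suc p)"
      using coboundaries_lincomb[OF d b(1), of 1 1] by simp
    moreover have "h = (\<lambda>y vs. \<theta> y vs + ((\<eta> y vs - \<theta> y vs) + b y vs))" using b(2) by simp
    ultimately show "h \<in> coh_class n U \<omega> (Suc p) \<theta>" unfolding coh_class_def mem_Collect_eq
      by (intro exI conjI)
  qed
  assume d: "(\<lambda>y vs. \<eta> y vs - \<theta> y vs) \<in> coboundaries n U \<omega> (Suc p)"
  have "(\<lambda>y vs. \<theta> y vs - \<eta> y vs) \<in> coboundaries n U \<omega> (Suc p)"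
    using coboundaries_lincomb[OF d d, of "-1" 0] by simp
  then show "coh_class n U \<omega> (Suc p) \<eta> = coh_class n U \<omega> (Suc p) \<theta>"
    using sub[OF d] sub by blast
qed

text \<open>When all forms of the degree are cocycles, a basis of cohomology is a family that spans
  all forms modulo coboundaries and is independent modulo coboundaries. In this form the statement
  no longer mentions classes or extensional coefficient functions.\<close>

lemma cohomology_basis_top_iff:
  assumes top: "\<And>\<eta>. \<eta> \<in> Omega n U (Suc p) \<Longrightarrow> nabla n U \<omega> \<eta> = (\<lambda>y vs. 0)"
    and J: "finite J" and f: "\<And>j. j \<in> J \<Longrightarrow> f j \<in> Omega n U (Suc p)"
  shows "cohomology_basis n U \<omega> (Suc p) J f \<longleftrightarrow>
    (\<forall>\<eta>\<in>Omega n U (Suc p). \<exists>c. \<exists>\<beta>\<in>Omega n U p.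
      \<forall>y vs. \<eta> y vs = (\<Sum>j\<in>J. c j * f j y vs) + nabla n U \<omega> \<beta> y vs) \<and>
    (\<forall>c. \<forall>\<beta>\<in>Omega n U p. (\<forall>y vs. (\<Sum>j\<in>J. c j * f j y vs) = nabla n U \<omega> \<beta> y vs) \<longrightarrow> (\<forall>j\<in>J. c j = 0))"
    (is "_ \<longleftrightarrow> ?S \<and> ?I")
proof -
  let ?B = "coboundaries n U \<omega> (Suc p)"
  have coc: "cocycles n U \<omega> (Suc p) = Omega n U (Suc p)"
    using top by (auto simp: cocycles_def)
  have S: "?S \<longleftrightarrow> (\<forall>\<eta>\<in>Omega n U (Suc p). \<exists>c. (\<lambda>y vs. \<eta> y vs - (\<Sum>j\<in>J. c j * f j y vs)) \<in> ?B)"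
    unfolding coboundaries_iff fun_eq_iff by (simp add: diff_eq_eq add.commute)
  have I: "?I \<longleftrightarrow> (\<forall>c. (\<lambda>y vs. \<Sum>j\<in>J. c j * f j y vs) \<in> ?B \<longrightarrow> (\<forall>j\<in>J. c j = 0))"
    unfolding coboundaries_iff fun_eq_iff by blast
  show ?thesis
  proof
    assume b: "cohomology_basis n U \<omega> (Suc p) J f"
    have ex1: "\<exists>!c. c \<in> J \<rightarrow>\<^sub>E UNIV \<and>
        (\<lambda>y vs. \<eta> y vs - (\<Sum>j\<in>J. c j * f j y vs)) \<in> ?B" if "\<eta> \<in> Omega n U (Suc p)" for \<eta>
      using b that unfolding cohomology_basis_def cohomology_def coc
      by (auto simp: coh_class_eq_iff)
    have "?S" unfolding S using ex1 by blast
    moreover have ?I unfolding I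
    proof (intro allI impI ballI)
      fix c j assume c: "(\<lambda>y vs. \<Sum>j\<in>J. c j * f j y vs) \<in> ?B" and j: "j \<in> J"
      \<comment> \<open>The coefficients \<open>- c\<close> and \<open>0\<close>, made extensional
        on \<open>J\<close>, both represent the class of the zero form, so uniqueness identifies
        them.\<close>
      have "(\<lambda>y vs. (0 :: complex) - (\<Sum>j\<in>J. restrict (\<lambda>j. - c j) J j * f j y vs)) \<in> ?B"
        using c by (simp add: sum_negf)
      moreover have "(\<lambda>y vs. (0 :: complex) - (\<Sum>j\<in>J. restrict (\<lambda>j. 0) J j * f j y vs)) \<in> ?B"
        using coboundaries_zero by simp
      moreover have "restrict g J \<in> J \<rightarrow>\<^sub>E (UNIV :: complex set)" for g by simp
      ultimately have eq: "restrict (\<lambda>j. - c j) J = restrict (\<lambda>j. 0) J"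
        by (intro ex1_unique[OF ex1[OF Omega_zero]]) (rule conjI, assumption, assumption)+
      from fun_cong[OF eq, of j] show "c j = 0" using j by simp
    qed
    ultimately show "?S \<and> ?I" ..
  next
    assume "?S \<and> ?I"
    then have S': "\<And>\<eta>. \<eta> \<in> Omega n U (Suc p) \<Longrightarrow>
        \<exists>c. (\<lambda>y vs. \<eta> y vs - (\<Sum>j\<in>J. c j * f j y vs)) \<in> ?B"
      and I': "\<And>c. (\<lambda>y vs. \<Sum>j\<in>J. c j * f j y vs) \<in> ?B \<Longrightarrow> (\<forall>j\<in>J. c j = 0)"
      using S I by blast+
    have "\<exists>!c. c \<in> J \<rightarrow>\<^sub>E UNIV \<and> (\<lambda>y vs. \<eta> y vs - (\<Sum>j\<in>J. c j * f j y vs)) \<in> ?B"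
      if \<eta>: "\<eta> \<in> Omega n U (Suc p)" for \<eta>
    proof -
      obtain c where c: "(\<lambda>y vs. \<eta> y vs - (\<Sum>j\<in>J. c j * f j y vs)) \<in> ?B" using S'[OF \<eta>] by blast
      show ?thesis
      proof (rule ex1I[of _ "restrict c J"])
        show "restrict c J \<in> J \<rightarrow>\<^sub>E UNIV \<and> (\<lambda>y vs. \<eta> y vs - (\<Sum>j\<in>J. restrict c J j * f j y vs)) \<in> ?B"
          using c by simp
        fix d assume d: "d \<in> J \<rightarrow>\<^sub>E UNIV \<and> (\<lambda>y vs. \<eta> y vs - (\<Sum>j\<in>J. d j * f j y vs)) \<in> ?B"
        have "(\<lambda>y vs. \<Sum>j\<in>J. (d j - c j) * f j y vs) \<in> ?B"
          using coboundaries_lincomb[OF c conjunct2[OF d], of 1 "-1"]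
          by (simp add: sum_subtractf left_diff_distrib)
        then have "\<forall>j\<in>J. d j = c j" using I'[of "\<lambda>j. d j - c j"] by auto
        then show "d = restrict c J" using d by (auto simp: PiE_def extensional_def)
      qed
    qed
    then show "cohomology_basis n U \<omega> (Suc p) J f"
      unfolding cohomology_basis_def cohomology_def coc using J f
      by (auto simp: coh_class_eq_iff)
  qed
qed

end

section \<open>Exterior products of 1-forms as determinants\<close>

lemma wedge1_Omega:
  assumes \<psi>: "\<psi> \<in> Omega n U 1" and \<eta>: "\<eta> \<in> Omega n U p"
  shows "wedge1 \<psi> \<eta> \<in> Omega n U (Suc p)"
proof (rule OmegaI)
  fix y :: "complex vec" and vs :: "complex vec list"
  assume "\<not> (y \<in> U \<and> length vs = Suc p \<and> set vs \<subseteq> carrier_vec n)"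
  then show "wedge1 \<psi> \<eta> y vs = 0" by (rule wedge1_outside[OF \<psi> \<eta>])
next
  fix vs :: "complex vec list" assume vs: "length vs = Suc p" "set vs \<subseteq> carrier_vec n"
  have "vs ! i \<in> carrier_vec n" "length (omit i vs) = p" "set (omit i vs) \<subseteq> carrier_vec n"
    if "i < Suc p" for i using vs that set_omit[of i vs] by (auto simp: length_omit)
  then show "regular_on n U (\<lambda>y. wedge1 \<psi> \<eta> y vs)"
    unfolding wedge1_def using vs
    by (intro regular_sum regular_mult regular_const Omega_regular[OF \<psi>] Omega_regular[OF \<eta>]) auto
next
  fix y assume y: "y \<in> U"
  have "alternating n (Suc p) (\<lambda>vs. \<Sum>i<length vs. (-1) ^ i * (\<psi> y [vs ! i] * \<eta> y (omit i vs)))"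
  proof (rule alternating_antisymmetrize)
    show "alternating n p (\<lambda>ws. \<psi> y [u] * \<eta> y ws)" for u
      using Omega_alternating[OF \<eta> y] unfolding alternating_def by (simp add: algebra_simps)
    show "\<psi> y [a \<cdot>\<^sub>v u + b \<cdot>\<^sub>v v] * \<eta> y ws = a * (\<psi> y [u] * \<eta> y ws) + b * (\<psi> y [v] * \<eta> y ws)"
      if "u \<in> carrier_vec n" "v \<in> carrier_vec n" for u v a b ws
      using alternating_lin[OF Omega_alternating[OF \<psi> y], of "[u]" 0 u v a b] that
      by (simp add: algebra_simps)
  qed
  then show "alternating n (Suc p) (wedge1 \<psi> \<eta> y)"
    by (rule alternating_cong) (simp add: wedge1_def mult.assoc)
next
  fix y :: "complex vec" and vs :: "complex vec list" and c
  assume y: "y \<in> U" and vs: "length vs = Suc p" "set vs \<subseteq> carrier_vec n" and c: "(c :: complex) \<noteq> 0"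
  have "\<psi> (c \<cdot>\<^sub>v y) [c \<cdot>\<^sub>v (vs ! i)] = \<psi> y [vs ! i] \<and>
      \<eta> (c \<cdot>\<^sub>v y) (map (\<lambda>v. c \<cdot>\<^sub>v v) (omit i vs)) = \<eta> y (omit i vs)" if i: "i < Suc p" for i
  proof -
    have "vs ! i \<in> carrier_vec n" "set (omit i vs) \<subseteq> carrier_vec n" "length (omit i vs) = p"
      using vs i set_omit[of i vs] nth_mem[of i vs] by (auto simp: length_omit)
    then show ?thesis
      using Omega_scale[OF \<psi> y _ _ c, of "[vs ! i]"] Omega_scale[OF \<eta> y _ _ c, of "omit i vs"]
      by simp
  qed
  then show "wedge1 \<psi> \<eta> (c \<cdot>\<^sub>v y) (map (\<lambda>v. c \<cdot>\<^sub>v v) vs) = wedge1 \<psi> \<eta> y vs"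
    using vs unfolding wedge1_def by (simp add: map_omit[symmetric] del: sum.lessThan_Suc)
next
  fix y :: "complex vec" and vs :: "complex vec list"
  assume y: "y \<in> U" and vs: "length vs = Suc p" "set vs \<subseteq> carrier_vec n" "y \<in> set vs"
  obtain k where k: "k < length vs" "vs ! k = y" using vs by (metis in_set_conv_nth)
  have "\<psi> y [vs ! i] * \<eta> y (omit i vs) = 0" if i: "i < length vs" for i
  proof (cases "i = k")
    case True
    then show ?thesis using Omega_radial[OF \<psi> y, of "[y]"] k vs by auto
  next
    case False
    then have "y \<in> set (omit i vs)" using in_set_omit[OF i k(1)] k by auto
    then have "\<eta> y (omit i vs) = 0"
      using Omega_radial[OF \<eta> y] vs set_omit[of i vs] i by (simp add: length_omit subset_trans)
    then show ?thesis by simp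
  qed
  then show "wedge1 \<psi> \<eta> y vs = 0" by (auto simp: wedge1_def mult.assoc intro!: sum.neutral)
qed

lemma form_on_const_Omega:
  assumes U: "open_cone n U"
  shows "form_on n U 0 (\<lambda>y vs. 1) \<in> Omega n U 0"
proof (rule OmegaI)
  show "regular_on n U (\<lambda>y. form_on n U 0 (\<lambda>y vs. 1) y vs)" if "length vs = 0" for vs
    by (rule regular_cong[OF regular_const[of n U 1]]) (use that in \<open>auto simp: form_on_def\<close>)
qed (use open_cone_smult[OF U] in \<open>auto simp: form_on_def alternating_def\<close>)

lemma wedge_list_Omega:
  assumes "open_cone n U"
  shows "set \<psi>s \<subseteq> Omega n U 1 \<Longrightarrow> wedge_list n U \<psi>s \<in> Omega n U (length \<psi>s)"
proof (induction \<psi>s)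
  case Nil
  then show ?case using form_on_const_Omega[OF assms] by (simp add: wedge_list_def)
next
  case (Cons \<psi> \<psi>s)
  then show ?case using wedge1_Omega[of \<psi> n U "wedge_list n U \<psi>s"] by (simp add: wedge_list_def)
qed

text \<open>Unfolding \<open>wedge1\<close> once is the Laplace expansion along the first row:
  omitting the \<open>j\<close>-th vector deletes column \<open>j\<close>.\<close>

lemma wedge_list_eq_det:
  assumes "y \<in> U"
  shows "length vs = length \<psi>s \<Longrightarrow> set vs \<subseteq> carrier_vec n \<Longrightarrow> wedge_list n U \<psi>s y vs =
    det (mat (length \<psi>s) (length \<psi>s) (\<lambda>(i, j). (\<psi>s ! i) y [vs ! j]))"
proof (induction \<psi>s arbitrary: vs)
  case Nil
  then show ?case using assms by (simp add: wedge_list_def form_on_def)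
next
  case (Cons \<psi> \<psi>s)
  let ?k = "length \<psi>s"
  let ?A = "mat (Suc ?k) (Suc ?k) (\<lambda>(i, j). ((\<psi> # \<psi>s) ! i) y [vs ! j])"
  have "det ?A = (\<Sum>j<Suc ?k. ?A $$ (0, j) * cofactor ?A 0 j)"
    by (rule laplace_expansion_row) auto
  also have "\<dots> = (\<Sum>j<Suc ?k. (-1) ^ j * \<psi> y [vs ! j] * wedge_list n U \<psi>s y (omit j vs))"
  proof (rule sum.cong)
    fix j assume j: "j \<in> {..<Suc ?k}"
    have "mat_delete ?A 0 j = mat ?k ?k (\<lambda>(i, j'). (\<psi>s ! i) y [omit j vs ! j'])"
      by (rule eq_matI) (use Cons.prems j in \<open>auto simp: mat_delete_def nth_omit\<close>)
    moreover have "wedge_list n U \<psi>s y (omit j vs) = det (mat ?k ?k (\<lambda>(i, j'). (\<psi>s ! i) y [omit j vs ! j']))"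
      using Cons.prems j set_omit[of j vs] by (intro Cons.IH) (auto simp: length_omit)
    ultimately show "?A $$ (0, j) * cofactor ?A 0 j = (-1) ^ j * \<psi> y [vs ! j] * wedge_list n U \<psi>s y (omit j vs)"
      using j by (simp add: cofactor_def)
  qed simp
  also have "\<dots> = wedge_list n U (\<psi> # \<psi>s) y vs"
    using Cons.prems by (simp add: wedge_list_def wedge1_def del: sum.lessThan_Suc)
  finally show ?case by simp
qed

section \<open>Products of linear forms\<close>

definition lin_series :: "nat \<Rightarrow> (nat \<Rightarrow> complex vec) \<Rightarrow> complex fps" where
  "lin_series r l = (\<Prod>p<r. fps_const (l p $ 0) + fps_const (l p $ 1) * fps_X)"

text \<open>The symmetric product map of the points \<open>l 0, ..., l (r - 1)\<close>, read off from a product of linear forms.\<close>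
definition lin_prod :: "nat \<Rightarrow> (nat \<Rightarrow> complex vec) \<Rightarrow> complex vec" where
  "lin_prod r l = vec (r + 1) (fps_nth (lin_series r l))"

text \<open>The scalar product of \<open>y\<close> with the Veronese vector \<open>(c0^r, c0^(r-1) c1, ..., c1^r)\<close>; the map \<open>h\<close>
  embeds the complex numbers in the ring that contains \<open>c0\<close> and \<open>c1\<close>.\<close>
definition bform :: "(complex \<Rightarrow> 'a :: comm_ring_1) \<Rightarrow> nat \<Rightarrow> 'a \<Rightarrow> 'a \<Rightarrow> complex vec \<Rightarrow> 'a" where
  "bform h r c0 c1 y = (\<Sum>k\<le>r. h (y $ k) * (c0 ^ (r - k) * c1 ^ k))"

lemma lin_prod_carrier [simp]: "lin_prod r l \<in> carrier_vec (r + 1)" "lin_prod r l \<in> carrier_vec (Suc r)"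
  by (simp_all add: lin_prod_def)

lemma lin_prod_nth: "k \<le> r \<Longrightarrow> lin_prod r l $ k = fps_nth (lin_series r l) k"
  by (simp add: lin_prod_def)

lemma lin_series_Suc: "lin_series (Suc r) l =
    fps_const (l r $ 0) * lin_series r l + fps_const (l r $ 1) * (fps_X * lin_series r l)"
  by (simp add: lin_series_def algebra_simps)

lemma lin_series_Suc_nth: "fps_nth (lin_series (Suc r) l) k =
    l r $ 0 * fps_nth (lin_series r l) k + (if k = 0 then 0 else l r $ 1 * fps_nth (lin_series r l) (k - 1))"
  unfolding lin_series_Suc by simp

lemma lin_series_nth_eq_0: "r < k \<Longrightarrow> fps_nth (lin_series r l) k = 0"
proof (induction r arbitrary: k)
  case 0
  then show ?case by (simp add: lin_series_def)
qed (simp add: lin_series_Suc_nth)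

lemma lin_series_cong: "(\<And>p. p < r \<Longrightarrow> l p = m p) \<Longrightarrow> lin_series r l = lin_series r m"
  by (simp add: lin_series_def)

lemma lin_prod_cong: "(\<And>p. p < r \<Longrightarrow> l p = m p) \<Longrightarrow> lin_prod r l = lin_prod r m"
  using lin_series_cong[of r l m] by (simp add: lin_prod_def)

text \<open>The coordinates of a symmetric product are the coefficients of a product of binary
  linear forms, so pairing with a Veronese vector evaluates that product. It is stated over a ring
  extension because it is used for points as well as for curves, whose coordinates are power
  series.\<close>

lemma bform_lin_prod:
  assumes "comm_ring_hom h"
  shows "bform h r c0 c1 (lin_prod r l) = (\<Prod>p<r. h (l p $ 0) * c0 + h (l p $ 1) * c1)"
proof -
  interpret comm_ring_hom h by fact
  have "(\<Sum>k\<le>r. h (fps_nth (lin_series r l) k) * (c0 ^ (r - k) * c1 ^ k)) =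
      (\<Prod>p<r. h (l p $ 0) * c0 + h (l p $ 1) * c1)"
  proof (induction r)
    case 0
    then show ?case by (simp add: lin_series_def)
  next
    case (Suc r)
    let ?e = "\<lambda>k. h (fps_nth (lin_series r l) k)"
    have "(\<Sum>k\<le>Suc r. h (fps_nth (lin_series (Suc r) l) k) * (c0 ^ (Suc r - k) * c1 ^ k)) =
      (\<Sum>k\<le>Suc r. h (l r $ 0) * ?e k * (c0 ^ (Suc r - k) * c1 ^ k)) +
      (\<Sum>k\<le>Suc r. (if k = 0 then 0 else h (l r $ 1) * ?e (k - 1)) * (c0 ^ (Suc r - k) * c1 ^ k))"
      unfolding sum.distrib[symmetric]
      by (intro sum.cong refl) (simp add: lin_series_Suc_nth hom_add hom_mult distrib_right)
    also have "(\<Sum>k\<le>Suc r. h (l r $ 0) * ?e k * (c0 ^ (Suc r - k) * c1 ^ k)) =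
      h (l r $ 0) * c0 * (\<Sum>k\<le>r. ?e k * (c0 ^ (r - k) * c1 ^ k))"
      by (simp add: sum.atMost_Suc lin_series_nth_eq_0 sum_distrib_left Suc_diff_le mult_ac cong: sum.cong_simp)
    also have "(\<Sum>k\<le>Suc r. (if k = 0 then 0 else h (l r $ 1) * ?e (k - 1)) * (c0 ^ (Suc r - k) * c1 ^ k)) =
      h (l r $ 1) * c1 * (\<Sum>k\<le>r. ?e k * (c0 ^ (r - k) * c1 ^ k))"
      by (subst sum.atMost_Suc_shift) (simp add: sum_distrib_left mult_ac)
    finally show ?case unfolding Suc.IH by (simp add: distrib_right[symmetric] mult.commute)
  qed
  then show ?thesis by (simp add: bform_def lin_prod_nth cong: sum.cong_simp)
qed

lemma lin_series_remove:
  assumes "p < r"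
  shows "lin_series r l = (fps_const (l p $ 0) + fps_const (l p $ 1) * fps_X) *
    (\<Prod>q\<in>{..<r} - {p}. fps_const (l q $ 0) + fps_const (l q $ 1) * fps_X)"
  unfolding lin_series_def using assms by (subst prod.remove[of _ p]) auto

text \<open>The symmetric product map is linear in each factor separately. Moving one point along a
  line therefore moves the image along a line exactly, without higher order terms.\<close>

lemma lin_prod_linear:
  assumes p: "p < r" and uv: "u \<in> carrier_vec 2" "v \<in> carrier_vec 2"
  shows "lin_prod r (l(p := u + e \<cdot>\<^sub>v v)) = lin_prod r (l(p := u)) + e \<cdot>\<^sub>v lin_prod r (l(p := v))"
proof -
  let ?R = "\<Prod>q\<in>{..<r} - {p}. fps_const (l q $ 0) + fps_const (l q $ 1) * fps_X"
  have s: "lin_series r (l(p := w)) = (fps_const (w $ 0) + fps_const (w $ 1) * fps_X) * ?R" for w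
  proof -
    have "(\<Prod>q\<in>{..<r} - {p}. fps_const ((l(p := w)) q $ 0) + fps_const ((l(p := w)) q $ 1) * fps_X) = ?R"
      by (intro prod.cong) auto
    then show ?thesis using lin_series_remove[OF p, of "l(p := w)"] by simp
  qed
  have "lin_series r (l(p := u + e \<cdot>\<^sub>v v)) = lin_series r (l(p := u)) + fps_const e * lin_series r (l(p := v))"
    unfolding s using uv by (simp add: algebra_simps fps_const_add[symmetric] fps_const_mult[symmetric]
      del: fps_const_add fps_const_mult)
  then show ?thesis by (intro eq_vecI) (auto simp: lin_prod_def)
qed

lemma lin_prod_permute:
  assumes "\<pi> permutes {..<r}"
  shows "lin_prod r (\<lambda>q. l (\<pi> q)) = lin_prod r l"
proof -
  have "lin_series r l = lin_series r (\<lambda>q. l (\<pi> q))"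
    unfolding lin_series_def using prod.permute[OF assms, of "\<lambda>p. fps_const (l p $ 0) + fps_const (l p $ 1) * fps_X"]
    by (simp add: o_def)
  then show ?thesis by (simp add: lin_prod_def)
qed

lemma bform_add:
  assumes "comm_ring_hom h" "u \<in> carrier_vec (r + 1)" "v \<in> carrier_vec (r + 1)"
  shows "bform h r c0 c1 (u + v) = bform h r c0 c1 u + bform h r c0 c1 v"
proof -
  interpret comm_ring_hom h by fact
  show ?thesis unfolding bform_def sum.distrib[symmetric]
    using assms(2,3) by (intro sum.cong refl) (simp add: hom_add distrib_right)
qed

lemma bform_smult:
  assumes "comm_ring_hom h" "v \<in> carrier_vec (r + 1)"
  shows "bform h r c0 c1 (e \<cdot>\<^sub>v v) = h e * bform h r c0 c1 v"
proof -
  interpret comm_ring_hom h by fact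
  show ?thesis unfolding bform_def sum_distrib_left
    using assms(2) by (intro sum.cong refl) (simp add: hom_mult mult.assoc)
qed

lemma comm_ring_hom_id: "comm_ring_hom (\<lambda>c :: complex. c)"
  by unfold_locales auto

lemma comm_ring_hom_fps_const: "comm_ring_hom (fps_const :: complex \<Rightarrow> complex fps)"
  by unfold_locales auto

abbreviation cform :: "nat \<Rightarrow> complex \<Rightarrow> complex \<Rightarrow> complex vec \<Rightarrow> complex" where
  "cform \<equiv> bform (\<lambda>c. c)"

lemma cform_scale: "cform r (e * c0) (e * c1) y = e ^ r * cform r c0 c1 y"
proof -
  have "(e * c0) ^ (r - k) * (e * c1) ^ k = e ^ r * (c0 ^ (r - k) * c1 ^ k)" if "k \<le> r" for k
  proof -
    have "e ^ r = e ^ (r - k) * e ^ k" using that by (simp add: power_add[symmetric])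
    then show ?thesis by (simp add: power_mult_distrib mult_ac)
  qed
  then show ?thesis by (simp add: bform_def sum_distrib_left mult.left_commute cong: sum.cong_simp)
qed

lemma degree_linear_mult:
  fixes p :: "complex poly"
  assumes "degree p \<le> m"
  shows "degree ([:x, y:] * p) \<le> Suc m \<and> coeff ([:x, y:] * p) (Suc m) = y * coeff p m"
proof -
  have "coeff p (Suc m) = 0" using assms by (simp add: coeff_eq_0)
  moreover have "degree ([:x, y:] * p) \<le> Suc m"
    using degree_mult_le[of "[:x, y:]" p] assms by (simp split: if_splits)
  ultimately show ?thesis by simp
qed

lemma degree_linear_power_mult:
  fixes p :: "complex poly"
  assumes "degree p \<le> m"
  shows "degree ([:x, y:] ^ n * p) \<le> m + n \<and> coeff ([:x, y:] ^ n * p) (m + n) = y ^ n * coeff p m"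
proof (induction n)
  case (Suc n)
  have "[:x, y:] ^ Suc n * p = [:x, y:] * ([:x, y:] ^ n * p)" by (simp only: power_Suc mult.assoc)
  then show ?case using degree_linear_mult[OF conjunct1[OF Suc], of x y] Suc
    by (simp only: add_Suc_right power_Suc mult.assoc simp_thms)
qed (use assms in simp)

text \<open>Restriction of a binary form to the affine line \<open>b - Z a\<close>.\<close>
lemma bform_poly:
  fixes a0 a1 b0 b1 :: complex
  defines "R \<equiv> \<lambda>r. bform (\<lambda>c. [:c:]) r [:b0, - a0:] [:b1, - a1:]"
  shows "poly (R r u) z = cform r (b0 - z * a0) (b1 - z * a1) u"
    and "degree (R r u) \<le> r" and "coeff (R r u) r = (-1) ^ r * cform r a0 a1 u"
proof -
  show "poly (R r u) z = cform r (b0 - z * a0) (b1 - z * a1) u"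
    by (simp add: R_def bform_def poly_sum algebra_simps)
  have *: "degree ([:b0, - a0:] ^ (r - k) * [:b1, - a1:] ^ k) \<le> r \<and>
      coeff ([:b0, - a0:] ^ (r - k) * [:b1, - a1:] ^ k) r = (-1) ^ r * (a0 ^ (r - k) * a1 ^ k)"
    if "k \<le> r" for k
  proof -
    have 1: "degree ([:b1, - a1:] ^ k * 1) \<le> k \<and> coeff ([:b1, - a1:] ^ k * 1) k = (- a1) ^ k"
      using degree_linear_power_mult[of 1 0 b1 "- a1" k] by simp
    have "(- a0) ^ (r - k) * (- a1) ^ k = (-1) ^ r * (a0 ^ (r - k) * a1 ^ k)"
      unfolding power_minus[of a0] power_minus[of a1] using that
      by (simp add: mult_ac power_add[symmetric])
    then show ?thesis
      using degree_linear_power_mult[of "[:b1, - a1:] ^ k" k b0 "- a0" "r - k"] 1 that by simp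
  qed
  then show "degree (R r u) \<le> r"
    unfolding R_def bform_def by (intro degree_sum_le) (auto intro!: order.trans[OF degree_smult_le])
  show "coeff (R r u) r = (-1) ^ r * cform r a0 a1 u"
    unfolding R_def bform_def using * by (simp add: coeff_sum sum_distrib_left mult.left_commute cong: sum.cong_simp)
qed

text \<open>A binary form of degree \<open>r\<close> with \<open>r + 1\<close> distinct zeros on the
  projective line vanishes: here the zeros are \<open>a\<close> and the points
  \<open>b - z a\<close>. The value at \<open>a\<close> is, up to sign, the coefficient of degree
  \<open>r\<close> of the restriction \<open>R\<close> to the affine line, so \<open>R\<close> has
  degree below \<open>r\<close> and \<open>r\<close> roots.\<close>

lemma cform_eq_0_imp:
  assumes u: "u \<in> carrier_vec (r + 1)" and ab: "a0 * b1 - a1 * b0 = (1 :: complex)"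
    and a: "cform r a0 a1 u = 0"
    and Z: "finite Z" "card Z = r" "\<And>z. z \<in> Z \<Longrightarrow> cform r (b0 - z * a0) (b1 - z * a1) u = 0"
  shows "u = 0\<^sub>v (r + 1)"
proof -
  define R where "R = bform (\<lambda>c. [:c:]) r [:b0, - a0:] [:b1, - a1:] u"
  have R: "poly R z = cform r (b0 - z * a0) (b1 - z * a1) u" for z
    unfolding R_def by (rule bform_poly)
  have "R = 0"
  proof (rule ccontr)
    assume "R \<noteq> 0"
    have "coeff R r = 0" "degree R \<le> r" using bform_poly[of r b0 a0 b1 a1 u] a by (simp_all add: R_def)
    then have "degree R < r" using \<open>R \<noteq> 0\<close> by (metis le_neq_implies_less leading_coeff_neq_0)
    moreover have "Z \<subseteq> {z. poly R z = 0}" using Z R by auto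
    then have "r \<le> degree R"
      using Z card_mono[OF poly_roots_finite[OF \<open>R \<noteq> 0\<close>]] card_poly_roots_bound[OF \<open>R \<noteq> 0\<close>] by (metis order.trans)
    ultimately show False by simp
  qed
  then have zero: "cform r (b0 - z * a0) (b1 - z * a1) u = 0" for z using R[of z] by simp
  define Q where "Q = (\<Sum>k\<le>r. monom (u $ k) k)"
  have "poly Q \<zeta> = 0" if "a0 * \<zeta> \<noteq> a1" for \<zeta>
  proof -
    \<comment> \<open>The point \<open>(1, \<zeta>)\<close> is \<open>e\<close> times
      \<open>b - z a\<close>. The condition \<open>e \<noteq> 0\<close> excludes only the direction
      of \<open>a\<close>, which is not on this affine line.\<close>
    define e where "e = a0 * \<zeta> - a1"
    define z where "z = (b0 * \<zeta> - b1) / e"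
    have "e \<noteq> 0" using that by (simp add: e_def)
    then have "e * (b0 - z * a0) = 1" "e * (b1 - z * a1) = \<zeta>"
      using ab by (auto simp: z_def field_simps e_def) (simp_all add: algebra_simps)?
    then have "cform r 1 \<zeta> u = 0" using cform_scale[of r e "b0 - z * a0" "b1 - z * a1" u] zero by simp
    then show ?thesis by (simp add: Q_def poly_sum poly_monom bform_def)
  qed
  then have "{\<zeta>. a0 * \<zeta> \<noteq> a1} \<subseteq> {\<zeta>. poly Q \<zeta> = 0}" by auto
  moreover have "infinite {\<zeta>. a0 * \<zeta> \<noteq> a1}"
  proof -
    have "{\<zeta>. a0 * \<zeta> = a1} \<subseteq> {a1 / a0}" using ab by (auto simp: field_simps)
    then have "finite {\<zeta>. a0 * \<zeta> = a1}" using finite_subset by blast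
    then have "infinite (UNIV - {\<zeta>. a0 * \<zeta> = a1})"
      using infinite_UNIV_char_0 by (simp add: Diff_infinite_finite)
    moreover have "UNIV - {\<zeta>. a0 * \<zeta> = a1} = {\<zeta>. a0 * \<zeta> \<noteq> a1}" by auto
    ultimately show ?thesis by simp
  qed
  ultimately have "Q = 0" using poly_roots_finite[of Q] finite_subset by blast
  have "u $ k = 0" if "k \<le> r" for k
  proof -
    have "coeff Q k = u $ k" using that by (simp add: Q_def coeff_sum)
    then show ?thesis using \<open>Q = 0\<close> by simp
  qed
  then show ?thesis using u by (intro eq_vecI) auto
qed

section \<open>The symmetric product of a punctured line\<close>

lemma eq_smult_vec_if_diff:
  fixes u v :: "complex vec"
  assumes v: "v \<in> carrier_vec n" and u: "u \<in> carrier_vec n" and eq: "v + (- c) \<cdot>\<^sub>v u = 0\<^sub>v n"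
  shows "v = c \<cdot>\<^sub>v u"
proof (rule eq_vecI)
  fix i assume "i < dim_vec (c \<cdot>\<^sub>v u)"
  then have i: "i < n" using u by simp
  have "(v + (- c) \<cdot>\<^sub>v u) $ i = 0" unfolding eq using i by simp
  then show "v $ i = (c \<cdot>\<^sub>v u) $ i" using i u v by simp
qed (use u v in simp)

text \<open>
  The punctures are the point \<open>a\<close>, placed at infinity, and the points \<open>b - p a\<close> for \<open>p\<close> in \<open>P\<close>.
  The point \<open>s = sg t\<close> is given by \<open>s a = 1\<close> and \<open>s b = t\<close>, so that it is not a puncture iff \<open>t\<close> is not in
  \<open>P\<close>.  The set \<open>V r\<close> is the cone over the \<open>r\<close>-th symmetric product, \<open>pt r t\<close> is the image of
  \<open>(sg (t 0), ..., sg (t (r - 1)))\<close>, \<open>tg r t p\<close> its derivative in \<open>t p\<close>, and \<open>tg2 r t p q\<close> the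
  second derivative in \<open>t p\<close> and \<open>t q\<close>, which vanishes for \<open>p = q\<close> (unlike the value given below).
\<close>
locale punctured_line =
  fixes a0 a1 b0 b1 :: complex and P :: "complex set"
  assumes ab: "a0 * b1 - a1 * b0 = 1" and finite_P: "finite P"
begin

definition V :: "nat \<Rightarrow> complex vec set" where
  "V r = {y \<in> carrier_vec (r + 1). cform r a0 a1 y \<noteq> 0 \<and>
    (\<forall>p\<in>P. cform r (b0 - p * a0) (b1 - p * a1) y \<noteq> 0)}"

definition sg :: "complex \<Rightarrow> complex vec" where
  "sg t = vec 2 (\<lambda>i. if i = 0 then b1 - t * a1 else t * a0 - b0)"

definition dsg :: "complex vec" where
  "dsg = vec 2 (\<lambda>i. if i = 0 then - a1 else a0)"

definition pt :: "nat \<Rightarrow> (nat \<Rightarrow> complex) \<Rightarrow> complex vec" where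
  "pt r t = lin_prod r (\<lambda>q. sg (t q))"

definition tg :: "nat \<Rightarrow> (nat \<Rightarrow> complex) \<Rightarrow> nat \<Rightarrow> complex vec" where
  "tg r t p = lin_prod r ((\<lambda>q. sg (t q))(p := dsg))"

definition tg2 :: "nat \<Rightarrow> (nat \<Rightarrow> complex) \<Rightarrow> nat \<Rightarrow> nat \<Rightarrow> complex vec" where
  "tg2 r t p q = lin_prod r ((\<lambda>q. sg (t q))(p := dsg, q := dsg))"

abbreviation tgs :: "nat \<Rightarrow> (nat \<Rightarrow> complex) \<Rightarrow> complex vec list" where
  "tgs r t \<equiv> map (tg r t) [0..<r]"

definition regpt :: "nat \<Rightarrow> (nat \<Rightarrow> complex) \<Rightarrow> bool" where
  "regpt r t \<longleftrightarrow> (\<forall>q<r. t q \<notin> P)"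

lemma sg_carrier [simp]: "sg t \<in> carrier_vec 2" "dsg \<in> carrier_vec 2"
  by (simp_all add: sg_def dsg_def)

lemma sg_nth: "sg t $ 0 = b1 - t * a1" "sg t $ 1 = t * a0 - b0" "dsg $ 0 = - a1" "dsg $ 1 = a0"
  "sg t $ Suc 0 = t * a0 - b0" "dsg $ Suc 0 = a0"
  by (simp_all add: sg_def dsg_def)

lemma sg_add: "sg (t + e) = sg t + e \<cdot>\<^sub>v dsg"
  by (rule eq_vecI) (auto simp: sg_def dsg_def algebra_simps)

lemma pt_carrier [simp]: "pt r t \<in> carrier_vec (r + 1)" "tg r t p \<in> carrier_vec (r + 1)"
  "tg2 r t p q \<in> carrier_vec (r + 1)"
  "pt r t \<in> carrier_vec (Suc r)" "tg r t p \<in> carrier_vec (Suc r)" "tg2 r t p q \<in> carrier_vec (Suc r)"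
  by (simp_all add: pt_def tg_def tg2_def)

lemma pt_cong: "(\<And>q. q < r \<Longrightarrow> t q = t' q) \<Longrightarrow> pt r t = pt r t'"
  unfolding pt_def by (intro lin_prod_cong) simp

lemma tg_cong: "(\<And>q. q < r \<Longrightarrow> q \<noteq> p \<Longrightarrow> t q = t' q) \<Longrightarrow> tg r t p = tg r t' p"
  unfolding tg_def by (intro lin_prod_cong) simp

lemma bform_pt:
  "comm_ring_hom h \<Longrightarrow> bform h r c0 c1 (pt r t) = (\<Prod>q<r. h (b1 - t q * a1) * c0 + h (t q * a0 - b0) * c1)"
  unfolding pt_def by (subst bform_lin_prod) (simp_all add: sg_nth)

lemma bform_tg:
  assumes "comm_ring_hom h" and p: "p < r"
  shows "bform h r c0 c1 (tg r t p) = (h (- a1) * c0 + h a0 * c1) *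
    (\<Prod>q\<in>{..<r} - {p}. h (b1 - t q * a1) * c0 + h (t q * a0 - b0) * c1)"
  unfolding tg_def bform_lin_prod[OF assms(1)] using p
  by (subst prod.remove[of _ p]) (auto simp: sg_nth intro!: prod.cong arg_cong2[of _ _ _ _ "(*)"])

lemma sg_form: "(b1 - t * a1) * (b0 - z * a0) + (t * a0 - b0) * (b1 - z * a1) = t - z"
  "(b1 - t * a1) * a0 + (t * a0 - b0) * a1 = 1"
  "- a1 * (b0 - z * a0) + a0 * (b1 - z * a1) = 1"
proof -
  have "(b1 - t * a1) * (b0 - z * a0) + (t * a0 - b0) * (b1 - z * a1) = (t - z) * (a0 * b1 - a1 * b0)"
    "(b1 - t * a1) * a0 + (t * a0 - b0) * a1 = a0 * b1 - a1 * b0"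
    "- a1 * (b0 - z * a0) + a0 * (b1 - z * a1) = a0 * b1 - a1 * b0"
    by (simp_all add: algebra_simps)
  then show "(b1 - t * a1) * (b0 - z * a0) + (t * a0 - b0) * (b1 - z * a1) = t - z"
  "(b1 - t * a1) * a0 + (t * a0 - b0) * a1 = 1" "- a1 * (b0 - z * a0) + a0 * (b1 - z * a1) = 1"
    using ab by simp_all
qed

lemma cform_pt: "cform r (b0 - z * a0) (b1 - z * a1) (pt r t) = (\<Prod>q<r. t q - z)"
  "cform r a0 a1 (pt r t) = 1"
  by (simp_all add: bform_pt comm_ring_hom_id sg_form)

lemma cform_tg:
  assumes "p < r"
  shows "cform r (b0 - z * a0) (b1 - z * a1) (tg r t p) = (\<Prod>q\<in>{..<r} - {p}. t q - z)"
    "cform r a0 a1 (tg r t p) = 0"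
  using assms sg_form(3) by (simp_all add: bform_tg comm_ring_hom_id sg_form(1,2) del: mult_minus_left)

lemma pt_in_V: "regpt r t \<Longrightarrow> pt r t \<in> V r"
  by (auto simp: V_def cform_pt regpt_def)

lemma open_cone_V: "open_cone (r + 1) (V r)"
  unfolding open_cone_def
proof (intro conjI ballI allI impI)
  show "V r \<subseteq> carrier_vec (r + 1)" by (auto simp: V_def)
next
  fix y v :: "complex vec" assume y: "y \<in> V r" and v: "v \<in> carrier_vec (r + 1)"
  then have yc: "y \<in> carrier_vec (r + 1)" by (simp add: V_def)
  have ne: "\<forall>\<^sub>F t in nhds 0. cform r c0 c1 (y + t \<cdot>\<^sub>v v) \<noteq> 0" if "cform r c0 c1 y \<noteq> 0" for c0 c1
  proof -
    have "((\<lambda>t. cform r c0 c1 y + t * cform r c0 c1 v) \<longlongrightarrow> cform r c0 c1 y) (nhds 0)"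
      by (auto intro!: tendsto_eq_intros filterlim_ident)
    from tendsto_imp_eventually_ne[OF this that] show ?thesis
      using yc v by (simp add: bform_add bform_smult comm_ring_hom_id)
  qed
  have "\<forall>\<^sub>F t in nhds 0. \<forall>p\<in>P. cform r (b0 - p * a0) (b1 - p * a1) (y + t \<cdot>\<^sub>v v) \<noteq> 0"
    using y by (intro eventually_ball_finite finite_P ballI ne) (simp add: V_def)
  moreover have "\<forall>\<^sub>F t in nhds 0. cform r a0 a1 (y + t \<cdot>\<^sub>v v) \<noteq> 0"
    using y by (intro ne) (simp add: V_def)
  ultimately show "\<forall>\<^sub>F t in nhds 0. y + t \<cdot>\<^sub>v v \<in> V r"
    by eventually_elim (use yc v in \<open>simp add: V_def\<close>)
next
  fix y c assume "y \<in> V r" "(c :: complex) \<noteq> 0"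
  then show "c \<cdot>\<^sub>v y \<in> V r" by (simp add: V_def bform_smult comm_ring_hom_id)
qed

lemma cform_zero_all:
  assumes "u \<in> carrier_vec (r + 1)" "cform r a0 a1 u = 0"
    "\<And>z. cform r (b0 - z * a0) (b1 - z * a1) u = 0"
  shows "u = 0\<^sub>v (r + 1)"
proof (rule cform_eq_0_imp[OF assms(1) ab assms(2), of "of_nat ` {..<r}"])
  show "card ((of_nat :: nat \<Rightarrow> complex) ` {..<r}) = r"
    by (subst card_image) (auto simp: inj_on_def)
qed (use assms(3) in auto)

text \<open>Regard \<open>y\<close> as a binary form. It does not vanish at \<open>a\<close>, so its
  restriction to the line \<open>b - Z a\<close> has degree exactly \<open>r\<close>; the roots are
  the coordinates \<open>t q\<close>, and they avoid \<open>P\<close> because \<open>y\<close> does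
  not vanish at the finite punctures. Two forms that agree at \<open>a\<close> and on the whole line
  are equal.\<close>

lemma V_obtain_pt:
  assumes y: "y \<in> V r"
  obtains c t where "c \<noteq> 0" "regpt r t" "y = c \<cdot>\<^sub>v pt r t"
proof -
  define c where "c = cform r a0 a1 y"
  define R where "R = bform (\<lambda>c. [:c:]) r [:b0, - a0:] [:b1, - a1:] y"
  have yc: "y \<in> carrier_vec (r + 1)" and c: "c \<noteq> 0" using y by (auto simp: V_def c_def)
  have poly_R: "poly R z = cform r (b0 - z * a0) (b1 - z * a1) y" for z
    unfolding R_def by (rule bform_poly)
  have cR: "coeff R r = (-1) ^ r * c" and "degree R \<le> r"
    using bform_poly[of r b0 a0 b1 a1 y] by (simp_all add: R_def c_def)
  have nz: "coeff R r \<noteq> 0" unfolding cR using c by simp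
  then have deg: "degree R = r" using \<open>degree R \<le> r\<close> le_degree[OF nz] by simp
  have "R \<noteq> 0" using nz by auto
  then obtain A where A: "size A = degree R" "R = smult (lead_coeff R) (\<Prod>x\<in>#A. [:-x, 1:])"
    using alg_closed_imp_factorization by blast
  obtain ts where ts: "mset ts = A" using ex_mset by blast
  define t where "t q = ts ! q" for q
  have len: "length ts = r" using A(1) ts deg by auto
  have "(\<Prod>x\<in>#A. [:-x, 1:]) = (\<Prod>x\<leftarrow>ts. [:-x, 1:])"
    unfolding ts[symmetric] by (metis mset_map prod_mset_prod_list)
  also have "\<dots> = (\<Prod>q<r. [:- t q, 1:])"
    unfolding prod.list_conv_set_nth using len by (simp add: t_def atLeast0LessThan)
  finally have R': "R = smult ((-1) ^ r * c) (\<Prod>q<r. [:- t q, 1:])" using A(2) deg cR by metis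
  have val: "cform r (b0 - z * a0) (b1 - z * a1) y = c * (\<Prod>q<r. t q - z)" for z
  proof -
    have "(\<Prod>q<r. t q - z) = (\<Prod>q<r. (-1) * (z - t q))" by simp
    also have "\<dots> = (-1) ^ r * (\<Prod>q<r. z - t q)" unfolding prod.distrib by simp
    finally have "(\<Prod>q<r. t q - z) = (-1) ^ r * (\<Prod>q<r. z - t q)" .
    then show ?thesis unfolding poly_R[symmetric] R' by (simp add: poly_prod mult_ac)
  qed
  have "y + (- c) \<cdot>\<^sub>v pt r t = 0\<^sub>v (r + 1)"
  proof (rule cform_zero_all)
    show "cform r a0 a1 (y + (- c) \<cdot>\<^sub>v pt r t) = 0"
      using yc by (simp add: bform_add bform_smult comm_ring_hom_id cform_pt c_def)
    show "cform r (b0 - z * a0) (b1 - z * a1) (y + (- c) \<cdot>\<^sub>v pt r t) = 0" for z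
      using yc by (simp add: bform_add bform_smult comm_ring_hom_id cform_pt val)
  qed (use yc in simp)
  then have "y = c \<cdot>\<^sub>v pt r t"
    by (rule eq_smult_vec_if_diff[OF yc pt_carrier(1)])
  moreover have "regpt r t"
    unfolding regpt_def
  proof (intro allI impI notI)
    fix q assume "q < r" "t q \<in> P"
    then have "c * (\<Prod>q'<r. t q' - t q) \<noteq> 0" using y val[of "t q"] by (auto simp: V_def)
    moreover have "(\<Prod>q'<r. t q' - t q) = 0" using \<open>q < r\<close> by (intro prod_zero) auto
    ultimately show False by simp
  qed
  ultimately show ?thesis using that c by blast
qed

lemma pt_upd:
  assumes "p < r"
  shows "pt r (t(p := t p + e)) = pt r t + e \<cdot>\<^sub>v tg r t p"
proof -
  have "(\<lambda>q. sg ((t(p := t p + e)) q)) = (\<lambda>q. sg (t q))(p := sg (t p) + e \<cdot>\<^sub>v dsg)"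
    by (auto simp: sg_add)
  moreover have "(\<lambda>q. sg (t q))(p := sg (t p)) = (\<lambda>q. sg (t q))" by auto
  ultimately show ?thesis unfolding pt_def tg_def
    by (simp add: lin_prod_linear[OF assms])
qed

lemma tg_upd:
  assumes "q < r" "p \<noteq> q"
  shows "tg r (t(q := t q + e)) p = tg r t p + e \<cdot>\<^sub>v tg2 r t p q"
proof -
  let ?l = "(\<lambda>q. sg (t q))(p := dsg)"
  have "(\<lambda>i. sg ((t(q := t q + e)) i))(p := dsg) = ?l(q := sg (t q) + e \<cdot>\<^sub>v dsg)"
    using assms(2) by (auto simp: sg_add)
  moreover have "?l(q := sg (t q)) = ?l" using assms(2) by auto
  ultimately show ?thesis unfolding tg_def tg2_def
    by (simp add: lin_prod_linear[OF assms(1)] del: fun_upd_apply)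
qed

lemma tg2_commute: "tg2 r t p q = tg2 r t q p"
  unfolding tg2_def by (cases "p = q") (simp_all add: fun_upd_twist)

lemma pt_permute: "\<pi> permutes {..<r} \<Longrightarrow> pt r (\<lambda>q. t (\<pi> q)) = pt r t"
  unfolding pt_def by (rule lin_prod_permute)

lemma tg_permute:
  assumes \<pi>: "\<pi> permutes {..<r}"
  shows "tg r (\<lambda>q. t (\<pi> q)) p = tg r t (\<pi> p)"
proof -
  have "(\<lambda>q. sg (t (\<pi> q)))(p := dsg) = (\<lambda>q. ((\<lambda>q. sg (t q))(\<pi> p := dsg)) (\<pi> q))"
    using permutes_inj[OF \<pi>] by (auto simp: inj_def)
  then show ?thesis unfolding tg_def using lin_prod_permute[OF \<pi>, of "(\<lambda>q. sg (t q))(\<pi> p := dsg)"]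
    by simp
qed

text \<open>Lagrange interpolation for binary forms. A vector is determined by its values at
  \<open>a\<close> and at the \<open>r\<close> distinct points with coordinates \<open>t q\<close>.
  The vector \<open>pt r t\<close> adjusts the value at \<open>a\<close>, and
  \<open>tg r t k\<close> vanishes at \<open>a\<close> and at the points \<open>t q\<close> for
  \<open>q \<noteq> k\<close> but not at \<open>t k\<close>, so the values can be corrected one
  after the other.\<close>

lemma vspan_tangents:
  assumes inj: "inj_on t {..<r}" and v: "v \<in> carrier_vec (r + 1)"
  shows "v \<in> vspan (insert (pt r t) (tg r t ` {..<r}))"
proof -
  let ?S = "insert (pt r t) (tg r t ` {..<r})"
  let ?z = "\<lambda>q. cform r (b0 - t q * a0) (b1 - t q * a1)"
  have S: "?S \<subseteq> carrier_vec (r + 1)" by auto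
  have "\<exists>u\<in>vspan ?S. cform r a0 a1 u = cform r a0 a1 v \<and> (\<forall>q<k. ?z q u = ?z q v)" if "k \<le> r" for k
    using that
  proof (induction k)
    case 0
    let ?u = "cform r a0 a1 v \<cdot>\<^sub>v pt r t + 0 \<cdot>\<^sub>v pt r t"
    have "?u \<in> vspan ?S" by (intro vspan.comb vspan.base) auto
    moreover have "cform r a0 a1 ?u = cform r a0 a1 v"
      by (simp add: bform_add bform_smult comm_ring_hom_id cform_pt)
    ultimately show ?case by auto
  next
    case (Suc k)
    then obtain u where u: "u \<in> vspan ?S" "cform r a0 a1 u = cform r a0 a1 v" "\<forall>q<k. ?z q u = ?z q v"
      by auto
    have k: "k < r" using Suc.prems by simp
    have uc: "u \<in> carrier_vec (r + 1)" using vspan_carrier[OF S u(1)] .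
    define d where "d = (\<Prod>q\<in>{..<r} - {k}. t q - t k)"
    have d: "d \<noteq> 0" using inj k unfolding d_def by (auto simp: inj_on_def)
    let ?u = "1 \<cdot>\<^sub>v u + ((?z k v - ?z k u) / d) \<cdot>\<^sub>v tg r t k"
    have "?u \<in> vspan ?S" using k by (intro vspan.comb u vspan.base) auto
    moreover have "cform r a0 a1 ?u = cform r a0 a1 v"
      using uc k u by (simp add: bform_add bform_smult comm_ring_hom_id cform_tg)
    moreover have "?z q ?u = ?z q v" if "q < Suc k" for q
    proof (cases "q = k")
      case True
      then show ?thesis using uc k d
        by (simp add: bform_add bform_smult comm_ring_hom_id cform_tg d_def[symmetric])
    next
      case False
      then have "q < k" using that by simp
      then have "(\<Prod>q'\<in>{..<r} - {k}. t q' - t q) = 0" using k by (intro prod_zero) auto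
      then show ?thesis using uc k u \<open>q < k\<close>
        by (simp add: bform_add bform_smult comm_ring_hom_id cform_tg)
    qed
    ultimately show ?case by blast
  qed
  from this[of r] obtain u where u: "u \<in> vspan ?S" "cform r a0 a1 u = cform r a0 a1 v" "\<forall>q<r. ?z q u = ?z q v"
    by auto
  have uc: "u \<in> carrier_vec (r + 1)" using vspan_carrier[OF S u(1)] .
  have "v + (-1) \<cdot>\<^sub>v u = 0\<^sub>v (r + 1)"
  proof (rule cform_eq_0_imp[OF _ ab, of _ _ "t ` {..<r}"])
    show "card (t ` {..<r}) = r" using inj by (simp add: card_image)
  qed (use uc v u in \<open>auto simp: bform_add bform_smult comm_ring_hom_id\<close>)
  then have "v = 1 \<cdot>\<^sub>v u" by (rule eq_smult_vec_if_diff[OF v uc])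
  then show ?thesis using u by simp
qed

end

section \<open>Derivatives along curves and the pullback of the twisted differential\<close>

lemma polyfun_tendsto:
  assumes "f \<in> polyfun n" "\<And>i. i < n \<Longrightarrow> ((\<lambda>e. y e $ i) \<longlongrightarrow> z $ i) F"
  shows "((\<lambda>e. f (y e)) \<longlongrightarrow> f z) F"
  using assms(1)
proof induction
  case (coord i)
  then show ?case using assms(2) by simp
qed (auto intro: tendsto_intros)

lemma lin_series_tendsto:
  assumes "\<And>p. p < r \<Longrightarrow> ((\<lambda>e. l e p $ 0) \<longlongrightarrow> m p $ 0) F"
    "\<And>p. p < r \<Longrightarrow> ((\<lambda>e. l e p $ 1) \<longlongrightarrow> m p $ 1) F"
  shows "((\<lambda>e. fps_nth (lin_series r (l e)) k) \<longlongrightarrow> fps_nth (lin_series r m) k) F"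
  using assms
proof (induction r arbitrary: k)
  case 0
  then show ?case by (simp add: lin_series_def)
next
  case (Suc r)
  have IH: "((\<lambda>e. fps_nth (lin_series r (l e)) k) \<longlongrightarrow> fps_nth (lin_series r m) k) F" for k
    using Suc.IH[of k] Suc.prems by simp
  show ?case unfolding lin_series_Suc_nth
    by (cases "k = 0") (simp_all only: simp_thms if_True if_False, intro tendsto_add tendsto_mult tendsto_const IH Suc.prems lessI,
      intro tendsto_add tendsto_mult tendsto_const IH Suc.prems lessI)
qed

text \<open>Product rule for a form whose base point and first \<open>k\<close> vectors move
  affinely. Linearity in slot \<open>k\<close> splits off a term with the explicit factor
  \<open>e\<close>, and its derivative at 0 is the value of the form with \<open>ws ! k\<close> in
  that slot.\<close>

lemma Omega_curve_derivative:
  assumes U: "open_cone n U" and \<eta>: "\<eta> \<in> Omega n U p" and y: "y \<in> U" and u: "u \<in> carrier_vec n"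
    and ws: "length ws = p" "set ws \<subseteq> carrier_vec n"
  shows "k \<le> p \<Longrightarrow> length vs = p \<Longrightarrow> set vs \<subseteq> carrier_vec n \<Longrightarrow>
    ((\<lambda>e. \<eta> (y + e \<cdot>\<^sub>v u) (map (\<lambda>i. if i < k then vs ! i + e \<cdot>\<^sub>v (ws ! i) else vs ! i) [0..<p]))
      has_field_derivative deriv (\<lambda>e. \<eta> (y + e \<cdot>\<^sub>v u) vs) 0 + (\<Sum>i<k. \<eta> y (vs[i := ws ! i]))) (at 0)"
proof (induction k arbitrary: vs)
  case 0
  have "map (\<lambda>i. vs ! i) [0..<p] = vs" using 0 map_nth[of vs] by simp
  then show ?case using Omega_field_derivative[OF U \<eta> y u, of vs] by simp
next
  case (Suc k)
  let ?L = "\<lambda>k vs e. map (\<lambda>i. if i < k then vs ! i + e \<cdot>\<^sub>v (ws ! i) else vs ! i) [0..<p]"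
  have k: "k < p" "k \<le> p" using Suc.prems by auto
  have vk: "vs ! k \<in> carrier_vec n" and wk: "ws ! k \<in> carrier_vec n"
    using Suc.prems ws k by auto
  let ?vs = "vs[k := ws ! k]"
  have vs': "length ?vs = p" "set ?vs \<subseteq> carrier_vec n"
    using Suc.prems set_list_update_carrier[OF _ wk] by auto
  have c: "vs ! i \<in> carrier_vec n" "ws ! i \<in> carrier_vec n" if "i < p" for i
    using Suc.prems ws that by auto
  have Lc: "length (?L k vs e) = p" "set (?L k vs e) \<subseteq> carrier_vec n" for e
    using c by auto
  have 1: "?L (Suc k) vs e = (?L k vs e)[k := vs ! k + e \<cdot>\<^sub>v (ws ! k)]" for e
    using k by (intro nth_equalityI) (auto simp: nth_list_update less_Suc_eq)
  have 2: "(?L k vs e)[k := vs ! k] = ?L k vs e" for e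
    using k by (intro nth_equalityI) (auto simp: nth_list_update)
  have 3: "(?L k vs e)[k := ws ! k] = ?L k ?vs e" for e
    using k Suc.prems by (intro nth_equalityI) (auto simp: nth_list_update)
  have ev: "\<forall>\<^sub>F e in nhds 0. \<eta> (y + e \<cdot>\<^sub>v u) (?L (Suc k) vs e) =
      \<eta> (y + e \<cdot>\<^sub>v u) (?L k vs e) + e * \<eta> (y + e \<cdot>\<^sub>v u) (?L k ?vs e)"
    using open_cone_line[OF U y u]
  proof eventually_elim
    case (elim e)
    show ?case unfolding 1 using alternating_add_smult[OF Omega_alternating[OF \<eta> elim] Lc k(1) vk wk, of e e]
      unfolding 2 3 .
  qed
  have h0: "\<eta> (y + 0 \<cdot>\<^sub>v u) (?L k ?vs 0) = \<eta> y ?vs"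
  proof -
    have "y + 0 \<cdot>\<^sub>v u = y" using open_cone_carrier[OF U y] u by auto
    moreover have "?L k ?vs 0 = ?vs"
    proof (rule nth_equalityI)
      fix i assume "i < length (?L k ?vs 0)"
      then have i: "i < p" by simp
      have "?vs ! i \<in> carrier_vec n" using i vs' by auto
      then have "?vs ! i + 0 \<cdot>\<^sub>v (ws ! i) = ?vs ! i" using c[OF i] by auto
      then show "?L k ?vs 0 ! i = ?vs ! i" using i by (simp del: nth_list_update_eq nth_list_update_neq)
    qed (use vs' in simp)
    ultimately show ?thesis by simp
  qed
  have "((\<lambda>e. \<eta> (y + e \<cdot>\<^sub>v u) (?L k vs e) + e * \<eta> (y + e \<cdot>\<^sub>v u) (?L k ?vs e)) has_field_derivative
      (deriv (\<lambda>e. \<eta> (y + e \<cdot>\<^sub>v u) vs) 0 + (\<Sum>i<k. \<eta> y (vs[i := ws ! i]))) +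
      (1 * \<eta> (y + 0 \<cdot>\<^sub>v u) (?L k ?vs 0) +
        (deriv (\<lambda>e. \<eta> (y + e \<cdot>\<^sub>v u) ?vs) 0 + (\<Sum>i<k. \<eta> y (?vs[i := ws ! i]))) * 0)) (at 0)"
    by (intro DERIV_add DERIV_mult DERIV_ident Suc.IH k Suc.prems vs')
  then show ?case
    unfolding DERIV_cong_ev[OF refl ev refl] h0 by (simp add: add.assoc)
qed

lemma sum_skip: "p < Suc m \<Longrightarrow> (\<Sum>i<m. F (if i < p then i else Suc i)) = (\<Sum>q\<in>{..<Suc m} - {p}. F q)"
proof (rule sum.reindex_bij_witness[of _ "\<lambda>q. if q < p then q else q - 1" "\<lambda>i. if i < p then i else Suc i"])
  fix i assume p: "p < Suc m" and i: "i \<in> {..<m}"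
  show "(if (if i < p then i else Suc i) < p then if i < p then i else Suc i
      else (if i < p then i else Suc i) - 1) = i" by simp
  show "(if i < p then i else Suc i) \<in> {..<Suc m} - {p}" using i p by (cases "i < p") simp_all
next
  fix q assume p: "p < Suc m" and q: "q \<in> {..<Suc m} - {p}"
  show "(if (if q < p then q else q - 1) < p then if q < p then q else q - 1
      else Suc (if q < p then q else q - 1)) = q" using q by (cases "q < p") (simp_all, linarith)
  show "(if q < p then q else q - 1) \<in> {..<m}" using q p by (cases "q < p") auto
qed (rule refl)

lemma eq_minus_imp_0:
  fixes x :: complex
  assumes "x = - x"
  shows "x = 0"
proof -
  have "x + x = x + - x" using assms by (rule arg_cong)
  then have "2 * x = 0" unfolding mult_2 by simp
  then show ?thesis by simp
qed

lemma sum_antisymmetric: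
  fixes T :: "nat \<Rightarrow> nat \<Rightarrow> complex"
  assumes "\<And>p q. p < r \<Longrightarrow> q < r \<Longrightarrow> p \<noteq> q \<Longrightarrow> T p q = - T q p"
  shows "(\<Sum>p<r. \<Sum>q\<in>{..<r} - {p}. T p q) = 0"
proof -
  define T' where "T' p q = (if p = q then 0 else T p q)" for p q
  have "(\<Sum>p<r. \<Sum>q\<in>{..<r} - {p}. T p q) = (\<Sum>p<r. \<Sum>q<r. T' p q)"
    by (intro sum.cong refl sum.mono_neutral_cong_left) (auto simp: T'_def)
  moreover have "(\<Sum>p<r. \<Sum>q<r. T' p q) = 0"
  proof -
    have "(\<Sum>p<r. \<Sum>q<r. T' p q) = (\<Sum>p<r. \<Sum>q<r. T' q p)" by (rule sum.swap)
    also have "\<dots> = (\<Sum>p<r. \<Sum>q<r. - T' p q)"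
    proof (intro sum.cong refl)
      fix p q assume "p \<in> {..<r}" "q \<in> {..<r}"
      then show "T' q p = - T' p q" using assms[of q p] unfolding T'_def by (cases "p = q") simp_all
    qed
    finally have "(\<Sum>p<r. \<Sum>q<r. T' p q) = - (\<Sum>p<r. \<Sum>q<r. T' p q)" unfolding sum_negf .
    then show ?thesis by (rule eq_minus_imp_0)
  qed
  ultimately show ?thesis by simp
qed

context punctured_line
begin

text \<open>The pullback of \<open>\<psi>\<close> to \<open>X^r\<close> is the sum of the forms
  \<open>f (t p) dt_p\<close>; the condition is this equality evaluated on the coordinate vectors,
  whose images under the symmetric product map are \<open>tg r t p\<close>.\<close>

definition traces :: "nat \<Rightarrow> (complex \<Rightarrow> complex) \<Rightarrow> dform \<Rightarrow> bool" where
  "traces r f \<psi> \<longleftrightarrow> \<psi> \<in> Omega (r + 1) (V r) 1 \<and>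
    (\<forall>t p. regpt r t \<longrightarrow> p < r \<longrightarrow> \<psi> (pt r t) [tg r t p] = f (t p))"

lemma traces_Omega: "traces r f \<psi> \<Longrightarrow> \<psi> \<in> Omega (r + 1) (V r) 1"
  by (simp add: traces_def)

lemma traces_tg: "traces r f \<psi> \<Longrightarrow> regpt r t \<Longrightarrow> p < r \<Longrightarrow> \<psi> (pt r t) [tg r t p] = f (t p)"
  by (simp add: traces_def)

text \<open>The differential on the cone, which is defined with constant vector fields, becomes the
  ordinary one in the coordinates \<open>t p\<close>, although the fields \<open>tg\<close> are not
  constant. The derivative \<open>D p\<close> of a coefficient contains, besides the derivative of
  the form, one term with \<open>tg2\<close> for every other slot, and these terms disappear from
  the alternating sum.\<close>

lemma nabla_pullback:
  assumes r: "r = Suc m" and \<eta>: "\<eta> \<in> Omega (r + 1) (V r) m" and \<omega>: "traces r w \<omega>" and t: "regpt r t"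
  shows "\<exists>D. (\<forall>p<r. ((\<lambda>x. \<eta> (pt r (t(p := x))) (omit p (tgs r (t(p := x))))) has_field_derivative D p) (at (t p))) \<and>
    nabla (r + 1) (V r) \<omega> \<eta> (pt r t) (tgs r t) =
      (\<Sum>p<r. (-1) ^ p * (D p + w (t p) * \<eta> (pt r t) (omit p (tgs r t))))"
proof -
  let ?y = "pt r t"
  let ?d = "\<lambda>p. deriv (\<lambda>e. \<eta> (?y + e \<cdot>\<^sub>v tg r t p) (omit p (tgs r t))) 0"
  let ?S = "\<lambda>p q. \<eta> ?y (omit p ((tgs r t)[q := tg2 r t q p]))"
  define D where "D p = ?d p + (\<Sum>q\<in>{..<r} - {p}. ?S p q)" for p
  have y: "?y \<in> V r" using t by (rule pt_in_V)
  have tgs: "length (tgs r t) = Suc m" "set (tgs r t) \<subseteq> carrier_vec (r + 1)"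
    using r by auto
  have "((\<lambda>x. \<eta> (pt r (t(p := x))) (omit p (tgs r (t(p := x))))) has_field_derivative D p) (at (t p))"
    if p: "p < r" for p
  proof -
    let ?vs = "omit p (tgs r t)" and ?ws = "omit p (map (\<lambda>q. tg2 r t q p) [0..<r])"
    have vs: "length ?vs = m" "set ?vs \<subseteq> carrier_vec (r + 1)"
      and ws: "length ?ws = m" "set ?ws \<subseteq> carrier_vec (r + 1)"
      using p r set_omit[of p "tgs r t"] set_omit[of p "map (\<lambda>q. tg2 r t q p) [0..<r]"]
      by (auto simp: length_omit)
    have L: "omit p (tgs r (t(p := t p + e))) =
        map (\<lambda>i. if i < m then ?vs ! i + e \<cdot>\<^sub>v (?ws ! i) else ?vs ! i) [0..<m]" for e
    proof (rule nth_equalityI)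
      fix i assume "i < length (omit p (tgs r (t(p := t p + e))))"
      then have i: "i < m" using p r by (simp add: length_omit)
      define q where "q = (if i < p then i else Suc i)"
      have q: "q < r" "q \<noteq> p" using i r by (auto simp: q_def)
      have nth: "omit p (map f [0..<r]) ! i = f q" for f :: "nat \<Rightarrow> complex vec"
        using i p r q(1) by (simp add: nth_omit q_def[symmetric] del: upt_Suc)
      show "omit p (tgs r (t(p := t p + e))) ! i =
        map (\<lambda>i. if i < m then ?vs ! i + e \<cdot>\<^sub>v (?ws ! i) else ?vs ! i) [0..<m] ! i"
        using i tg_upd[OF p q(2)] by (simp only: nth nth_map length_upt minus_nat.diff_0 nth_upt add_0 if_True)
    qed (use p r in \<open>simp add: length_omit\<close>)
    have S: "\<eta> ?y (?vs[i := ?ws ! i]) = ?S p (if i < p then i else Suc i)" if i: "i < m" for i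
    proof -
      define q where "q = (if i < p then i else Suc i)"
      have q: "q < r" "q \<noteq> p" "(if q < p then q else q - 1) = i" using i r by (auto simp: q_def)
      have "?ws ! i = tg2 r t q p"
        using i p r q(1) by (simp add: nth_omit q_def[symmetric] del: upt_Suc)
      moreover have "omit p ((tgs r t)[q := tg2 r t q p]) = ?vs[i := tg2 r t q p]"
        using q p by (subst omit_update) auto
      ultimately show ?thesis by (simp add: q_def[symmetric])
    qed
    have "((\<lambda>e. \<eta> (?y + e \<cdot>\<^sub>v tg r t p)
        (map (\<lambda>i. if i < m then ?vs ! i + e \<cdot>\<^sub>v (?ws ! i) else ?vs ! i) [0..<m]))
        has_field_derivative ?d p + (\<Sum>i<m. \<eta> ?y (?vs[i := ?ws ! i]))) (at 0)"
      by (rule Omega_curve_derivative[OF open_cone_V \<eta> y pt_carrier(2) ws order_refl vs])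
    also have "(\<Sum>i<m. \<eta> ?y (?vs[i := ?ws ! i])) = (\<Sum>i<m. ?S p (if i < p then i else Suc i))"
      by (intro sum.cong refl S) simp
    also have "\<dots> = (\<Sum>q\<in>{..<r} - {p}. ?S p q)" unfolding r by (rule sum_skip) (use p r in simp)
    finally have "((\<lambda>e. \<eta> (pt r (t(p := t p + e))) (omit p (tgs r (t(p := t p + e))))) has_field_derivative D p) (at 0)"
      unfolding L pt_upd[OF p] D_def .
    then show ?thesis
      using DERIV_shift[of "\<lambda>x. \<eta> (pt r (t(p := x))) (omit p (tgs r (t(p := x))))" "D p" 0 "t p"]
      by (simp add: add.commute)
  qed
  moreover have "nabla (r + 1) (V r) \<omega> \<eta> ?y (tgs r t) =
      (\<Sum>p<r. (-1) ^ p * (D p + w (t p) * \<eta> ?y (omit p (tgs r t))))"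
  proof -
    \<comment> \<open>Moving \<open>tg2 r t q p\<close> from slot \<open>q\<close> of the list
      without \<open>p\<close> to slot \<open>p\<close> of the list without \<open>q\<close> changes
      the sign, whereas \<open>tg2\<close> is symmetric in \<open>p\<close> and
      \<open>q\<close>.\<close>
    have "(-1) ^ p * ?S p q = - ((-1) ^ q * ?S q p)" if "p < r" "q < r" "p \<noteq> q" for p q
      using alternating_omit_slot[OF Omega_alternating[OF \<eta> y] tgs, of "tg2 r t q p" p q] that r
      unfolding tg2_commute[of r t p q] by simp
    then have "(\<Sum>p<r. \<Sum>q\<in>{..<r} - {p}. (-1) ^ p * ?S p q) = 0"
      by (rule sum_antisymmetric)
    then have 0: "(\<Sum>p<r. (-1) ^ p * (\<Sum>q\<in>{..<r} - {p}. ?S p q)) = 0"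
      by (simp only: sum_distrib_left)
    have "nabla (r + 1) (V r) \<omega> \<eta> ?y (tgs r t) =
        (\<Sum>p<r. (-1) ^ p * cov \<omega> \<eta> ?y (tg r t p) (omit p (tgs r t)))"
      unfolding nabla_eq[OF y tgs(2)] by (intro sum.cong) auto
    also have "\<dots> = (\<Sum>p<r. (-1) ^ p * (?d p + w (t p) * \<eta> ?y (omit p (tgs r t))))"
      by (intro sum.cong refl) (simp add: cov_def traces_tg[OF \<omega> t])
    also have "\<dots> = (\<Sum>p<r. (-1) ^ p * (?d p + w (t p) * \<eta> ?y (omit p (tgs r t)))) +
        (\<Sum>p<r. (-1) ^ p * (\<Sum>q\<in>{..<r} - {p}. ?S p q))"
      unfolding 0 by simp
    also have "\<dots> = (\<Sum>p<r. (-1) ^ p * (D p + w (t p) * \<eta> ?y (omit p (tgs r t))))"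
      unfolding sum.distrib[symmetric] D_def by (intro sum.cong refl) (simp only: distrib_left add_ac)
    finally show ?thesis .
  qed
  ultimately show ?thesis by blast
qed

section \<open>A form of degree \<open>r\<close> is determined by its pullback\<close>

lemma top_form_permute:
  assumes \<eta>: "\<eta> \<in> Omega (r + 1) (V r) r" and t: "regpt r t" and \<pi>: "\<pi> permutes {..<r}"
  shows "\<eta> (pt r (\<lambda>q. t (\<pi> q))) (tgs r (\<lambda>q. t (\<pi> q))) = of_int (sign \<pi>) * \<eta> (pt r t) (tgs r t)"
proof -
  have "\<pi> i < r" if "i < r" for i using permutes_in_image[OF \<pi>, of i] that by simp
  then have e: "tgs r (\<lambda>q. t (\<pi> q)) = map (\<lambda>i. tgs r t ! \<pi> i) [0..<r]"
    by (simp add: tg_permute[OF \<pi>])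
  have "length (tgs r t) = r" "set (tgs r t) \<subseteq> carrier_vec (r + 1)" by auto
  moreover have "\<pi> permutes {0..<r}" using \<pi> by (simp add: atLeast0LessThan)
  ultimately show ?thesis
    unfolding e pt_permute[OF \<pi>]
    by (intro alternating_permute[OF Omega_alternating[OF \<eta> pt_in_V[OF t]]])
qed

text \<open>For distinct coordinates the point and the tangent vectors span, so it suffices to test
  lists of these. Such a list contains the radial vector, or has a repetition, or is a permutation
  of all tangent vectors; in the last case it is the full tangent list at the permuted
  \<open>t\<close>, which has the same image point.\<close>

lemma top_form_eq_0_distinct:
  assumes \<eta>: "\<eta> \<in> Omega (r + 1) (V r) r"
    and zero: "\<And>t. regpt r t \<Longrightarrow> \<eta> (pt r t) (tgs r t) = 0"
    and t: "regpt r t" "inj_on t {..<r}" and vs: "length vs = r" "set vs \<subseteq> carrier_vec (r + 1)"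
  shows "\<eta> (pt r t) vs = 0"
proof -
  let ?S = "insert (pt r t) (tg r t ` {..<r})"
  note y = pt_in_V[OF t(1)]
  have S: "?S \<subseteq> carrier_vec (r + 1)" by auto
  have z: "\<eta> (pt r t) ws = 0" if ws: "length ws = r" "set ws \<subseteq> ?S" for ws
  proof (cases "pt r t \<in> set ws \<or> \<not> distinct ws")
    case True
    have "set ws \<subseteq> carrier_vec (r + 1)" using ws(2) S by (rule subset_trans)
    then show ?thesis
      using True Omega_radial[OF \<eta> y ws(1)] alternating_repeat[OF Omega_alternating[OF \<eta> y] ws(1)] by blast
  next
    case False
    then have "\<exists>q<r. ws ! i = tg r t q" if "i < r" for i
      using ws that nth_mem[of i ws] by fastforce
    then obtain g where g: "\<And>i. i < r \<Longrightarrow> g i < r \<and> ws ! i = tg r t (g i)" by metis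
    define \<pi> where "\<pi> i = (if i < r then g i else i)" for i
    have inj: "inj_on \<pi> {..<r}"
    proof (rule inj_onI)
      fix i j assume ij: "i \<in> {..<r}" "j \<in> {..<r}" "\<pi> i = \<pi> j"
      then have "ws ! i = ws ! j" using g[of i] g[of j] by (simp add: \<pi>_def)
      then show "i = j" using False ws ij by (simp add: nth_eq_iff_index_eq)
    qed
    have "\<pi> ` {..<r} \<subseteq> {..<r}" using g by (auto simp: \<pi>_def)
    then have "bij_betw \<pi> {..<r} {..<r}"
      using inj by (simp add: bij_betw_def endo_inj_surj)
    then have \<pi>: "\<pi> permutes {..<r}" by (rule bij_imp_permutes) (simp add: \<pi>_def)
    have "tg r (\<lambda>q. t (\<pi> q)) i = ws ! i" if "i < r" for i
      unfolding tg_permute[OF \<pi>] using g[OF that] that by (simp add: \<pi>_def)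
    then have "ws = tgs r (\<lambda>q. t (\<pi> q))"
      using ws(1) by (intro nth_equalityI) simp_all
    moreover have "regpt r (\<lambda>q. t (\<pi> q))"
      using t(1) g by (auto simp: regpt_def \<pi>_def)
    ultimately show ?thesis using zero pt_permute[OF \<pi>] by metis
  qed
  have "set vs \<subseteq> vspan ?S" using vs vspan_tangents[OF t(2)] by blast
  then show ?thesis
    using alternating_zero_vspan[OF Omega_alternating[OF \<eta> y] S z, of vs "[]"] vs by simp
qed

text \<open>Where coordinates coincide the tangent vectors no longer span with the point. The
  vectors \<open>ws\<close> are kept fixed, and the rational function of the point is evaluated as a
  limit from points with distinct coordinates.\<close>

theorem top_form_eq_0:
  assumes \<eta>: "\<eta> \<in> Omega (r + 1) (V r) r"
    and zero: "\<And>t. regpt r t \<Longrightarrow> \<eta> (pt r t) (tgs r t) = 0"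
  shows "\<eta> y vs = 0"
proof (cases "y \<in> V r \<and> length vs = r \<and> set vs \<subseteq> carrier_vec (r + 1)")
  case False
  then show ?thesis by (rule Omega_form[OF \<eta>])
next
  case True
  then obtain c t where c: "c \<noteq> 0" and t: "regpt r t" and y: "y = c \<cdot>\<^sub>v pt r t" using V_obtain_pt by blast
  have "\<eta> (pt r t) ws = 0" if ws: "length ws = r" "set ws \<subseteq> carrier_vec (r + 1)" for ws
  proof -
    obtain A B where AB: "A \<in> polyfun (r + 1)" "B \<in> polyfun (r + 1)"
      "\<forall>y\<in>V r. B y \<noteq> 0 \<and> \<eta> y ws = A y / B y"
      using Omega_regular[OF \<eta> ws] unfolding regular_on_def by blast
    \<comment> \<open>Different speeds \<open>q\<close> separate coincident coordinates for all
      \<open>e \<noteq> 0\<close>; coordinates that were distinct, or outside \<open>P\<close>,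
      remain so for small \<open>e\<close>.\<close>
    define T where "T e q = t q + e * of_nat q" for e :: complex and q
    have lim: "((\<lambda>e. T e q) \<longlongrightarrow> t q) (at 0)" for q
      unfolding T_def by (auto intro!: tendsto_eq_intros)
    have "((\<lambda>e. pt r (T e) $ i) \<longlongrightarrow> pt r t $ i) (at 0)" if "i < r + 1" for i
    proof -
      have "((\<lambda>e. fps_nth (lin_series r (\<lambda>q. sg (T e q))) i) \<longlongrightarrow> fps_nth (lin_series r (\<lambda>q. sg (t q))) i) (at 0)"
        by (rule lin_series_tendsto) (auto simp: sg_nth intro!: tendsto_intros lim)
      then show ?thesis using that by (simp add: pt_def lin_prod_nth)
    qed
    then have "((\<lambda>e. A (pt r (T e)) / B (pt r (T e))) \<longlongrightarrow> A (pt r t) / B (pt r t)) (at 0)"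
      by (intro tendsto_divide polyfun_tendsto[OF AB(1)] polyfun_tendsto[OF AB(2)])
        (use AB(3) pt_in_V[OF t] in blast)+
    moreover have "\<forall>\<^sub>F e in at 0. A (pt r (T e)) / B (pt r (T e)) = 0"
    proof -
      have 1: "\<forall>\<^sub>F e in at 0. \<forall>q\<in>{..<r}. \<forall>p\<in>P. T e q \<noteq> p"
      proof (intro eventually_ball_finite finite_lessThan finite_P ballI)
        fix q p assume "q \<in> {..<r}" "p \<in> P"
        then have "t q \<noteq> p" using t by (auto simp: regpt_def)
        then show "\<forall>\<^sub>F e in at 0. T e q \<noteq> p" using lim by (rule tendsto_imp_eventually_ne[rotated])
      qed
      have 2: "\<forall>\<^sub>F e in at 0. \<forall>q\<in>{..<r}. \<forall>q'\<in>{..<r} - {q}. T e q \<noteq> T e q'"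
      proof (intro eventually_ball_finite ballI)
        fix q q' assume q: "q \<in> {..<r}" "q' \<in> {..<r} - {q}"
        show "\<forall>\<^sub>F e in at 0. T e q \<noteq> T e q'"
        proof (cases "t q = t q'")
          case True
          have "\<forall>\<^sub>F e :: complex in at 0. e \<noteq> 0" by (rule eventually_neq_at_within)
          then show ?thesis by eventually_elim (use q True in \<open>auto simp: T_def\<close>)
        next
          case False
          have "((\<lambda>e. T e q - T e q') \<longlongrightarrow> t q - t q') (at 0)" by (intro tendsto_diff lim)
          then have "\<forall>\<^sub>F e in at 0. T e q - T e q' \<noteq> 0"
            by (rule tendsto_imp_eventually_ne) (use False in simp)
          then show ?thesis by eventually_elim simp
        qed
      qed auto
      from 1 2 show ?thesis
      proof eventually_elim
        case (elim e)
        have reg: "regpt r (T e)" using elim(1) by (auto simp: regpt_def)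
        have "inj_on (T e) {..<r}" using elim(2) by (auto simp: inj_on_def)
        then have "\<eta> (pt r (T e)) ws = 0"
          using top_form_eq_0_distinct[OF \<eta> zero reg _ ws] by blast
        then show ?case using AB pt_in_V[OF reg] by auto
      qed
    qed
    ultimately have "A (pt r t) / B (pt r t) = 0"
      by (intro tendsto_unique[OF trivial_limit_at _ tendsto_eventually])
    moreover have "\<eta> (pt r t) ws = A (pt r t) / B (pt r t)" using AB(3) pt_in_V[OF t] by blast
    ultimately show ?thesis by simp
  qed
  moreover have sc: "set (map (\<lambda>v. (1 / c) \<cdot>\<^sub>v v) vs) \<subseteq> carrier_vec (r + 1)" using True by auto
  ultimately have "\<eta> (pt r t) (map (\<lambda>v. (1 / c) \<cdot>\<^sub>v v) vs) = 0" using True by simp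
  moreover have "map (\<lambda>v. c \<cdot>\<^sub>v v) (map (\<lambda>v. (1 / c) \<cdot>\<^sub>v v) vs) = vs"
    using c by (intro nth_equalityI) (auto simp: smult_smult_assoc)
  ultimately show ?thesis
    unfolding y using Omega_scale[OF \<eta> pt_in_V[OF t] _ sc c] True by simp
qed

corollary Omega_top_unique:
  assumes "\<eta> \<in> Omega (r + 1) (V r) r" "\<theta> \<in> Omega (r + 1) (V r) r"
    and "\<And>t. regpt r t \<Longrightarrow> \<eta> (pt r t) (tgs r t) = \<theta> (pt r t) (tgs r t)"
  shows "\<eta> = \<theta>"
proof (intro ext)
  fix y vs
  have "(\<lambda>y vs. 1 * \<eta> y vs + (-1) * \<theta> y vs) \<in> Omega (r + 1) (V r) r"
    by (rule Omega_lincomb[OF assms(1,2)])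
  from top_form_eq_0[OF this, of y vs] show "\<eta> y vs = \<theta> y vs" using assms(3) by simp
qed

end

section \<open>Expansion in coordinates\<close>

lemma sum_PiE_lessThan_Suc:
  "(\<Sum>\<kappa>\<in>{..<Suc k} \<rightarrow>\<^sub>E X. F \<kappa>) = (\<Sum>\<kappa>\<in>{..<k} \<rightarrow>\<^sub>E X. \<Sum>x\<in>X. F (\<kappa>(k := x)))"
proof -
  have "(\<Sum>\<kappa>\<in>{..<Suc k} \<rightarrow>\<^sub>E X. F \<kappa>) = (\<Sum>(x, \<kappa>)\<in>X \<times> ({..<k} \<rightarrow>\<^sub>E X). F (\<kappa>(k := x)))"
    unfolding lessThan_Suc PiE_insert_eq
    by (subst sum.reindex[OF inj_combinator]) (auto simp: case_prod_beta)
  also have "\<dots> = (\<Sum>x\<in>X. \<Sum>\<kappa>\<in>{..<k} \<rightarrow>\<^sub>E X. F (\<kappa>(k := x)))" by (simp add: sum.cartesian_product)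
  also have "\<dots> = (\<Sum>\<kappa>\<in>{..<k} \<rightarrow>\<^sub>E X. \<Sum>x\<in>X. F (\<kappa>(k := x)))" by (rule sum.swap)
  finally show ?thesis .
qed

lemma alternating_slot_expand:
  assumes f: "alternating n p f" and vs: "length vs = p" "set vs \<subseteq> carrier_vec n" and k: "k < p"
    and v: "v \<in> carrier_vec n"
  shows "f (vs[k := v]) = (\<Sum>i<n. v $ i * f (vs[k := unit_vec n i]))"
proof -
  have "f (vs[k := vec n (\<lambda>i. if i < m then v $ i else 0)]) = (\<Sum>i<m. v $ i * f (vs[k := unit_vec n i]))"
    if "m \<le> n" for m
    using that
  proof (induction m)
    case 0
    have "vec n (\<lambda>i. if i < 0 then v $ i else 0) = 0 \<cdot>\<^sub>v unit_vec n 0" by auto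
    then show ?case using alternating_smult[OF f vs k, of "unit_vec n 0" 0] by simp
  next
    case (Suc m)
    let ?u = "vec n (\<lambda>i. if i < m then v $ i else 0)"
    have "vec n (\<lambda>i. if i < Suc m then v $ i else 0) = ?u + v $ m \<cdot>\<^sub>v unit_vec n m"
      using Suc.prems by (intro eq_vecI) (auto simp: less_Suc_eq)
    then show ?case
      using alternating_add_smult[OF f vs k, of ?u "unit_vec n m" "v $ m"] Suc by simp
  qed
  from this[of n] have "f (vs[k := vec n (\<lambda>i. if i < n then v $ i else 0)]) =
    (\<Sum>i<n. v $ i * f (vs[k := unit_vec n i]))" by simp
  moreover have "vec n (\<lambda>i. if i < n then v $ i else 0) = v" using v by (intro eq_vecI) auto
  ultimately show ?thesis by simp
qed

text \<open>Reduces a form on vectors that vary with the point to its values on unit vectors.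
  Regularity of a form is a statement about fixed vectors, so this is how rationality in
  \<open>t\<close> is obtained.\<close>

lemma alternating_expand:
  assumes f: "alternating n p f" and vs: "length vs = p" "set vs \<subseteq> carrier_vec n"
  shows "f vs = (\<Sum>g\<in>{..<p} \<rightarrow>\<^sub>E {..<n}. (\<Prod>i<p. vs ! i $ g i) * f (map (\<lambda>i. unit_vec n (g i)) [0..<p]))"
proof -
  let ?L = "\<lambda>k g. map (\<lambda>i. if i < k then unit_vec n (g i) else vs ! i) [0..<p]"
  have "f vs = (\<Sum>g\<in>{..<k} \<rightarrow>\<^sub>E {..<n}. (\<Prod>i<k. vs ! i $ g i) * f (?L k g))" if "k \<le> p" for k
    using that
  proof (induction k)
    case 0
    have "map (\<lambda>i. vs ! i) [0..<p] = vs" using vs map_nth[of vs] by simp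
    then show ?case by simp
  next
    case (Suc k)
    have k: "k < p" using Suc.prems by simp
    have vk: "vs ! k \<in> carrier_vec n" using vs k by auto
    have c: "length (?L k g) = p" "set (?L k g) \<subseteq> carrier_vec n" for g
      using vs by (auto simp: subset_iff)
    have "f (?L k g) = (\<Sum>j<n. vs ! k $ j * f (?L (Suc k) (g(k := j))))" for g
    proof -
      have 1: "(?L k g)[k := vs ! k] = ?L k g"
        using k by (intro nth_equalityI) (auto simp: nth_list_update)
      have 2: "(?L k g)[k := unit_vec n j] = ?L (Suc k) (g(k := j))" for j
        using k by (intro nth_equalityI) (auto simp: nth_list_update)
      from alternating_slot_expand[OF f c[of g] k vk] show ?thesis unfolding 1 2 .
    qed
    then have "f vs = (\<Sum>g\<in>{..<k} \<rightarrow>\<^sub>E {..<n}. \<Sum>j<n. (\<Prod>i<k. vs ! i $ g i) *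
        (vs ! k $ j * f (?L (Suc k) (g(k := j)))))"
      using Suc by (simp add: sum_distrib_left)
    also have "\<dots> = (\<Sum>g\<in>{..<Suc k} \<rightarrow>\<^sub>E {..<n}. (\<Prod>i<Suc k. vs ! i $ g i) * f (?L (Suc k) g))"
      unfolding sum_PiE_lessThan_Suc
    proof (intro sum.cong refl)
      fix g :: "nat \<Rightarrow> nat" and j
      have "(\<Prod>i<k. vs ! i $ (g(k := j)) i) = (\<Prod>i<k. vs ! i $ g i)" by (intro prod.cong) auto
      then show "(\<Prod>i<k. vs ! i $ g i) * (vs ! k $ j * f (?L (Suc k) (g(k := j)))) =
        (\<Prod>i<Suc k. vs ! i $ (g(k := j)) i) * f (?L (Suc k) (g(k := j)))" by (simp add: mult.assoc)
    qed
    finally show ?case .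
  qed
  from this[of p] have "f vs = (\<Sum>g\<in>{..<p} \<rightarrow>\<^sub>E {..<n}. (\<Prod>i<p. vs ! i $ g i) * f (?L p g))" by simp
  moreover have "?L p g = map (\<lambda>i. unit_vec n (g i)) [0..<p]" for g by (intro map_cong) auto
  ultimately show ?thesis by simp
qed

text \<open>Forms of degree \<open>n\<close> in \<open>n\<close> homogeneous coordinates vanish: in a basis containing the point
  itself, \<open>n\<close> distinct vectors include it.\<close>
lemma Omega_top_eq_0:
  assumes U: "open_cone n U" "0\<^sub>v n \<notin> U" and \<eta>: "\<eta> \<in> Omega n U n"
  shows "\<eta> y vs = 0"
proof (cases "y \<in> U \<and> length vs = n \<and> set vs \<subseteq> carrier_vec n")
  case False
  then show ?thesis by (rule Omega_form[OF \<eta>])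
next
  case True
  then have y: "y \<in> U" and vs: "length vs = n" "set vs \<subseteq> carrier_vec n" by auto
  have yc: "y \<in> carrier_vec n" using open_cone_carrier[OF U(1) y] .
  have "y \<noteq> 0\<^sub>v n" using y U(2) by auto
  then obtain k where k: "k < n" "y $ k \<noteq> 0" using yc by (metis eq_vecI carrier_vecD index_zero_vec)
  let ?S = "insert y (unit_vec n ` ({..<n} - {k}))"
  have S: "?S \<subseteq> carrier_vec n" using yc by auto
  have "v \<in> vspan ?S" if v: "v \<in> carrier_vec n" for v
  proof -
    have "\<exists>u\<in>vspan ?S. u $ k = v $ k \<and> (\<forall>i<m. u $ i = v $ i)" if "m \<le> n" for m
      using that
    proof (induction m)
      case 0
      have "(v $ k / y $ k) \<cdot>\<^sub>v y + 0 \<cdot>\<^sub>v y \<in> vspan ?S" by (intro vspan.comb vspan.base) auto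
      then show ?case using k yc by (intro bexI[of _ "(v $ k / y $ k) \<cdot>\<^sub>v y + 0 \<cdot>\<^sub>v y"]) auto
    next
      case (Suc m)
      then obtain u where u: "u \<in> vspan ?S" "u $ k = v $ k" "\<forall>i<m. u $ i = v $ i" by auto
      have uc: "u \<in> carrier_vec n" using vspan_carrier[OF S u(1)] .
      show ?case
      proof (cases "m = k")
        case True
        then show ?thesis using u by (auto simp: less_Suc_eq)
      next
        case False
        let ?u = "1 \<cdot>\<^sub>v u + (v $ m - u $ m) \<cdot>\<^sub>v unit_vec n m"
        have "?u \<in> vspan ?S" using False Suc.prems by (intro vspan.comb u(1) vspan.base) auto
        moreover have "?u $ k = v $ k" "\<forall>i<Suc m. ?u $ i = v $ i"
          using u uc False k Suc.prems by (auto simp: less_Suc_eq)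
        ultimately show ?thesis by blast
      qed
    qed
    from this[of n] obtain u where u: "u \<in> vspan ?S" "\<forall>i<n. u $ i = v $ i" by auto
    have "u = v" using u v vspan_carrier[OF S u(1)] by (intro eq_vecI) auto
    then show ?thesis using u by simp
  qed
  then have span: "set vs \<subseteq> vspan ?S" using vs by auto
  have z: "\<eta> y ws = 0" if ws: "length ws = n" "set ws \<subseteq> ?S" for ws
  proof (cases "y \<in> set ws")
    case True
    then show ?thesis using Omega_radial[OF \<eta> y ws(1)] ws(2) S by blast
  next
    case False
    then have "set ws \<subseteq> unit_vec n ` ({..<n} - {k})" using ws by auto
    then have "card (set ws) \<le> card ({..<n} - {k})"
      by (meson card_image_le card_mono finite_Diff finite_imageI finite_lessThan order_trans)
    also have "\<dots> < n" using k by simp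
    finally have "\<not> distinct ws" using ws distinct_card by fastforce
    then show ?thesis using alternating_repeat[OF Omega_alternating[OF \<eta> y] ws(1)] ws(2) S by blast
  qed
  show ?thesis using alternating_zero_vspan[OF Omega_alternating[OF \<eta> y] S z, of vs "[]"] vs span by simp
qed

section \<open>Rational functions of several variables on the punctured line\<close>

context punctured_line
begin

lemma zero_notin_V: "0\<^sub>v (r + 1) \<notin> V r"
  by (simp add: V_def bform_def)

definition Q :: "complex poly" where
  "Q = (\<Prod>p\<in>P. [:- p, 1:])"

text \<open>For fixed \<open>d\<close> and \<open>D\<close> the restrictions to the complement of
  \<open>P\<close> form a finite-dimensional space, on which evaluation at \<open>d + 1\<close>
  points is injective. The common denominator \<open>Q ^ D\<close> makes the space closed under sums
  without change of bounds.\<close>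

definition rat :: "nat \<Rightarrow> nat \<Rightarrow> (complex \<Rightarrow> complex) \<Rightarrow> bool" where
  "rat d D h \<longleftrightarrow> (\<exists>p. degree p \<le> d \<and> (\<forall>x. x \<notin> P \<longrightarrow> h x = poly p x / poly Q x ^ D))"

definition rational :: "(complex \<Rightarrow> complex) \<Rightarrow> bool" where
  "rational h \<longleftrightarrow> (\<exists>d D. rat d D h)"

lemma poly_Q: "x \<notin> P \<Longrightarrow> poly Q x \<noteq> 0"
  using finite_P by (simp add: Q_def poly_prod)

lemma degree_Q: "degree Q \<le> card P"
  using degree_prod_sum_le[OF finite_P, of "\<lambda>p. [:- p, 1:]"] by (simp add: Q_def)

lemma degree_Q_power: "degree (Q ^ D) \<le> D * card P"
  using degree_power_le[of Q D] degree_Q by (metis mult.commute mult_le_mono1 order_trans)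

lemma rat_raise:
  assumes "rat d D h"
  shows "rat (d + k * card P) (D + k) h"
proof -
  obtain p where p: "degree p \<le> d" "\<And>x. x \<notin> P \<Longrightarrow> h x = poly p x / poly Q x ^ D"
    using assms unfolding rat_def by blast
  show ?thesis unfolding rat_def
  proof (intro exI[of _ "p * Q ^ k"] conjI allI impI)
    show "degree (p * Q ^ k) \<le> d + k * card P"
      using degree_mult_le[of p "Q ^ k"] degree_Q_power[of k] p(1) by simp
    show "h x = poly (p * Q ^ k) x / poly Q x ^ (D + k)" if "x \<notin> P" for x
      using p(2)[OF that] poly_Q[OF that] by (simp add: power_add)
  qed
qed

lemma rat_mono: "rat d D h \<Longrightarrow> d \<le> d' \<Longrightarrow> rat d' D h"
  unfolding rat_def by (meson order_trans)

text \<open>The new bounds are symmetric in \<open>(d, D)\<close> and \<open>(d', D')\<close>, so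
  functions with different bounds are placed in one space.\<close>

lemma rat_common: "rat d D h \<Longrightarrow> rat (d + d' + (D + D') * card P) (D + D') h"
  by (rule rat_mono[OF rat_raise[of d D h D']]) (simp_all add: algebra_simps)

lemma rat_common': "rat d D h \<Longrightarrow> rat (d' + d + (D' + D) * card P) (D' + D) h"
  using rat_common[of d D h d' D'] by (simp add: add.commute)

lemma rat_add:
  assumes "rat d D f" "rat d D g"
  shows "rat d D (\<lambda>x. f x + g x)"
proof -
  obtain p q where "degree p \<le> d" "\<forall>x. x \<notin> P \<longrightarrow> f x = poly p x / poly Q x ^ D"
    "degree q \<le> d" "\<forall>x. x \<notin> P \<longrightarrow> g x = poly q x / poly Q x ^ D"
    using assms unfolding rat_def by blast
  then show ?thesis unfolding rat_def
    by (intro exI[of _ "p + q"]) (auto simp: degree_add_le add_divide_distrib)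
qed

lemma rat_mult:
  assumes "rat d D f" "rat d' D' g"
  shows "rat (d + d') (D + D') (\<lambda>x. f x * g x)"
proof -
  obtain p q where "degree p \<le> d" "\<forall>x. x \<notin> P \<longrightarrow> f x = poly p x / poly Q x ^ D"
    "degree q \<le> d'" "\<forall>x. x \<notin> P \<longrightarrow> g x = poly q x / poly Q x ^ D'"
    using assms unfolding rat_def by blast
  then show ?thesis unfolding rat_def
    using degree_mult_le[of p q] by (intro exI[of _ "p * q"]) (auto simp: power_add)
qed

lemma rat_const: "rat 0 0 (\<lambda>x. c)"
  unfolding rat_def by (intro exI[of _ "[:c:]"]) simp

lemma rat_cmult: "rat d D f \<Longrightarrow> rat d D (\<lambda>x. c * f x)"
  using rat_mult[OF rat_const, of d D f c] by simp

lemma rat_cong: "rat d D f \<Longrightarrow> (\<And>x. x \<notin> P \<Longrightarrow> f x = g x) \<Longrightarrow> rat d D g"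
  unfolding rat_def by metis

text \<open>A polynomial without zeros off \<open>P\<close> is a product of linear factors of
  \<open>Q\<close>, hence divides \<open>Q ^ D\<close> as soon as its degree is at most
  \<open>D\<close>. The resulting bounds depend on the degree bounds alone, not on the
  polynomials.\<close>

lemma rat_quotient:
  assumes p: "degree p \<le> d" and q: "degree q \<le> D" "\<And>x. x \<notin> P \<Longrightarrow> poly q x \<noteq> 0"
  shows "rat (d + D * card P) D (\<lambda>x. poly p x / poly q x)"
proof -
  have "infinite (- P)" using finite_P by (simp add: infinite_UNIV_char_0 Compl_eq_Diff_UNIV Diff_infinite_finite)
  then obtain x0 where "x0 \<notin> P" by (metis Compl_iff ex_in_conv finite.emptyI)
  then have "q \<noteq> 0" using q(2) by fastforce
  then obtain A where A: "size A = degree q" "q = smult (lead_coeff q) (\<Prod>x\<in>#A. [:-x, 1:])"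
    using alg_closed_imp_factorization by blast
  have "\<forall>x\<in>#A. x \<in> P"
  proof (rule ccontr)
    assume "\<not> ?thesis"
    then obtain x where x: "x \<in># A" "x \<notin> P" by auto
    then have "[:-x, 1:] dvd (\<Prod>x\<in>#A. [:-x, 1:])" by (intro dvd_prod_mset) auto
    then have "[:-x, 1:] dvd q" using A(2) by (metis dvd_smult)
    then have "poly q x = 0" by (simp add: poly_eq_0_iff_dvd)
    then show False using q(2) x by blast
  qed
  then have "(\<Prod>x\<in>#A. [:-x, 1:]) dvd Q ^ size A"
  proof (induction A)
    case (add x A)
    have "[:-x, 1:] dvd Q" unfolding Q_def using add.prems finite_P by (intro dvd_prodI) auto
    moreover have "(\<Prod>x\<in>#A. [:-x, 1:]) dvd Q ^ size A" using add by simp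
    ultimately show ?case
      unfolding image_mset_add_mset prod_mset.add_mset size_add_mset power_Suc by (rule mult_dvd_mono)
  qed simp
  then have "smult (lead_coeff q) (\<Prod>x\<in>#A. [:-x, 1:]) dvd Q ^ size A"
    by (rule smult_dvd) (use \<open>q \<noteq> 0\<close> in simp)
  then have "q dvd Q ^ size A" unfolding A(2)[symmetric] .
  also have "Q ^ size A dvd Q ^ D" using A(1) q(1) by (simp add: le_imp_power_dvd)
  finally obtain s where s: "Q ^ D = q * s" by (elim dvdE)
  have "Q ^ D \<noteq> 0" using poly_Q[OF \<open>x0 \<notin> P\<close>] by (metis poly_0 power_eq_0_iff poly_power)
  then have "degree s \<le> degree (Q ^ D)" unfolding s by (simp add: degree_mult_eq)
  then have "degree s \<le> D * card P" using degree_Q_power[of D] by simp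
  show ?thesis unfolding rat_def
  proof (intro exI[of _ "p * s"] conjI allI impI)
    show "degree (p * s) \<le> d + D * card P"
      using degree_mult_le[of p s] p \<open>degree s \<le> D * card P\<close> by simp
    show "poly p x / poly q x = poly (p * s) x / poly Q x ^ D" if x: "x \<notin> P" for x
    proof -
      have "poly Q x ^ D = poly q x * poly s x" unfolding poly_mult[symmetric] s[symmetric] by (simp add: poly_power)
      moreover have "poly Q x ^ D \<noteq> 0" using poly_Q[OF x] by simp
      ultimately show ?thesis using q(2)[OF x] by (simp add: field_simps)
    qed
  qed
qed

lemma rat_derivative:
  assumes "rat d D h"
  shows "\<exists>h'. rat (d + D * card P) (2 * D) h' \<and> (\<forall>x. x \<notin> P \<longrightarrow> (h has_field_derivative h' x) (at x))"
proof -
  obtain p where p: "degree p \<le> d" "\<And>x. x \<notin> P \<Longrightarrow> h x = poly p x / poly Q x ^ D"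
    using assms unfolding rat_def by blast
  let ?n = "pderiv p * Q ^ D - p * pderiv (Q ^ D)"
  let ?h = "\<lambda>x. poly ?n x / poly Q x ^ (2 * D)"
  have "degree ?n \<le> d + D * card P"
  proof (intro degree_diff_le)
    show "degree (pderiv p * Q ^ D) \<le> d + D * card P"
      using degree_mult_le[of "pderiv p" "Q ^ D"] degree_Q_power[of D] degree_pderiv[of p] p(1) by simp
    show "degree (p * pderiv (Q ^ D)) \<le> d + D * card P"
      using degree_mult_le[of p "pderiv (Q ^ D)"] degree_Q_power[of D] degree_pderiv[of "Q ^ D"] p(1) by simp
  qed
  then have "rat (d + D * card P) (2 * D) ?h" unfolding rat_def by (intro exI[of _ ?n]) simp
  moreover have "(h has_field_derivative ?h x) (at x)" if x: "x \<notin> P" for x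
  proof -
    have "((\<lambda>x. poly p x / poly (Q ^ D) x) has_field_derivative
        (poly (pderiv p) x * poly (Q ^ D) x - poly p x * poly (pderiv (Q ^ D)) x) /
        (poly (Q ^ D) x * poly (Q ^ D) x)) (at x)"
      by (intro DERIV_divide poly_DERIV) (use poly_Q[OF x] in \<open>simp add: poly_power\<close>)
    also have "(poly (pderiv p) x * poly (Q ^ D) x - poly p x * poly (pderiv (Q ^ D)) x) /
        (poly (Q ^ D) x * poly (Q ^ D) x) = ?h x"
      by (simp add: poly_power mult_2 power_add)
    finally have "((\<lambda>x. poly p x / poly Q x ^ D) has_field_derivative ?h x) (at x)"
      by (simp only: poly_power)
    moreover have "\<forall>\<^sub>F x in nhds x. h x = poly p x / poly Q x ^ D"
    proof -
      have "open (- P)" by (intro open_Compl finite_imp_closed finite_P)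
      then have "\<forall>\<^sub>F x in nhds x. x \<in> - P" using x by (intro eventually_nhds_in_open) auto
      then show ?thesis by eventually_elim (use p(2) in auto)
    qed
    ultimately show ?thesis by (subst DERIV_cong_ev[OF refl _ refl])
  qed
  ultimately show ?thesis by blast
qed

text \<open>The Lagrange basis polynomial of \<open>\<xi>\<close>, transplanted to numerators over
  \<open>Q ^ D\<close> and normalized so that its value at \<open>\<xi>\<close> is 1.\<close>

definition node :: "complex set \<Rightarrow> nat \<Rightarrow> complex \<Rightarrow> complex \<Rightarrow> complex" where
  "node X D \<xi> x = poly (\<Prod>\<xi>'\<in>X - {\<xi>}. smult (1 / (\<xi> - \<xi>')) [:- \<xi>', 1:]) x * poly Q \<xi> ^ D / poly Q x ^ D"

definition nodes :: "nat \<Rightarrow> complex set \<Rightarrow> bool" where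
  "nodes d X \<longleftrightarrow> finite X \<and> card X = Suc d \<and> X \<inter> P = {}"

lemma ex_nodes: "\<exists>X. nodes d X"
proof -
  have "infinite (- P)" using finite_P by (simp add: infinite_UNIV_char_0 Compl_eq_Diff_UNIV Diff_infinite_finite)
  then obtain X where "finite X" "card X = Suc d" "X \<subseteq> - P" by (metis infinite_arbitrarily_large)
  then show ?thesis by (auto simp: nodes_def)
qed

lemma rational_node: "rational (node X D \<xi>)"
  unfolding rational_def rat_def node_def
  by (intro exI[of _ "degree (smult (poly Q \<xi> ^ D) (\<Prod>\<xi>'\<in>X - {\<xi>}. smult (1 / (\<xi> - \<xi>')) [:- \<xi>', 1:]))"]
      exI[of _ D] exI[of _ "smult (poly Q \<xi> ^ D) (\<Prod>\<xi>'\<in>X - {\<xi>}. smult (1 / (\<xi> - \<xi>')) [:- \<xi>', 1:])"])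
    (simp add: mult.commute)

lemma rat_interpolation:
  assumes h: "rat d D h" and X: "nodes d X" and x: "x \<notin> P"
  shows "h x = (\<Sum>\<xi>\<in>X. h \<xi> * node X D \<xi> x)"
proof -
  obtain p where p: "degree p \<le> d" "\<And>x. x \<notin> P \<Longrightarrow> h x = poly p x / poly Q x ^ D"
    using h unfolding rat_def by blast
  let ?l = "\<lambda>\<xi>. \<Prod>\<xi>'\<in>X - {\<xi>}. smult (1 / (\<xi> - \<xi>')) [:- \<xi>', 1:]"
  have fin: "finite X" and card: "card X = Suc d" and notP: "\<And>\<xi>. \<xi> \<in> X \<Longrightarrow> \<xi> \<notin> P"
    using X by (auto simp: nodes_def)
  have l: "poly (?l \<xi>) \<zeta> = (if \<zeta> = \<xi> then 1 else 0)" if "\<xi> \<in> X" "\<zeta> \<in> X" for \<xi> \<zeta>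
  proof (cases "\<zeta> = \<xi>")
    case True
    have "poly (?l \<xi>) \<xi> = 1"
      unfolding poly_prod by (intro prod.neutral) (auto simp: diff_divide_distrib[symmetric])
    then show ?thesis using True by simp
  next
    case False
    have "poly (?l \<xi>) \<zeta> = 0" unfolding poly_prod
      by (rule prod_zero) (use fin that False in \<open>auto intro!: bexI[of _ \<zeta>]\<close>)
    then show ?thesis using False by simp
  qed
  have "p = (\<Sum>\<xi>\<in>X. smult (poly p \<xi>) (?l \<xi>))" (is "_ = ?s")
  proof (rule poly_eqI_degree[of X])
    fix \<zeta> assume \<zeta>: "\<zeta> \<in> X"
    have "poly ?s \<zeta> = (\<Sum>\<xi>\<in>X. poly p \<xi> * (if \<zeta> = \<xi> then 1 else 0))"
      unfolding poly_sum by (intro sum.cong refl) (use l \<zeta> in \<open>simp only: poly_smult\<close>)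
    then show "poly p \<zeta> = poly ?s \<zeta>" using \<zeta> fin by (simp add: if_distrib[of "\<lambda>x. _ * x"] cong: if_cong)
  next
    show "degree p < card X" using p card by simp
    have "degree (?l \<xi>) \<le> d" if "\<xi> \<in> X" for \<xi>
    proof -
      have "degree (?l \<xi>) \<le> (\<Sum>\<xi>'\<in>X - {\<xi>}. degree (smult (1 / (\<xi> - \<xi>')) [:- \<xi>', 1:]))"
        using degree_prod_sum_le[of "X - {\<xi>}" "\<lambda>\<xi>'. smult (1 / (\<xi> - \<xi>')) [:- \<xi>', 1:]"] fin by (simp add: o_def)
      also have "\<dots> \<le> (\<Sum>\<xi>'\<in>X - {\<xi>}. 1)" by (intro sum_mono) simp
      finally show ?thesis using fin card that by simp
    qed
    then have "degree ?s \<le> d" by (intro degree_sum_le fin) (meson degree_smult_le order_trans)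
    then show "degree ?s < card X" using card by simp
  qed
  then have "poly p x = (\<Sum>\<xi>\<in>X. poly p \<xi> * poly (?l \<xi>) x)"
    by (metis (mono_tags, lifting) poly_sum poly_smult sum.cong)
  then have "h x = (\<Sum>\<xi>\<in>X. poly p \<xi> * poly (?l \<xi>) x) / poly Q x ^ D"
    using p(2)[OF x] by simp
  also have "\<dots> = (\<Sum>\<xi>\<in>X. h \<xi> * node X D \<xi> x)"
    unfolding sum_divide_distrib
  proof (intro sum.cong refl)
    fix \<xi> assume "\<xi> \<in> X"
    then have "poly Q \<xi> \<noteq> 0" "h \<xi> = poly p \<xi> / poly Q \<xi> ^ D" using notP poly_Q p(2) by auto
    then show "poly p \<xi> * poly (?l \<xi>) x / poly Q x ^ D = h \<xi> * node X D \<xi> x" by (simp add: node_def)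
  qed
  finally show ?thesis .
qed

end

section \<open>Functions that are rational of bounded degree in each variable\<close>

context punctured_line
begin

text \<open>Degree bounds that are uniform in the remaining variables permit Lagrange interpolation in all
  variables at one fixed set of nodes.\<close>
definition sep_poly :: "nat \<Rightarrow> ((nat \<Rightarrow> complex) \<Rightarrow> complex) \<Rightarrow> bool" where
  "sep_poly r F \<longleftrightarrow> (\<exists>d. \<forall>t p. regpt r t \<longrightarrow> p < r \<longrightarrow>
    (\<exists>f. degree f \<le> d \<and> (\<forall>x. F (t(p := x)) = poly f x)))"

definition sep_rat :: "nat \<Rightarrow> nat \<Rightarrow> nat \<Rightarrow> ((nat \<Rightarrow> complex) \<Rightarrow> complex) \<Rightarrow> bool" where
  "sep_rat r d D F \<longleftrightarrow> (\<forall>t p. regpt r t \<longrightarrow> p < r \<longrightarrow> rat d D (\<lambda>x. F (t(p := x))))"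

lemma sep_rat_common: "sep_rat r d D F \<Longrightarrow> sep_rat r (d + d' + (D + D') * card P) (D + D') F"
  "sep_rat r d D F \<Longrightarrow> sep_rat r (d' + d + (D' + D) * card P) (D' + D) F"
  unfolding sep_rat_def by (auto intro: rat_common rat_common')

lemma sep_poly_const: "sep_poly r (\<lambda>t. c)"
  unfolding sep_poly_def by (intro exI[of _ 0] allI impI exI[of _ "[:c:]"]) simp

lemma sep_poly_coord: "sep_poly r (\<lambda>t. t q)"
  unfolding sep_poly_def
proof (intro exI[of _ "1 :: nat"] allI impI)
  fix t :: "nat \<Rightarrow> complex" and p
  show "\<exists>f. degree f \<le> 1 \<and> (\<forall>x. (t(p := x)) q = poly f x)"
    by (rule exI[of _ "if p = q then [:0, 1:] else [:t q:]"]) auto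
qed

lemma sep_poly_add:
  assumes "sep_poly r F" "sep_poly r G"
  shows "sep_poly r (\<lambda>t. F t + G t)"
proof -
  obtain d where d: "\<And>t p. regpt r t \<Longrightarrow> p < r \<Longrightarrow> \<exists>f. degree f \<le> d \<and> (\<forall>x. F (t(p := x)) = poly f x)"
    using assms(1) unfolding sep_poly_def by blast
  obtain e where e: "\<And>t p. regpt r t \<Longrightarrow> p < r \<Longrightarrow> \<exists>f. degree f \<le> e \<and> (\<forall>x. G (t(p := x)) = poly f x)"
    using assms(2) unfolding sep_poly_def by blast
  show ?thesis unfolding sep_poly_def
  proof (intro exI[of _ "max d e"] allI impI)
    fix t p assume tp: "regpt r t" "p < r"
    obtain f where f: "degree f \<le> d" "\<And>x. F (t(p := x)) = poly f x" using d[OF tp] by blast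
    obtain g where g: "degree g \<le> e" "\<And>x. G (t(p := x)) = poly g x" using e[OF tp] by blast
    show "\<exists>h. degree h \<le> max d e \<and> (\<forall>x. F (t(p := x)) + G (t(p := x)) = poly h x)"
      by (rule exI[of _ "f + g"]) (use f g in \<open>auto intro!: degree_add_le\<close>)
  qed
qed

lemma sep_poly_mult:
  assumes "sep_poly r F" "sep_poly r G"
  shows "sep_poly r (\<lambda>t. F t * G t)"
proof -
  obtain d where d: "\<And>t p. regpt r t \<Longrightarrow> p < r \<Longrightarrow> \<exists>f. degree f \<le> d \<and> (\<forall>x. F (t(p := x)) = poly f x)"
    using assms(1) unfolding sep_poly_def by blast
  obtain e where e: "\<And>t p. regpt r t \<Longrightarrow> p < r \<Longrightarrow> \<exists>f. degree f \<le> e \<and> (\<forall>x. G (t(p := x)) = poly f x)"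
    using assms(2) unfolding sep_poly_def by blast
  show ?thesis unfolding sep_poly_def
  proof (intro exI[of _ "d + e"] allI impI)
    fix t p assume tp: "regpt r t" "p < r"
    obtain f where f: "degree f \<le> d" "\<And>x. F (t(p := x)) = poly f x" using d[OF tp] by blast
    obtain g where g: "degree g \<le> e" "\<And>x. G (t(p := x)) = poly g x" using e[OF tp] by blast
    show "\<exists>h. degree h \<le> d + e \<and> (\<forall>x. F (t(p := x)) * G (t(p := x)) = poly h x)"
      by (rule exI[of _ "f * g"]) (use f g degree_mult_le[of f g] in auto)
  qed
qed

lemma sep_poly_prod: "(\<And>i. i \<in> I \<Longrightarrow> sep_poly r (F i)) \<Longrightarrow> sep_poly r (\<lambda>t. \<Prod>i\<in>I. F i t)"
  by (induction I rule: infinite_finite_induct) (auto intro: sep_poly_const sep_poly_mult)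

lemma sep_poly_lin_series:
  assumes "\<And>q. sep_poly r (\<lambda>t. l t q $ 0)" "\<And>q. sep_poly r (\<lambda>t. l t q $ 1)"
  shows "sep_poly r (\<lambda>t. fps_nth (lin_series m (l t)) k)"
proof (induction m arbitrary: k)
  case 0
  show ?case unfolding lin_series_def by (simp add: sep_poly_const)
next
  case (Suc m)
  show ?case unfolding lin_series_Suc_nth
    by (cases "k = 0") (simp_all only: simp_thms if_True if_False, (intro sep_poly_add sep_poly_mult sep_poly_const Suc assms)+)
qed

lemma sep_poly_sg: "sep_poly r (\<lambda>t. sg (t q) $ 0)" "sep_poly r (\<lambda>t. sg (t q) $ 1)"
proof -
  have "sep_poly r (\<lambda>t. b1 + t q * (- a1))" "sep_poly r (\<lambda>t. t q * a0 + (- b0))"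
    by (intro sep_poly_add sep_poly_mult sep_poly_const sep_poly_coord)+
  then show "sep_poly r (\<lambda>t. sg (t q) $ 0)" "sep_poly r (\<lambda>t. sg (t q) $ 1)"
    by (simp_all add: sg_nth)
qed

lemma sep_poly_pt: "i < r + 1 \<Longrightarrow> sep_poly r (\<lambda>t. pt r t $ i)"
  unfolding pt_def lin_prod_def by (simp add: sep_poly_lin_series sep_poly_sg[unfolded One_nat_def])

lemma sep_poly_tg: "i < r + 1 \<Longrightarrow> sep_poly r (\<lambda>t. tg r t p $ i)"
proof -
  assume i: "i < r + 1"
  have "sep_poly r (\<lambda>t. ((\<lambda>q. sg (t q))(p := dsg)) q $ j)" if "j = 0 \<or> j = 1" for q j
    using that sep_poly_sg[of r q] by (cases "q = p") (auto simp: sep_poly_const)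
  then have "sep_poly r (\<lambda>t. fps_nth (lin_series r ((\<lambda>q. sg (t q))(p := dsg))) i)"
    by (intro sep_poly_lin_series) blast+
  then show ?thesis using i unfolding tg_def lin_prod_def by simp
qed

lemma sep_poly_polyfun: "f \<in> polyfun (r + 1) \<Longrightarrow> sep_poly r (\<lambda>t. f (pt r t))"
proof (induction rule: polyfun.induct)
  case (add f g)
  from sep_poly_add[OF add.IH] show ?case .
next
  case (mult f g)
  from sep_poly_mult[OF mult.IH] show ?case .
qed (simp_all add: sep_poly_const sep_poly_pt)

lemma sep_poly_imp_rat:
  assumes "sep_poly r F"
  shows "\<exists>d D. sep_rat r d D F"
proof -
  obtain d where d: "\<And>t p. regpt r t \<Longrightarrow> p < r \<Longrightarrow> \<exists>f. degree f \<le> d \<and> (\<forall>x. F (t(p := x)) = poly f x)"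
    using assms unfolding sep_poly_def by blast
  have "rat d 0 (\<lambda>x. F (t(p := x)))" if tp: "regpt r t" "p < r" for t p
  proof -
    obtain f where "degree f \<le> d" "\<And>x. F (t(p := x)) = poly f x" using d[OF tp] by blast
    then show ?thesis unfolding rat_def by (intro exI[of _ f]) simp
  qed
  then show ?thesis unfolding sep_rat_def by blast
qed

lemma regpt_upd: "regpt r t \<Longrightarrow> x \<notin> P \<Longrightarrow> regpt r (t(p := x))"
  by (auto simp: regpt_def)

lemma sep_rat_quotient:
  assumes "sep_poly r F" "sep_poly r G" "\<And>t. regpt r t \<Longrightarrow> G t \<noteq> 0"
    and H: "\<And>t. regpt r t \<Longrightarrow> H t = F t / G t"
  shows "\<exists>d D. sep_rat r d D H"
proof -
  obtain d where d: "\<And>t p. regpt r t \<Longrightarrow> p < r \<Longrightarrow> \<exists>f. degree f \<le> d \<and> (\<forall>x. F (t(p := x)) = poly f x)"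
    using assms(1) unfolding sep_poly_def by blast
  obtain e where e: "\<And>t p. regpt r t \<Longrightarrow> p < r \<Longrightarrow> \<exists>f. degree f \<le> e \<and> (\<forall>x. G (t(p := x)) = poly f x)"
    using assms(2) unfolding sep_poly_def by blast
  have "rat (d + e * card P) e (\<lambda>x. H (t(p := x)))" if tp: "regpt r t" "p < r" for t p
  proof -
    obtain f where f: "degree f \<le> d" "\<And>x. F (t(p := x)) = poly f x" using d[OF tp] by blast
    obtain g where g: "degree g \<le> e" "\<And>x. G (t(p := x)) = poly g x" using e[OF tp] by blast
    have "poly g x \<noteq> 0" if "x \<notin> P" for x
      using assms(3)[OF regpt_upd[OF tp(1) that, of p]] g(2)[of x] by simp
    from rat_quotient[OF f(1) g(1) this] show ?thesis
      by (rule rat_cong) (use H[OF regpt_upd[OF tp(1)], of _ p] f(2) g(2) in simp_all)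
  qed
  then show ?thesis unfolding sep_rat_def by blast
qed

lemma sep_rat_add:
  assumes "\<exists>d D. sep_rat r d D F" "\<exists>d D. sep_rat r d D G"
  shows "\<exists>d D. sep_rat r d D (\<lambda>t. F t + G t)"
proof -
  obtain d D d' D' where "sep_rat r d D F" "sep_rat r d' D' G" using assms by blast
  from sep_rat_common(1)[OF this(1), of d' D'] sep_rat_common(2)[OF this(2), of d D]
  have "sep_rat r (d + d' + (D + D') * card P) (D + D') (\<lambda>t. F t + G t)"
    unfolding sep_rat_def by (simp add: rat_add)
  then show ?thesis by blast
qed

lemma sep_rat_mult:
  assumes "\<exists>d D. sep_rat r d D F" "\<exists>d D. sep_rat r d D G"
  shows "\<exists>d D. sep_rat r d D (\<lambda>t. F t * G t)"
proof -
  obtain d D d' D' where "sep_rat r d D F" "sep_rat r d' D' G" using assms by blast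
  then have "sep_rat r (d + d') (D + D') (\<lambda>t. F t * G t)"
    unfolding sep_rat_def by (simp add: rat_mult)
  then show ?thesis by blast
qed

lemma sep_rat_sum:
  "finite I \<Longrightarrow> (\<And>i. i \<in> I \<Longrightarrow> \<exists>d D. sep_rat r d D (F i)) \<Longrightarrow> \<exists>d D. sep_rat r d D (\<lambda>t. \<Sum>i\<in>I. F i t)"
proof (induction I rule: finite_induct)
  case empty
  then show ?case using sep_poly_imp_rat[OF sep_poly_const[of r 0]] by simp
next
  case (insert i I)
  then show ?case using sep_rat_add[of r "F i" "\<lambda>t. \<Sum>i\<in>I. F i t"] by simp
qed

text \<open>By \<open>alternating_expand\<close> the value is a finite sum of products of
  coordinates of the vectors, polynomial in each variable, and values on unit vectors, which are
  quotients of polynomials in the coordinates of \<open>pt r t\<close>.\<close>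

lemma sep_rat_form:
  assumes \<eta>: "\<eta> \<in> Omega (r + 1) (V r) m"
    and L: "\<And>t i. L t i \<in> carrier_vec (r + 1)" "\<And>i j. j < r + 1 \<Longrightarrow> sep_poly r (\<lambda>t. L t i $ j)"
  shows "\<exists>d D. sep_rat r d D (\<lambda>t. \<eta> (pt r t) (map (L t) [0..<m]))"
proof -
  let ?e = "\<lambda>g :: nat \<Rightarrow> nat. map (\<lambda>i. unit_vec (r + 1) (g i) :: complex vec) [0..<m]"
  let ?K = "{..<m} \<rightarrow>\<^sub>E {..<r + 1}"
  have "\<exists>d D. sep_rat r d D (\<lambda>t. \<eta> (pt r t) (?e g))" for g
  proof -
    have "length (?e g) = m" "set (?e g) \<subseteq> carrier_vec (r + 1)" by auto
    then obtain A B where AB: "A \<in> polyfun (r + 1)" "B \<in> polyfun (r + 1)"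
      "\<forall>y\<in>V r. B y \<noteq> 0 \<and> \<eta> y (?e g) = A y / B y"
      using Omega_regular[OF \<eta>] unfolding regular_on_def by blast
    show ?thesis
      by (rule sep_rat_quotient[OF sep_poly_polyfun[OF AB(1)] sep_poly_polyfun[OF AB(2)]])
        (use AB(3) pt_in_V in blast)+
  qed
  then have e: "\<exists>d D. sep_rat r d D (\<lambda>t. (\<Prod>i<m. L t i $ g i) * \<eta> (pt r t) (?e g))" if "g \<in> ?K" for g
    by (rule sep_rat_mult[rotated])
      (intro sep_poly_imp_rat sep_poly_prod L(2), use that in \<open>auto simp: PiE_iff\<close>)
  define G where "G t = (\<Sum>g\<in>?K. (\<Prod>i<m. L t i $ g i) * \<eta> (pt r t) (?e g))" for t
  have "\<exists>d D. sep_rat r d D G"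
    unfolding G_def by (rule sep_rat_sum[OF _ e]) (simp_all add: finite_PiE)
  then obtain d D where *: "sep_rat r d D G" by blast
  have eq: "\<eta> (pt r t) (map (L t) [0..<m]) = G t"
    if t: "regpt r t" for t
  proof -
    have Lc: "length (map (L t) [0..<m]) = m" "set (map (L t) [0..<m]) \<subseteq> carrier_vec (r + 1)"
      using L(1) by auto
    show ?thesis
      unfolding G_def alternating_expand[OF Omega_alternating[OF \<eta> pt_in_V[OF t]] Lc]
      by (intro sum.cong refl arg_cong2[of _ _ _ _ "(*)"] prod.cong) auto
  qed
  have "sep_rat r d D (\<lambda>t. \<eta> (pt r t) (map (L t) [0..<m]))"
    unfolding sep_rat_def
  proof (intro allI impI)
    fix t p assume tp: "regpt r t" "p < r"
    show "rat d D (\<lambda>x. \<eta> (pt r (t(p := x))) (map (L (t(p := x))) [0..<m]))"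
      using *[unfolded sep_rat_def, rule_format, OF tp]
      by (rule rat_cong) (use eq[OF regpt_upd[OF tp(1)]] in simp)
  qed
  then show ?thesis by blast
qed

lemma sep_rat_top_form:
  "\<eta> \<in> Omega (r + 1) (V r) r \<Longrightarrow> \<exists>d D. sep_rat r d D (\<lambda>t. \<eta> (pt r t) (tgs r t))"
  using sep_rat_form[of \<eta> r r "tg r"] sep_poly_tg by simp

lemma sep_rat_omit_form:
  assumes \<eta>: "\<eta> \<in> Omega (r + 1) (V r) (r - 1)" and p: "p < r"
  shows "\<exists>d D. sep_rat r d D (\<lambda>t. \<eta> (pt r t) (omit p (tgs r t)))"
proof -
  have e: "omit p (tgs r t) = map (\<lambda>i. tg r t (if i < p then i else Suc i)) [0..<r - 1]" for t
    using p by (intro nth_equalityI) (auto simp: length_omit nth_omit)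
  show ?thesis unfolding e by (intro sep_rat_form \<eta> sep_poly_tg) simp_all
qed

lemma regpt_nodes:
  assumes "nodes d X" "\<kappa> \<in> {..<r} \<rightarrow>\<^sub>E X"
  shows "regpt r \<kappa>"
  using assms unfolding nodes_def regpt_def by (metis IntI PiE_mem empty_iff lessThan_iff)

text \<open>One variable is interpolated at a time: \<open>?m k \<kappa>\<close> has its first
  \<open>k\<close> coordinates at nodes and the others at \<open>t\<close>. Through
  \<open>cong\<close> the extensional function \<open>\<kappa>\<close> itself may serve as argument
  of \<open>F\<close> at the end.\<close>

lemma tensor_interpolation:
  assumes F: "sep_rat r d D F" and X: "nodes d X" and t: "regpt r t"
    and cong: "\<And>t t'. (\<And>q. q < r \<Longrightarrow> t q = t' q) \<Longrightarrow> F t = F t'"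
  shows "F t = (\<Sum>\<kappa>\<in>{..<r} \<rightarrow>\<^sub>E X. F \<kappa> * (\<Prod>p<r. node X D (\<kappa> p) (t p)))"
proof -
  let ?m = "\<lambda>k \<kappa> i. if i < k then \<kappa> i else t i"
  have "F t = (\<Sum>\<kappa>\<in>{..<k} \<rightarrow>\<^sub>E X. F (?m k \<kappa>) * (\<Prod>p<k. node X D (\<kappa> p) (t p)))" if "k \<le> r" for k
    using that
  proof (induction k)
    case 0
    then show ?case by simp
  next
    case (Suc k)
    have k: "k < r" using Suc.prems by simp
    have tk: "t k \<notin> P" using t k by (simp add: regpt_def)
    have step: "F (?m k \<kappa>) = (\<Sum>\<xi>\<in>X. F (?m (Suc k) (\<kappa>(k := \<xi>))) * node X D \<xi> (t k))"
      if \<kappa>: "\<kappa> \<in> {..<k} \<rightarrow>\<^sub>E X" for \<kappa>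
    proof -
      have reg: "regpt r (?m k \<kappa>)"
        using t regpt_nodes[OF X \<kappa>] by (auto simp: regpt_def)
      have "rat d D (\<lambda>x. F ((?m k \<kappa>)(k := x)))" using F reg k by (auto simp: sep_rat_def)
      from rat_interpolation[OF this X tk]
      have "F ((?m k \<kappa>)(k := t k)) = (\<Sum>\<xi>\<in>X. F ((?m k \<kappa>)(k := \<xi>)) * node X D \<xi> (t k))" .
      moreover have "(?m k \<kappa>)(k := t k) = ?m k \<kappa>" by auto
      moreover have "(?m k \<kappa>)(k := \<xi>) = ?m (Suc k) (\<kappa>(k := \<xi>))" for \<xi> by (auto simp: less_Suc_eq)
      ultimately show ?thesis by simp
    qed
    have "F t = (\<Sum>\<kappa>\<in>{..<k} \<rightarrow>\<^sub>E X. F (?m k \<kappa>) * (\<Prod>p<k. node X D (\<kappa> p) (t p)))"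
      using Suc by simp
    also have "\<dots> = (\<Sum>\<kappa>\<in>{..<k} \<rightarrow>\<^sub>E X. \<Sum>\<xi>\<in>X. F (?m (Suc k) (\<kappa>(k := \<xi>))) *
        (\<Prod>p<Suc k. node X D ((\<kappa>(k := \<xi>)) p) (t p)))"
    proof (intro sum.cong refl)
      fix \<kappa> assume \<kappa>: "\<kappa> \<in> {..<k} \<rightarrow>\<^sub>E X"
      have "(\<Prod>p<k. node X D ((\<kappa>(k := \<xi>)) p) (t p)) = (\<Prod>p<k. node X D (\<kappa> p) (t p))" for \<xi>
        by (intro prod.cong) auto
      then show "F (?m k \<kappa>) * (\<Prod>p<k. node X D (\<kappa> p) (t p)) = (\<Sum>\<xi>\<in>X. F (?m (Suc k) (\<kappa>(k := \<xi>))) *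
        (\<Prod>p<Suc k. node X D ((\<kappa>(k := \<xi>)) p) (t p)))"
        unfolding step[OF \<kappa>] sum_distrib_right by (intro sum.cong refl) (simp add: mult_ac)
    qed
    finally show ?case unfolding sum_PiE_lessThan_Suc .
  qed
  from this[of r] have "F t = (\<Sum>\<kappa>\<in>{..<r} \<rightarrow>\<^sub>E X. F (?m r \<kappa>) * (\<Prod>p<r. node X D (\<kappa> p) (t p)))" by simp
  moreover have "F (?m r \<kappa>) = F \<kappa>" for \<kappa> by (rule cong) simp
  ultimately show ?thesis by simp
qed

end

section \<open>Forms and functions with prescribed trace\<close>

lemma fps_nth_inverse_Suc:
  fixes f :: "complex fps"
  assumes "fps_nth f 0 \<noteq> 0" "0 < n"
  shows "fps_nth (inverse f) n = - inverse (fps_nth f 0) *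
    (\<Sum>i\<in>{Suc 0..n}. fps_nth f i * fps_nth (inverse f) (n - i))"
proof -
  have "(\<Sum>i=0..n. fps_nth f i * fps_nth (inverse f) (n - i)) = 0"
    unfolding fps_mult_nth[symmetric] using inverse_mult_eq_1'[OF assms(1)] assms(2) by simp
  then have "fps_nth f 0 * fps_nth (inverse f) n + (\<Sum>i\<in>{Suc 0..n}. fps_nth f i * fps_nth (inverse f) (n - i)) = 0"
    by (simp add: sum.atLeast_Suc_atMost)
  then show ?thesis using assms(1) by (simp add: field_simps add_eq_0_iff)
qed

lemma regular_fps_inverse:
  fixes f :: "complex vec \<Rightarrow> complex fps"
  assumes f: "\<And>n. regular_on m U (\<lambda>y. fps_nth (f y) n)" and f0: "\<And>y. y \<in> U \<Longrightarrow> fps_nth (f y) 0 \<noteq> 0"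
  shows "regular_on m U (\<lambda>y. fps_nth (inverse (f y)) n)"
proof (induction n rule: less_induct)
  case (less n)
  show ?case
  proof (cases n)
    case 0
    then show ?thesis using regular_inverse[OF f f0] by simp
  next
    case (Suc k)
    have "regular_on m U (\<lambda>y. (- 1) * inverse (fps_nth (f y) 0) *
        (\<Sum>i\<in>{Suc 0..n}. fps_nth (f y) i * fps_nth (inverse (f y)) (n - i)))"
      using less Suc by (intro regular_mult regular_const regular_sum f regular_inverse f0) auto
    then show ?thesis
      by (rule regular_cong) (use Suc in \<open>simp add: fps_nth_inverse_Suc f0\<close>)
  qed
qed

lemma regular_fps_mult:
  fixes f g :: "complex vec \<Rightarrow> complex fps"
  assumes "\<And>n. regular_on m U (\<lambda>y. fps_nth (f y) n)" "\<And>n. regular_on m U (\<lambda>y. fps_nth (g y) n)"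
  shows "regular_on m U (\<lambda>y. fps_nth (f y * g y) n)"
  unfolding fps_mult_nth by (intro regular_sum regular_mult assms)

abbreviation fform :: "nat \<Rightarrow> complex fps \<Rightarrow> complex fps \<Rightarrow> complex vec \<Rightarrow> complex fps" where
  "fform \<equiv> bform fps_const"

lemma fform_nth: "fps_nth (fform r c0 c1 y) n = (\<Sum>k\<le>r. y $ k * fps_nth (c0 ^ (r - k) * c1 ^ k) n)"
  by (simp add: bform_def fps_sum_nth)

lemma fform_nth_0: "fps_nth (fform r c0 c1 y) 0 = cform r (fps_nth c0 0) (fps_nth c1 0) y"
  unfolding fform_nth by (simp add: bform_def fps_power_zeroth)

lemma regular_fform: "regular_on (r + 1) U (\<lambda>y. fps_nth (fform r c0 c1 y) n)"
  unfolding fform_nth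
  by (intro regular_polyfun polyfun_sum polyfun.mult polyfun.const polyfun.coord) auto

lemma fform_add: "u \<in> carrier_vec (r + 1) \<Longrightarrow> v \<in> carrier_vec (r + 1) \<Longrightarrow>
    fform r c0 c1 (u + v) = fform r c0 c1 u + fform r c0 c1 v"
  by (rule bform_add[OF comm_ring_hom_fps_const])

lemma fform_smult: "v \<in> carrier_vec (r + 1) \<Longrightarrow> fform r c0 c1 (e \<cdot>\<^sub>v v) = fps_const e * fform r c0 c1 v"
  by (rule bform_smult[OF comm_ring_hom_fps_const])

text \<open>Along a curve \<open>c(T)\<close>, \<open>dlog r c0 c1 n\<close> is the coefficient of \<open>T^n\<close> in the logarithmic
  differential of \<open>y c(T)\<close>; it is \<open>d theta_n\<close> in the coordinates given by the curve.\<close>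
definition dlog :: "nat \<Rightarrow> complex fps \<Rightarrow> complex fps \<Rightarrow> nat \<Rightarrow> complex vec \<Rightarrow> complex vec \<Rightarrow> complex" where
  "dlog r c0 c1 n y v = fps_nth (fform r c0 c1 v * inverse (fform r c0 c1 y)) n"

lemma form1_Omega:
  assumes U: "open_cone n U" and reg: "\<And>v. v \<in> carrier_vec n \<Longrightarrow> regular_on n U (\<lambda>y. \<psi> y v)"
    and lin: "\<And>y u v a b. y \<in> U \<Longrightarrow> u \<in> carrier_vec n \<Longrightarrow> v \<in> carrier_vec n \<Longrightarrow>
      \<psi> y (a \<cdot>\<^sub>v u + b \<cdot>\<^sub>v v) = a * \<psi> y u + b * \<psi> y v"
    and scale: "\<And>y v c. y \<in> U \<Longrightarrow> v \<in> carrier_vec n \<Longrightarrow> c \<noteq> 0 \<Longrightarrow> \<psi> (c \<cdot>\<^sub>v y) (c \<cdot>\<^sub>v v) = \<psi> y v"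
    and radial: "\<And>y. y \<in> U \<Longrightarrow> \<psi> y y = 0"
  shows "form_on n U 1 (\<lambda>y vs. \<psi> y (vs ! 0)) \<in> Omega n U 1"
proof (rule OmegaI)
  fix y :: "complex vec" and vs :: "complex vec list"
  assume "\<not> (y \<in> U \<and> length vs = 1 \<and> set vs \<subseteq> carrier_vec n)"
  then show "form_on n U 1 (\<lambda>y vs. \<psi> y (vs ! 0)) y vs = 0" unfolding form_on_def by (simp only: if_False)
next
  fix vs :: "complex vec list" assume vs: "length vs = 1" "set vs \<subseteq> carrier_vec n"
  then have "vs ! 0 \<in> carrier_vec n" by auto
  then show "regular_on n U (\<lambda>y. form_on n U 1 (\<lambda>y vs. \<psi> y (vs ! 0)) y vs)"
    by (rule regular_cong[OF reg]) (use vs in \<open>simp add: form_on_def\<close>)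
next
  fix y assume y: "y \<in> U"
  show "alternating n 1 (form_on n U 1 (\<lambda>y vs. \<psi> y (vs ! 0)) y)"
    unfolding alternating_def
  proof (intro allI impI conjI ballI)
    fix vs :: "complex vec list" and i :: nat and u v :: "complex vec" and a b
    assume vs: "length vs = 1 \<and> set vs \<subseteq> carrier_vec n" and i: "i < 1"
      and u: "u \<in> carrier_vec n" and v: "v \<in> carrier_vec n"
    have "form_on n U 1 (\<lambda>y vs. \<psi> y (vs ! 0)) y (vs[i := w]) = \<psi> y w" if "w \<in> carrier_vec n" for w
      using set_list_update_carrier[of vs n w i] vs i y that by (simp add: form_on_def)
    then show "form_on n U 1 (\<lambda>y vs. \<psi> y (vs ! 0)) y (vs[i := a \<cdot>\<^sub>v u + b \<cdot>\<^sub>v v]) =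
      a * form_on n U 1 (\<lambda>y vs. \<psi> y (vs ! 0)) y (vs[i := u]) +
      b * form_on n U 1 (\<lambda>y vs. \<psi> y (vs ! 0)) y (vs[i := v])" using u v lin[OF y u v] by simp
  next
    fix vs :: "complex vec list"
    assume "length vs = 1 \<and> set vs \<subseteq> carrier_vec n" "\<not> distinct vs"
    then show "form_on n U 1 (\<lambda>y vs. \<psi> y (vs ! 0)) y vs = 0"
      by (metis One_nat_def distinct_singleton length_0_conv length_Suc_conv)
  qed
next
  fix y :: "complex vec" and vs :: "complex vec list" and c
  assume y: "y \<in> U" and vs: "length vs = 1" "set vs \<subseteq> carrier_vec n" and c: "(c :: complex) \<noteq> 0"
  have "c \<cdot>\<^sub>v y \<in> U" using open_cone_smult[OF U y c] .
  moreover have "set (map (\<lambda>v. c \<cdot>\<^sub>v v) vs) \<subseteq> carrier_vec n" using vs by auto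
  moreover have "vs ! 0 \<in> carrier_vec n" using vs by auto
  ultimately show "form_on n U 1 (\<lambda>y vs. \<psi> y (vs ! 0)) (c \<cdot>\<^sub>v y) (map (\<lambda>v. c \<cdot>\<^sub>v v) vs) =
      form_on n U 1 (\<lambda>y vs. \<psi> y (vs ! 0)) y vs"
    using scale[OF y _ c, of "vs ! 0"] y vs unfolding form_on_def by simp
next
  fix y :: "complex vec" and vs :: "complex vec list"
  assume y: "y \<in> U" and vs: "length vs = 1" "set vs \<subseteq> carrier_vec n" "y \<in> set vs"
  then have "vs ! 0 = y" by (cases vs) auto
  then show "form_on n U 1 (\<lambda>y vs. \<psi> y (vs ! 0)) y vs = 0" using radial[OF y] by (simp add: form_on_def)
qed

lemma form0_Omega:
  assumes U: "open_cone n U" and reg: "regular_on n U f"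
    and scale: "\<And>y c. y \<in> U \<Longrightarrow> c \<noteq> 0 \<Longrightarrow> f (c \<cdot>\<^sub>v y) = f y"
  shows "form_on n U 0 (\<lambda>y vs. f y) \<in> Omega n U 0"
proof (rule OmegaI)
  show "regular_on n U (\<lambda>y. form_on n U 0 (\<lambda>y vs. f y) y vs)" if "length vs = 0" for vs
    by (rule regular_cong[OF reg]) (use that in \<open>simp add: form_on_def\<close>)
qed (use open_cone_smult[OF U] scale in \<open>auto simp: form_on_def alternating_def\<close>)

context punctured_line
begin

lemma traces_lincomb:
  assumes "traces r f \<psi>" "traces r g \<chi>"
  shows "traces r (\<lambda>x. a * f x + b * g x) (\<lambda>y vs. a * \<psi> y vs + b * \<chi> y vs)"
  using assms Omega_lincomb unfolding traces_def by auto

lemma traces_cong: "traces r f \<psi> \<Longrightarrow> (\<And>x. x \<notin> P \<Longrightarrow> f x = g x) \<Longrightarrow> traces r g \<psi>"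
  unfolding traces_def regpt_def by auto

definition fun_traces :: "nat \<Rightarrow> (complex \<Rightarrow> complex) \<Rightarrow> dform \<Rightarrow> bool" where
  "fun_traces r g \<theta> \<longleftrightarrow> \<theta> \<in> Omega (r + 1) (V r) 0 \<and>
    (\<forall>t. regpt r t \<longrightarrow> \<theta> (pt r t) [] = (\<Sum>q<r. g (t q)))"

lemma fun_traces_lincomb:
  assumes "fun_traces r f \<psi>" "fun_traces r g \<chi>"
  shows "fun_traces r (\<lambda>x. a * f x + b * g x) (\<lambda>y vs. a * \<psi> y vs + b * \<chi> y vs)"
  using assms Omega_lincomb unfolding fun_traces_def by (auto simp: sum.distrib sum_distrib_left)

lemma fun_traces_cong: "fun_traces r f \<theta> \<Longrightarrow> (\<And>x. x \<notin> P \<Longrightarrow> f x = g x) \<Longrightarrow> fun_traces r g \<theta>"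
  unfolding fun_traces_def regpt_def by auto

text \<open>At \<open>pt r t\<close> the series \<open>fform r c0 c1\<close> is the product of the factors \<open>sform c0 c1 (t q)\<close>.\<close>
definition sform :: "complex fps \<Rightarrow> complex fps \<Rightarrow> complex \<Rightarrow> complex fps" where
  "sform c0 c1 x = fps_const (b1 - x * a1) * c0 + fps_const (x * a0 - b0) * c1"

definition dsform :: "complex fps \<Rightarrow> complex fps \<Rightarrow> complex fps" where
  "dsform c0 c1 = fps_const (- a1) * c0 + fps_const a0 * c1"

text \<open>The curve starts at a point where no \<open>y\<close> in \<open>V r\<close> vanishes;
  this makes the power series \<open>fform r c0 c1 y\<close> invertible.\<close>

definition avoids :: "nat \<Rightarrow> complex fps \<Rightarrow> complex fps \<Rightarrow> bool" where
  "avoids r c0 c1 \<longleftrightarrow> (\<forall>y\<in>V r. cform r (fps_nth c0 0) (fps_nth c1 0) y \<noteq> 0)"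

lemma avoids_nz: "avoids r c0 c1 \<Longrightarrow> y \<in> V r \<Longrightarrow> fps_nth (fform r c0 c1 y) 0 \<noteq> 0"
  by (simp add: avoids_def fform_nth_0)

lemma fform_pt: "fform r c0 c1 (pt r t) = (\<Prod>q<r. sform c0 c1 (t q))"
  by (simp add: bform_pt comm_ring_hom_fps_const sform_def)

lemma fform_tg: "p < r \<Longrightarrow> fform r c0 c1 (tg r t p) = dsform c0 c1 * (\<Prod>q\<in>{..<r} - {p}. sform c0 c1 (t q))"
  by (simp add: bform_tg comm_ring_hom_fps_const sform_def dsform_def)

lemma sform_nz:
  assumes "avoids r c0 c1" "regpt r t" "q < r"
  shows "fps_nth (sform c0 c1 (t q)) 0 \<noteq> 0"
proof -
  have "fps_nth (\<Prod>q<r. sform c0 c1 (t q)) 0 \<noteq> 0"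
    using avoids_nz[OF assms(1) pt_in_V[OF assms(2)]] by (simp add: fform_pt)
  moreover have "fps_nth (\<Prod>q<r. sform c0 c1 (t q)) 0 = (\<Prod>q<r. fps_nth (sform c0 c1 (t q)) 0)"
    by (induction r) simp_all
  ultimately show ?thesis using assms(3) by (metis finite_lessThan lessThan_iff prod_zero)
qed

text \<open>Only the \<open>p\<close>-th factor of the product depends on \<open>t p\<close>, and
  all other factors cancel in the logarithmic differential.\<close>

lemma dlog_tg:
  assumes "avoids r c0 c1" "regpt r t" "p < r"
  shows "dlog r c0 c1 n (pt r t) (tg r t p) = fps_nth (dsform c0 c1 * inverse (sform c0 c1 (t p))) n"
proof -
  let ?R = "\<Prod>q\<in>{..<r} - {p}. sform c0 c1 (t q)"
  have y: "fform r c0 c1 (pt r t) = sform c0 c1 (t p) * ?R"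
    unfolding fform_pt using assms(3) by (subst prod.remove[of _ p]) auto
  have "fps_nth (sform c0 c1 (t p) * ?R) 0 \<noteq> 0"
    using avoids_nz[OF assms(1) pt_in_V[OF assms(2)]] unfolding y .
  then have "fps_nth ?R 0 \<noteq> 0" by simp
  then have "?R * inverse (sform c0 c1 (t p) * ?R) = inverse (sform c0 c1 (t p))"
    using inverse_mult_eq_1'[of ?R] by (simp add: fps_inverse_mult mult.left_commute)
  then show ?thesis unfolding dlog_def y fform_tg[OF assms(3)] by (simp only: mult.assoc)
qed

text \<open>On the radial vector \<open>y\<close> the quotient of the two series is 1, so only the
  coefficients with \<open>n k = 0\<close> contribute there. A combination descends to projective
  space exactly because the weights at order zero add up to 0, which is \<open>bal\<close>.\<close>

lemma traces_dlog:
  assumes K: "finite K" and av: "\<And>k. k \<in> K \<Longrightarrow> avoids r (c0 k) (c1 k)"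
    and bal: "(\<Sum>k\<in>{k \<in> K. n k = 0}. \<alpha> k) = 0"
  shows "traces r (\<lambda>x. \<Sum>k\<in>K. \<alpha> k * fps_nth (dsform (c0 k) (c1 k) * inverse (sform (c0 k) (c1 k) x)) (n k))
    (form_on (r + 1) (V r) 1 (\<lambda>y vs. \<Sum>k\<in>K. \<alpha> k * dlog r (c0 k) (c1 k) (n k) y (vs ! 0)))"
  unfolding traces_def
proof (intro conjI allI impI)
  show "form_on (r + 1) (V r) 1 (\<lambda>y vs. \<Sum>k\<in>K. \<alpha> k * dlog r (c0 k) (c1 k) (n k) y (vs ! 0)) \<in> Omega (r + 1) (V r) 1"
  proof (rule form1_Omega[OF open_cone_V])
    fix v :: "complex vec"
    show "regular_on (r + 1) (V r) (\<lambda>y. \<Sum>k\<in>K. \<alpha> k * dlog r (c0 k) (c1 k) (n k) y v)"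
      unfolding dlog_def
      by (intro regular_sum regular_cmult regular_fps_mult regular_fps_inverse regular_fform regular_const avoids_nz av)
  next
    fix y u v :: "complex vec" and a b
    assume "u \<in> carrier_vec (r + 1)" "v \<in> carrier_vec (r + 1)"
    then have "dlog r c0 c1 n y (a \<cdot>\<^sub>v u + b \<cdot>\<^sub>v v) = a * dlog r c0 c1 n y u + b * dlog r c0 c1 n y v" for c0 c1 n
      unfolding dlog_def by (simp add: fform_add fform_smult distrib_right mult.assoc)
    then show "(\<Sum>k\<in>K. \<alpha> k * dlog r (c0 k) (c1 k) (n k) y (a \<cdot>\<^sub>v u + b \<cdot>\<^sub>v v)) =
        a * (\<Sum>k\<in>K. \<alpha> k * dlog r (c0 k) (c1 k) (n k) y u) + b * (\<Sum>k\<in>K. \<alpha> k * dlog r (c0 k) (c1 k) (n k) y v)"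
      by (simp add: sum_distrib_left sum.distrib distrib_left mult.left_commute)
  next
    fix y v :: "complex vec" and c :: complex
    assume y: "y \<in> V r" and v: "v \<in> carrier_vec (r + 1)" and c: "c \<noteq> 0"
    have yc: "y \<in> carrier_vec (r + 1)" using y by (simp add: V_def)
    have "fps_const c * fform r c0 c1 v * inverse (fps_const c * fform r c0 c1 y) =
        fform r c0 c1 v * inverse (fform r c0 c1 y)" for c0 c1
    proof -
      have "fps_const c * inverse (fps_const c) = 1" using inverse_mult_eq_1'[of "fps_const c"] c by simp
      then have "(fps_const c * inverse (fps_const c)) * (fform r c0 c1 v * inverse (fform r c0 c1 y)) =
        fform r c0 c1 v * inverse (fform r c0 c1 y)" by (simp only: mult_1)
      then show ?thesis by (simp only: fps_inverse_mult mult_ac)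
    qed
    then show "(\<Sum>k\<in>K. \<alpha> k * dlog r (c0 k) (c1 k) (n k) (c \<cdot>\<^sub>v y) (c \<cdot>\<^sub>v v)) =
        (\<Sum>k\<in>K. \<alpha> k * dlog r (c0 k) (c1 k) (n k) y v)"
      unfolding dlog_def fform_smult[OF v] fform_smult[OF yc] by (simp only:)
  next
    fix y assume y: "y \<in> V r"
    have "dlog r (c0 k) (c1 k) (n k) y y = (if n k = 0 then 1 else 0)" if "k \<in> K" for k
      unfolding dlog_def using inverse_mult_eq_1'[OF avoids_nz[OF av[OF that] y]] by simp
    then have "(\<Sum>k\<in>K. \<alpha> k * dlog r (c0 k) (c1 k) (n k) y y) = (\<Sum>k\<in>K. if n k = 0 then \<alpha> k else 0)"
      by (intro sum.cong refl) simp
    also have "\<dots> = (\<Sum>k\<in>{k \<in> K. n k = 0}. \<alpha> k)"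
      by (rule sum.inter_filter[symmetric]) (rule K)
    finally show "(\<Sum>k\<in>K. \<alpha> k * dlog r (c0 k) (c1 k) (n k) y y) = 0" using bal by simp
  qed
next
  fix t p assume t: "regpt r t" and p: "p < r"
  show "form_on (r + 1) (V r) 1 (\<lambda>y vs. \<Sum>k\<in>K. \<alpha> k * dlog r (c0 k) (c1 k) (n k) y (vs ! 0)) (pt r t) [tg r t p] =
      (\<Sum>k\<in>K. \<alpha> k * fps_nth (dsform (c0 k) (c1 k) * inverse (sform (c0 k) (c1 k) (t p))) (n k))"
    using pt_in_V[OF t] dlog_tg[OF av t p] by (simp add: form_on_def)
qed

text \<open>Here the derivative is taken in the parameter \<open>T\<close> of the curve. The
  logarithmic derivative of the product over \<open>q\<close> is a sum over \<open>q\<close>, and a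
  scalar factor of \<open>y\<close> cancels from it, so its coefficients are functions on projective
  space.\<close>

lemma fun_traces_dlog:
  assumes av: "avoids r c0 c1"
  shows "fun_traces r (\<lambda>x. fps_nth (fps_deriv (sform c0 c1 x) * inverse (sform c0 c1 x)) n)
    (form_on (r + 1) (V r) 0 (\<lambda>y vs. fps_nth (fps_deriv (fform r c0 c1 y) * inverse (fform r c0 c1 y)) n))"
  unfolding fun_traces_def
proof (intro conjI allI impI)
  show "form_on (r + 1) (V r) 0 (\<lambda>y vs. fps_nth (fps_deriv (fform r c0 c1 y) * inverse (fform r c0 c1 y)) n)
      \<in> Omega (r + 1) (V r) 0"
  proof (rule form0_Omega[OF open_cone_V])
    have "regular_on (r + 1) (V r) (\<lambda>y. fps_nth (fps_deriv (fform r c0 c1 y)) n)" for n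
      unfolding fps_deriv_nth by (intro regular_mult regular_const regular_fform)
    then show "regular_on (r + 1) (V r) (\<lambda>y. fps_nth (fps_deriv (fform r c0 c1 y) * inverse (fform r c0 c1 y)) n)"
      by (intro regular_fps_mult regular_fps_inverse regular_fform avoids_nz av)
  next
    fix y and c :: complex assume y: "y \<in> V r" and c: "c \<noteq> 0"
    have yc: "y \<in> carrier_vec (r + 1)" using y by (simp add: V_def)
    have "fps_const c * inverse (fps_const c) = 1" using inverse_mult_eq_1'[of "fps_const c"] c by simp
    then have "(fps_const c * inverse (fps_const c)) * (fps_deriv (fform r c0 c1 y) * inverse (fform r c0 c1 y)) =
      fps_deriv (fform r c0 c1 y) * inverse (fform r c0 c1 y)" by (simp only: mult_1)
    moreover have "fps_deriv (fform r c0 c1 (c \<cdot>\<^sub>v y)) = fps_const c * fps_deriv (fform r c0 c1 y)"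
      unfolding fform_smult[OF yc] by simp
    ultimately show "fps_nth (fps_deriv (fform r c0 c1 (c \<cdot>\<^sub>v y)) * inverse (fform r c0 c1 (c \<cdot>\<^sub>v y))) n =
        fps_nth (fps_deriv (fform r c0 c1 y) * inverse (fform r c0 c1 y)) n"
      unfolding fform_smult[OF yc] by (simp only: fps_inverse_mult mult_ac)
  qed
next
  fix t assume t: "regpt r t"
  have "fps_deriv (\<Prod>q<m. f q) * inverse (\<Prod>q<m. f q) = (\<Sum>q<m. fps_deriv (f q) * inverse (f q))"
    if "\<And>q. q < m \<Longrightarrow> fps_nth (f q) 0 \<noteq> 0" for m and f :: "nat \<Rightarrow> complex fps"
    using that
  proof (induction m)
    case (Suc m)
    have nz: "fps_nth (\<Prod>q<m. f q) 0 \<noteq> 0" if "\<And>q. q < m \<Longrightarrow> fps_nth (f q) 0 \<noteq> 0" for m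
      using that by (induction m) simp_all
    have 1: "(\<Prod>q<m. f q) * inverse (\<Prod>q<m. f q) = 1" "f m * inverse (f m) = 1"
      using nz[of m] Suc.prems by (auto intro!: inverse_mult_eq_1')
    have "fps_deriv (\<Prod>q<Suc m. f q) * inverse (\<Prod>q<Suc m. f q) =
      (fps_deriv (\<Prod>q<m. f q) * inverse (\<Prod>q<m. f q)) * (f m * inverse (f m)) +
      (fps_deriv (f m) * inverse (f m)) * ((\<Prod>q<m. f q) * inverse (\<Prod>q<m. f q))"
      by (simp add: fps_inverse_mult algebra_simps)
    then show ?case using Suc 1 by simp
  qed simp
  from this[of r "\<lambda>q. sform c0 c1 (t q)"]
  have "fps_deriv (fform r c0 c1 (pt r t)) * inverse (fform r c0 c1 (pt r t)) =
    (\<Sum>q<r. fps_deriv (sform c0 c1 (t q)) * inverse (sform c0 c1 (t q)))"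
    unfolding fform_pt using sform_nz[OF av t] by blast
  then show "form_on (r + 1) (V r) 0 (\<lambda>y vs. fps_nth (fps_deriv (fform r c0 c1 y) * inverse (fform r c0 c1 y)) n) (pt r t) [] =
    (\<Sum>q<r. fps_nth (fps_deriv (sform c0 c1 (t q)) * inverse (sform c0 c1 (t q))) n)"
    using pt_in_V[OF t] by (simp add: form_on_def fps_sum_nth)
qed

end

definition fps_lin :: "complex \<Rightarrow> complex \<Rightarrow> complex fps" where
  "fps_lin u v = Abs_fps (\<lambda>n. if n = 0 then u else if n = 1 then v else 0)"

lemma fps_lin_nth: "fps_nth (fps_lin u v) n = (if n = 0 then u else if n = 1 then v else 0)"
  by (simp add: fps_lin_def)

lemma fps_lin_mult_nth: "fps_nth (fps_lin u v * f) n = u * fps_nth f n + (if n = 0 then 0 else v * fps_nth f (n - 1))"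
proof -
  have "fps_lin u v = fps_const u + fps_const v * fps_X"
    by (intro fps_ext) (simp add: fps_lin_nth)
  then show ?thesis by (simp add: distrib_right mult.assoc)
qed

lemma inverse_fps_lin:
  assumes "u \<noteq> 0"
  shows "inverse (fps_lin u v) = Abs_fps (\<lambda>n. (- v) ^ n / u ^ Suc n)"
proof (rule fps_inverse_unique)
  show "fps_lin u v * Abs_fps (\<lambda>n. (- v) ^ n / u ^ Suc n) = 1"
  proof (rule fps_ext)
    fix n
    show "fps_nth (fps_lin u v * Abs_fps (\<lambda>n. (- v) ^ n / u ^ Suc n)) n = fps_nth 1 n"
      using assms by (cases n) (simp_all add: fps_lin_mult_nth fps_lin_nth field_simps)
  qed
qed

context punctured_line
begin

section \<open>Partial fractions\<close>

text \<open>Generated by linear combinations so that forms can be constructed by rule induction. The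
  rule \<open>ext_off\<close> expresses that values at the punctures are irrelevant.\<close>

inductive pfrac :: "(complex \<Rightarrow> complex) \<Rightarrow> bool" where
  pow: "pfrac (\<lambda>x. x ^ n)"
| pole: "p \<in> P \<Longrightarrow> pfrac (\<lambda>x. 1 / (x - p) ^ Suc n)"
| lin: "pfrac f \<Longrightarrow> pfrac g \<Longrightarrow> pfrac (\<lambda>x. a * f x + b * g x)"
| ext_off: "pfrac f \<Longrightarrow> (\<And>x. x \<notin> P \<Longrightarrow> f x = g x) \<Longrightarrow> pfrac g"

lemma pfrac_mult_ident: "pfrac f \<Longrightarrow> pfrac (\<lambda>x. x * f x)"
proof (induction rule: pfrac.induct)
  case (pow n)
  show ?case using pfrac.pow[of "Suc n"] by simp
next
  case (pole p n)
  have "pfrac (\<lambda>x. 1 / (x - p) ^ n)"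
    using pfrac.pow[of 0] pfrac.pole[OF pole] by (cases n) auto
  from pfrac.lin[OF this pfrac.pole[OF pole, of n], of 1 p] show ?case
  proof (rule pfrac.ext_off)
    fix x assume "x \<notin> P"
    then have "x - p \<noteq> 0" using pole by auto
    then show "1 * (1 / (x - p) ^ n) + p * (1 / (x - p) ^ Suc n) = x * (1 / (x - p) ^ Suc n)"
      by (simp add: field_simps)
  qed
next
  case (lin f g a b)
  from pfrac.lin[OF lin.IH, of a b] show ?case by (rule pfrac.ext_off) (simp add: algebra_simps)
next
  case (ext_off f g)
  from ext_off.IH show ?case by (rule pfrac.ext_off) (simp add: ext_off.hyps)
qed

text \<open>For a pole at \<open>p' \<noteq> p\<close> the identity \<open>1 / ((x - p) (x - p')) =
  (1 / (x - p) - 1 / (x - p')) / (p - p')\<close> lowers the order at \<open>p'\<close> by one at a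
  time.\<close>

lemma pfrac_divide:
  assumes p: "p \<in> P"
  shows "pfrac f \<Longrightarrow> pfrac (\<lambda>x. f x / (x - p))"
proof (induction rule: pfrac.induct)
  case (pow n)
  show ?case
  proof (induction n)
    case 0
    show ?case using pfrac.pole[OF p, of 0] by simp
  next
    case (Suc n)
    from pfrac.lin[OF pfrac.pow[of n] Suc, of 1 p] show ?case
    proof (rule pfrac.ext_off)
      fix x assume "x \<notin> P"
      then have "x - p \<noteq> 0" using p by auto
      then show "1 * x ^ n + p * (x ^ n / (x - p)) = x ^ Suc n / (x - p)" by (simp add: field_simps)
    qed
  qed
next
  case (pole p' n)
  show ?case
  proof (cases "p' = p")
    case True
    show ?thesis using pfrac.pole[OF p, of "Suc n"] True by (simp add: mult.commute)
  next
    case False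
    then have d: "p - p' \<noteq> 0" by simp
    show ?thesis
    proof (induction n)
      case 0
      from pfrac.lin[OF pfrac.pole[OF p, of 0] pfrac.pole[OF pole, of 0], of "1 / (p - p')" "- 1 / (p - p')"]
      show ?case
      proof (rule pfrac.ext_off)
        fix x assume "x \<notin> P"
        then have "x - p \<noteq> 0" "x - p' \<noteq> 0" using p pole by auto
        then show "1 / (p - p') * (1 / (x - p) ^ Suc 0) + - 1 / (p - p') * (1 / (x - p') ^ Suc 0) =
          1 / (x - p') ^ Suc 0 / (x - p)" using d by (simp add: divide_simps)
      qed
    next
      case (Suc n)
      from pfrac.lin[OF Suc pfrac.pole[OF pole, of "Suc n"], of "1 / (p - p')" "- 1 / (p - p')"]
      show ?case
      proof (rule pfrac.ext_off)
        fix x assume x: "x \<notin> P"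
        define u where "u = x - p'"
        define e where "e = p - p'"
        have nz: "x - p \<noteq> 0" "u \<noteq> 0" "e \<noteq> 0" using p pole x d by (auto simp: u_def e_def)
        have xp: "x - p = u - e" by (simp add: u_def e_def)
        have "1 / e * (1 / u ^ Suc n / (u - e)) + - 1 / e * (1 / u ^ Suc (Suc n)) = 1 / u ^ Suc (Suc n) / (u - e)"
          using nz xp by (simp add: divide_simps)
        then show "1 / (p - p') * (1 / (x - p') ^ Suc n / (x - p)) + - 1 / (p - p') * (1 / (x - p') ^ Suc (Suc n)) =
          1 / (x - p') ^ Suc (Suc n) / (x - p)" unfolding xp u_def e_def .
      qed
    qed
  qed
next
  case (lin f g a b)
  from pfrac.lin[OF lin.IH, of a b] show ?case by (rule pfrac.ext_off) (simp add: add_divide_distrib)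
next
  case (ext_off f g)
  from ext_off.IH show ?case by (rule pfrac.ext_off) (simp add: ext_off.hyps)
qed

lemma rational_imp_pfrac:
  assumes "rational h"
  shows "pfrac h"
proof -
  obtain f D where f: "\<And>x. x \<notin> P \<Longrightarrow> h x = poly f x / poly Q x ^ D"
    using assms unfolding rational_def rat_def by blast
  have "pfrac (poly f)"
  proof (induction f)
    case 0
    from pfrac.lin[OF pfrac.pow pfrac.pow, of 0 _ 0] show ?case by simp
  next
    case (pCons c f)
    from pfrac.lin[OF pfrac.pow[of 0] pfrac_mult_ident[OF pCons.IH], of c 1] show ?case
      by (rule pfrac.ext_off) simp
  qed
  then have "pfrac (\<lambda>x. poly f x / poly Q x ^ D)"
  proof (induction D)
    case (Suc D)
    have "pfrac (\<lambda>x. poly f x / poly Q x ^ D / (\<Prod>p\<in>S. x - p))" if "S \<subseteq> P" "finite S" for S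
      using that(2,1)
    proof (induction S rule: finite_induct)
      case empty
      then show ?case using Suc by simp
    next
      case (insert p S)
      then have "pfrac (\<lambda>x. poly f x / poly Q x ^ D / (\<Prod>p\<in>S. x - p) / (x - p))"
        by (intro pfrac_divide) auto
      then show ?case by (rule pfrac.ext_off) (use insert in \<open>simp add: mult.commute\<close>)
    qed
    from this[OF order_refl finite_P] show ?case
      by (rule pfrac.ext_off) (simp add: Q_def poly_prod mult.commute)
  qed simp
  then show ?thesis by (rule pfrac.ext_off) (simp add: f)
qed

lemma sform_lin: "sform (fps_lin u v) (fps_lin u' v') x =
    fps_lin ((b1 - x * a1) * u + (x * a0 - b0) * u') ((b1 - x * a1) * v + (x * a0 - b0) * v')"
  unfolding sform_def by (intro fps_ext) (simp add: fps_lin_nth)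

lemma dsform_lin: "dsform (fps_lin u v) (fps_lin u' v') = fps_lin (a0 * u' - a1 * u) (a0 * v' - a1 * v)"
  unfolding dsform_def by (intro fps_ext) (simp add: fps_lin_nth)

text \<open>Two curves provide all partial fractions. The curve \<open>(b - p a) - T a\<close>
  starts at the puncture \<open>p\<close> and pairs with \<open>sg x\<close> to
  \<open>(x - p) - T\<close>, whose inverse generates the powers of \<open>1 / (x - p)\<close>. The
  curve \<open>a - T b\<close> starts at infinity and pairs to \<open>1 - x T\<close>, whose inverse
  generates the powers of \<open>x\<close>. The constant curve \<open>a\<close> has trace 0 and
  serves to balance weights.\<close>

lemma
  shows sform_pole: "sform (fps_lin (b0 - p * a0) (- a0)) (fps_lin (b1 - p * a1) (- a1)) x = fps_lin (x - p) (-1)"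
    and dsform_pole: "dsform (fps_lin (b0 - p * a0) (- a0)) (fps_lin (b1 - p * a1) (- a1)) = fps_lin 1 0"
    and sform_inf: "sform (fps_lin a0 (- b0)) (fps_lin a1 (- b1)) x = fps_lin 1 (- x)"
    and dsform_inf: "dsform (fps_lin a0 (- b0)) (fps_lin a1 (- b1)) = fps_lin 0 (-1)"
    and dsform_const: "dsform (fps_lin a0 0) (fps_lin a1 0) = 0"
proof -
  have 1: "(b1 - x * a1) * (- a0) + (x * a0 - b0) * (- a1) = -1"
    using sg_form(2)[of x] by (simp add: algebra_simps)
  have 2: "(b1 - x * a1) * (- b0) + (x * a0 - b0) * (- b1) = - x"
    using sg_form(1)[of x 0] by (simp add: algebra_simps)
  have 3: "a0 * (b1 - p * a1) - a1 * (b0 - p * a0) = 1" "a0 * (- a1) - a1 * (- a0) = 0"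
    "a0 * a1 - a1 * a0 = 0" "a0 * (- b1) - a1 * (- b0) = -1"
    using ab by (simp_all add: algebra_simps)
  show "sform (fps_lin (b0 - p * a0) (- a0)) (fps_lin (b1 - p * a1) (- a1)) x = fps_lin (x - p) (-1)"
    unfolding sform_lin sg_form(1) 1 ..
  show "sform (fps_lin a0 (- b0)) (fps_lin a1 (- b1)) x = fps_lin 1 (- x)"
    unfolding sform_lin sg_form(2) 2 ..
  show "dsform (fps_lin (b0 - p * a0) (- a0)) (fps_lin (b1 - p * a1) (- a1)) = fps_lin 1 0"
    unfolding dsform_lin 3 ..
  show "dsform (fps_lin a0 (- b0)) (fps_lin a1 (- b1)) = fps_lin 0 (-1)"
    unfolding dsform_lin 3 ..
  show "dsform (fps_lin a0 0) (fps_lin a1 0) = 0"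
    unfolding dsform_lin 3 by (intro fps_ext) (simp add: fps_lin_nth)
qed

lemma avoids_pole: "p \<in> P \<Longrightarrow> avoids r (fps_lin (b0 - p * a0) v) (fps_lin (b1 - p * a1) v')"
  by (simp add: avoids_def fps_lin_nth V_def)

lemma avoids_inf: "avoids r (fps_lin a0 v) (fps_lin a1 v')"
  by (simp add: avoids_def fps_lin_nth V_def)

theorem ex_traces:
  assumes "rational h"
  shows "\<exists>\<psi>. traces r h \<psi>"
  using rational_imp_pfrac[OF assms]
proof induction
  case (pow n)
  \<comment> \<open>The series is \<open>- T / (1 - x T)\<close>, with coefficient
    \<open>- x ^ n\<close> at order \<open>Suc n\<close>; hence this order and the weight
    \<open>- 1\<close>.\<close>
  have "\<exists>\<psi>. traces r (\<lambda>x. \<Sum>k\<in>{0::nat}. - 1 * fps_nth (dsform (fps_lin a0 (- b0)) (fps_lin a1 (- b1)) *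
      inverse (sform (fps_lin a0 (- b0)) (fps_lin a1 (- b1)) x)) (Suc n)) \<psi>"
    by (rule exI, rule traces_dlog) (auto simp: avoids_inf)
  then obtain \<psi> where "traces r (\<lambda>x. \<Sum>k\<in>{0::nat}. - 1 * fps_nth (dsform (fps_lin a0 (- b0)) (fps_lin a1 (- b1)) *
      inverse (sform (fps_lin a0 (- b0)) (fps_lin a1 (- b1)) x)) (Suc n)) \<psi>" ..
  then have "traces r (\<lambda>x. x ^ n) \<psi>"
    by (rule traces_cong) (simp add: dsform_inf sform_inf inverse_fps_lin fps_lin_mult_nth)
  then show ?case by blast
next
  case (pole p n)
  \<comment> \<open>The curve with index 1 is constant at \<open>a\<close> and does not change the
    trace. For a simple pole, \<open>n = 0\<close>, it has weight \<open>- 1\<close> and makes the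
    weights at order zero sum to 0; for \<open>n > 0\<close> its weight is 0.\<close>
  let ?c0 = "\<lambda>k :: nat. if k = 0 then fps_lin (b0 - p * a0) (- a0) else fps_lin a0 0"
  let ?c1 = "\<lambda>k :: nat. if k = 0 then fps_lin (b1 - p * a1) (- a1) else fps_lin a1 0"
  let ?n = "\<lambda>k :: nat. if k = 0 then n else 0"
  let ?\<alpha> = "\<lambda>k :: nat. if k = 0 then 1 else if n = 0 then - 1 else (0 :: complex)"
  let ?f = "\<lambda>x. \<Sum>k\<in>{0, 1}. ?\<alpha> k * fps_nth (dsform (?c0 k) (?c1 k) * inverse (sform (?c0 k) (?c1 k) x)) (?n k)"
  have "{k \<in> {0, 1}. ?n k = 0} = (if n = 0 then {0, 1} else {1})" by auto
  then have bal: "(\<Sum>k\<in>{k \<in> {0, 1}. ?n k = 0}. ?\<alpha> k) = 0" by (simp del: mem_Collect_eq)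
  have "\<exists>\<psi>. traces r ?f \<psi>"
    by (rule exI, rule traces_dlog[OF _ _ bal]) (use pole in \<open>auto simp: avoids_inf avoids_pole\<close>)
  then obtain \<psi> where "traces r ?f \<psi>" ..
  then have "traces r (\<lambda>x. 1 / (x - p) ^ Suc n) \<psi>"
  proof (rule traces_cong)
    fix x assume "x \<notin> P"
    then have "x - p \<noteq> 0" using pole by auto
    then show "?f x = 1 / (x - p) ^ Suc n"
      by (simp add: dsform_const dsform_pole sform_pole inverse_fps_lin fps_lin_mult_nth)
  qed
  then show ?case by blast
next
  case (lin f g a b)
  then show ?case using traces_lincomb by blast
next
  case (ext_off f g)
  then show ?case using traces_cong by blast
qed

text \<open>The same two curves, now with the logarithmic derivative in \<open>T\<close>, give
  Newton's power sums of the \<open>t q\<close> and of the \<open>1 / (t q - p)\<close> up to sign.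
  Only the constant function, with trace \<open>r\<close>, has to be treated separately.\<close>

theorem ex_fun_traces:
  assumes "rational h"
  shows "\<exists>\<theta>. fun_traces r h \<theta>"
  using rational_imp_pfrac[OF assms]
proof induction
  case (pow n)
  show ?case
  proof (cases n)
    case 0
    have "form_on (r + 1) (V r) 0 (\<lambda>y vs. of_nat r) \<in> Omega (r + 1) (V r) 0"
      by (rule form0_Omega[OF open_cone_V regular_const]) simp
    then have "fun_traces r (\<lambda>x. x ^ n) (form_on (r + 1) (V r) 0 (\<lambda>y vs. of_nat r))"
      unfolding fun_traces_def using pt_in_V 0 by (auto simp: form_on_def)
    then show ?thesis by blast
  next
    case (Suc m)
    from fun_traces_dlog[OF avoids_inf, of r "- b0" "- b1" m] obtain \<theta> where
      \<theta>: "fun_traces r (\<lambda>x. fps_nth (fps_deriv (sform (fps_lin a0 (- b0)) (fps_lin a1 (- b1)) x) *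
        inverse (sform (fps_lin a0 (- b0)) (fps_lin a1 (- b1)) x)) m) \<theta>" by blast
    have "fun_traces r (\<lambda>x. x ^ n) (\<lambda>y vs. (- 1) * \<theta> y vs + 0 * \<theta> y vs)"
    proof (rule fun_traces_cong[OF fun_traces_lincomb[OF \<theta> \<theta>, of "- 1" 0]])
      fix x
      have "fps_deriv (fps_lin 1 (- x)) = fps_lin (- x) 0" by (intro fps_ext) (simp add: fps_lin_nth)
      then show "- 1 * fps_nth (fps_deriv (sform (fps_lin a0 (- b0)) (fps_lin a1 (- b1)) x) *
        inverse (sform (fps_lin a0 (- b0)) (fps_lin a1 (- b1)) x)) m +
        0 * fps_nth (fps_deriv (sform (fps_lin a0 (- b0)) (fps_lin a1 (- b1)) x) *
        inverse (sform (fps_lin a0 (- b0)) (fps_lin a1 (- b1)) x)) m = x ^ n"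
        using Suc by (simp add: sform_inf inverse_fps_lin fps_lin_mult_nth)
    qed
    then show ?thesis by blast
  qed
next
  case (pole p n)
  let ?s = "sform (fps_lin (b0 - p * a0) (- a0)) (fps_lin (b1 - p * a1) (- a1))"
  from fun_traces_dlog[OF avoids_pole[OF pole], of r "- a0" "- a1" n] obtain \<theta> where
    \<theta>: "fun_traces r (\<lambda>x. fps_nth (fps_deriv (?s x) * inverse (?s x)) n) \<theta>" by blast
  have "fun_traces r (\<lambda>x. 1 / (x - p) ^ Suc n) (\<lambda>y vs. (- 1) * \<theta> y vs + 0 * \<theta> y vs)"
  proof (rule fun_traces_cong[OF fun_traces_lincomb[OF \<theta> \<theta>, of "- 1" 0]])
    fix x assume "x \<notin> P"
    then have "x - p \<noteq> 0" using pole by auto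
    moreover have "fps_deriv (fps_lin (x - p) (- 1)) = fps_lin (- 1) 0" by (intro fps_ext) (simp add: fps_lin_nth)
    ultimately show "- 1 * fps_nth (fps_deriv (?s x) * inverse (?s x)) n +
        0 * fps_nth (fps_deriv (?s x) * inverse (?s x)) n = 1 / (x - p) ^ Suc n"
      by (simp add: sform_pole inverse_fps_lin fps_lin_mult_nth)
  qed
  then show ?case by blast
next
  case (lin f g a b)
  then show ?case using fun_traces_lincomb by blast
next
  case (ext_off f g)
  then show ?case using fun_traces_cong by blast
qed

end

section \<open>The top cohomology of the symmetric product\<close>

text \<open>Logarithmic derivative of \<open>\<Prod>j. 1 + s u_j\<close> at \<open>s = 0\<close>, applied to the columns of a determinant.\<close>
lemma sum_det_scaled_rows:
  fixes a :: "nat \<Rightarrow> nat \<Rightarrow> complex"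
  shows "(\<Sum>k<m. det (mat m m (\<lambda>(i, j). if i = k then u j * a i j else a i j))) =
    (\<Sum>j<m. u j) * det (mat m m (\<lambda>(i, j). a i j))"
proof -
  let ?S = "{\<pi>. \<pi> permutes {0..<m}}"
  let ?t = "\<lambda>\<pi>. signof \<pi> * (\<Prod>i = 0..<m. a i (\<pi> i))"
  have lt: "\<pi> i < m" if "\<pi> \<in> ?S" "i < m" for \<pi> i using that permutes_in_image[of \<pi> "{0..<m}" i] by auto
  have "det (mat m m (\<lambda>(i, j). if i = k then u j * a i j else a i j)) = (\<Sum>\<pi>\<in>?S. u (\<pi> k) * ?t \<pi>)"
    if k: "k < m" for k
    unfolding det_def'[OF mat_carrier]
  proof (intro sum.cong refl)
    fix \<pi> assume \<pi>: "\<pi> \<in> ?S"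
    have "(\<Prod>i = 0..<m. mat m m (\<lambda>(i, j). if i = k then u j * a i j else a i j) $$ (i, \<pi> i)) =
      (\<Prod>i = 0..<m. (if i = k then u (\<pi> k) else 1) * a i (\<pi> i))"
      using lt[OF \<pi>] by (intro prod.cong) auto
    also have "\<dots> = u (\<pi> k) * (\<Prod>i = 0..<m. a i (\<pi> i))"
      unfolding prod.distrib using k by (simp add: prod.delta)
    finally show "signof \<pi> * (\<Prod>i = 0..<m. mat m m (\<lambda>(i, j). if i = k then u j * a i j else a i j) $$ (i, \<pi> i)) =
      u (\<pi> k) * ?t \<pi>" by simp
  qed
  then have "(\<Sum>k<m. det (mat m m (\<lambda>(i, j). if i = k then u j * a i j else a i j))) =
    (\<Sum>k<m. \<Sum>\<pi>\<in>?S. u (\<pi> k) * ?t \<pi>)" by (intro sum.cong refl) simp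
  also have "\<dots> = (\<Sum>\<pi>\<in>?S. \<Sum>k<m. u (\<pi> k) * ?t \<pi>)" by (rule sum.swap)
  also have "\<dots> = (\<Sum>\<pi>\<in>?S. (\<Sum>j<m. u j) * ?t \<pi>)"
  proof (intro sum.cong refl)
    fix \<pi> assume \<pi>: "\<pi> \<in> ?S"
    have "(\<Sum>j<m. u j) = (\<Sum>k<m. u (\<pi> k))"
      using \<pi> sum.permute[of \<pi> "{..<m}" u] by (simp add: atLeast0LessThan o_def)
    then show "(\<Sum>k<m. u (\<pi> k) * ?t \<pi>) = (\<Sum>j<m. u j) * ?t \<pi>"
      unfolding sum_distrib_right[symmetric] by simp
  qed
  also have "\<dots> = (\<Sum>j<m. u j) * det (mat m m (\<lambda>(i, j). a i j))"
    unfolding det_def'[OF mat_carrier] sum_distrib_left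
    by (intro sum.cong refl arg_cong2[of _ _ _ _ "(*)"] prod.cong) (use lt in auto)
  finally show ?thesis .
qed

lemma Omega_mult0:
  assumes \<theta>: "\<theta> \<in> Omega n U 0" and \<eta>: "\<eta> \<in> Omega n U p"
  shows "(\<lambda>y vs. \<theta> y [] * \<eta> y vs) \<in> Omega n U p"
proof (rule OmegaI)
  fix y :: "complex vec" and vs :: "complex vec list"
  show "\<theta> y [] * \<eta> y vs = 0" if "\<not> (y \<in> U \<and> length vs = p \<and> set vs \<subseteq> carrier_vec n)"
    using Omega_form[OF \<eta> that] by simp
  show "\<theta> y [] * \<eta> y vs = 0" if "y \<in> U" "length vs = p" "set vs \<subseteq> carrier_vec n" "y \<in> set vs"
    using Omega_radial[OF \<eta> that] by simp
  show "regular_on n U (\<lambda>y. \<theta> y [] * \<eta> y vs)" if "length vs = p" "set vs \<subseteq> carrier_vec n"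
    using Omega_regular[OF \<eta> that] Omega_regular[OF \<theta>, of "[]"] by (simp add: regular_mult)
  show "\<theta> (c \<cdot>\<^sub>v y) [] * \<eta> (c \<cdot>\<^sub>v y) (map (\<lambda>v. c \<cdot>\<^sub>v v) vs) = \<theta> y [] * \<eta> y vs"
    if "y \<in> U" "length vs = p" "set vs \<subseteq> carrier_vec n" "c \<noteq> 0" for c
    using Omega_scale[OF \<eta> that] Omega_scale[OF \<theta> that(1), of "[]" c] that by simp
  show "alternating n p (\<lambda>vs. \<theta> y [] * \<eta> y vs)" if "y \<in> U"
    using Omega_alternating[OF \<eta> that] unfolding alternating_def by (simp add: algebra_simps)
qed

definition det_fun :: "nat \<Rightarrow> (nat \<Rightarrow> complex \<Rightarrow> complex) \<Rightarrow> (nat \<Rightarrow> complex) \<Rightarrow> complex" where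
  "det_fun r h t = det (mat r r (\<lambda>(i, j). h i (t j)))"

lemma det_fun_linear:
  assumes k: "k < r" and eq: "\<And>j. j < r \<Longrightarrow> g (t j) = a * g1 (t j) + b * g2 (t j)"
  shows "det_fun r (h(k := g)) t = a * det_fun r (h(k := g1)) t + b * det_fun r (h(k := g2)) t"
proof -
  let ?A = "\<lambda>g. mat r r (\<lambda>(i, j). (h(k := g)) i (t j))"
  have A: "?A g \<in> carrier_mat r r" for g by simp
  have cof: "cofactor (?A g) k j = cofactor (?A g1) k j" if "j < r" for g g1 j
  proof -
    have "mat_delete (?A g) k j = mat_delete (?A g1) k j"
      unfolding mat_delete_def by (rule eq_matI) (auto simp: that)
    then show ?thesis by (simp add: cofactor_def)
  qed
  have L: "det (?A g') = (\<Sum>j<r. g' (t j) * cofactor (?A g) k j)" for g'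
    unfolding laplace_expansion_row[OF A k]
  proof (intro sum.cong refl)
    fix j assume "j \<in> {..<r}"
    then show "?A g' $$ (k, j) * cofactor (?A g') k j = g' (t j) * cofactor (?A g) k j"
      using k cof[of j g' g] by simp
  qed
  show ?thesis unfolding det_fun_def L
    by (simp add: eq sum_distrib_left sum.distrib[symmetric] algebra_simps)
qed

lemma det_fun_cong: "(\<And>i j. i < r \<Longrightarrow> j < r \<Longrightarrow> h i (t j) = h' i (t j)) \<Longrightarrow> det_fun r h t = det_fun r h' t"
  unfolding det_fun_def by (intro arg_cong[of _ _ det] eq_matI) auto

lemma det_fun_permute:
  assumes "\<pi> permutes {..<r}"
  shows "det_fun r (\<lambda>i. h (\<pi> i)) t = of_int (sign \<pi>) * det_fun r h t"
proof -
  have \<pi>: "\<pi> permutes {0..<r}" using assms by (simp add: atLeast0LessThan)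
  have "mat r r (\<lambda>(i, j). h (\<pi> i) (t j)) = mat r r (\<lambda>(i, j). mat r r (\<lambda>(i, j). h i (t j)) $$ (\<pi> i, j))"
    using permutes_in_image[OF \<pi>] by (intro eq_matI) auto
  then show ?thesis
    unfolding det_fun_def using det_permute_rows[OF mat_carrier \<pi>] by simp
qed

context punctured_line
begin

lemma rat_lincomb: "rat d D f \<Longrightarrow> rat d D g \<Longrightarrow> rat d D (\<lambda>x. a * f x + b * g x)"
  by (intro rat_add rat_cmult)

lemma rational_lincomb:
  assumes "rational f" "rational g"
  shows "rational (\<lambda>x. a * f x + b * g x)"
proof -
  obtain d D d' D' where "rat d D f" "rat d' D' g" using assms unfolding rational_def by blast
  then have "rat (d + d' + (D + D') * card P) (D + D') (\<lambda>x. a * f x + b * g x)"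
    by (intro rat_lincomb rat_common rat_common')
  then show ?thesis unfolding rational_def by blast
qed

lemma rational_mult: "rational f \<Longrightarrow> rational g \<Longrightarrow> rational (\<lambda>x. f x * g x)"
  unfolding rational_def using rat_mult by blast

lemma rational_zero: "rational (\<lambda>x. 0)"
  unfolding rational_def using rat_const by blast

lemma rational_sum:
  "(\<And>i. i \<in> I \<Longrightarrow> rational (f i)) \<Longrightarrow> rational (\<lambda>x. \<Sum>i\<in>I. c i * f i x)"
proof (induction I rule: infinite_finite_induct)
  case (insert i I)
  then show ?case using rational_lincomb[of "f i" "\<lambda>x. \<Sum>i\<in>I. c i * f i x" "c i" 1] by simp
qed (simp_all add: rational_zero)

lemma rational_field_derivative:
  "rational g \<Longrightarrow> x \<notin> P \<Longrightarrow> (g has_field_derivative deriv g x) (at x)"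
  unfolding rational_def using rat_derivative DERIV_imp_deriv by metis

lemma ex_regpt: "\<exists>t. regpt r t"
proof -
  obtain X where "nodes 0 X" using ex_nodes by blast
  then obtain x where "x \<in> X" "X \<inter> P = {}" by (auto simp: nodes_def card_Suc_eq)
  then show ?thesis by (intro exI[of _ "\<lambda>_. x"]) (auto simp: regpt_def)
qed

text \<open>All variables but the first are frozen at a regular point; the value on
  \<open>tg r t 0\<close> is then a rational function of the first.\<close>

lemma traces_rational:
  assumes \<psi>: "traces r f \<psi>" and r: "0 < r"
  shows "rational f"
proof -
  have "\<exists>d D. sep_rat r d D (\<lambda>t. \<psi> (pt r t) (map ((\<lambda>t i. tg r t 0) t) [0..<1]))"
    by (intro sep_rat_form traces_Omega[OF \<psi>] sep_poly_tg) simp_all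
  then obtain d D where *: "sep_rat r d D (\<lambda>t. \<psi> (pt r t) [tg r t 0])" by auto
  obtain t where t: "regpt r t" using ex_regpt by blast
  have "rat d D f"
    by (rule rat_cong[OF *[unfolded sep_rat_def, rule_format, OF t r]])
      (use traces_tg[OF \<psi> regpt_upd[OF t] r] in simp)
  then show ?thesis unfolding rational_def by blast
qed

lemma wedge_list_tgs:
  assumes t: "regpt r t" and q: "\<And>j. j < length \<chi>s \<Longrightarrow> q j < r"
    and \<chi>s: "\<And>k. k < length \<chi>s \<Longrightarrow> traces r (h k) (\<chi>s ! k)"
  shows "wedge_list (r + 1) (V r) \<chi>s (pt r t) (map (\<lambda>j. tg r t (q j)) [0..<length \<chi>s]) =
    det_fun (length \<chi>s) h (\<lambda>j. t (q j))"
proof -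
  have "wedge_list (r + 1) (V r) \<chi>s (pt r t) (map (\<lambda>j. tg r t (q j)) [0..<length \<chi>s]) =
      det (mat (length \<chi>s) (length \<chi>s) (\<lambda>(i, j). (\<chi>s ! i) (pt r t) [map (\<lambda>j. tg r t (q j)) [0..<length \<chi>s] ! j]))"
    by (rule wedge_list_eq_det[OF pt_in_V[OF t]]) auto
  also have "\<dots> = det_fun (length \<chi>s) h (\<lambda>j. t (q j))"
    unfolding det_fun_def
    by (intro arg_cong[of _ _ det] eq_matI) (use traces_tg[OF \<chi>s t q] in auto)
  finally show ?thesis .
qed

definition nab :: "(complex \<Rightarrow> complex) \<Rightarrow> (complex \<Rightarrow> complex) \<Rightarrow> complex \<Rightarrow> complex" where
  "nab w g x = deriv g x + w x * g x"

lemma omit_tgs: "p < Suc m \<Longrightarrow> omit p (tgs (Suc m) t) = map (\<lambda>j. tg (Suc m) t (if j < p then j else Suc j)) [0..<m]"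
  by (intro nth_equalityI) (auto simp: length_omit nth_omit simp del: upt_Suc)

text \<open>
  With \<open>T\<close> denoting a form or function of given trace and \<open>h 0, ..., h (m - 1)\<close> the rows other than \<open>s\<close>, take
  \<open>\<beta> = (-1)^s (T(g) T(h 0) \<and> ... \<and> T(h (m - 1)) - \<Sum>_k T(h 0) \<and> ... \<and> T(g h k) \<and> ... \<and> T(h (m - 1)))\<close>.
  On the tangent vectors other than the \<open>p\<close>-th it takes the value
  \<open>(-1)^s g (t p)\<close> times a minor that does not depend on \<open>t p\<close>.
\<close>
lemma coboundary_exists:
  assumes r: "r = Suc m" and \<omega>: "traces r w \<omega>" and g: "rational g" and s: "s < r"
    and h: "\<And>k. k < r \<Longrightarrow> rational (h k)"
  shows "\<exists>\<beta>\<in>Omega (r + 1) (V r) m. \<forall>t. regpt r t \<longrightarrow>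
    nabla (r + 1) (V r) \<omega> \<beta> (pt r t) (tgs r t) = det_fun r (h(s := nab w g)) t"
proof -
  define h' where "h' k = h (if k < s then k else Suc k)" for k
  have h': "rational (h' k)" "rational (\<lambda>x. g x * h' k x)" if "k < m" for k
    using that r by (auto simp: h'_def intro!: h rational_mult g)
  obtain \<theta> where \<theta>: "fun_traces r g \<theta>" using ex_fun_traces[OF g] by blast
  have "\<forall>k. \<exists>\<chi>. k < m \<longrightarrow> traces r (h' k) \<chi>" using ex_traces h' by blast
  then obtain \<chi> where \<chi>: "\<And>k. k < m \<Longrightarrow> traces r (h' k) (\<chi> k)" by metis
  have "\<forall>k. \<exists>\<chi>. k < m \<longrightarrow> traces r (\<lambda>x. g x * h' k x) \<chi>" using ex_traces h' by blast
  then obtain \<chi>' where \<chi>': "\<And>k. k < m \<Longrightarrow> traces r (\<lambda>x. g x * h' k x) (\<chi>' k)" by metis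
  let ?W = "\<lambda>\<chi>. wedge_list (r + 1) (V r) (map \<chi> [0..<m])"
  have W: "?W \<xi> \<in> Omega (r + 1) (V r) m" if "\<And>k. k < m \<Longrightarrow> traces r (u k) (\<xi> k)" for u \<xi>
    using wedge_list_Omega[OF open_cone_V, of "map \<xi> [0..<m]" r] that traces_Omega by fastforce
  let ?q = "\<lambda>p j. if j < p then j else Suc j"
  have Wt: "?W \<xi> (pt r t) (omit p (tgs r t)) = det_fun m u (\<lambda>j. t (?q p j))"
    if "\<And>k. k < m \<Longrightarrow> traces r (u k) (\<xi> k)" "regpt r t" "p < r" for u \<xi> t p
    using wedge_list_tgs[OF that(2), of "map \<xi> [0..<m]" "?q p" u] that(1,3) r
    by (simp add: omit_tgs del: upt_Suc)
  have \<chi>k: "traces r ((h'(k := \<lambda>x. g x * h' k x)) i) ((\<chi>(k := \<chi>' k)) i)" if "k < m" "i < m" for k i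
    using \<chi> \<chi>' that by auto
  define \<beta> where "\<beta> = (\<lambda>y vs. (-1) ^ s * (\<theta> y [] * ?W \<chi> y vs) + (- ((-1) ^ s)) *
    (\<Sum>k\<in>{..<m}. 1 * ?W (\<chi>(k := \<chi>' k)) y vs))"
  have \<beta>: "\<beta> \<in> Omega (r + 1) (V r) m"
    unfolding \<beta>_def
  proof (intro Omega_lincomb Omega_mult0 Omega_sum)
    show "\<theta> \<in> Omega (r + 1) (V r) 0" using \<theta> by (simp add: fun_traces_def)
    show "?W \<chi> \<in> Omega (r + 1) (V r) m" using \<chi> by (rule W)
    show "?W (\<chi>(k := \<chi>' k)) \<in> Omega (r + 1) (V r) m" if "k \<in> {..<m}" for k
      using that by (intro W[OF \<chi>k]) auto
  qed
  \<comment> \<open>The trace of \<open>g\<close> gives the sum of \<open>g (t q)\<close> over all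
    \<open>q\<close>. By \<open>sum_det_scaled_rows\<close> the wedge products with one modified
    factor give the sum over \<open>q \<noteq> p\<close>, so that only \<open>g (t p)\<close>
    remains.\<close>
  have val: "\<beta> (pt r t) (omit p (tgs r t)) = (-1) ^ s * (g (t p) * det_fun m h' (\<lambda>j. t (?q p j)))"
    if t: "regpt r t" and p: "p < r" for t p
  proof -
    let ?u = "\<lambda>j. g (t (?q p j))"
    have "(\<Sum>k<m. ?W (\<chi>(k := \<chi>' k)) (pt r t) (omit p (tgs r t))) =
      (\<Sum>k<m. det (mat m m (\<lambda>(i, j). if i = k then ?u j * h' i (t (?q p j)) else h' i (t (?q p j)))))"
    proof (intro sum.cong refl)
      fix k assume "k \<in> {..<m}"
      then have "?W (\<chi>(k := \<chi>' k)) (pt r t) (omit p (tgs r t)) =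
          det_fun m (h'(k := \<lambda>x. g x * h' k x)) (\<lambda>j. t (?q p j))"
        by (intro Wt[OF \<chi>k] t p) auto
      also have "\<dots> = det (mat m m (\<lambda>(i, j). if i = k then ?u j * h' i (t (?q p j)) else h' i (t (?q p j))))"
        unfolding det_fun_def by (intro arg_cong[of _ _ det] eq_matI) auto
      finally show "?W (\<chi>(k := \<chi>' k)) (pt r t) (omit p (tgs r t)) =
        det (mat m m (\<lambda>(i, j). if i = k then ?u j * h' i (t (?q p j)) else h' i (t (?q p j))))" .
    qed
    also have "\<dots> = (\<Sum>j<m. ?u j) * det_fun m h' (\<lambda>j. t (?q p j))"
      unfolding det_fun_def by (rule sum_det_scaled_rows)
    also have "(\<Sum>j<m. ?u j) = (\<Sum>q\<in>{..<r} - {p}. g (t q))"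
      using sum_skip[of p m "\<lambda>q. g (t q)"] p r by simp
    finally have 1: "(\<Sum>k<m. ?W (\<chi>(k := \<chi>' k)) (pt r t) (omit p (tgs r t))) =
      (\<Sum>q\<in>{..<r} - {p}. g (t q)) * det_fun m h' (\<lambda>j. t (?q p j))" .
    have 2: "\<theta> (pt r t) [] = g (t p) + (\<Sum>q\<in>{..<r} - {p}. g (t q))"
      using \<theta> t p by (simp add: fun_traces_def sum.remove[of "{..<r}" p])
    have 3: "?W \<chi> (pt r t) (omit p (tgs r t)) = det_fun m h' (\<lambda>j. t (?q p j))"
      by (intro Wt[OF \<chi>] t p)
    show ?thesis unfolding \<beta>_def by (simp only: 1 2 3 mult_1) (simp only: algebra_simps, simp)
  qed
  have "nabla (r + 1) (V r) \<omega> \<beta> (pt r t) (tgs r t) = det_fun r (h(s := nab w g)) t" if t: "regpt r t" for t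
  proof -
    obtain D where D: "\<And>p. p < r \<Longrightarrow> ((\<lambda>x. \<beta> (pt r (t(p := x))) (omit p (tgs r (t(p := x))))) has_field_derivative D p) (at (t p))"
      and nb: "nabla (r + 1) (V r) \<omega> \<beta> (pt r t) (tgs r t) =
        (\<Sum>p<r. (-1) ^ p * (D p + w (t p) * \<beta> (pt r t) (omit p (tgs r t))))"
      using nabla_pullback[OF r \<beta> \<omega> t] by blast
    let ?M = "\<lambda>p. det_fun m h' (\<lambda>j. t (?q p j))"
    have Dp: "D p = (-1) ^ s * (deriv g (t p) * ?M p)" if p: "p < r" for p
    proof -
      have tp: "t p \<notin> P" using t p by (simp add: regpt_def)
      have M: "det_fun m h' (\<lambda>j. (t(p := x)) (?q p j)) = ?M p" for x
        by (intro arg_cong[of _ _ "det_fun m h'"] ext) auto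
      have "open (- P)" by (intro open_Compl finite_imp_closed finite_P)
      then have "\<forall>\<^sub>F x in nhds (t p). x \<in> - P" using tp by (intro eventually_nhds_in_open) auto
      then have ev: "\<forall>\<^sub>F x in nhds (t p). \<beta> (pt r (t(p := x))) (omit p (tgs r (t(p := x)))) =
          (-1) ^ s * (g x * ?M p)"
        by eventually_elim (use val[OF regpt_upd[OF t] p] M in simp)
      have "((\<lambda>x. (-1) ^ s * (g x * ?M p)) has_field_derivative (-1) ^ s * (deriv g (t p) * ?M p)) (at (t p))"
        by (intro DERIV_cmult DERIV_cmult_right rational_field_derivative g tp)
      then have "((\<lambda>x. \<beta> (pt r (t(p := x))) (omit p (tgs r (t(p := x))))) has_field_derivative
          (-1) ^ s * (deriv g (t p) * ?M p)) (at (t p))"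
        by (subst DERIV_cong_ev[OF refl ev refl])
      from DERIV_unique[OF D[OF p] this] show ?thesis .
    qed
    let ?A = "mat r r (\<lambda>(i, j). (h(s := nab w g)) i (t j))"
    \<comment> \<open>In the Laplace expansion along row \<open>s\<close>, the sign
      \<open>(-1) ^ s\<close> built into \<open>\<beta>\<close> is the row part of the cofactor
      sign, and the column part is the sign of the omitted vector in \<open>nabla\<close>.\<close>
    have "det ?A = (\<Sum>p<r. ?A $$ (s, p) * cofactor ?A s p)"
      by (rule laplace_expansion_row) (use s in auto)
    also have "\<dots> = (\<Sum>p<r. (-1) ^ p * (D p + w (t p) * \<beta> (pt r t) (omit p (tgs r t))))"
    proof (intro sum.cong refl)
      fix p assume "p \<in> {..<r}"
      then have p: "p < r" by simp
      have "mat_delete ?A s p = mat m m (\<lambda>(i, j). h' i (t (?q p j)))"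
        by (rule eq_matI) (use r p s in \<open>auto simp: mat_delete_def h'_def\<close>)
      then have "cofactor ?A s p = (-1) ^ (s + p) * ?M p" by (simp add: cofactor_def det_fun_def)
      then show "?A $$ (s, p) * cofactor ?A s p = (-1) ^ p * (D p + w (t p) * \<beta> (pt r t) (omit p (tgs r t)))"
        using p s unfolding Dp[OF p] val[OF t p] by (simp add: nab_def power_add algebra_simps)
    qed
    finally show ?thesis unfolding nb det_fun_def by simp
  qed
  then show ?thesis using \<beta> by blast
qed

end

section \<open>Determinants and increasing index lists\<close>

lemma finite_sorted_lists:
  "finite J \<Longrightarrow> finite {js :: nat list. length js = r \<and> sorted_wrt (<) js \<and> set js \<subseteq> J}"
  by (rule finite_subset[OF _ finite_lists_length_eq[of J r]]) auto

text \<open>This makes the pairing of determinants with products of dual functionals diagonal: among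
  all permutations only the identity contributes, and only if the lists agree.\<close>

lemma sorted_lists_permutation_unique:
  fixes js ks :: "nat list"
  assumes js: "length js = r" "sorted_wrt (<) js" and ks: "length ks = r" "sorted_wrt (<) ks"
    and \<pi>: "\<pi> permutes {0..<r}" and eq: "\<And>j. j < r \<Longrightarrow> js ! \<pi> j = ks ! j"
  shows "js = ks \<and> \<pi> = id"
proof -
  have lt: "\<pi> j < r" if "j < r" for j using permutes_in_image[OF \<pi>, of j] that by simp
  have sd: "sorted js" "distinct js" "sorted ks" "distinct ks"
    using js ks by (simp_all add: strict_sorted_iff)
  have "set ks \<subseteq> set js"
  proof
    fix x assume "x \<in> set ks"
    then obtain j where j: "j < r" "x = ks ! j" using ks by (metis in_set_conv_nth)
    then have "x = js ! \<pi> j" using eq by simp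
    then show "x \<in> set js" using lt[OF j(1)] js by simp
  qed
  moreover have "card (set ks) = card (set js)" using sd js ks by (simp add: distinct_card)
  ultimately have "set ks = set js" by (intro card_subset_eq) auto
  then have e: "js = ks" using sd by (metis sorted_distinct_set_unique)
  have "\<pi> j = j" for j
  proof (cases "j < r")
    case True
    then show ?thesis using eq[OF True] lt[OF True] e sd(2) js by (simp add: nth_eq_iff_index_eq)
  next
    case False
    then show ?thesis using \<pi> by (simp add: permutes_def)
  qed
  then show ?thesis using e by auto
qed

lemma det_fun_eq_sum:
  "det_fun r h t = (\<Sum>\<pi> | \<pi> permutes {0..<r}. of_int (sign \<pi>) * (\<Prod>j<r. h (\<pi> j) (t j)))"
proof -
  have "det_fun r h t = (\<Sum>\<pi> | \<pi> permutes {0..<r}. signof \<pi> * (\<Prod>j<r. mat r r (\<lambda>(i, j). h i (t j)) $$ (\<pi> j, j)))"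
    unfolding det_fun_def by (rule det_col) simp
  also have "\<dots> = (\<Sum>\<pi> | \<pi> permutes {0..<r}. of_int (sign \<pi>) * (\<Prod>j<r. h (\<pi> j) (t j)))"
  proof (intro sum.cong refl arg_cong2[of _ _ _ _ "(*)"])
    fix \<pi> assume "\<pi> \<in> {\<pi>. \<pi> permutes {0..<r}}"
    then have "\<pi> j < r" if "j < r" for j using that permutes_in_image[of \<pi> "{0..<r}" j] by simp
    then show "(\<Prod>j<r. mat r r (\<lambda>(i, j). h i (t j)) $$ (\<pi> j, j)) = (\<Prod>j<r. h (\<pi> j) (t j))"
      by (intro prod.cong) auto
  qed
  finally show ?thesis .
qed

text \<open>Here the permutation acts on the variables rather than on the functions, which is the
  shape produced by antisymmetrizing a product of one-variable functions.\<close>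

lemma det_fun_eq_sum':
  "det_fun r h t = (\<Sum>\<pi> | \<pi> permutes {0..<r}. of_int (sign \<pi>) * (\<Prod>i<r. h i (t (\<pi> i))))"
proof -
  have "det_fun r h t = (\<Sum>\<pi> | \<pi> permutes {0..<r}. signof \<pi> * (\<Prod>i = 0..<r. mat r r (\<lambda>(i, j). h i (t j)) $$ (i, \<pi> i)))"
    unfolding det_fun_def by (rule det_def'[OF mat_carrier])
  also have "\<dots> = (\<Sum>\<pi> | \<pi> permutes {0..<r}. of_int (sign \<pi>) * (\<Prod>i<r. h i (t (\<pi> i))))"
  proof (intro sum.cong refl arg_cong2[of _ _ _ _ "(*)"])
    fix \<pi> assume "\<pi> \<in> {\<pi>. \<pi> permutes {0..<r}}"
    then have "\<pi> j < r" if "j < r" for j using that permutes_in_image[of \<pi> "{0..<r}" j] by simp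
    then show "(\<Prod>i = 0..<r. mat r r (\<lambda>(i, j). h i (t j)) $$ (i, \<pi> i)) = (\<Prod>i<r. h i (t (\<pi> i)))"
      unfolding atLeast0LessThan by (intro prod.cong) auto
  qed
  finally show ?thesis .
qed

lemma sum_PiE_remove:
  assumes p: "p < r"
  shows "(\<Sum>\<kappa>\<in>{..<r} \<rightarrow>\<^sub>E X. F \<kappa>) = (\<Sum>\<kappa>\<in>({..<r} - {p}) \<rightarrow>\<^sub>E X. \<Sum>x\<in>X. F (\<kappa>(p := x)))"
proof -
  have "{..<r} = insert p ({..<r} - {p})" using p by auto
  then have "(\<Sum>\<kappa>\<in>{..<r} \<rightarrow>\<^sub>E X. F \<kappa>) = (\<Sum>\<kappa>\<in>insert p ({..<r} - {p}) \<rightarrow>\<^sub>E X. F \<kappa>)" by simp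
  also have "\<dots> = (\<Sum>(x, \<kappa>)\<in>X \<times> (({..<r} - {p}) \<rightarrow>\<^sub>E X). F (\<kappa>(p := x)))"
    unfolding PiE_insert_eq by (subst sum.reindex[OF inj_combinator]) (auto simp: case_prod_beta)
  also have "\<dots> = (\<Sum>x\<in>X. \<Sum>\<kappa>\<in>({..<r} - {p}) \<rightarrow>\<^sub>E X. F (\<kappa>(p := x)))" by (simp add: sum.cartesian_product)
  also have "\<dots> = (\<Sum>\<kappa>\<in>({..<r} - {p}) \<rightarrow>\<^sub>E X. \<Sum>x\<in>X. F (\<kappa>(p := x)))" by (rule sum.swap)
  finally show ?thesis .
qed

section \<open>One-variable functions modulo twisted derivatives\<close>

context punctured_line
begin

lemma rat_common_family:
  fixes d D :: "'i \<Rightarrow> nat"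
  assumes "finite I"
  shows "\<exists>d0 D0. \<forall>i\<in>I. \<forall>h. rat (d i) (D i) h \<longrightarrow> rat d0 D0 h"
  using assms
proof (induction I rule: finite_induct)
  case (insert i I)
  then obtain d0 D0 where 0: "\<forall>i\<in>I. \<forall>h. rat (d i) (D i) h \<longrightarrow> rat d0 D0 h" by blast
  show ?case
    by (rule exI[of _ "d i + d0 + (D i + D0) * card P"], rule exI[of _ "D i + D0"])
      (use 0 rat_common rat_common' in blast)
qed simp

text \<open>The new bounds depend on \<open>w\<close>, \<open>d\<close> and \<open>D\<close> but not
  on \<open>g\<close>, so one set of nodes serves for the derivatives of all functions in the
  space.\<close>

lemma rat_nab:
  assumes "rational w"
  shows "\<exists>d' D'. \<forall>g. rat d D g \<longrightarrow> rat d' D' (nab w g)"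
proof -
  obtain e E where w: "rat e E w" using assms unfolding rational_def by blast
  let ?d = "d + D * card P + (e + d) + (2 * D + (E + D)) * card P" and ?D = "2 * D + (E + D)"
  have "rat ?d ?D (nab w g)" if g: "rat d D g" for g
  proof -
    obtain g' where g': "rat (d + D * card P) (2 * D) g'"
      "\<And>x. x \<notin> P \<Longrightarrow> (g has_field_derivative g' x) (at x)" using rat_derivative[OF g] by blast
    have "rat ?d ?D (\<lambda>x. g' x + w x * g x)"
      by (intro rat_add rat_common[OF g'(1)] rat_common'[OF rat_mult[OF w g]])
    then show ?thesis
      by (rule rat_cong) (use DERIV_imp_deriv[OF g'(2)] in \<open>simp add: nab_def\<close>)
  qed
  then show ?thesis by blast
qed

lemma nab_sum:
  assumes "\<And>i. i \<in> I \<Longrightarrow> rational (g i)" and x: "x \<notin> P"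
  shows "nab w (\<lambda>x. \<Sum>i\<in>I. c i * g i x) x = (\<Sum>i\<in>I. c i * nab w (g i) x)"
proof -
  have "((\<lambda>x. \<Sum>i\<in>I. c i * g i x) has_field_derivative (\<Sum>i\<in>I. c i * deriv (g i) x)) (at x)"
    by (intro DERIV_sum DERIV_cmult rational_field_derivative assms)
  then show ?thesis
    unfolding nab_def by (simp add: DERIV_imp_deriv sum_distrib_left sum.distrib[symmetric] algebra_simps)
qed

text \<open>The classes of the functions \<open>f j\<close> form a basis of the cohomology of the punctured line.\<close>
definition line_basis :: "(complex \<Rightarrow> complex) \<Rightarrow> nat set \<Rightarrow> (nat \<Rightarrow> complex \<Rightarrow> complex) \<Rightarrow> bool" where
  "line_basis w J f \<longleftrightarrow> finite J \<and> (\<forall>j\<in>J. rational (f j)) \<and>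
    (\<forall>h. rational h \<longrightarrow> (\<exists>c g. rational g \<and> (\<forall>x. x \<notin> P \<longrightarrow> h x = (\<Sum>j\<in>J. c j * f j x) + nab w g x))) \<and>
    (\<forall>c g. rational g \<longrightarrow> (\<forall>x. x \<notin> P \<longrightarrow> (\<Sum>j\<in>J. c j * f j x) = nab w g x) \<longrightarrow> (\<forall>j\<in>J. c j = 0))"

text \<open>The coefficient functional as a sum over nodes. Each node function is expanded in the
  basis modulo \<open>nab\<close>, with coefficients \<open>l\<close>; by interpolation the
  coefficients of \<open>h\<close> are then the sums of \<open>h \<xi>\<close> times those of the
  node at \<open>\<xi>\<close>. Uniqueness of coefficients gives the values on the basis and on
  twisted derivatives.\<close>

lemma line_basis_dual:
  assumes lb: "line_basis w J f" and X: "nodes d X"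
  shows "\<exists>l. (\<forall>i\<in>J. \<forall>j\<in>J. rat d D (f i) \<longrightarrow> (\<Sum>\<xi>\<in>X. f i \<xi> * l j \<xi>) = (if i = j then 1 else 0)) \<and>
    (\<forall>j\<in>J. \<forall>g. rational g \<longrightarrow> rat d D (nab w g) \<longrightarrow> (\<Sum>\<xi>\<in>X. nab w g \<xi> * l j \<xi>) = 0)"
proof -
  have J: "finite J" using lb by (simp add: line_basis_def)
  have ind: "\<And>c g j. rational g \<Longrightarrow> (\<And>x. x \<notin> P \<Longrightarrow> (\<Sum>j\<in>J. c j * f j x) = nab w g x) \<Longrightarrow> j \<in> J \<Longrightarrow> c j = 0"
    using lb unfolding line_basis_def by blast
  have "\<forall>\<xi>. \<exists>c g. rational g \<and> (\<forall>x. x \<notin> P \<longrightarrow> node X D \<xi> x = (\<Sum>j\<in>J. c j * f j x) + nab w g x)"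
    using lb rational_node unfolding line_basis_def by blast
  then obtain l G where G: "\<And>\<xi>. rational (G \<xi>)"
    and l: "\<And>\<xi> x. x \<notin> P \<Longrightarrow> node X D \<xi> x = (\<Sum>j\<in>J. l \<xi> j * f j x) + nab w (G \<xi>) x"
    by metis
  have expand: "h x = (\<Sum>j\<in>J. (\<Sum>\<xi>\<in>X. h \<xi> * l \<xi> j) * f j x) + nab w (\<lambda>x. \<Sum>\<xi>\<in>X. h \<xi> * G \<xi> x) x"
    if h: "rat d D h" and x: "x \<notin> P" for h x
  proof -
    have "h x = (\<Sum>\<xi>\<in>X. h \<xi> * ((\<Sum>j\<in>J. l \<xi> j * f j x) + nab w (G \<xi>) x))"
      using rat_interpolation[OF h X x] l[OF x] by simp
    also have "\<dots> = (\<Sum>\<xi>\<in>X. \<Sum>j\<in>J. h \<xi> * l \<xi> j * f j x) + (\<Sum>\<xi>\<in>X. h \<xi> * nab w (G \<xi>) x)"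
      by (simp add: distrib_left sum.distrib sum_distrib_left mult.assoc)
    also have "(\<Sum>\<xi>\<in>X. \<Sum>j\<in>J. h \<xi> * l \<xi> j * f j x) = (\<Sum>j\<in>J. (\<Sum>\<xi>\<in>X. h \<xi> * l \<xi> j) * f j x)"
      unfolding sum_distrib_right by (rule sum.swap)
    also have "(\<Sum>\<xi>\<in>X. h \<xi> * nab w (G \<xi>) x) = nab w (\<lambda>x. \<Sum>\<xi>\<in>X. h \<xi> * G \<xi> x) x"
      using nab_sum[of X G x w h] G x by simp
    finally show ?thesis .
  qed
  have "(\<Sum>\<xi>\<in>X. f i \<xi> * l \<xi> j) = (if i = j then 1 else 0)" if i: "i \<in> J" and j: "j \<in> J" and r: "rat d D (f i)" for i j
  proof -
    let ?g = "\<lambda>x. \<Sum>\<xi>\<in>X. f i \<xi> * G \<xi> x"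
    \<comment> \<open>\<open>f i\<close> is expanded in two ways, by itself and through the nodes;
      independence applies to the difference of the two.\<close>
    have "(if i = j then 1 else 0) - (\<Sum>\<xi>\<in>X. f i \<xi> * l \<xi> j) = 0"
    proof (rule ind[of ?g "\<lambda>j. (if i = j then 1 else 0) - (\<Sum>\<xi>\<in>X. f i \<xi> * l \<xi> j)" j, OF _ _ j])
      show "rational ?g" by (intro rational_sum G)
      fix x assume x: "x \<notin> P"
      have "(\<Sum>k\<in>J. (if i = k then 1 else 0) * f k x) = f i x"
        using i J by (simp add: if_distrib[of "\<lambda>c. c * _"] cong: if_cong)
      then show "(\<Sum>k\<in>J. ((if i = k then 1 else 0) - (\<Sum>\<xi>\<in>X. f i \<xi> * l \<xi> k)) * f k x) = nab w ?g x"
        unfolding left_diff_distrib sum_subtractf using expand[OF r x] by simp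
    qed
    then show ?thesis by simp
  qed
  moreover have "(\<Sum>\<xi>\<in>X. nab w g \<xi> * l \<xi> j) = 0"
    if j: "j \<in> J" and g: "rational g" and r: "rat d D (nab w g)" for j g
  proof (rule ind[of "\<lambda>x. 1 * g x + (- 1) * (\<Sum>\<xi>\<in>X. nab w g \<xi> * G \<xi> x)" "\<lambda>j. \<Sum>\<xi>\<in>X. nab w g \<xi> * l \<xi> j" j, OF _ _ j])
    show "rational (\<lambda>x. 1 * g x + (- 1) * (\<Sum>\<xi>\<in>X. nab w g \<xi> * G \<xi> x))"
      by (intro rational_lincomb g rational_sum G)
    fix x assume x: "x \<notin> P"
    let ?g = "\<lambda>x. \<Sum>\<xi>\<in>X. nab w g \<xi> * G \<xi> x"
    have "((\<lambda>x. 1 * g x + (- 1) * ?g x) has_field_derivative 1 * deriv g x + (- 1) * deriv ?g x) (at x)"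
      by (intro DERIV_add DERIV_cmult rational_field_derivative g x rational_sum G)
    then have "nab w (\<lambda>x. 1 * g x + (- 1) * ?g x) x = nab w g x - nab w ?g x"
      unfolding nab_def by (simp add: DERIV_imp_deriv algebra_simps)
    then show "(\<Sum>j\<in>J. (\<Sum>\<xi>\<in>X. nab w g \<xi> * l \<xi> j) * f j x) = nab w (\<lambda>x. 1 * g x + (- 1) * ?g x) x"
      using expand[OF r x] by simp
  qed
  ultimately show ?thesis by (intro exI[of _ "\<lambda>j \<xi>. l \<xi> j"]) blast
qed

definition indices :: "nat \<Rightarrow> nat set \<Rightarrow> nat list set" where
  "indices r J = {js. length js = r \<and> sorted_wrt (<) js \<and> set js \<subseteq> J}"

section \<open>Spanning by wedge products\<close>

context
  fixes r m :: nat and w :: "complex \<Rightarrow> complex" and \<omega> :: dform and J :: "nat set"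
    and f :: "nat \<Rightarrow> complex \<Rightarrow> complex" and \<psi> :: "nat \<Rightarrow> dform"
  assumes r: "r = Suc m" and \<omega>: "traces r w \<omega>" and lb: "line_basis w J f"
    and \<psi>: "\<And>j. j \<in> J \<Longrightarrow> traces r (f j) (\<psi> j)"
begin

lemma finite_indices: "finite (indices r J)"
  using finite_sorted_lists lb unfolding indices_def line_basis_def by blast

lemma wedge_indices:
  assumes js: "length js = r" "set js \<subseteq> J"
  shows "wedge_list (r + 1) (V r) (map \<psi> js) \<in> Omega (r + 1) (V r) r"
    and "regpt r t \<Longrightarrow> wedge_list (r + 1) (V r) (map \<psi> js) (pt r t) (tgs r t) = det_fun r (\<lambda>i. f (js ! i)) t"
proof -
  have in_J: "js ! k \<in> J" if "k < r" for k using js that by auto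
  show "wedge_list (r + 1) (V r) (map \<psi> js) \<in> Omega (r + 1) (V r) r"
    using wedge_list_Omega[OF open_cone_V, of "map \<psi> js" r] \<psi> traces_Omega js by fastforce
  show "wedge_list (r + 1) (V r) (map \<psi> js) (pt r t) (tgs r t) = det_fun r (\<lambda>i. f (js ! i)) t" if "regpt r t"
    using wedge_list_tgs[OF that, of "map \<psi> js" "\<lambda>j. j" "\<lambda>i. f (js ! i)"] js \<psi> in_J by simp
qed

text \<open>Functions that, as restrictions of top forms, represent combinations of the wedge products.\<close>
definition spanned :: "((nat \<Rightarrow> complex) \<Rightarrow> complex) \<Rightarrow> bool" where
  "spanned F \<longleftrightarrow> (\<exists>c. \<exists>\<beta>\<in>Omega (r + 1) (V r) m. \<forall>t. regpt r t \<longrightarrow>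
    F t = (\<Sum>js\<in>indices r J. c js * det_fun r (\<lambda>i. f (js ! i)) t) +
      nabla (r + 1) (V r) \<omega> \<beta> (pt r t) (tgs r t))"

lemma spanned_lincomb:
  assumes "spanned F" "spanned G" and H: "\<And>t. regpt r t \<Longrightarrow> H t = a * F t + b * G t"
  shows "spanned H"
proof -
  obtain c \<beta> where 1: "\<beta> \<in> Omega (r + 1) (V r) m" "\<And>t. regpt r t \<Longrightarrow>
    F t = (\<Sum>js\<in>indices r J. c js * det_fun r (\<lambda>i. f (js ! i)) t) + nabla (r + 1) (V r) \<omega> \<beta> (pt r t) (tgs r t)"
    using assms(1) unfolding spanned_def by blast
  obtain c' \<beta>' where 2: "\<beta>' \<in> Omega (r + 1) (V r) m" "\<And>t. regpt r t \<Longrightarrow>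
    G t = (\<Sum>js\<in>indices r J. c' js * det_fun r (\<lambda>i. f (js ! i)) t) + nabla (r + 1) (V r) \<omega> \<beta>' (pt r t) (tgs r t)"
    using assms(2) unfolding spanned_def by blast
  show ?thesis unfolding spanned_def
  proof (intro exI[of _ "\<lambda>js. a * c js + b * c' js"] bexI[of _ "\<lambda>y vs. a * \<beta> y vs + b * \<beta>' y vs"] allI impI)
    show "(\<lambda>y vs. a * \<beta> y vs + b * \<beta>' y vs) \<in> Omega (r + 1) (V r) m" by (rule Omega_lincomb[OF 1(1) 2(1)])
    fix t assume t: "regpt r t"
    show "H t = (\<Sum>js\<in>indices r J. (a * c js + b * c' js) * det_fun r (\<lambda>i. f (js ! i)) t) +
      nabla (r + 1) (V r) \<omega> (\<lambda>y vs. a * \<beta> y vs + b * \<beta>' y vs) (pt r t) (tgs r t)"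
      unfolding nabla_lincomb[OF open_cone_V traces_Omega[OF \<omega>] 1(1) 2(1)] H[OF t] 1(2)[OF t] 2(2)[OF t]
      by (simp add: distrib_left distrib_right sum.distrib sum_distrib_left mult.assoc)
  qed
qed

lemma spanned_zero: "(\<And>t. regpt r t \<Longrightarrow> F t = 0) \<Longrightarrow> spanned F"
  unfolding spanned_def
proof (intro exI[of _ "\<lambda>_. 0"] bexI[of _ "\<lambda>y vs. 0"] allI impI)
  show "(\<lambda>y vs. 0) \<in> Omega (r + 1) (V r) m" by (rule Omega_zero)
  have "nabla (r + 1) (V r) \<omega> (\<lambda>y vs. 0 * 0 + 0 * 0) = (\<lambda>y vs. 0)"
    using nabla_lincomb[OF open_cone_V traces_Omega[OF \<omega>] Omega_zero[of _ _ m] Omega_zero, of 0 0] by simp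
  then show "F t = (\<Sum>js\<in>indices r J. 0 * det_fun r (\<lambda>i. f (js ! i)) t) + nabla (r + 1) (V r) \<omega> (\<lambda>y vs. 0) (pt r t) (tgs r t)"
    if "\<And>t. regpt r t \<Longrightarrow> F t = 0" "regpt r t" for t
    using that by simp
qed

lemma spanned_cong:
  assumes "spanned F" "\<And>t. regpt r t \<Longrightarrow> G t = F t"
  shows "spanned G"
  by (rule spanned_lincomb[OF assms(1,1), of _ 1 0]) (simp add: assms(2))

lemma spanned_sum:
  assumes "\<And>i. i \<in> I \<Longrightarrow> spanned (F i)"
  shows "spanned (\<lambda>t. \<Sum>i\<in>I. c i * F i t)"
  using assms
proof (induction I rule: infinite_finite_induct)
  case (insert i I)
  then have "spanned (F i)" "spanned (\<lambda>t. \<Sum>i\<in>I. c i * F i t)" by simp_all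
  then show ?case by (rule spanned_lincomb[of _ _ _ "c i" 1]) (use insert in simp)
qed (simp_all add: spanned_zero)

text \<open>A repeated index gives equal rows and determinant zero; otherwise sorting the list
  changes the determinant by a sign.\<close>

lemma spanned_indices:
  assumes js: "length js = r" "set js \<subseteq> J"
  shows "spanned (det_fun r (\<lambda>i. f (js ! i)))"
proof (cases "distinct js")
  case False
  then obtain a b where ab: "a < r" "b < r" "a \<noteq> b" "js ! a = js ! b" using js by (auto simp: distinct_conv_nth)
  have "det_fun r (\<lambda>i. f (js ! i)) t = 0" for t
    unfolding det_fun_def
    by (rule det_identical_rows[OF _ ab(3) ab(1,2)]) (use ab in \<open>auto intro!: eq_vecI\<close>)
  then show ?thesis by (intro spanned_zero)
next
  case True
  define ks where "ks = sort js"
  have ks: "ks \<in> indices r J" "length ks = r"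
    using js True by (auto simp: ks_def indices_def strict_sorted_iff)
  have "mset js = mset ks" by (simp add: ks_def)
  then obtain \<pi> where \<pi>: "\<pi> permutes {..<length ks}" "permute_list \<pi> ks = js"
    by (rule mset_eq_permutation)
  have "js ! i = ks ! \<pi> i" if "i < r" for i
    using permute_list_nth[OF \<pi>(1), of i] \<pi>(2) that ks(2) by simp
  then have e: "det_fun r (\<lambda>i. f (js ! i)) t = of_int (sign \<pi>) * det_fun r (\<lambda>i. f (ks ! i)) t" for t
    using det_fun_permute[of \<pi> r "\<lambda>i. f (ks ! i)" t] \<pi>(1) ks(2)
    by (metis (mono_tags, lifting) det_fun_cong)
  have "spanned (det_fun r (\<lambda>i. f (ks ! i)))"
    unfolding spanned_def
  proof (intro exI[of _ "\<lambda>js. if js = ks then 1 else 0"] bexI[of _ "\<lambda>y vs. 0"] allI impI)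
    show "(\<lambda>y vs. 0) \<in> Omega (r + 1) (V r) m" by (rule Omega_zero)
    have z: "nabla (r + 1) (V r) \<omega> (\<lambda>y vs. 0) = (\<lambda>y vs. 0)"
      using nabla_lincomb[OF open_cone_V traces_Omega[OF \<omega>] Omega_zero[of _ _ m] Omega_zero, of 0 0] by simp
    show "det_fun r (\<lambda>i. f (ks ! i)) t = (\<Sum>js\<in>indices r J. (if js = ks then 1 else 0) * det_fun r (\<lambda>i. f (js ! i)) t) +
      nabla (r + 1) (V r) \<omega> (\<lambda>y vs. 0) (pt r t) (tgs r t)" for t
      unfolding z using ks finite_indices by (simp add: if_distrib[of "\<lambda>c. c * _"] cong: if_cong)
  qed
  then show ?thesis by (rule spanned_lincomb[of _ _ _ "of_int (sign \<pi>)" 0, OF _ _]) (use e in \<open>auto intro: spanned_zero\<close>)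
qed

text \<open>Induction on the number \<open>k\<close> of rows that are still arbitrary. The last of
  these is a combination of basis functions plus \<open>nab w g\<close>: the second part gives a
  coboundary by \<open>coboundary_exists\<close>, and each basis function turns the row into one of
  the basis rows.\<close>

lemma spanned_det:
  "length js = r - k \<Longrightarrow> set js \<subseteq> J \<Longrightarrow> k \<le> r \<Longrightarrow> (\<And>i. i < k \<Longrightarrow> rational (h i)) \<Longrightarrow>
    spanned (det_fun r (\<lambda>i. if i < k then h i else f (js ! (i - k))))"
proof (induction k arbitrary: js)
  case 0
  then show ?case using spanned_indices[of js] by simp
next
  case (Suc k)
  have k: "k < r" using Suc.prems by simp
  let ?H = "\<lambda>i. if i < Suc k then h i else f (js ! (i - Suc k))"
  have "rational (h k)" using Suc.prems by simp
  then obtain c g where g: "rational g"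
    and hk: "\<And>x. x \<notin> P \<Longrightarrow> h k x = (\<Sum>j\<in>J. c j * f j x) + nab w g x"
    using lb unfolding line_basis_def by blast
  have ratH: "rational (?H i)" if "i < r" for i
  proof (cases "i < Suc k")
    case False
    then have "js ! (i - Suc k) \<in> J" using Suc.prems(1,2) that by (intro subsetD[OF Suc.prems(2)] nth_mem) simp
    then show ?thesis using lb False by (simp add: line_basis_def)
  qed (use Suc.prems in simp)
  obtain \<beta> where \<beta>: "\<beta> \<in> Omega (r + 1) (V r) m" "\<And>t. regpt r t \<Longrightarrow>
      nabla (r + 1) (V r) \<omega> \<beta> (pt r t) (tgs r t) = det_fun r (?H(k := nab w g)) t"
    using coboundary_exists[where h = ?H, OF r \<omega> g k ratH] by blast
  have s1: "spanned (det_fun r (?H(k := nab w g)))"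
    unfolding spanned_def
  proof (intro exI[of _ "\<lambda>_. 0"] bexI[OF _ \<beta>(1)] allI impI)
    fix t assume "regpt r t"
    from \<beta>(2)[OF this] show "det_fun r (?H(k := nab w g)) t =
      (\<Sum>js\<in>indices r J. 0 * det_fun r (\<lambda>i. f (js ! i)) t) + nabla (r + 1) (V r) \<omega> \<beta> (pt r t) (tgs r t)"
      by (simp only: mult_zero_left sum.neutral_const add_0)
  qed
  have s2: "spanned (det_fun r (?H(k := f j)))" if j: "j \<in> J" for j
  proof -
    \<comment> \<open>Row \<open>k\<close> stands directly before the basis rows, so
      \<open>j\<close> is put in front of \<open>js\<close>.\<close>
    have "?H(k := f j) = (\<lambda>i. if i < k then h i else f ((j # js) ! (i - k)))"
      by (intro ext) (auto simp: less_Suc_eq nth_Cons' Suc_diff_le)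
    moreover have "spanned (det_fun r (\<lambda>i. if i < k then h i else f ((j # js) ! (i - k))))"
      using Suc.prems j k by (intro Suc.IH) auto
    ultimately show ?thesis by simp
  qed
  have lin: "det_fun r (?H(k := \<lambda>x. \<Sum>j\<in>I. c j * f j x)) t = (\<Sum>j\<in>I. c j * det_fun r (?H(k := f j)) t)"
    if "finite I" for I t
    using that
  proof (induction I rule: finite_induct)
    case empty
    show ?case using det_fun_linear[OF k, of "\<lambda>x. 0" t 0 "\<lambda>x. 0" 0 "\<lambda>x. 0" ?H]
      by (simp del: fun_upd_apply)
  next
    case (insert j I)
    then show ?case
      using det_fun_linear[OF k, of "\<lambda>x. \<Sum>j\<in>insert j I. c j * f j x" t "c j" "f j" 1 "\<lambda>x. \<Sum>j\<in>I. c j * f j x" ?H]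
      by (simp del: fun_upd_apply)
  qed
  have "spanned (\<lambda>t. \<Sum>j\<in>J. c j * det_fun r (?H(k := f j)) t)" by (intro spanned_sum s2)
  from this s1 show ?case
  proof (rule spanned_lincomb[of _ _ _ 1 1])
    fix t assume t: "regpt r t"
    have J: "finite J" using lb by (simp add: line_basis_def)
    have H: "?H(k := h k) = ?H" by auto
    have "h k (t q) = 1 * (\<Sum>j\<in>J. c j * f j (t q)) + 1 * nab w g (t q)" if "q < r" for q
      using hk t that by (simp add: regpt_def)
    from det_fun_linear[OF k, of "h k" t 1 "\<lambda>x. \<Sum>j\<in>J. c j * f j x" 1 "nab w g" ?H, OF this]
    show "det_fun r ?H t = 1 * (\<Sum>j\<in>J. c j * det_fun r (?H(k := f j)) t) + 1 * det_fun r (?H(k := nab w g)) t"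
      unfolding H lin[OF J] .
  qed
qed

lemma spanned_top_form:
  assumes \<eta>: "\<eta> \<in> Omega (r + 1) (V r) r"
  shows "spanned (\<lambda>t. \<eta> (pt r t) (tgs r t))"
proof -
  define F where "F t = \<eta> (pt r t) (tgs r t)" for t
  obtain d D where F: "sep_rat r d D F" using sep_rat_top_form[OF \<eta>] unfolding F_def by blast
  obtain X where X: "nodes d X" using ex_nodes by blast
  have cong: "F t = F t'" if "\<And>q. q < r \<Longrightarrow> t q = t' q" for t t'
  proof -
    have "pt r t = pt r t'" "tg r t = tg r t'"
      using that by (auto intro: pt_cong tg_cong)
    then show ?thesis unfolding F_def by (simp only:)
  qed
  let ?S = "{\<pi>. \<pi> permutes {0..<r}}" and ?K = "{..<r} \<rightarrow>\<^sub>E X"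
  have finS: "finite ?S" by (simp add: finite_permutations)
  have "F t = (\<Sum>\<kappa>\<in>?K. (F \<kappa> / of_nat (card ?S)) * det_fun r (\<lambda>i. node X D (\<kappa> i)) t)" if t: "regpt r t" for t
  proof -
    have anti: "of_int (sign \<pi>) * F (\<lambda>q. t (\<pi> q)) = F t" if \<pi>: "\<pi> \<in> ?S" for \<pi>
    proof -
      have "\<pi> permutes {..<r}" using \<pi> by (simp add: atLeast0LessThan)
      from top_form_permute[OF \<eta> t this] have "F (\<lambda>q. t (\<pi> q)) = of_int (sign \<pi>) * F t" by (simp add: F_def)
      then show ?thesis by (simp add: mult.assoc[symmetric] of_int_mult[symmetric] sign_idempotent del: of_int_mult)
    qed
    \<comment> \<open>Average over the \<open>r!\<close> permutations. All permuted points are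
      interpolated at the same nodes, with the same values \<open>F \<kappa>\<close>, so for each
      \<open>\<kappa>\<close> the products of node functions assemble into one determinant.\<close>
    have "of_nat (card ?S) * F t = (\<Sum>\<pi>\<in>?S. of_int (sign \<pi>) * F (\<lambda>q. t (\<pi> q)))"
      using anti by simp
    also have "\<dots> = (\<Sum>\<pi>\<in>?S. \<Sum>\<kappa>\<in>?K. F \<kappa> * (of_int (sign \<pi>) * (\<Prod>i<r. node X D (\<kappa> i) (t (\<pi> i)))))"
    proof (intro sum.cong refl)
      fix \<pi> assume \<pi>: "\<pi> \<in> ?S"
      have "regpt r (\<lambda>q. t (\<pi> q))"
        using t \<pi> permutes_in_image[of \<pi> "{0..<r}"] by (auto simp: regpt_def)
      from tensor_interpolation[OF F X this cong]
      show "of_int (sign \<pi>) * F (\<lambda>q. t (\<pi> q)) =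
        (\<Sum>\<kappa>\<in>?K. F \<kappa> * (of_int (sign \<pi>) * (\<Prod>i<r. node X D (\<kappa> i) (t (\<pi> i)))))"
        by (simp add: sum_distrib_left mult.left_commute)
    qed
    also have "\<dots> = (\<Sum>\<kappa>\<in>?K. F \<kappa> * det_fun r (\<lambda>i. node X D (\<kappa> i)) t)"
      unfolding det_fun_eq_sum' sum_distrib_left by (rule sum.swap)
    finally have "of_nat (card ?S) * F t = (\<Sum>\<kappa>\<in>?K. F \<kappa> * det_fun r (\<lambda>i. node X D (\<kappa> i)) t)" .
    moreover have "card ?S \<noteq> 0" using finS permutes_id by (metis card_eq_0_iff empty_iff mem_Collect_eq)
    ultimately have "F t = (\<Sum>\<kappa>\<in>?K. F \<kappa> * det_fun r (\<lambda>i. node X D (\<kappa> i)) t) / of_nat (card ?S)"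
      by (simp add: field_simps)
    then show ?thesis by (simp add: sum_divide_distrib)
  qed
  moreover have "spanned (\<lambda>t. \<Sum>\<kappa>\<in>?K. (F \<kappa> / of_nat (card ?S)) * det_fun r (\<lambda>i. node X D (\<kappa> i)) t)"
  proof (intro spanned_sum)
    fix \<kappa>
    have "spanned (det_fun r (\<lambda>i. if i < r then node X D (\<kappa> i) else f ([] ! (i - r))))"
      by (rule spanned_det) (auto simp: rational_node)
    then show "spanned (det_fun r (\<lambda>i. node X D (\<kappa> i)))"
    proof (rule spanned_cong)
      show "det_fun r (\<lambda>i. node X D (\<kappa> i)) t =
        det_fun r (\<lambda>i. if i < r then node X D (\<kappa> i) else f ([] ! (i - r))) t" for t
        by (rule det_fun_cong) simp
    qed
  qed
  ultimately show ?thesis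
    unfolding F_def[symmetric] using spanned_cong by blast
qed

lemma top_form_expansion:
  assumes "\<eta> \<in> Omega (r + 1) (V r) r"
  shows "\<exists>c. \<exists>\<beta>\<in>Omega (r + 1) (V r) m. \<forall>t. regpt r t \<longrightarrow> \<eta> (pt r t) (tgs r t) =
    (\<Sum>js\<in>indices r J. c js * det_fun r (\<lambda>i. f (js ! i)) t) +
      nabla (r + 1) (V r) \<omega> \<beta> (pt r t) (tgs r t)"
  using spanned_top_form[OF assms] unfolding spanned_def .

end

end

section \<open>Linear independence and the basis theorem\<close>

context punctured_line
begin

text \<open>
  Apply in the variable \<open>t q\<close> the functional, supplied by \<open>line_basis_dual\<close>, that reads off the
  coefficient of \<open>f (js0 ! q)\<close>: the resulting functional \<open>\<Lambda>\<close> is dual to the determinants and kills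
  the pullback of every coboundary.
\<close>
lemma wedge_independent:
  assumes r: "r = Suc m" and \<omega>: "traces r w \<omega>" and lb: "line_basis w J f"
    and \<beta>: "\<beta> \<in> Omega (r + 1) (V r) m"
    and eq: "\<And>t. regpt r t \<Longrightarrow> (\<Sum>js\<in>indices r J. c js * det_fun r (\<lambda>i. f (js ! i)) t) =
      nabla (r + 1) (V r) \<omega> \<beta> (pt r t) (tgs r t)"
    and js0: "js0 \<in> indices r J"
  shows "c js0 = 0"
proof -
  have J: "finite J" and ratf: "\<And>j. j \<in> J \<Longrightarrow> rational (f j)" using lb by (auto simp: line_basis_def)
  have fin: "finite (indices r J)" using finite_sorted_lists[OF J] by (simp add: indices_def)
  have idx: "length js = r" "sorted_wrt (<) js" "\<And>q. q < r \<Longrightarrow> js ! q \<in> J" if "js \<in> indices r J" for js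
    using that by (auto simp: indices_def)
  define a where "a p t = \<beta> (pt r t) (omit p (tgs r t))" for p t
  have "\<forall>p. \<exists>d D. p < r \<longrightarrow> sep_rat r d D (a p)"
    using sep_rat_omit_form[of \<beta> r] \<beta> r unfolding a_def by fastforce
  then obtain d D where a: "\<And>p. p < r \<Longrightarrow> sep_rat r (d p) (D p) (a p)" by metis
  have w: "rational w" using traces_rational[OF \<omega>] r by simp
  have "\<forall>p. \<exists>e E. \<forall>g. rat (d p) (D p) g \<longrightarrow> rat e E (nab w g)" using rat_nab[OF w] by blast
  then obtain e E where eE: "\<And>p g. rat (d p) (D p) g \<Longrightarrow> rat (e p) (E p) (nab w g)" by metis
  obtain d0 D0 where 0: "\<And>p h. p < r \<Longrightarrow> rat (e p) (E p) h \<Longrightarrow> rat d0 D0 h"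
    using rat_common_family[of "{..<r}" e E] by auto
  have "\<forall>j. \<exists>d D. j \<in> J \<longrightarrow> rat d D (f j)" using ratf unfolding rational_def by blast
  then obtain u U where u: "\<And>j. j \<in> J \<Longrightarrow> rat (u j) (U j) (f j)" by metis
  obtain d1 D1 where 1: "\<And>j h. j \<in> J \<Longrightarrow> rat (u j) (U j) h \<Longrightarrow> rat d1 D1 h"
    using rat_common_family[OF J, of u U] by auto
  \<comment> \<open>One space that contains the basis functions and, for every variable
    \<open>p\<close>, the twisted derivatives in that variable of the coefficient \<open>a p\<close>
    of \<open>\<beta>\<close>. Its nodes can be used in all variables simultaneously.\<close>
  define dd where "dd = d0 + d1 + (D0 + D1) * card P"
  define DD where "DD = D0 + D1"
  have f_rat: "rat dd DD (f j)" if "j \<in> J" for j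
    unfolding dd_def DD_def by (rule rat_common'[OF 1[OF that u[OF that]]])
  have nab_rat: "rat dd DD (nab w g)" if "p < r" "rat (d p) (D p) g" for p g
    unfolding dd_def DD_def by (rule rat_common[OF 0[OF that(1) eE[OF that(2)]]])
  obtain X where X: "nodes dd X" using ex_nodes by blast
  have finX: "finite X" using X by (simp add: nodes_def)
  obtain l where l1: "\<And>i j. i \<in> J \<Longrightarrow> j \<in> J \<Longrightarrow> (\<Sum>\<xi>\<in>X. f i \<xi> * l j \<xi>) = (if i = j then 1 else 0)"
    and l2: "\<And>j g. j \<in> J \<Longrightarrow> rational g \<Longrightarrow> rat dd DD (nab w g) \<Longrightarrow> (\<Sum>\<xi>\<in>X. nab w g \<xi> * l j \<xi>) = 0"
    using line_basis_dual[OF lb X, of DD] f_rat by metis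
  let ?K = "{..<r} \<rightarrow>\<^sub>E X"
  let ?S = "{\<pi>. \<pi> permutes {0..<r}}"
  define \<Lambda> where "\<Lambda> F = (\<Sum>\<kappa>\<in>?K. F \<kappa> * (\<Prod>q<r. l (js0 ! q) (\<kappa> q)))" for F
  have L1: "\<Lambda> (det_fun r (\<lambda>i. f (js ! i))) = (if js = js0 then 1 else 0)" if js: "js \<in> indices r J" for js
  proof -
    have "\<Lambda> (det_fun r (\<lambda>i. f (js ! i))) = (\<Sum>\<kappa>\<in>?K. \<Sum>\<pi>\<in>?S. of_int (sign \<pi>) *
        (\<Prod>j<r. f (js ! \<pi> j) (\<kappa> j) * l (js0 ! j) (\<kappa> j)))"
      unfolding \<Lambda>_def det_fun_eq_sum by (simp add: sum_distrib_right prod.distrib mult.assoc)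
    also have "\<dots> = (\<Sum>\<pi>\<in>?S. of_int (sign \<pi>) * (\<Sum>\<kappa>\<in>?K. \<Prod>j<r. f (js ! \<pi> j) (\<kappa> j) * l (js0 ! j) (\<kappa> j)))"
      unfolding sum_distrib_left by (rule sum.swap)
    also have "\<dots> = (\<Sum>\<pi>\<in>?S. of_int (sign \<pi>) * (\<Prod>j<r. \<Sum>\<xi>\<in>X. f (js ! \<pi> j) \<xi> * l (js0 ! j) \<xi>))"
      by (intro sum.cong refl arg_cong2[of _ _ _ _ "(*)"] prod_sum_PiE[symmetric]) (use finX in auto)
    also have "\<dots> = (\<Sum>\<pi>\<in>?S. if js = js0 \<and> \<pi> = id then 1 else 0)"
    proof (intro sum.cong refl)
      fix \<pi> assume "\<pi> \<in> ?S"
      then have \<pi>: "\<pi> permutes {0..<r}" by simp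
      have lt: "\<pi> j < r" if "j < r" for j using permutes_in_image[OF \<pi>, of j] that by simp
      have p: "(\<Prod>j<r. \<Sum>\<xi>\<in>X. f (js ! \<pi> j) \<xi> * l (js0 ! j) \<xi>) = (\<Prod>j<r. if js ! \<pi> j = js0 ! j then 1 else 0)"
        using l1 idx(3)[OF js] idx(3)[OF js0] lt by (intro prod.cong refl) simp
      show "of_int (sign \<pi>) * (\<Prod>j<r. \<Sum>\<xi>\<in>X. f (js ! \<pi> j) \<xi> * l (js0 ! j) \<xi>) =
        (if js = js0 \<and> \<pi> = id then 1 else 0)"
      proof (cases "js = js0 \<and> \<pi> = id")
        case True
        then show ?thesis unfolding p by simp
      next
        case False
        then obtain j where "j < r" "js ! \<pi> j \<noteq> js0 ! j"
          using sorted_lists_permutation_unique[OF idx(1,2)[OF js] idx(1,2)[OF js0] \<pi>] by blast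
        then have "(\<Prod>j<r. if js ! \<pi> j = js0 ! j then 1 else 0 :: complex) = 0"
          by (intro prod_zero) auto
        then show ?thesis unfolding p using False by simp
      qed
    qed
    also have "\<dots> = (if js = js0 then 1 else 0)"
      using permutes_id[of "{0..<r}"] by (simp add: finite_permutations sum.delta)
    finally show ?thesis .
  qed
  \<comment> \<open>Summation over the node in variable \<open>p\<close> is done innermost. With the
    other nodes fixed, the functional of this variable meets a twisted derivative and gives
    0.\<close>
  have L2: "\<Lambda> (\<lambda>t. nab w (\<lambda>x. a p (t(p := x))) (t p)) = 0" if p: "p < r" for p
  proof -
    have "\<Lambda> (\<lambda>t. nab w (\<lambda>x. a p (t(p := x))) (t p)) =
      (\<Sum>\<kappa>\<in>({..<r} - {p}) \<rightarrow>\<^sub>E X. \<Sum>\<xi>\<in>X. nab w (\<lambda>x. a p (\<kappa>(p := x))) \<xi> *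
        (\<Prod>q<r. l (js0 ! q) ((\<kappa>(p := \<xi>)) q)))"
      unfolding \<Lambda>_def sum_PiE_remove[OF p] by simp
    also have "\<dots> = 0"
    proof (rule sum.neutral, rule ballI)
      fix \<kappa> assume \<kappa>: "\<kappa> \<in> ({..<r} - {p}) \<rightarrow>\<^sub>E X"
      \<comment> \<open>\<open>sep_rat\<close> speaks of a full regular point, while
        \<open>\<kappa>\<close> has no value at \<open>p\<close>. An arbitrary node is filled in and
        then overwritten by the variable \<open>x\<close>.\<close>
      obtain \<xi>0 where \<xi>0: "\<xi>0 \<in> X" using X by (auto simp: nodes_def card_Suc_eq)
      have "regpt r (\<kappa>(p := \<xi>0))"
        using \<kappa> \<xi>0 X by (auto simp: regpt_def nodes_def PiE_iff)
      from a[OF p, unfolded sep_rat_def, rule_format, OF this p]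
      have g: "rat (d p) (D p) (\<lambda>x. a p (\<kappa>(p := x)))" by simp
      then have "rational (\<lambda>x. a p (\<kappa>(p := x)))" unfolding rational_def by blast
      from l2[OF idx(3)[OF js0 p] this nab_rat[OF p g]]
      have z: "(\<Sum>\<xi>\<in>X. nab w (\<lambda>x. a p (\<kappa>(p := x))) \<xi> * l (js0 ! p) \<xi>) = 0" .
      have "(\<Prod>q<r. l (js0 ! q) ((\<kappa>(p := \<xi>)) q)) = l (js0 ! p) \<xi> * (\<Prod>q\<in>{..<r} - {p}. l (js0 ! q) (\<kappa> q))" for \<xi>
        using p by (subst prod.remove[of _ p]) (auto intro!: arg_cong2[of _ _ _ _ "(*)"] prod.cong)
      then have "(\<Sum>\<xi>\<in>X. nab w (\<lambda>x. a p (\<kappa>(p := x))) \<xi> * (\<Prod>q<r. l (js0 ! q) ((\<kappa>(p := \<xi>)) q))) =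
        (\<Sum>\<xi>\<in>X. nab w (\<lambda>x. a p (\<kappa>(p := x))) \<xi> * l (js0 ! p) \<xi>) * (\<Prod>q\<in>{..<r} - {p}. l (js0 ! q) (\<kappa> q))"
        by (simp only: sum_distrib_right mult.assoc)
      then show "(\<Sum>\<xi>\<in>X. nab w (\<lambda>x. a p (\<kappa>(p := x))) \<xi> * (\<Prod>q<r. l (js0 ! q) ((\<kappa>(p := \<xi>)) q))) = 0"
        using z by simp
    qed
    finally show ?thesis .
  qed
  have L3: "(\<Sum>js\<in>indices r J. c js * det_fun r (\<lambda>i. f (js ! i)) \<kappa>) =
    (\<Sum>p<r. (-1) ^ p * nab w (\<lambda>x. a p (\<kappa>(p := x))) (\<kappa> p))" if \<kappa>: "\<kappa> \<in> ?K" for \<kappa>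
  proof -
    have reg: "regpt r \<kappa>" using regpt_nodes[OF X \<kappa>] .
    obtain D' where D': "\<And>p. p < r \<Longrightarrow> ((\<lambda>x. a p (\<kappa>(p := x))) has_field_derivative D' p) (at (\<kappa> p))"
      and nb: "nabla (r + 1) (V r) \<omega> \<beta> (pt r \<kappa>) (tgs r \<kappa>) = (\<Sum>p<r. (-1) ^ p * (D' p + w (\<kappa> p) * a p \<kappa>))"
      using nabla_pullback[OF r \<beta> \<omega> reg] unfolding a_def by blast
    show ?thesis unfolding eq[OF reg] nb
      by (intro sum.cong refl) (use DERIV_imp_deriv[OF D'] in \<open>simp add: nab_def\<close>)
  qed
  have "c js0 = (\<Sum>js\<in>indices r J. c js * \<Lambda> (det_fun r (\<lambda>i. f (js ! i))))"
    using js0 fin by (simp add: L1 if_distrib[of "\<lambda>x. _ * x"] cong: if_cong sum.cong_simp)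
  also have "\<dots> = (\<Sum>\<kappa>\<in>?K. (\<Sum>js\<in>indices r J. c js * det_fun r (\<lambda>i. f (js ! i)) \<kappa>) * (\<Prod>q<r. l (js0 ! q) (\<kappa> q)))"
    unfolding \<Lambda>_def sum_distrib_left sum_distrib_right by (subst sum.swap) (simp only: mult.assoc)
  also have "\<dots> = (\<Sum>\<kappa>\<in>?K. (\<Sum>p<r. (-1) ^ p * nab w (\<lambda>x. a p (\<kappa>(p := x))) (\<kappa> p)) * (\<Prod>q<r. l (js0 ! q) (\<kappa> q)))"
    by (intro sum.cong refl arg_cong2[of _ _ _ _ "(*)"] L3)
  also have "\<dots> = (\<Sum>p<r. (-1) ^ p * \<Lambda> (\<lambda>t. nab w (\<lambda>x. a p (t(p := x))) (t p)))"
    unfolding \<Lambda>_def sum_distrib_left sum_distrib_right by (subst sum.swap) (simp only: mult.assoc)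
  also have "\<dots> = 0" by (simp add: L2)
  finally show ?thesis .
qed

lemma nabla_top_zero:
  assumes \<omega>: "\<omega> \<in> Omega (r + 1) (V r) 1" and \<eta>: "\<eta> \<in> Omega (r + 1) (V r) r"
  shows "nabla (r + 1) (V r) \<omega> \<eta> = (\<lambda>y vs. 0)"
proof (intro ext)
  have "nabla (r + 1) (V r) \<omega> \<eta> \<in> Omega (r + 1) (V r) (r + 1)"
    using nabla_Omega[OF open_cone_V \<omega> \<eta>] by simp
  from Omega_top_eq_0[OF open_cone_V zero_notin_V this]
  show "nabla (r + 1) (V r) \<omega> \<eta> y vs = 0" for y vs .
qed

text \<open>The expansion and the independence are statements about pullbacks to \<open>X^r\<close>.
  \<open>Omega_top_unique\<close> lifts the expansion to an identity of forms, and a relation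
  between forms is evaluated on tangent lists to reach \<open>wedge_independent\<close>.\<close>

theorem wedge_basis:
  assumes r: "r = Suc m" and \<omega>: "traces r w \<omega>" and lb: "line_basis w J f"
    and \<psi>: "\<And>j. j \<in> J \<Longrightarrow> traces r (f j) (\<psi> j)"
  shows "cohomology_basis (r + 1) (V r) \<omega> r (indices r J) (\<lambda>js. wedge_list (r + 1) (V r) (map \<psi> js))"
proof -
  note U = open_cone_V and \<omega>' = traces_Omega[OF \<omega>]
  note ctx = r \<omega> lb \<psi>
  have fin: "finite (indices r J)" using finite_indices[OF ctx] .
  have sp: "\<exists>c. \<exists>\<beta>\<in>Omega (r + 1) (V r) m. \<forall>t. regpt r t \<longrightarrow> \<eta> (pt r t) (tgs r t) =
    (\<Sum>js\<in>indices r J. c js * det_fun r (\<lambda>i. f (js ! i)) t) +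
      nabla (r + 1) (V r) \<omega> \<beta> (pt r t) (tgs r t)" if "\<eta> \<in> Omega (r + 1) (V r) r" for \<eta>
    by (rule top_form_expansion[OF r \<omega> lb _ that]) (rule \<psi>)
  have W: "wedge_list (r + 1) (V r) (map \<psi> js) \<in> Omega (r + 1) (V r) r"
    "\<And>t. regpt r t \<Longrightarrow> wedge_list (r + 1) (V r) (map \<psi> js) (pt r t) (tgs r t) = det_fun r (\<lambda>i. f (js ! i)) t"
    if "js \<in> indices r J" for js
    using wedge_indices[OF ctx, of js] that by (auto simp: indices_def)
  have comb: "(\<lambda>y vs. \<Sum>js\<in>indices r J. c js * wedge_list (r + 1) (V r) (map \<psi> js) y vs) \<in> Omega (r + 1) (V r) r" for c
    by (intro Omega_sum W)
  have nb: "nabla (r + 1) (V r) \<omega> \<beta> \<in> Omega (r + 1) (V r) r" if "\<beta> \<in> Omega (r + 1) (V r) m" for \<beta>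
    using nabla_Omega[OF U \<omega>' that] r by simp
  have "cohomology_basis (r + 1) (V r) \<omega> (Suc m) (indices r J) (\<lambda>js. wedge_list (r + 1) (V r) (map \<psi> js))"
  proof (subst cohomology_basis_top_iff[OF U \<omega>'])
    show "nabla (r + 1) (V r) \<omega> \<eta> = (\<lambda>y vs. 0)" if "\<eta> \<in> Omega (r + 1) (V r) (Suc m)" for \<eta>
      using nabla_top_zero[OF \<omega>'] that unfolding r by blast
    show "finite (indices r J)" by (rule fin)
    show "wedge_list (r + 1) (V r) (map \<psi> js) \<in> Omega (r + 1) (V r) (Suc m)" if "js \<in> indices r J" for js
      using W(1)[OF that] unfolding r .
    show "(\<forall>\<eta>\<in>Omega (r + 1) (V r) (Suc m). \<exists>c. \<exists>\<beta>\<in>Omega (r + 1) (V r) m. \<forall>y vs.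
        \<eta> y vs = (\<Sum>js\<in>indices r J. c js * wedge_list (r + 1) (V r) (map \<psi> js) y vs) + nabla (r + 1) (V r) \<omega> \<beta> y vs) \<and>
      (\<forall>c. \<forall>\<beta>\<in>Omega (r + 1) (V r) m. (\<forall>y vs. (\<Sum>js\<in>indices r J. c js * wedge_list (r + 1) (V r) (map \<psi> js) y vs) =
        nabla (r + 1) (V r) \<omega> \<beta> y vs) \<longrightarrow> (\<forall>js\<in>indices r J. c js = 0))"
    proof (intro conjI ballI allI impI)
      fix \<eta> assume "\<eta> \<in> Omega (r + 1) (V r) (Suc m)"
      then have \<eta>: "\<eta> \<in> Omega (r + 1) (V r) r" unfolding r .
      obtain c \<beta> where \<beta>: "\<beta> \<in> Omega (r + 1) (V r) m" and eq: "\<And>t. regpt r t \<Longrightarrow> \<eta> (pt r t) (tgs r t) =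
          (\<Sum>js\<in>indices r J. c js * det_fun r (\<lambda>i. f (js ! i)) t) + nabla (r + 1) (V r) \<omega> \<beta> (pt r t) (tgs r t)"
        using sp[OF \<eta>] by blast
      have "\<eta> = (\<lambda>y vs. 1 * (\<Sum>js\<in>indices r J. c js * wedge_list (r + 1) (V r) (map \<psi> js) y vs) +
          1 * nabla (r + 1) (V r) \<omega> \<beta> y vs)"
      proof (rule Omega_top_unique[OF \<eta> Omega_lincomb[OF comb nb[OF \<beta>]]])
        fix t assume t: "regpt r t"
        show "\<eta> (pt r t) (tgs r t) =
          1 * (\<Sum>js\<in>indices r J. c js * wedge_list (r + 1) (V r) (map \<psi> js) (pt r t) (tgs r t)) +
          1 * nabla (r + 1) (V r) \<omega> \<beta> (pt r t) (tgs r t)"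
          unfolding eq[OF t] mult_1
          by (intro arg_cong2[of _ _ _ _ "(+)"] sum.cong refl) (simp only: W(2)[OF _ t])
      qed
      then show "\<exists>c. \<exists>\<beta>\<in>Omega (r + 1) (V r) m. \<forall>y vs.
        \<eta> y vs = (\<Sum>js\<in>indices r J. c js * wedge_list (r + 1) (V r) (map \<psi> js) y vs) + nabla (r + 1) (V r) \<omega> \<beta> y vs"
        using \<beta> by (intro exI[of _ c] bexI[of _ \<beta>] allI) (simp_all add: fun_eq_iff)
    next
      fix c \<beta> js
      assume \<beta>: "\<beta> \<in> Omega (r + 1) (V r) m" and eq: "\<forall>y vs. (\<Sum>js\<in>indices r J. c js * wedge_list (r + 1) (V r) (map \<psi> js) y vs) =
        nabla (r + 1) (V r) \<omega> \<beta> y vs" and js: "js \<in> indices r J"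
      show "c js = 0"
      proof (rule wedge_independent[OF r \<omega> lb \<beta> _ js])
        fix t assume t: "regpt r t"
        show "(\<Sum>js\<in>indices r J. c js * det_fun r (\<lambda>i. f (js ! i)) t) = nabla (r + 1) (V r) \<omega> \<beta> (pt r t) (tgs r t)"
          unfolding eq[rule_format, symmetric] by (intro sum.cong refl) (simp only: W(2)[OF _ t])
      qed
    qed
  qed
  then show ?thesis unfolding r .
qed

end

section \<open>The cohomology of the punctured line as the case \<open>r = 1\<close>\<close>

context punctured_line
begin

lemma pt_1: "pt 1 t = sg (t 0)"
proof (rule eq_vecI)
  fix i assume "i < dim_vec (sg (t 0))"
  then have "i = 0 \<or> i = 1" by (auto simp: sg_def)
  then show "pt 1 t $ i = sg (t 0) $ i" by (auto simp: pt_def lin_prod_def lin_series_def)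
qed (simp add: pt_def lin_prod_def sg_def)

lemma tg_1: "tg 1 t 0 = dsg"
proof (rule eq_vecI)
  fix i assume "i < dim_vec dsg"
  then have "i = 0 \<or> i = 1" by (auto simp: dsg_def)
  then show "tg 1 t 0 $ i = dsg $ i" by (auto simp: tg_def lin_prod_def lin_series_def)
qed (simp add: tg_def lin_prod_def dsg_def)

lemma tgs_1: "tgs 1 t = [dsg]"
  using tg_1[of t] by simp

lemma regpt_1: "regpt 1 t \<longleftrightarrow> t 0 \<notin> P"
  by (auto simp: regpt_def)

lemma traces_1I:
  assumes "\<phi> \<in> Omega 2 (V 1) 1"
  shows "traces 1 (\<lambda>x. \<phi> (sg x) [dsg]) \<phi>"
  using assms unfolding traces_def by (auto simp: pt_1[unfolded One_nat_def] tg_1[unfolded One_nat_def] numeral_2_eq_2)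

lemma nabla_function_line:
  assumes \<omega>: "traces 1 w \<omega>" and \<beta>: "\<beta> \<in> Omega 2 (V 1) 0" and x: "x \<notin> P"
  shows "nabla 2 (V 1) \<omega> \<beta> (sg x) [dsg] = nab w (\<lambda>x. \<beta> (sg x) []) x"
proof -
  have r: "(1 :: nat) = Suc 0" and \<beta>': "\<beta> \<in> Omega (1 + 1) (V 1) 0" using \<beta> by (simp_all add: numeral_2_eq_2)
  have reg: "regpt 1 (\<lambda>_. x)" using x by (simp add: regpt_1[unfolded One_nat_def])
  obtain D where D: "\<And>p. p < 1 \<Longrightarrow> ((\<lambda>y. \<beta> (pt 1 ((\<lambda>_. x)(p := y))) (omit p (tgs 1 ((\<lambda>_. x)(p := y))))) has_field_derivative D p) (at x)"
    and nb: "nabla (1 + 1) (V 1) \<omega> \<beta> (pt 1 (\<lambda>_. x)) (tgs 1 (\<lambda>_. x)) =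
      (\<Sum>p<1. (-1) ^ p * (D p + w x * \<beta> (pt 1 (\<lambda>_. x)) (omit p (tgs 1 (\<lambda>_. x)))))"
    using nabla_pullback[OF r \<beta>' \<omega> reg] by blast
  have e: "omit 0 [dsg] = []" by (simp add: omit_def)
  have "((\<lambda>y. \<beta> (sg y) []) has_field_derivative D 0) (at x)"
    using D[of 0] unfolding pt_1 tgs_1 e by simp
  then have "deriv (\<lambda>y. \<beta> (sg y) []) x = D 0" by (rule DERIV_imp_deriv)
  then show ?thesis using nb unfolding pt_1 tgs_1 nab_def by (simp add: e numeral_2_eq_2)
qed

lemma rational_function_line:
  assumes "\<beta> \<in> Omega 2 (V 1) 0"
  shows "rational (\<lambda>x. \<beta> (sg x) [])"
proof -
  have \<beta>': "\<beta> \<in> Omega (1 + 1) (V 1) 0" using assms by (simp add: numeral_2_eq_2)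
  have "\<exists>d D. sep_rat 1 d D (\<lambda>t. \<beta> (pt 1 t) (map ((\<lambda>t i. 0\<^sub>v 2) t) [0..<0]))"
    by (intro sep_rat_form \<beta>') (simp_all add: sep_poly_const numeral_2_eq_2)
  then obtain d D where *: "sep_rat 1 d D (\<lambda>t. \<beta> (pt 1 t) [])" by auto
  obtain t where t: "regpt 1 t" using ex_regpt by blast
  have "rat d D (\<lambda>x. \<beta> (sg x) [])"
    using *[unfolded sep_rat_def, rule_format, OF t, of 0] unfolding pt_1 by simp
  then show ?thesis unfolding rational_def by blast
qed

text \<open>For \<open>r = 1\<close> the cone \<open>V 1\<close> lies over the line itself.
  Functions lift to 1-forms by \<open>ex_traces\<close> and to 0-forms by
  \<open>ex_fun_traces\<close>, and restriction along \<open>sg\<close> goes back, so the basis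
  property passes from forms to functions.\<close>

theorem line_basis_of_cohomology_basis:
  assumes \<omega>: "traces 1 w \<omega>" and \<phi>: "\<And>j. j \<in> J \<Longrightarrow> \<phi> j \<in> Omega 2 (V 1) 1" and J: "finite J"
    and basis: "cohomology_basis 2 (V 1) \<omega> 1 J \<phi>"
  shows "line_basis w J (\<lambda>j x. \<phi> j (sg x) [dsg])"
proof -
  have two: "1 + 1 = (2 :: nat)" by simp
  note U = open_cone_V[of 1, unfolded two] and \<omega>' = traces_Omega[OF \<omega>, unfolded two]
  have top: "nabla 2 (V 1) \<omega> \<eta> = (\<lambda>y vs. 0)" if "\<eta> \<in> Omega 2 (V 1) (Suc 0)" for \<eta>
    using nabla_top_zero[of \<omega> 1 \<eta>] \<omega>' that unfolding two by simp
  have \<phi>': "\<phi> j \<in> Omega 2 (V 1) (Suc 0)" if "j \<in> J" for j using \<phi>[OF that] by simp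
  have "cohomology_basis 2 (V 1) \<omega> (Suc 0) J \<phi>" using basis by simp
  note B = iffD1[OF cohomology_basis_top_iff[where f = \<phi>, OF U \<omega>' top J \<phi>'] this]
  have S: "\<exists>c. \<exists>\<beta>\<in>Omega 2 (V 1) 0. \<forall>y vs. \<eta> y vs = (\<Sum>j\<in>J. c j * \<phi> j y vs) + nabla 2 (V 1) \<omega> \<beta> y vs"
    if "\<eta> \<in> Omega 2 (V 1) 1" for \<eta>
    using conjunct1[OF B] that unfolding One_nat_def by blast
  have I: "c j = 0" if "\<beta> \<in> Omega 2 (V 1) 0"
    "\<And>y vs. (\<Sum>j\<in>J. c j * \<phi> j y vs) = nabla 2 (V 1) \<omega> \<beta> y vs" "j \<in> J" for c \<beta> j
    using conjunct2[OF B] that by blast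
  show ?thesis unfolding line_basis_def
  proof (intro conjI ballI allI impI J)
    show "rational (\<lambda>x. \<phi> j (sg x) [dsg])" if "j \<in> J" for j
      by (rule traces_rational[OF traces_1I[OF \<phi>[OF that]]]) simp
  next
    fix h assume "rational h"
    then obtain \<chi> where \<chi>: "traces 1 h \<chi>" using ex_traces by blast
    obtain c \<beta> where \<beta>: "\<beta> \<in> Omega 2 (V 1) 0"
      and eq: "\<And>y vs. \<chi> y vs = (\<Sum>j\<in>J. c j * \<phi> j y vs) + nabla 2 (V 1) \<omega> \<beta> y vs"
      using S[OF traces_Omega[OF \<chi>, unfolded two]] by blast
    show "\<exists>c g. rational g \<and> (\<forall>x. x \<notin> P \<longrightarrow> h x = (\<Sum>j\<in>J. c j * \<phi> j (sg x) [dsg]) + nab w g x)"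
    proof (intro exI[of _ c] exI[of _ "\<lambda>x. \<beta> (sg x) []"] conjI allI impI rational_function_line \<beta>)
      fix x assume x: "x \<notin> P"
      then have "regpt 1 (\<lambda>_. x)" by (simp add: regpt_1[unfolded One_nat_def])
      from traces_tg[OF \<chi> this, of 0] have "h x = \<chi> (sg x) [dsg]" unfolding pt_1 tg_1 by simp
      then show "h x = (\<Sum>j\<in>J. c j * \<phi> j (sg x) [dsg]) + nab w (\<lambda>x. \<beta> (sg x) []) x"
        unfolding eq nabla_function_line[OF \<omega> \<beta> x] .
    qed
  next
    fix c g j assume g: "rational g" and j: "j \<in> J"
      and eq: "\<forall>x. x \<notin> P \<longrightarrow> (\<Sum>j\<in>J. c j * \<phi> j (sg x) [dsg]) = nab w g x"
    obtain \<theta> where \<theta>: "fun_traces 1 g \<theta>" using ex_fun_traces[OF g] by blast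
    then have \<theta>': "\<theta> \<in> Omega 2 (V 1) 0" by (simp add: fun_traces_def numeral_2_eq_2)
    have \<theta>g: "\<theta> (sg x) [] = g x" if "x \<notin> P" for x
    proof -
      have "regpt 1 (\<lambda>_. x)" using that by (simp add: regpt_1[unfolded One_nat_def])
      from \<theta>[unfolded fun_traces_def, THEN conjunct2, rule_format, OF this]
      show ?thesis unfolding pt_1 by simp
    qed
    \<comment> \<open>The relation is known only along the affine coordinate; a 1-form on
      \<open>V 1\<close> is determined there, so it holds between forms on the cone.\<close>
    have "(\<lambda>y vs. \<Sum>j\<in>J. c j * \<phi> j y vs) = nabla (1 + 1) (V 1) \<omega> \<theta>"
    proof (rule Omega_top_unique)
      show "(\<lambda>y vs. \<Sum>j\<in>J. c j * \<phi> j y vs) \<in> Omega (1 + 1) (V 1) 1"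
        unfolding two by (intro Omega_sum \<phi>)
      show "nabla (1 + 1) (V 1) \<omega> \<theta> \<in> Omega (1 + 1) (V 1) 1"
        unfolding two using nabla_Omega[OF U \<omega>' \<theta>'] by simp
      fix t assume "regpt 1 t"
      then have x: "t 0 \<notin> P" by (simp add: regpt_1[unfolded One_nat_def])
      have "open (- P)" by (intro open_Compl finite_imp_closed finite_P)
      then have "\<forall>\<^sub>F x in nhds (t 0). x \<in> - P" using x by (intro eventually_nhds_in_open) auto
      then have "\<forall>\<^sub>F x in nhds (t 0). \<theta> (sg x) [] = g x" by eventually_elim (use \<theta>g in simp)
      then have "deriv (\<lambda>x. \<theta> (sg x) []) (t 0) = deriv g (t 0)" by (rule deriv_cong_ev) simp
      then have "nab w (\<lambda>x. \<theta> (sg x) []) (t 0) = nab w g (t 0)" by (simp add: nab_def \<theta>g[OF x])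
      then show "(\<Sum>j\<in>J. c j * \<phi> j (pt 1 t) (tgs 1 t)) = nabla (1 + 1) (V 1) \<omega> \<theta> (pt 1 t) (tgs 1 t)"
        unfolding pt_1 tgs_1 two nabla_function_line[OF \<omega> \<theta>' x] using eq x by simp
    qed
    then show "c j = 0" using I[OF \<theta>' _ j, of c] unfolding two by (metis (no_types, lifting))
  qed
qed

end

section \<open>The differentials \<open>d theta_m\<close> as logarithmic differentials\<close>

lemma fps_inverse_agree:
  fixes f g :: "complex fps"
  assumes "\<And>j. j \<le> m \<Longrightarrow> fps_nth f j = fps_nth g j" "fps_nth f 0 \<noteq> 0"
  shows "n \<le> m \<Longrightarrow> fps_nth (inverse f) n = fps_nth (inverse g) n"
proof (induction n rule: less_induct)
  case (less n)
  have g0: "fps_nth g 0 \<noteq> 0" using assms(1)[of 0] assms(2) by simp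
  show ?case
  proof (cases "n = 0")
    case True
    then show ?thesis using assms(1)[of 0] by simp
  next
    case False
    have "(\<Sum>i\<in>{Suc 0..n}. fps_nth f i * fps_nth (inverse f) (n - i)) =
      (\<Sum>i\<in>{Suc 0..n}. fps_nth g i * fps_nth (inverse g) (n - i))"
      by (intro sum.cong refl) (use less assms(1) in auto)
    then show ?thesis
      using False assms(1)[of 0] by (simp add: fps_nth_inverse_Suc[OF assms(2)] fps_nth_inverse_Suc[OF g0])
  qed
qed

text \<open>The vector \<open>y w^(k)\<close> has only as many specified entries as the block has
  columns, whereas the series of the curve continues with zeros. Comparison is therefore limited to
  coefficients up to \<open>m\<close>.\<close>

lemma fps_mult_inverse_agree:
  fixes f g f' g' :: "complex fps"
  assumes "\<And>j. j \<le> m \<Longrightarrow> fps_nth f j = fps_nth f' j" "\<And>j. j \<le> m \<Longrightarrow> fps_nth g j = fps_nth g' j"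
    "fps_nth g 0 \<noteq> 0"
  shows "fps_nth (f * inverse g) m = fps_nth (f' * inverse g') m"
  unfolding fps_mult_nth using assms(1) fps_inverse_agree[OF assms(2,3)] by (intro sum.cong refl) simp

lemma fps_inverse_tendsto:
  fixes f :: "complex \<Rightarrow> complex fps"
  assumes f: "\<And>n. ((\<lambda>t. fps_nth (f t) n) \<longlongrightarrow> fps_nth g n) F" and g: "fps_nth g 0 \<noteq> 0"
  shows "((\<lambda>t. fps_nth (inverse (f t)) n) \<longlongrightarrow> fps_nth (inverse g) n) F"
proof (induction n rule: less_induct)
  case (less n)
  have ev: "\<forall>\<^sub>F t in F. fps_nth (f t) 0 \<noteq> 0" by (rule tendsto_imp_eventually_ne[OF f g])
  show ?case
  proof (cases "n = 0")
    case True
    then show ?thesis using tendsto_inverse[OF f[of 0] g] by simp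
  next
    case False
    have "((\<lambda>t. - inverse (fps_nth (f t) 0) * (\<Sum>i\<in>{Suc 0..n}. fps_nth (f t) i * fps_nth (inverse (f t)) (n - i)))
      \<longlongrightarrow> - inverse (fps_nth g 0) * (\<Sum>i\<in>{Suc 0..n}. fps_nth g i * fps_nth (inverse g) (n - i))) F"
      by (intro tendsto_mult tendsto_minus tendsto_inverse tendsto_sum f g less) (use False in auto)
    moreover have "\<forall>\<^sub>F t in F. - inverse (fps_nth (f t) 0) *
        (\<Sum>i\<in>{Suc 0..n}. fps_nth (f t) i * fps_nth (inverse (f t)) (n - i)) = fps_nth (inverse (f t)) n"
      using ev by eventually_elim (use False in \<open>simp add: fps_nth_inverse_Suc[of _ n]\<close>)
    ultimately show ?thesis
      using False by (simp only: fps_nth_inverse_Suc[OF g, of n] tendsto_cong)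
  qed
qed

text \<open>Differentiation in \<open>T\<close> turns the logarithm into \<open>X' / X\<close>. The
  constant term, and with it the branch of the logarithm, disappears, and the factor
  \<open>x 0\<close> that was divided out cancels.\<close>

lemma theta_eq:
  assumes "x 0 \<noteq> 0"
  shows "theta (Suc n) x = fps_nth (fps_deriv (Abs_fps x) * inverse (Abs_fps x)) n / of_nat (Suc n)"
proof -
  let ?a = "Abs_fps (\<lambda>j. if j = 0 then 0 else x j / x 0)"
  have a0: "fps_nth ?a 0 = 0" by simp
  have X: "Abs_fps x = fps_const (x 0) * (1 + ?a)"
    using assms by (intro fps_ext) (simp add: fps_mult_left_const_nth)
  have "fps_deriv (fps_ln 1 oo ?a) = (inverse (1 + fps_X) oo ?a) * fps_deriv ?a"
    using fps_compose_deriv[OF a0, of "fps_ln (1 :: complex)"] by (simp add: fps_ln_deriv)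
  also have "inverse (1 + fps_X) oo ?a = inverse (1 + ?a)"
  proof -
    have "inverse (1 + fps_X) oo ?a = inverse ((1 + fps_X) oo ?a)"
      by (rule fps_inverse_compose[OF a0]) simp
    also have "(1 + fps_X) oo ?a = 1 + ?a" by (simp add: fps_compose_add_distrib a0)
    finally show ?thesis .
  qed
  finally have d: "fps_deriv (fps_ln 1 oo ?a) = fps_deriv ?a * inverse (1 + ?a)" by (simp add: mult.commute)
  have "fps_const (x 0) * inverse (fps_const (x 0)) = 1"
    using inverse_mult_eq_1'[of "fps_const (x 0)"] assms by simp
  then have "(fps_const (x 0) * inverse (fps_const (x 0))) * (fps_deriv (1 + ?a) * inverse (1 + ?a)) =
    fps_deriv (1 + ?a) * inverse (1 + ?a)" by (simp only: mult_1)
  moreover have "fps_deriv (Abs_fps x) = fps_const (x 0) * fps_deriv (1 + ?a)" unfolding X by simp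
  ultimately have "fps_deriv (Abs_fps x) * inverse (Abs_fps x) = fps_deriv ?a * inverse (1 + ?a)"
    unfolding X fps_inverse_mult by (simp only: mult_ac) simp
  then have F: "fps_nth (fps_deriv (Abs_fps x) * inverse (Abs_fps x)) n =
      of_nat (Suc n) * fps_nth (fps_ln 1 oo ?a) (Suc n)"
    unfolding d[symmetric] by simp
  have "theta (Suc n) x = fps_nth (fps_ln 1 oo ?a) (Suc n)" by (simp add: theta_def)
  then show ?thesis unfolding F by (simp only: nonzero_mult_div_cancel_left[OF of_nat_neq_0])
qed

text \<open>The differential of \<open>log X\<close> in direction \<open>V\<close> is
  \<open>V / X\<close>. With \<open>X_t = X + t V\<close>, the difference
  \<open>X_t' / X_t - X' / X\<close> is exactly \<open>t (V' - X' V / X) / X_t\<close>; as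
  \<open>t\<close> tends to 0 the cofactor of \<open>t\<close> tends to the
  \<open>T\<close>-derivative of \<open>V / X\<close>, and only coefficientwise continuity of the
  inverse is needed.\<close>

lemma dtheta_eq:
  assumes x0: "x 0 \<noteq> 0"
  shows "dtheta m x v = fps_nth (Abs_fps v * inverse (Abs_fps x)) m"
proof (cases m)
  case 0
  then show ?thesis by (simp add: dtheta_def divide_inverse)
next
  case (Suc n)
  let ?X = "Abs_fps x" and ?V = "Abs_fps v"
  let ?Xt = "\<lambda>t. Abs_fps (\<lambda>j. x j + t * v j)"
  \<comment> \<open>For small \<open>t \<noteq> 0\<close> this is the difference quotient of
    \<open>theta (Suc n)\<close> in closed form.\<close>
  define G where "G t = fps_nth ((fps_deriv ?V - fps_deriv ?X * ?V * inverse ?X) * inverse (?Xt t)) n / of_nat (Suc n)" for t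
  have X0: "fps_nth ?X 0 \<noteq> 0" using x0 by simp
  have lim: "((\<lambda>t. fps_nth (?Xt t) k) \<longlongrightarrow> fps_nth ?X k) (at 0)" for k
    by (auto intro!: tendsto_eq_intros)
  have "(G \<longlongrightarrow> fps_nth ((fps_deriv ?V - fps_deriv ?X * ?V * inverse ?X) * inverse ?X) n / of_nat (Suc n)) (at 0)"
    unfolding G_def fps_mult_nth[of _ "inverse _"]
    by (intro tendsto_divide tendsto_sum tendsto_mult tendsto_const fps_inverse_tendsto lim X0)
      (rule of_nat_neq_0)
  also have "fps_nth ((fps_deriv ?V - fps_deriv ?X * ?V * inverse ?X) * inverse ?X) n / of_nat (Suc n) =
    fps_nth (?V * inverse ?X) (Suc n)"
  proof -
    have "fps_deriv (inverse ?X) = - fps_deriv ?X * (inverse ?X)\<^sup>2"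
      by (rule fps_inverse_deriv) (use X0 in simp)
    then have "fps_deriv (?V * inverse ?X) = (fps_deriv ?V - fps_deriv ?X * ?V * inverse ?X) * inverse ?X"
      by (simp add: power2_eq_square algebra_simps)
    from this[symmetric] show ?thesis by (simp add: fps_deriv_nth del: of_nat_Suc fps_deriv_mult)
  qed
  finally have G: "(G \<longlongrightarrow> fps_nth (?V * inverse ?X) (Suc n)) (at 0)" .
  have "\<forall>\<^sub>F t in at 0. x 0 + t * v 0 \<noteq> 0"
    by (rule tendsto_imp_eventually_ne[OF _ x0]) (auto intro!: tendsto_eq_intros)
  moreover have "\<forall>\<^sub>F t :: complex in at 0. t \<noteq> 0" by (rule eventually_neq_at_within)
  ultimately have "\<forall>\<^sub>F t in at 0. G t = (theta (Suc n) (\<lambda>j. x j + (0 + t) * v j) - theta (Suc n) (\<lambda>j. x j + 0 * v j)) / t"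
  proof eventually_elim
    case (elim t)
    have Xt0: "fps_nth (?Xt t) 0 \<noteq> 0" using elim by simp
    have Xt: "?Xt t = ?X + fps_const t * ?V" by (intro fps_ext) simp
    have 1: "?Xt t * inverse (?Xt t) = 1" "?X * inverse ?X = 1"
      using inverse_mult_eq_1'[OF Xt0] inverse_mult_eq_1'[OF X0] by auto
    have "fps_deriv (?Xt t) * inverse (?Xt t) - fps_deriv ?X * inverse ?X =
      fps_deriv (?Xt t) * inverse (?Xt t) * (?X * inverse ?X) - fps_deriv ?X * inverse ?X * (?Xt t * inverse (?Xt t))"
      unfolding 1 by simp
    also have "\<dots> = (fps_deriv (?Xt t) * (?X * inverse ?X) - fps_deriv ?X * inverse ?X * ?Xt t) * inverse (?Xt t)"
      by (simp add: algebra_simps)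
    also have "fps_deriv (?Xt t) * (?X * inverse ?X) - fps_deriv ?X * inverse ?X * ?Xt t =
      fps_const t * (fps_deriv ?V * (?X * inverse ?X) - fps_deriv ?X * ?V * inverse ?X)"
      unfolding Xt by (simp add: algebra_simps)
    finally have "fps_deriv (?Xt t) * inverse (?Xt t) - fps_deriv ?X * inverse ?X =
      fps_const t * ((fps_deriv ?V - fps_deriv ?X * ?V * inverse ?X) * inverse (?Xt t))"
      unfolding 1 by (simp add: mult.assoc)
    from arg_cong[OF this, of "\<lambda>f. fps_nth f n"]
    have d: "fps_nth (fps_deriv (?Xt t) * inverse (?Xt t)) n - fps_nth (fps_deriv ?X * inverse ?X) n =
      t * (of_nat (Suc n) * G t)"
      unfolding G_def by (simp add: fps_mult_left_const_nth del: of_nat_Suc)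
    have "theta (Suc n) (\<lambda>j. x j + t * v j) = fps_nth (fps_deriv (?Xt t) * inverse (?Xt t)) n / of_nat (Suc n)"
      "theta (Suc n) x = fps_nth (fps_deriv ?X * inverse ?X) n / of_nat (Suc n)"
      using elim x0 by (intro theta_eq; simp)+
    then have "theta (Suc n) (\<lambda>j. x j + t * v j) - theta (Suc n) x = t * G t"
      unfolding diff_divide_distrib[symmetric] d by (simp add: diff_divide_distrib[symmetric] d del: of_nat_Suc)
    then show ?case using elim by simp
  qed
  from tendsto_cong[OF this, THEN iffD1, OF G]
  have "((\<lambda>t. theta (Suc n) (\<lambda>j. x j + t * v j)) has_field_derivative fps_nth (?V * inverse ?X) (Suc n)) (at 0)"
    unfolding DERIV_def .
  then show ?thesis unfolding Suc dtheta_def by (simp add: DERIV_imp_deriv)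
qed

section \<open>The Veronese map and the symmetric product map\<close>

text \<open>Veronese entries and coordinates of the symmetric product map are both sums over index
  lists with prescribed total, that is, coefficients of a product of \<open>r\<close> polynomials of
  length \<open>n\<close>.\<close>

lemma sum_lists_prod_fps:
  fixes a :: "nat \<Rightarrow> nat \<Rightarrow> complex"
  assumes r: "0 < r"
  shows "(\<Sum>js\<in>{js. length js = r \<and> set js \<subseteq> {0..<n} \<and> sum_list js = k}. \<Prod>p<r. a p (js ! p)) =
    fps_nth (\<Prod>p<r. Abs_fps (\<lambda>j. if j < n then a p j else 0)) k"
proof -
  obtain m where m: "r = Suc m" using r by (cases r) auto
  let ?f = "\<lambda>p. Abs_fps (\<lambda>j. if j < n then a p j else 0)"
  have e: "{0..m} = {..<r}" unfolding m by auto
  have "fps_nth (\<Prod>p<r. ?f p) k = (\<Sum>v\<in>natpermute k r. \<Prod>p<r. fps_nth (?f p) (v ! p))"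
    using fps_prod_nth[of ?f m k] unfolding e m by simp
  also have "\<dots> = (\<Sum>js\<in>{js. length js = r \<and> set js \<subseteq> {0..<n} \<and> sum_list js = k}. \<Prod>p<r. a p (js ! p))"
  proof (rule sum.mono_neutral_cong_right)
    show "finite (natpermute k r)" by (rule natpermute_finite)
    show "{js. length js = r \<and> set js \<subseteq> {0..<n} \<and> sum_list js = k} \<subseteq> natpermute k r"
      by (auto simp: natpermute_def)
    show "\<forall>v\<in>natpermute k r - {js. length js = r \<and> set js \<subseteq> {0..<n} \<and> sum_list js = k}.
        (\<Prod>p<r. fps_nth (?f p) (v ! p)) = 0"
    proof
      fix v assume v: "v \<in> natpermute k r - {js. length js = r \<and> set js \<subseteq> {0..<n} \<and> sum_list js = k}"
      then have l: "length v = r" "sum_list v = k" by (auto simp: natpermute_def)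
      then have "\<not> set v \<subseteq> {0..<n}" using v by blast
      then obtain x where "x \<in> set v" "\<not> x < n" by (auto simp: subset_eq)
      then obtain p where "p < r" "\<not> v ! p < n" using l by (metis in_set_conv_nth)
      then show "(\<Prod>p<r. fps_nth (?f p) (v ! p)) = 0" by (intro prod_zero) auto
    qed
    fix v assume "v \<in> {js. length js = r \<and> set js \<subseteq> {0..<n} \<and> sum_list js = k}"
    then have "set v \<subseteq> {0..<n}" "length v = r" by auto
    then have "v ! p < n" if "p < r" for p using that by (metis atLeastLessThan_iff nth_mem subsetD)
    then show "(\<Prod>p<r. fps_nth (?f p) (v ! p)) = (\<Prod>p<r. a p (v ! p))" by (intro prod.cong) auto
  qed
  finally show ?thesis by simp
qed

lemma sym_map_eq_lin_prod:
  assumes "0 < r"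
  shows "sym_map r ss = lin_prod r ((!) ss)"
proof -
  have e: "{0, 1} = {0..<2 :: nat}" by auto
  have "Abs_fps (\<lambda>j. if j < 2 then u $ j else 0) = fps_const (u $ 0) + fps_const (u $ 1) * fps_X"
    for u :: "complex vec"
  proof (intro fps_ext)
    fix n :: nat
    consider "n = 0" | "n = 1" | "2 \<le> n" by linarith
    then show "fps_nth (Abs_fps (\<lambda>j. if j < 2 then u $ j else 0)) n =
      fps_nth (fps_const (u $ 0) + fps_const (u $ 1) * fps_X) n" by cases auto
  qed
  then have "(\<Sum>js\<in>{js. length js = r \<and> set js \<subseteq> {0..<2} \<and> sum_list js = k}. \<Prod>p<r. ss ! p $ (js ! p)) =
      fps_nth (lin_series r ((!) ss)) k" for k
    unfolding sum_lists_prod_fps[OF assms, where a = "\<lambda>p j. ss ! p $ j"] lin_series_def by (simp only:)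
  then show ?thesis unfolding sym_map_def lin_prod_def e by simp
qed

definition row_series :: "complex mat \<Rightarrow> nat \<Rightarrow> complex fps" where
  "row_series A i = Abs_fps (\<lambda>j. if j < dim_col A then A $$ (i, j) else 0)"

lemma veronese_block_nth:
  assumes r: "0 < r" and ij: "i \<le> r" "j < dim_col A"
  shows "veronese_block r A $$ (i, j) = fps_nth (row_series A 0 ^ (r - i) * row_series A 1 ^ i) j"
proof -
  have "veronese_block r A $$ (i, j) =
    fps_nth (\<Prod>p<r. Abs_fps (\<lambda>j. if j < dim_col A then A $$ (if p < r - i then 0 else 1, j) else 0)) j"
    unfolding veronese_block_def using ij
    by (simp add: sum_lists_prod_fps[OF r, where n = "dim_col A" and k = j
      and a = "\<lambda>p j. A $$ (if p < r - i then 0 else 1, j)"])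
  also have "(\<Prod>p<r. Abs_fps (\<lambda>j. if j < dim_col A then A $$ (if p < r - i then 0 else 1, j) else 0)) =
    (\<Prod>p<r. if p < r - i then row_series A 0 else row_series A 1)"
  proof (intro prod.cong refl)
    fix p
    show "Abs_fps (\<lambda>j. if j < dim_col A then A $$ (if p < r - i then 0 else 1, j) else 0) =
        (if p < r - i then row_series A 0 else row_series A 1)"
      unfolding row_series_def by (cases "p < r - i") (simp_all only: if_True if_False)
  qed
  also have "\<dots> = row_series A 0 ^ (r - i) * row_series A 1 ^ i"
  proof -
    have "{..<r} \<inter> {p. p < r - i} = {..<r - i}" "{..<r} \<inter> - {p. p < r - i} = {r - i..<r}" by auto
    then show ?thesis using ij by (simp add: prod.If_cases)
  qed
  finally show ?thesis .
qed

lemma concat_nth_offset: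
  "k < length xss \<Longrightarrow> j < length (xss ! k) \<Longrightarrow>
    concat xss ! (sum_list (map length (take k xss)) + j) = xss ! k ! j"
proof (induction xss arbitrary: k)
  case (Cons xs xss)
  then show ?case by (cases k) (auto simp: nth_append add.assoc)
qed simp

lemma block_veronese:
  assumes k: "k < length lam" and j: "j < lam ! k" and i: "i \<le> r" and z: "dim_row z = 2"
  shows "block lam (veronese lam r z) k $$ (i, j) = veronese_block r (block lam z k) $$ (i, j)"
proof -
  let ?xss = "map (\<lambda>k. cols (veronese_block r (block lam z k))) [0..<length lam]"
  have len: "map length ?xss = lam"
    by (intro nth_equalityI) (auto simp: veronese_block_def block_def)
  have off: "sum_list (map length (take k ?xss)) = sum_list (take k lam)"
    unfolding take_map[symmetric] len ..
  have lenk: "length (?xss ! k) = lam ! k" using k by (simp add: veronese_block_def block_def)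
  have lt: "sum_list (take k lam) + j < length (concat ?xss)"
  proof -
    have "sum_list lam = sum_list (take k lam @ lam ! k # drop (Suc k) lam)"
      using id_take_nth_drop[OF k] by simp
    then have "sum_list (take k lam) + lam ! k \<le> sum_list lam" by simp
    then show ?thesis using j unfolding length_concat len by simp
  qed
  have "block lam (veronese lam r z) k $$ (i, j) = veronese lam r z $$ (i, sum_list (take k lam) + j)"
    using i j by (simp add: block_def veronese_def)
  also have "\<dots> = concat ?xss ! (sum_list (take k lam) + j) $ i"
    unfolding veronese_def using i lt by (subst mat_of_cols_index) auto
  also have "concat ?xss ! (sum_list (take k lam) + j) = ?xss ! k ! j"
    using concat_nth_offset[of k ?xss j] k j lenk unfolding off by simp
  also have "?xss ! k ! j $ i = veronese_block r (block lam z k) $$ (i, j)"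
    using k j i by (simp add: veronese_block_def block_def)
  finally show ?thesis .
qed

section \<open>Consequences of genericity\<close>

lemma det_2x2:
  fixes A :: "complex mat"
  assumes A: "A \<in> carrier_mat 2 2"
  shows "det A = A $$ (0, 0) * A $$ (1, 1) - A $$ (0, 1) * A $$ (1, 0)"
proof -
  have D: "det (mat_delete A 0 j) = mat_delete A 0 j $$ (0, 0)" for j
    by (rule det_single) (use mat_delete_carrier[OF A, of 0 j] in simp)
  have "det A = (\<Sum>j<2. A $$ (0, j) * cofactor A 0 j)" by (rule laplace_expansion_row[OF A]) simp
  also have "\<dots> = A $$ (0, 0) * A $$ (1, 1) - A $$ (0, 1) * A $$ (1, 0)"
    using A by (simp add: numeral_2_eq_2 cofactor_def D[unfolded One_nat_def]) (simp add: mat_delete_def)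
  finally show ?thesis .
qed

lemma generic_det:
  assumes z: "z \<in> generic_stratum lam 2"
    and mu: "length mu = length lam" "\<And>k. k < length lam \<Longrightarrow> mu ! k \<le> lam ! k" "sum_list mu = 2"
    and cs: "concat (map (\<lambda>k. map (col (block lam z k)) [0..<mu ! k]) [0..<length lam]) = [u, v]"
  shows "u $ 0 * v $ 1 - v $ 0 * u $ 1 \<noteq> 0"
proof -
  have "dim_row z = 2" using z by (auto simp: generic_stratum_def)
  moreover have "det (sub_mu lam z mu) \<noteq> 0" using z mu by (auto simp: generic_stratum_def)
  moreover have "mat_of_cols 2 [u, v] \<in> carrier_mat 2 2"
    using mat_of_cols_carrier(1)[of 2 "[u, v]"] by (simp add: numeral_2_eq_2)
  ultimately show ?thesis
    unfolding sub_mu_def using det_2x2[of "mat_of_cols 2 [u, v]"] cs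
    by (simp add: mat_of_cols_index[unfolded numeral_2_eq_2] numeral_2_eq_2)
qed

text \<open>The choice of \<open>mu\<close> with entry 1 at 0 and at \<open>l\<close>, and 0
  elsewhere, selects the first columns of these two blocks: the puncture of block \<open>l\<close>
  differs from that of block 0.\<close>

lemma generic_pair:
  assumes z: "z \<in> generic_stratum lam 2" and l: "0 < l" "l < length lam" and pos: "\<forall>n\<in>set lam. 1 \<le> n"
  shows "col (block lam z 0) 0 $ 0 * col (block lam z l) 0 $ 1 -
    col (block lam z l) 0 $ 0 * col (block lam z 0) 0 $ 1 \<noteq> 0"
proof -
  define h where "h i = (if i = 0 \<or> i = l then 1 else 0 :: nat)" for i
  have split: "[0..<length lam] = 0 # [1..<l] @ l # [Suc l..<length lam]"
  proof -
    have "[0..<length lam] = [0..<l] @ [l..<length lam]"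
      using upt_add_eq_append[of 0 l "length lam - l"] l by simp
    also have "[0..<l] = 0 # [1..<l]" using l upt_conv_Cons[of 0 l] by simp
    also have "[l..<length lam] = l # [Suc l..<length lam]" using l by (simp add: upt_conv_Cons)
    finally show ?thesis by simp
  qed
  have z0: "sum_list (map h xs) = 0" "concat (map (\<lambda>k. map (col (block lam z k)) [0..<h k]) xs) = []"
    if "0 \<notin> set xs" "l \<notin> set xs" for xs
  proof -
    have h0: "h i = 0" if "i \<in> set xs" for i
      using that \<open>0 \<notin> set xs\<close> \<open>l \<notin> set xs\<close> by (metis h_def)
    have "map h xs = map (\<lambda>_. 0) xs" using h0 by (intro map_cong) simp_all
    then show "sum_list (map h xs) = 0" by simp
    show "concat (map (\<lambda>k. map (col (block lam z k)) [0..<h k]) xs) = []"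
      using h0 by simp
  qed
  show ?thesis
  proof (rule generic_det[OF z, of "map h [0..<length lam]"])
    show "map h [0..<length lam] ! k \<le> lam ! k" if "k < length lam" for k
      using pos nth_mem[OF that] that by (auto simp: h_def)
    show "sum_list (map h [0..<length lam]) = 2"
      unfolding split using z0(1)[of "[1..<l]"] z0(1)[of "[Suc l..<length lam]"] l by (simp add: h_def[of 0] h_def[of l])
    have "concat (map (\<lambda>k. map (col (block lam z k)) [0..<map h [0..<length lam] ! k]) [0..<length lam]) =
      concat (map (\<lambda>k. map (col (block lam z k)) [0..<h k]) [0..<length lam])"
      by (intro arg_cong[of _ _ concat] map_cong) auto
    also have "\<dots> = [col (block lam z 0) 0, col (block lam z l) 0]"
    proof -
      have z1: "concat (map (\<lambda>k. map (col (block lam z k)) [0..<h k]) [1..<l]) = []"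
        by (rule z0(2)) auto
      have z2: "concat (map (\<lambda>k. map (col (block lam z k)) [0..<h k]) [Suc l..<length lam]) = []"
        by (rule z0(2)) (use l in auto)
      show ?thesis unfolding split
        by (simp only: map_append list.map concat.simps concat_append z1 z2) (simp add: h_def)
    qed
    finally show "concat (map (\<lambda>k. map (col (block lam z k)) [0..<map h [0..<length lam] ! k]) [0..<length lam]) =
      [col (block lam z 0) 0, col (block lam z l) 0]" .
  qed simp
qed

text \<open>With a single block there is no second puncture to compare with; the choice
  \<open>mu = [2]\<close> shows that the first column is nonzero, being independent of the
  second.\<close>

lemma generic_single:
  assumes z: "z \<in> generic_stratum [n] 2" and n: "2 \<le> n"
  shows "col (block [n] z 0) 0 $ 0 * col (block [n] z 0) 1 $ 1 -
    col (block [n] z 0) 1 $ 0 * col (block [n] z 0) 0 $ 1 \<noteq> 0"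
  by (rule generic_det[OF z, of "[2]"]) (use n in \<open>auto simp: numeral_2_eq_2\<close>)

section \<open>The forms \<open>omega\<close>\<close>

abbreviation curve :: "nat list \<Rightarrow> complex mat \<Rightarrow> nat \<Rightarrow> nat \<Rightarrow> complex fps" where
  "curve lam z i k \<equiv> row_series (block lam z k) i"

text \<open>The blocks of \<open>u\<close> are the Veronese images of the blocks of \<open>z\<close>; for \<open>r = 1\<close> this holds with \<open>u = z\<close>.\<close>
definition veronese_image :: "nat list \<Rightarrow> complex mat \<Rightarrow> nat \<Rightarrow> complex mat \<Rightarrow> bool" where
  "veronese_image lam z r u \<longleftrightarrow> dim_row u = r + 1 \<and> (\<forall>k<length lam. \<forall>j<lam ! k. \<forall>i\<le>r.
    block lam u k $$ (i, j) = fps_nth (curve lam z 0 k ^ (r - i) * curve lam z 1 k ^ i) j)"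

lemma veronese_image_self:
  assumes "dim_row z = 2"
  shows "veronese_image lam z 1 z"
  unfolding veronese_image_def
proof (intro conjI allI impI)
  fix k j i assume "k < length lam" "j < lam ! k" "i \<le> (1 :: nat)"
  then have "i = 0 \<or> i = 1" "j < dim_col (block lam z k)" by (auto simp: block_def)
  then show "block lam z k $$ (i, j) = fps_nth (curve lam z 0 k ^ (1 - i) * curve lam z 1 k ^ i) j"
    by (auto simp: row_series_def)
qed (use assms in simp)

lemma veronese_image_veronese:
  assumes "0 < r" "dim_row z = 2"
  shows "veronese_image lam z r (veronese lam r z)"
  unfolding veronese_image_def
proof (intro conjI allI impI)
  show "dim_row (veronese lam r z) = r + 1" by (simp add: veronese_def)
  fix k j i assume k: "k < length lam" and j: "j < lam ! k" and i: "i \<le> r"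
  have "j < dim_col (block lam z k)" using j by (simp add: block_def)
  then show "block lam (veronese lam r z) k $$ (i, j) = fps_nth (curve lam z 0 k ^ (r - i) * curve lam z 1 k ^ i) j"
    unfolding block_veronese[OF k j i assms(2)] by (rule veronese_block_nth[OF assms(1) i])
qed

text \<open>The row vector of \<open>y\<close> times a block consists of the coefficients of the
  binary form \<open>y\<close> evaluated along the curve given by the block of
  \<open>z\<close>.\<close>

lemma block_mult_vec:
  assumes u: "veronese_image lam z r u" and k: "k < length lam" and j: "j < lam ! k"
    and y: "y \<in> carrier_vec (r + 1)"
  shows "(transpose_mat (block lam u k) *\<^sub>v y) $ j = fps_nth (fform r (curve lam z 0 k) (curve lam z 1 k) y) j"
    and "scalar_prod y (col (block lam u k) j) = fps_nth (fform r (curve lam z 0 k) (curve lam z 1 k) y) j"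
proof -
  have dims: "dim_row (block lam u k) = r + 1" "dim_col (block lam u k) = lam ! k"
    using u by (auto simp: veronese_image_def block_def)
  have "scalar_prod y (col (block lam u k) j) = (\<Sum>i<r + 1. y $ i * block lam u k $$ (i, j))"
    unfolding scalar_prod_def using dims j by (simp add: atLeast0LessThan)
  also have "\<dots> = fps_nth (fform r (curve lam z 0 k) (curve lam z 1 k) y) j"
    unfolding fform_nth Suc_eq_plus1[symmetric] lessThan_Suc_atMost
    using u k j by (intro sum.cong refl) (auto simp: veronese_image_def)
  finally show 1: "scalar_prod y (col (block lam u k) j) = fps_nth (fform r (curve lam z 0 k) (curve lam z 1 k) y) j" .
  have "col (block lam u k) j \<in> carrier_vec (r + 1)" using dims by (simp add: carrier_vecI)
  then show "(transpose_mat (block lam u k) *\<^sub>v y) $ j = fps_nth (fform r (curve lam z 0 k) (curve lam z 1 k) y) j"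
    using dims j 1 comm_scalar_prod[OF _ y] by simp
qed

section \<open>The arrangement and the forms \<open>omega\<close> in the affine coordinate\<close>

context punctured_line
begin

text \<open>Punctures are points of the projective line, while the locale fixes representatives; the
  first column of a block is such a representative up to the factor \<open>\<mu>\<close>.\<close>

definition puncture_at :: "complex \<Rightarrow> complex \<Rightarrow> bool" where
  "puncture_at c0 c1 \<longleftrightarrow> (\<exists>\<mu>. \<mu> \<noteq> 0 \<and> ((c0 = \<mu> * a0 \<and> c1 = \<mu> * a1) \<or>
    (\<exists>p\<in>P. c0 = \<mu> * (b0 - p * a0) \<and> c1 = \<mu> * (b1 - p * a1))))"

context
  fixes lam :: "nat list" and z :: "complex mat"
  assumes pos: "\<forall>n\<in>set lam. 1 \<le> n"
    and punctures: "\<And>k. k < length lam \<Longrightarrow>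
      puncture_at (fps_nth (curve lam z 0 k) 0) (fps_nth (curve lam z 1 k) 0)"
    and inf: "\<exists>k<length lam. fps_nth (curve lam z 0 k) 0 = a0 \<and> fps_nth (curve lam z 1 k) 0 = a1"
    and fin: "\<And>p. p \<in> P \<Longrightarrow> \<exists>k<length lam. \<exists>\<mu>. fps_nth (curve lam z 0 k) 0 = \<mu> * (b0 - p * a0) \<and>
      fps_nth (curve lam z 1 k) 0 = \<mu> * (b1 - p * a1)"
begin

text \<open>The first column of a block of \<open>u\<close> is the Veronese vector of the puncture,
  and rescaling the representative by \<open>\<mu>\<close> rescales the pairing by
  \<open>\<mu> ^ r\<close>.\<close>

lemma arr_cone_eq_V:
  assumes u: "veronese_image lam z r u" and r: "0 < r"
  shows "arr_cone lam u = V r"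
proof -
  have dim: "dim_row u = r + 1" using u by (simp add: veronese_image_def)
  have s: "scalar_prod y (col (block lam u k) 0) = cform r (fps_nth (curve lam z 0 k) 0) (fps_nth (curve lam z 1 k) 0) y"
    if "y \<in> carrier_vec (r + 1)" "k < length lam" for y k
    using block_mult_vec(2)[OF u that(2) _ that(1), of 0] pos nth_mem[OF that(2)] unfolding fform_nth_0
    by (metis One_nat_def Suc_le_lessD)
  show ?thesis
  proof (intro equalityI subsetI)
    fix y assume "y \<in> arr_cone lam u"
    then have y: "y \<in> carrier_vec (r + 1)" and nz: "\<And>k. k < length lam \<Longrightarrow>
        cform r (fps_nth (curve lam z 0 k) 0) (fps_nth (curve lam z 1 k) 0) y \<noteq> 0"
      using s dim by (auto simp: arr_cone_def)
    have "cform r a0 a1 y \<noteq> 0" using inf nz by metis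
    moreover have "cform r (b0 - p * a0) (b1 - p * a1) y \<noteq> 0" if p: "p \<in> P" for p
    proof -
      obtain k \<mu> where "k < length lam" "fps_nth (curve lam z 0 k) 0 = \<mu> * (b0 - p * a0)"
        "fps_nth (curve lam z 1 k) 0 = \<mu> * (b1 - p * a1)" using fin[OF p] by blast
      then have "\<mu> ^ r * cform r (b0 - p * a0) (b1 - p * a1) y \<noteq> 0" using nz by (metis cform_scale)
      then show ?thesis by auto
    qed
    ultimately show "y \<in> V r" using y by (simp add: V_def)
  next
    fix y assume y: "y \<in> V r"
    have yc: "y \<in> carrier_vec (r + 1)" using y by (simp add: V_def)
    have "cform r (fps_nth (curve lam z 0 k) 0) (fps_nth (curve lam z 1 k) 0) y \<noteq> 0" if k: "k < length lam" for k
    proof -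
      obtain \<mu> c0 c1 where c: "\<mu> \<noteq> 0" "cform r c0 c1 y \<noteq> 0" "fps_nth (curve lam z 0 k) 0 = \<mu> * c0"
        "fps_nth (curve lam z 1 k) 0 = \<mu> * c1"
        using punctures[OF k] y unfolding puncture_at_def V_def by blast
      then show ?thesis by (simp add: cform_scale)
    qed
    then show "y \<in> arr_cone lam u" using s[OF yc] yc dim by (simp add: arr_cone_def)
  qed
qed

text \<open>The trace is written in terms of \<open>z\<close> alone and mentions neither
  \<open>r\<close> nor \<open>u\<close>. The form on \<open>X\<close>, which is the case
  \<open>r = 1\<close> and \<open>u = z\<close>, and the form on \<open>Y\<close> thus have the same
  trace, which says that the second pulls back to the sum of the copies of the first.\<close>

lemma traces_omega:
  assumes u: "veronese_image lam z r u" and r: "0 < r"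
    and bal: "(\<Sum>k<length lam. vblock lam \<alpha> k $ 0) = 0"
  shows "traces r (\<lambda>x. \<Sum>(k, i)\<in>(SIGMA k:{..<length lam}. {..<lam ! k}). vblock lam \<alpha> k $ i *
      fps_nth (dsform (curve lam z 0 k) (curve lam z 1 k) * inverse (sform (curve lam z 0 k) (curve lam z 1 k) x)) i)
    (omega lam \<alpha> u)"
proof -
  let ?K = "SIGMA k:{..<length lam}. {..<lam ! k}"
  let ?d = "\<lambda>y vs. \<Sum>\<kappa>\<in>?K. vblock lam \<alpha> (fst \<kappa>) $ snd \<kappa> *
    dlog r (curve lam z 0 (fst \<kappa>)) (curve lam z 1 (fst \<kappa>)) (snd \<kappa>) y (vs ! 0 :: complex vec)"
  have dim: "dim_row u = r + 1" using u by (simp add: veronese_image_def)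
  have V: "arr_cone lam u = V r" by (rule arr_cone_eq_V[OF u r])
  have pos': "0 < lam ! k" if "k < length lam" for k using pos nth_mem[OF that] by fastforce
  have av: "avoids r (curve lam z 0 k) (curve lam z 1 k)" if k: "k < length lam" for k
    unfolding avoids_def
  proof
    fix y assume "y \<in> V r"
    then have y: "y \<in> arr_cone lam u" "y \<in> carrier_vec (r + 1)" by (auto simp: V V_def)
    then have "scalar_prod y (col (block lam u k) 0) \<noteq> 0" using k by (simp add: arr_cone_def)
    then show "cform r (fps_nth (curve lam z 0 k) 0) (fps_nth (curve lam z 1 k) 0) y \<noteq> 0"
      unfolding block_mult_vec(2)[OF u k pos'[OF k] y(2)] fform_nth_0 .
  qed
  have "omega lam \<alpha> u = form_on (r + 1) (V r) 1 ?d"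
  proof (intro ext)
    fix y vs
    show "omega lam \<alpha> u y vs = form_on (r + 1) (V r) 1 ?d y vs"
    proof (cases "y \<in> V r \<and> length vs = 1 \<and> set vs \<subseteq> carrier_vec (r + 1)")
      case False
      then show ?thesis unfolding omega_def form_on_def dim V by (simp only: if_False)
    next
      case True
      then have y: "y \<in> V r" "y \<in> carrier_vec (r + 1)" and v: "vs ! 0 \<in> carrier_vec (r + 1)"
        by (auto simp: V_def)
      have "dtheta i (\<lambda>j. (transpose_mat (block lam u k) *\<^sub>v y) $ j) (\<lambda>j. (transpose_mat (block lam u k) *\<^sub>v (vs ! 0)) $ j) =
        dlog r (curve lam z 0 k) (curve lam z 1 k) i y (vs ! 0)" if k: "k < length lam" and i: "i < lam ! k" for k i
      proof -
        have x0: "(transpose_mat (block lam u k) *\<^sub>v y) $ 0 \<noteq> 0"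
          using block_mult_vec(1)[OF u k pos'[OF k] y(2)] avoids_nz[OF av[OF k] y(1)] by simp
        show ?thesis unfolding dlog_def dtheta_eq[of "\<lambda>j. (transpose_mat (block lam u k) *\<^sub>v y) $ j", OF x0]
          by (rule fps_mult_inverse_agree)
            (use x0 i block_mult_vec(1)[OF u k _ v] block_mult_vec(1)[OF u k _ y(2)] in auto)
      qed
      then have "(\<Sum>k<length lam. \<Sum>i<lam ! k. vblock lam \<alpha> k $ i *
          dtheta i (\<lambda>j. (transpose_mat (block lam u k) *\<^sub>v y) $ j) (\<lambda>j. (transpose_mat (block lam u k) *\<^sub>v (vs ! 0)) $ j)) =
        (\<Sum>k<length lam. \<Sum>i<lam ! k. vblock lam \<alpha> k $ i * dlog r (curve lam z 0 k) (curve lam z 1 k) i y (vs ! 0))"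
        by (intro sum.cong refl) simp
      also have "\<dots> = ?d y vs" by (simp add: sum.Sigma case_prod_beta)
      finally show ?thesis unfolding omega_def form_on_def dim V using True by (simp only: if_True)
    qed
  qed
  moreover have "traces r (\<lambda>x. \<Sum>\<kappa>\<in>?K. vblock lam \<alpha> (fst \<kappa>) $ snd \<kappa> *
      fps_nth (dsform (curve lam z 0 (fst \<kappa>)) (curve lam z 1 (fst \<kappa>)) *
        inverse (sform (curve lam z 0 (fst \<kappa>)) (curve lam z 1 (fst \<kappa>)) x)) (snd \<kappa>))
    (form_on (r + 1) (V r) 1 ?d)"
  proof (rule traces_dlog)
    have "{\<kappa> \<in> ?K. snd \<kappa> = 0} = (\<lambda>k. (k, 0)) ` {..<length lam}" using pos' by auto
    then show "(\<Sum>\<kappa>\<in>{\<kappa> \<in> ?K. snd \<kappa> = 0}. vblock lam \<alpha> (fst \<kappa>) $ snd \<kappa>) = 0"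
      using bal by (simp add: sum.reindex inj_on_def)
  qed (use av in auto)
  ultimately show ?thesis by (simp add: case_prod_beta)
qed

end

text \<open>The pullback identity is evaluated with all but one of the \<open>r\<close> points
  standing still. The image then moves along a line with direction \<open>tg r t p\<close>, so the
  derivative in \<open>sym_pullback\<close> is this vector.\<close>

lemma traces_pullback:
  assumes r: "0 < r" and \<phi>: "\<phi> \<in> Omega 2 (V 1) 1" and \<psi>: "\<psi> \<in> Omega (r + 1) (V r) 1"
    and pb: "\<And>ss us. length ss = r \<Longrightarrow> set ss \<subseteq> V 1 \<Longrightarrow> length us = r \<Longrightarrow> set us \<subseteq> carrier_vec 2 \<Longrightarrow>
      sym_pullback r \<psi> ss us = (\<Sum>i<r. proj_pullback i \<phi> ss us)"
  shows "traces r (\<lambda>x. \<phi> (sg x) [dsg]) \<psi>"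
  unfolding traces_def
proof (intro conjI \<psi> allI impI)
  fix t p assume t: "regpt r t" and p: "p < r"
  define ss where "ss = map (\<lambda>q. sg (t q)) [0..<r]"
  \<comment> \<open>Only the \<open>p\<close>-th point moves; the zero vectors in the other slots
    annihilate every other projection.\<close>
  define us where "us = map (\<lambda>q. if q = p then dsg else 0\<^sub>v 2) [0..<r]"
  have sgV: "sg x \<in> V 1" if "x \<notin> P" for x
    using pt_in_V[of 1 "\<lambda>_. x"] that unfolding pt_1 regpt_1 by simp
  have ss: "length ss = r" "set ss \<subseteq> V 1" and us: "length us = r" "set us \<subseteq> carrier_vec 2"
    using t sgV by (auto simp: ss_def us_def regpt_def)
  have sm: "sym_map r (map2 (\<lambda>s u. s + e \<cdot>\<^sub>v u) ss us) = pt r t + e \<cdot>\<^sub>v tg r t p" for e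
  proof -
    have "map2 (\<lambda>s u. s + e \<cdot>\<^sub>v u) ss us ! q = sg ((t(p := t p + e)) q)" if "q < r" for q
    proof (cases "q = p")
      case True
      then show ?thesis using that by (simp add: ss_def us_def sg_add)
    next
      case False
      have "sg (t q) + e \<cdot>\<^sub>v 0\<^sub>v 2 = sg (t q)" by (rule eq_vecI) (auto simp: sg_def)
      then show ?thesis using that False by (simp add: ss_def us_def)
    qed
    then have "sym_map r (map2 (\<lambda>s u. s + e \<cdot>\<^sub>v u) ss us) = pt r (t(p := t p + e))"
      unfolding sym_map_eq_lin_prod[OF r] pt_def by (intro lin_prod_cong)
    then show ?thesis unfolding pt_upd[OF p] .
  qed
  have "sym_map r ss = pt r t"
    unfolding sym_map_eq_lin_prod[OF r] pt_def by (intro lin_prod_cong) (simp add: ss_def)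
  moreover have "vec (r + 1) (\<lambda>k. deriv (\<lambda>e. sym_map r (map2 (\<lambda>s u. s + e \<cdot>\<^sub>v u) ss us) $ k) 0) = tg r t p"
  proof (rule eq_vecI)
    fix k assume "k < dim_vec (tg r t p)"
    then have k: "k < r + 1" by (simp add: tg_def lin_prod_def)
    have "(\<lambda>e. (pt r t + e \<cdot>\<^sub>v tg r t p) $ k) = (\<lambda>e. pt r t $ k + e * tg r t p $ k)"
      using k by (auto simp: tg_def lin_prod_def)
    moreover have "((\<lambda>e. pt r t $ k + e * tg r t p $ k) has_field_derivative tg r t p $ k) (at 0)"
      by (auto intro!: derivative_eq_intros)
    ultimately show "vec (r + 1) (\<lambda>k. deriv (\<lambda>e. sym_map r (map2 (\<lambda>s u. s + e \<cdot>\<^sub>v u) ss us) $ k) 0) $ k = tg r t p $ k"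
      using k unfolding sm by (simp add: DERIV_imp_deriv)
  qed (simp add: tg_def lin_prod_def)
  ultimately have "\<psi> (pt r t) [tg r t p] = (\<Sum>i<r. proj_pullback i \<phi> ss us)"
    using pb[OF ss us] unfolding sym_pullback_def by simp
  also have "\<dots> = (\<Sum>i<r. if i = p then \<phi> (sg (t p)) [dsg] else 0)"
  proof (intro sum.cong refl)
    fix i assume "i \<in> {..<r}"
    then have i: "i < r" by simp
    show "proj_pullback i \<phi> ss us = (if i = p then \<phi> (sg (t p)) [dsg] else 0)"
    proof (cases "i = p")
      case True
      then show ?thesis using i by (simp add: proj_pullback_def ss_def us_def)
    next
      case False
      have "sg (t i) \<in> V 1" using t i sgV by (simp add: regpt_def)
      from alternating_smult[OF Omega_alternating[OF \<phi> this], of "[0\<^sub>v 2]" 0 "0\<^sub>v 2" 0]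
      have "\<phi> (sg (t i)) [0 \<cdot>\<^sub>v 0\<^sub>v 2] = 0" by simp
      moreover have "0 \<cdot>\<^sub>v 0\<^sub>v 2 = (0\<^sub>v 2 :: complex vec)" by (rule eq_vecI) auto
      ultimately have "\<phi> (sg (t i)) [0\<^sub>v 2] = 0" by simp
      then show ?thesis using i False by (simp add: proj_pullback_def ss_def us_def)
    qed
  qed
  also have "\<dots> = \<phi> (sg (t p)) [dsg]" using p by simp
  finally show "\<psi> (pt r t) [tg r t p] = \<phi> (sg (t p)) [dsg]" .
qed

end

theorem proposition4p11:
  fixes r N :: nat and lam :: "nat list"
    and z w :: "complex mat" and \<alpha> :: "complex vec"
    and \<phi> \<psi> :: "nat \<Rightarrow> dform"
  assumes "1 \<le> r" and "r + 1 < N"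
    and "\<forall>n\<in>set lam. 1 \<le> n" and "sum_list lam = N"
    and "z \<in> generic_stratum lam 2"
    and "w = veronese lam r z"
    and "\<alpha> \<in> carrier_vec N"
    and "(\<Sum>k<length lam. vblock lam \<alpha> k $ 0) = 0"
    and "\<forall>k<length lam. lam ! k = 1 \<longrightarrow> vblock lam \<alpha> k $ (lam ! k - 1) \<notin> \<int>"
    and "\<forall>k<length lam. lam ! k > 1 \<longrightarrow> vblock lam \<alpha> k $ (lam ! k - 1) \<noteq> 0"
    and "\<forall>j\<in>{1..N - 2}. \<phi> j \<in> Omega 2 (arr_cone lam z) 1"
    and "cohomology_basis 2 (arr_cone lam z) (omega lam \<alpha> z) 1 {1..N - 2} \<phi>"
    and "\<forall>j\<in>{1..N - 2}. \<psi> j \<in> Omega (r + 1) (arr_cone lam w) 1"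
    and "\<forall>j\<in>{1..N - 2}. \<forall>ss us.
           length ss = r \<and> set ss \<subseteq> arr_cone lam z \<and> length us = r \<and> set us \<subseteq> carrier_vec 2 \<longrightarrow>
           sym_pullback r (\<psi> j) ss us = (\<Sum>i<r. proj_pullback i (\<phi> j) ss us)"
  shows "cohomology_basis (r + 1) (arr_cone lam w) (omega lam \<alpha> w) r
           {js. length js = r \<and> sorted_wrt (<) js \<and> set js \<subseteq> {1..N - 2}}
           (\<lambda>js. wedge_list (r + 1) (arr_cone lam w) (map \<psi> js))"
proof -
  have r: "0 < r" using assms(1) by simp
  have z2: "dim_row z = 2" using assms(5) by (auto simp: generic_stratum_def)
  have pos: "\<And>k. k < length lam \<Longrightarrow> 1 \<le> lam ! k" using assms(3) by simp
  have len: "0 < length lam" using assms(2,4) by (cases lam) auto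
  define c where "c i k = fps_nth (curve lam z i k) 0" for i k
  have c: "c i k = col (block lam z k) 0 $ i" if "k < length lam" "i < 2" for i k
    using pos[OF that(1)] z2 that(2) by (simp add: c_def row_series_def block_def)
  have pair: "c 0 0 * c 1 k - c 0 k * c 1 0 \<noteq> 0" if "0 < k" "k < length lam" for k
    using generic_pair[OF assms(5) that assms(3)] c[OF len] c[OF that(2)] by simp
  \<comment> \<open>The puncture of block 0 is going to be put at infinity, so it must be a point of
    the projective line. A second block shows this, or, if there is none, the second column of the
    only block, which exists because \<open>N > 2\<close>.\<close>
  have nz: "c 0 0 \<noteq> 0 \<or> c 1 0 \<noteq> 0"
  proof (cases "1 < length lam")
    case True
    then show ?thesis using pair[of 1] by auto
  next
    case False
    then obtain n where n: "lam = [n]" using len by (cases lam) auto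
    have "2 \<le> n" using assms(1,2,4) n by simp
    from generic_single[OF assms(5)[unfolded n] this] show ?thesis using c[OF len] n by auto
  qed
  then obtain b0 b1 where ab: "c 0 0 * b1 - c 1 0 * b0 = 1"
  proof (cases "c 0 0 = 0")
    case True
    then show ?thesis using nz that[of 0 "- 1 / c 1 0"] that[of "- 1 / c 1 0" 0] by simp
  next
    case False
    then show ?thesis using that[of "1 / c 0 0" 0] that[of 0 "1 / c 0 0"] by simp
  qed
  \<comment> \<open>Coordinates of the first column of block \<open>k\<close> in the basis
    \<open>a\<close>, \<open>b\<close>, where \<open>a\<close> is the first column of block 0: the
    coefficient of \<open>b\<close> is \<open>\<mu> k\<close> and that of \<open>a\<close> is
    \<open>- \<mu> k * p k\<close>, so \<open>p k\<close> is the affine coordinate of the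
    puncture.\<close>
  define \<mu> where "\<mu> k = c 0 0 * c 1 k - c 0 k * c 1 0" for k
  define p where "p k = - (c 0 k * b1 - c 1 k * b0) / \<mu> k" for k
  have \<mu>: "\<mu> k \<noteq> 0" if "0 < k" "k < length lam" for k using pair[OF that] by (simp add: \<mu>_def)
  have ck: "c 0 k = \<mu> k * (b0 - p k * c 0 0)" "c 1 k = \<mu> k * (b1 - p k * c 1 0)"
    if "0 < k" "k < length lam" for k
  proof -
    have "\<mu> k * p k = c 1 k * b0 - c 0 k * b1" using \<mu>[OF that] by (simp add: p_def)
    moreover have "\<mu> k * b0 - (c 1 k * b0 - c 0 k * b1) * c 0 0 = c 0 k * (c 0 0 * b1 - c 1 0 * b0)"
      "\<mu> k * b1 - (c 1 k * b0 - c 0 k * b1) * c 1 0 = c 1 k * (c 0 0 * b1 - c 1 0 * b0)"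
      by (simp_all add: \<mu>_def algebra_simps)
    ultimately show "c 0 k = \<mu> k * (b0 - p k * c 0 0)" "c 1 k = \<mu> k * (b1 - p k * c 1 0)"
      unfolding ab by (simp_all add: right_diff_distrib mult.assoc[symmetric])
  qed
  interpret punctured_line "c 0 0" "c 1 0" b0 b1 "p ` {0<..<length lam}"
    by unfold_locales (use ab in auto)
  have P1: "puncture_at (fps_nth (curve lam z 0 k) 0) (fps_nth (curve lam z 1 k) 0)" if k: "k < length lam" for k
    unfolding puncture_at_def c_def[symmetric]
  proof (cases "k = 0")
    case True
    then show "\<exists>\<mu>. \<mu> \<noteq> 0 \<and> (c 0 k = \<mu> * c 0 0 \<and> c 1 k = \<mu> * c 1 0 \<or>
        (\<exists>q\<in>p ` {0<..<length lam}. c 0 k = \<mu> * (b0 - q * c 0 0) \<and> c 1 k = \<mu> * (b1 - q * c 1 0)))"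
      by (intro exI[of _ 1]) simp
  next
    case False
    then have "0 < k" by simp
    then show "\<exists>\<mu>. \<mu> \<noteq> 0 \<and> (c 0 k = \<mu> * c 0 0 \<and> c 1 k = \<mu> * c 1 0 \<or>
        (\<exists>q\<in>p ` {0<..<length lam}. c 0 k = \<mu> * (b0 - q * c 0 0) \<and> c 1 k = \<mu> * (b1 - q * c 1 0)))"
      using ck[OF _ k] \<mu>[OF _ k] k by (intro exI[of _ "\<mu> k"] conjI disjI2 bexI[of _ "p k"]) auto
  qed
  have P2: "\<exists>k<length lam. fps_nth (curve lam z 0 k) 0 = c 0 0 \<and> fps_nth (curve lam z 1 k) 0 = c 1 0"
    using len by (auto simp: c_def)
  have P3: "\<exists>k<length lam. \<exists>\<mu>. fps_nth (curve lam z 0 k) 0 = \<mu> * (b0 - q * c 0 0) \<and>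
      fps_nth (curve lam z 1 k) 0 = \<mu> * (b1 - q * c 1 0)" if q: "q \<in> p ` {0<..<length lam}" for q
  proof -
    obtain k where k: "0 < k" "k < length lam" "q = p k" using q by auto
    show ?thesis unfolding c_def[symmetric] k(3)
      using ck[OF k(1,2)] k(2) by (intro exI[of _ k] exI[of _ "\<mu> k"] conjI)
  qed
  note conc = assms(3) P1 P2 P3
  have imz: "veronese_image lam z 1 z" by (rule veronese_image_self[OF z2])
  have imw: "veronese_image lam z r w" unfolding assms(6) by (rule veronese_image_veronese[OF r z2])
  have one: "0 < (1 :: nat)" by simp
  have Vz: "arr_cone lam z = V 1" by (rule arr_cone_eq_V[OF conc imz one])
  have Vw: "arr_cone lam w = V r" by (rule arr_cone_eq_V[OF conc imw r])
  let ?J = "{1..N - 2}" and ?f = "\<lambda>j x. \<phi> j (sg x) [dsg]"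
  \<comment> \<open>A single function \<open>v\<close> is the trace of both forms; the same twisted
    derivative \<open>nab v\<close> thus governs \<open>X\<close> and \<open>Y\<close>.\<close>
  obtain v where \<omega>z: "traces 1 v (omega lam \<alpha> z)" and \<omega>w: "traces r v (omega lam \<alpha> w)"
    using traces_omega[OF conc imz one assms(8)] traces_omega[OF conc imw r assms(8)] by auto
  have \<phi>: "\<phi> j \<in> Omega 2 (V 1) 1" if "j \<in> ?J" for j using assms(11) that unfolding Vz by blast
  have lb: "line_basis v ?J ?f"
    by (rule line_basis_of_cohomology_basis[OF \<omega>z \<phi>]) (use assms(12) in \<open>simp_all only: Vz finite_atLeastAtMost\<close>)
  have \<psi>: "traces r (?f j) (\<psi> j)" if j: "j \<in> ?J" for j
  proof (rule traces_pullback[OF r \<phi>[OF j]])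
    show "\<psi> j \<in> Omega (r + 1) (V r) 1" using assms(13) j unfolding Vw by blast
    show "sym_pullback r (\<psi> j) ss us = (\<Sum>i<r. proj_pullback i (\<phi> j) ss us)"
      if "length ss = r" "set ss \<subseteq> V 1" "length us = r" "set us \<subseteq> carrier_vec 2" for ss us
      using assms(14) j that unfolding Vz by blast
  qed
  have m: "r = Suc (r - 1)" using r by simp
  from wedge_basis[OF m \<omega>w lb \<psi>] show ?thesis unfolding indices_def Vw .
qed

end
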